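(* Let $q>1$, $m\in\mathbb{N}^*$, $\sigma>0$, and consider the linear $q$-difference-differential equation $$(E)\qquad \sum_{j+\sigma|\alpha|\le m} a_{j,\alpha}(t,z)\,(tD_q)^j\partial_z^{\alpha}X = F(t,z),$$ where the sum is over $(j,\alpha)\in\mathbb{N}\times\mathbb{N}^d$ and where $a_{j,\alpha}(t,z)$ ($j+\sigma|\alpha|\le m$) and $F(t,z)$ are holomorphic in a neighborhood of $(0,0)\in\mathbb{C}_t\times\mathbb{C}_z^d$. Let $N_t$ denote the $t$-Newton polygon of $(E)$. Suppose: (A$_1$) there is an integer $m_0$ with $0\le m_0<m$ such that $N_t=\{(x,y)\in\mathbb{R}^2 : x\le m,\ y\ge\max\{0,x-m_0\}\}$; (A$_2$) if $|\alpha|>0$ then $(j,\mathrm{ord}_t(a_{j,\alpha}))$ lies in the interior of $N_t$ in $\mathbb{R}^2$ (no condition if $a_{j,\alpha}\equiv 0$); (A$_3$) $a_{m_0,0}(0,0)\ne 0$ and $\dfrac{a_{m,0}(t,z)}{t^{m-m_0}}\Big|_{t=0,z=0}\ne 0$; and the additional condition $$\mathrm{ord}_t(a_{j,\alpha})\ge j-m_0+2\quad\text{if } m_0\le j<m \text{ and } |\alpha|>0.$$ Let $\hat X(t,z)=\sum_{n\ge 0}X_n(z)t^n\in\mathcal{O}_R[[t]]$ (for some $R>0$) be a formal power series solution of $(E)$. Let $S\subset\mathbb{C}$ be the union of half-lines defined in the context. Then for any $\lambda\in\mathbb{C}\setminus(\{0\}\cup S)$ there are $r>0$, $R_1>0$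 and a holomorphic solution $W(t,z)$ of $(E)$ on $(D_r^*\setminus\mathscr{Z}_\lambda)\times D_{R_1}$ such that $W(t,z)$ admits $\hat X(t,z)$ as a $q$-Gevrey asymptotic expansion on $(D_r^*\setminus\mathscr{Z}_\lambda)\times D_{R_1}$.
   Context: $\mathbb{N}=\{0,1,2,\dots\}$, $\mathbb{N}^*=\{1,2,\dots\}$; $(t,z)=(t,z_1,\dots,z_d)\in\mathbb{C}\times\mathbb{C}^d$. For $\alpha\in\mathbb{N}^d$, $|\alpha|=\alpha_1+\cdots+\alpha_d$ and $\partial_z^\alpha=\partial_{z_1}^{\alpha_1}\cdots\partial_{z_d}^{\alpha_d}$. The $q$-difference operator is $D_q(f)(t,z)=\dfrac{f(qt,z)-f(t,z)}{qt-t}$ (so on formal series $D_q t^n=[n]_q t^{n-1}$). $[n]_q=\frac{q^n-1}{q-1}$, $[n]_q!=[1]_q\cdots[n]_q$, $[0]_q!=1$. $D_R=\{z\in\mathbb{C}^d: |z_i|<R\ (i=1,\dots,d)\}$, $\mathcal{O}_R$ is the set of holomorphic functions on $D_R$, and $D_r^*=\{t\in\mathbb{C}: 0<|t|<r\}$. For functions, the equation is understood at points where all of its terms are defined. Order and Newton polygon: for $f(t,z)\not\equiv 0$ holomorphic near $(0,0)$, $\mathrm{ord}_t(f)=\min\{p\in\mathbb{N}: (\partial_t^p f)(0,z)\not\equiv 0 \text{ near } z=0\}$, and $\mathrm{ord}_t(0)=\infty$. Put $C(a,b)=\{(x,y)\in\mathbb{R}^2: x\le a,\ y\ge b\}$ and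 $C(a,\infty)=\emptyset$. The $t$-Newton polygon of the equation is the convex hull in $\mathbb{R}^2$ of $\bigcup_{j+\sigma|\alpha|\le m}C(j,\mathrm{ord}_t(a_{j,\alpha}))$. The set $S$: by (A$_1$) and (A$_3$), for $m_0\le j\le m$ one can write $a_{j,0}(t,z)=t^{j-m_0}b_{j,0}(t,z)$ with $b_{j,0}$ holomorphic near $(0,0)$, $b_{m_0,0}(0,0)\ne0$, $b_{m,0}(0,0)\neq 0$. Set $P_0(\lambda,z)=\sum_{m_0\le j\le m}\frac{b_{j,0}(0,z)}{q^{j(j-1)/2}}\lambda^{j-m_0}$, let $\lambda_1,\dots,\lambda_{m-m_0}$ be the roots of $P_0(\lambda,0)=0$ (all nonzero), and $S=\bigcup_{i=1}^{m-m_0}\{\lambda_i\eta: \eta>0\}$. For $\lambda\in\mathbb{C}\setminus\{0\}$ and $\epsilon>0$: $\mathscr{Z}_\lambda=\{-\lambda(q-1)q^k: k\in\mathbb{Z}\}$ and $\mathscr{Z}_{\lambda,\epsilon}=\bigcup_{k\in\mathbb{Z}}\{t\in\mathbb{C}: |t+\lambda(q-1)q^k|<\epsilon|t|\}$. $q$-Gevrey asymptotic expansion: a holomorphic function $W(t,z)$ on $(D_r^*\setminus\mathscr{Z}_\lambda)\times D_{R_1}$ admits $\hat X(t,z)=\sum_{n\ge0}X_n(z)t^n$ as a $q$-Gevrey asymptotic expansion there if there are $M>0$ and $H>0$ such that $$\Bigl|W(t,z)-\sum_{n=0}^{N-1}X_n(z)t^n\Bigr|\le\frac{MH^N}{\epsilon}[N]_q!\,|t|^N$$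 holds on $(D_r^*\setminus\mathscr{Z}_{\lambda,\epsilon})\times D_{R_1}$ for every $N=0,1,2,\dots$ and every sufficiently small $\epsilon>0$. *)

theory Defs
  imports "HOL-Complex_Analysis.Complex_Analysis" "HOL-Library.Extended_Nat"
begin

unbundle no fps_syntax

subsection \<open>Holomorphic functions of several variables, partial derivatives\<close>

text \<open>
  The coordinates of \<open>\<complex>\<^sup>d\<close> are indexed by a finite type \<open>'d\<close> with \<open>CARD('d) = d\<close>. Holomorphic on
  an open set means: Frechet differentiable at each of its points with complex-linear derivative.
  The two versions are for functions of \<open>z\<close> and of \<open>(t, z)\<close>.
\<close>

definition holo_z :: "(complex ^ 'd \<Rightarrow> complex) \<Rightarrow> (complex ^ 'd) set \<Rightarrow> bool" where
  "holo_z f D \<longleftrightarrow>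
     (\<forall>z\<in>D. \<exists>g. (f has_derivative (\<lambda>v. \<Sum>i\<in>UNIV. g i * v $ i)) (at z))"

definition holo_tz :: "(complex \<times> (complex ^ 'd) \<Rightarrow> complex) \<Rightarrow> (complex \<times> (complex ^ 'd)) set \<Rightarrow> bool" where
  "holo_tz f D \<longleftrightarrow>
     (\<forall>p\<in>D. \<exists>c g. (f has_derivative (\<lambda>(s, v). c * s + (\<Sum>i\<in>UNIV. g i * v $ i))) (at p))"

definition polydisc :: "real \<Rightarrow> (complex ^ 'd) set" where
  "polydisc R = {z. \<forall>i. cmod (z $ i) < R}"

definition punctured_disc :: "real \<Rightarrow> complex set" where
  "punctured_disc r = {t. 0 < cmod t \<and> cmod t < r}"

definition partial_z :: "'d \<Rightarrow> (complex ^ 'd \<Rightarrow> complex) \<Rightarrow> complex ^ 'd \<Rightarrow> complex" where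
  "partial_z i f z = deriv (\<lambda>w. f (\<chi> k. if k = i then w else z $ k)) (z $ i)"

text \<open>
  The linear order on the index type only fixes the order in which the partial derivatives are
  composed (the smallest index is applied last).
\<close>

definition multi_partial_z ::
  "('d :: {finite, linorder} \<Rightarrow> nat) \<Rightarrow> ((complex, 'd) vec \<Rightarrow> complex) \<Rightarrow> (complex, 'd) vec \<Rightarrow> complex" where
  "multi_partial_z \<alpha> f = foldr (\<lambda>i. partial_z i ^^ \<alpha> i) (sorted_list_of_set UNIV) f"

definition mlen :: "('d :: finite \<Rightarrow> nat) \<Rightarrow> nat" where
  "mlen \<alpha> = (\<Sum>i\<in>UNIV. \<alpha> i)"

definition index_set :: "nat \<Rightarrow> real \<Rightarrow> (nat \<times> ('d :: finite \<Rightarrow> nat)) set" where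
  "index_set m \<sigma> = {(j, \<alpha>). real j + \<sigma> * real (mlen \<alpha>) \<le> real m}"


subsection \<open>\<open>q\<close>-calculus\<close>

definition qnum :: "real \<Rightarrow> nat \<Rightarrow> real" where
  "qnum q n = (q ^ n - 1) / (q - 1)"

definition qfact :: "real \<Rightarrow> nat \<Rightarrow> real" where
  "qfact q n = (\<Prod>i = 1..n. qnum q i)"

definition qderiv :: "real \<Rightarrow> (complex \<Rightarrow> complex) \<Rightarrow> complex \<Rightarrow> complex" where
  "qderiv q f t = (f (of_real q * t) - f t) / (of_real q * t - t)"

definition qeuler :: "real \<Rightarrow> (complex \<Rightarrow> complex) \<Rightarrow> complex \<Rightarrow> complex" where
  "qeuler q f t = t * qderiv q f t"

definition fps_qderiv :: "real \<Rightarrow> complex fps \<Rightarrow> complex fps" where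
  "fps_qderiv q f = Abs_fps (\<lambda>n. of_real (qnum q (n + 1)) * fps_nth f (n + 1))"

definition fps_qeuler :: "real \<Rightarrow> complex fps \<Rightarrow> complex fps" where
  "fps_qeuler q f = fps_X * fps_qderiv q f"


subsection \<open>Solutions of the equation\<close>

text \<open>
  The formal series \<open>\<Sum>n. X n z * t ^ n\<close> is given by its coefficients \<open>X\<close>. The equation is an identity
  of power series in \<open>t\<close> whose coefficients are holomorphic germs at \<open>z = 0\<close>; the coefficient
  functions \<open>a\<close> and \<open>F\<close> enter through their Taylor expansions in \<open>t\<close> at \<open>t = 0\<close>.
\<close>

definition formal_solution ::
  "real \<Rightarrow> nat \<Rightarrow> real \<Rightarrow> (nat \<Rightarrow> ('d :: {finite, linorder} \<Rightarrow> nat) \<Rightarrow> complex \<times> (complex, 'd) vec \<Rightarrow> complex)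
   \<Rightarrow> (complex \<times> (complex, 'd) vec \<Rightarrow> complex) \<Rightarrow> (nat \<Rightarrow> (complex, 'd) vec \<Rightarrow> complex) \<Rightarrow> bool" where
  "formal_solution q m \<sigma> a F X \<longleftrightarrow>
     (\<forall>\<^sub>F z in nhds 0.
        (\<Sum>(j, \<alpha>)\<in>index_set m \<sigma>.
           fps_expansion (\<lambda>t. a j \<alpha> (t, z)) 0 *
           (fps_qeuler q ^^ j) (Abs_fps (\<lambda>n. multi_partial_z \<alpha> (X n) z)))
        = fps_expansion (\<lambda>t. F (t, z)) 0)"

text \<open>
  \<open>W\<close> solves the equation on \<open>T \<times> D\<close>, at the points where all terms are defined: the coefficients
  are defined on \<open>U\<close>, and \<open>m\<close> applications of \<open>qeuler q\<close> at \<open>t\<close> use the values of \<open>W\<close> at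
  \<open>t, q t, \<dots>, q\<^sup>m t\<close>.
\<close>

definition function_solution_on ::
  "real \<Rightarrow> nat \<Rightarrow> real \<Rightarrow> (nat \<Rightarrow> ('d :: {finite, linorder} \<Rightarrow> nat) \<Rightarrow> complex \<times> (complex, 'd) vec \<Rightarrow> complex)
   \<Rightarrow> (complex \<times> (complex, 'd) vec \<Rightarrow> complex) \<Rightarrow> (complex \<times> (complex, 'd) vec) set
   \<Rightarrow> (complex \<times> (complex, 'd) vec \<Rightarrow> complex) \<Rightarrow> complex set \<Rightarrow> (complex, 'd) vec set \<Rightarrow> bool" where
  "function_solution_on q m \<sigma> a F U W T D \<longleftrightarrow>
     (\<forall>t z. (t, z) \<in> U \<and> z \<in> D \<and> (\<forall>i\<le>m. of_real q ^ i * t \<in> T) \<longrightarrow>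
        (\<Sum>(j, \<alpha>)\<in>index_set m \<sigma>.
           a j \<alpha> (t, z) * (qeuler q ^^ j) (\<lambda>s. multi_partial_z \<alpha> (\<lambda>y. W (s, y)) z) t)
        = F (t, z))"


subsection \<open>Newton polygon\<close>

definition ord_t :: "(complex \<times> (complex ^ 'd) \<Rightarrow> complex) \<Rightarrow> enat" where
  "ord_t f =
     (if \<forall>\<^sub>F p in nhds (0, 0). f p = 0 then \<infinity>
      else enat (LEAST p. \<not> (\<forall>\<^sub>F z in nhds 0. (deriv ^^ p) (\<lambda>t. f (t, z)) 0 = 0)))"

definition quadrant :: "real \<Rightarrow> enat \<Rightarrow> (real \<times> real) set" where
  "quadrant a b = (case b of enat p \<Rightarrow> {(x, y). x \<le> a \<and> y \<ge> real p} | \<infinity> \<Rightarrow> {})"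

definition newton_polygon ::
  "nat \<Rightarrow> real \<Rightarrow> (nat \<Rightarrow> ('d :: finite \<Rightarrow> nat) \<Rightarrow> complex \<times> (complex ^ 'd) \<Rightarrow> complex) \<Rightarrow> (real \<times> real) set" where
  "newton_polygon m \<sigma> a =
     convex hull (\<Union>(j, \<alpha>)\<in>index_set m \<sigma>. quadrant (real j) (ord_t (a j \<alpha>)))"


subsection \<open>The exceptional directions and the \<open>q\<close>-spirals\<close>

text \<open>\<open>f(t, z) / t\<^sup>k\<close>, with the removable singularity at \<open>t = 0\<close> filled in.\<close>

definition div_t_power :: "nat \<Rightarrow> (complex \<times> (complex ^ 'd) \<Rightarrow> complex) \<Rightarrow> complex \<times> (complex ^ 'd) \<Rightarrow> complex" where
  "div_t_power k f = (\<lambda>(t, z). remove_sings (\<lambda>s. f (s, z) / s ^ k) t)"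

definition char_poly0 ::
  "real \<Rightarrow> nat \<Rightarrow> nat \<Rightarrow> (nat \<Rightarrow> ('d \<Rightarrow> nat) \<Rightarrow> complex \<times> (complex ^ 'd) \<Rightarrow> complex)
   \<Rightarrow> complex \<Rightarrow> complex ^ 'd \<Rightarrow> complex" where
  "char_poly0 q m m0 a l z =
     (\<Sum>j = m0..m. div_t_power (j - m0) (a j (\<lambda>_. 0)) (0, z) / of_real q ^ (j * (j - 1) div 2) * l ^ (j - m0))"

definition sing_dirs ::
  "real \<Rightarrow> nat \<Rightarrow> nat \<Rightarrow> (nat \<Rightarrow> ('d \<Rightarrow> nat) \<Rightarrow> complex \<times> (complex ^ 'd) \<Rightarrow> complex) \<Rightarrow> complex set" where
  "sing_dirs q m m0 a = {l * of_real \<eta> | l \<eta>. char_poly0 q m m0 a l 0 = 0 \<and> \<eta> > 0}"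

definition qspiral :: "real \<Rightarrow> complex \<Rightarrow> complex set" where
  "qspiral q l = {- l * of_real ((q - 1) * q powi k) | k :: int. True}"

definition qspiral_nbhd :: "real \<Rightarrow> complex \<Rightarrow> real \<Rightarrow> complex set" where
  "qspiral_nbhd q l \<epsilon> =
     (\<Union>k :: int. {t. cmod (t + l * of_real ((q - 1) * q powi k)) < \<epsilon> * cmod t})"


subsection \<open>\<open>q\<close>-Gevrey asymptotic expansions\<close>

text \<open>The constants \<open>M\<close>, \<open>H\<close> and the threshold \<open>\<epsilon>0\<close> for \<open>\<epsilon>\<close> do not depend on \<open>N\<close>.\<close>

definition qGevrey_expansion ::
  "real \<Rightarrow> complex \<Rightarrow> real \<Rightarrow> real \<Rightarrow> (complex \<times> (complex ^ 'd) \<Rightarrow> complex)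
   \<Rightarrow> (nat \<Rightarrow> complex ^ 'd \<Rightarrow> complex) \<Rightarrow> bool" where
  "qGevrey_expansion q l r R1 W X \<longleftrightarrow>
     (\<exists>M>0. \<exists>H>0. \<exists>\<epsilon>0>0. \<forall>\<epsilon>. 0 < \<epsilon> \<and> \<epsilon> < \<epsilon>0 \<longrightarrow>
        (\<forall>N. \<forall>t \<in> punctured_disc r - qspiral_nbhd q l \<epsilon>. \<forall>z \<in> polydisc R1.
           cmod (W (t, z) - (\<Sum>n<N. X n z * t ^ n))
             \<le> M * H ^ N / \<epsilon> * qfact q N * cmod t ^ N))"

end

theory Submission
  imports Defs "HOL-Real_Asymp.Real_Asymp"
begin

text \<open>
  Write \<open>q\<close>-dilation as \<open>t \<mapsto> q t\<close>, put \<open>\<mu> = \<lambda> (q - 1)\<close> and let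
  \<open>\<theta>(t) = \<Sum>\<^sub>n q\<^bsup>-n(n-1)/2\<^esup> t\<^sup>n\<close> over all integers \<open>n\<close>. It satisfies
  \<open>\<theta>(q t) = q t \<theta>(t)\<close>, and \<open>\<theta>(t / \<mu>)\<close> vanishes exactly on the \<open>q\<close>-spiral of \<open>\<lambda>\<close>. The solution is sought as
  \<open>W = G / \<theta>(t / \<mu>)\<close> with \<open>G = \<Sum>\<^sub>n w\<^sub>n(z) t\<^sup>n\<close> a Laurent series in the punctured disc. Dividing by
  \<open>\<theta>\<close> turns \<open>q\<close>-dilation into \<open>t\<^sup>-\<^sup>1\<close> times \<open>q\<close>-dilation, so the terms on the edge of slope one of the Newton polygon
  become terms of the same order, and the equation becomes a recursion for \<open>w\<^sub>n\<close> with leading factor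
  \<open>P\<^sub>0(\<lambda> q\<^bsup>n-1\<^esup>, z)\<close>, up to a power of \<open>\<lambda> q\<^bsup>n-1\<^esup>\<close>; it is nonzero because \<open>\<lambda>\<close> lies outside \<open>S\<close>.

  The Gevrey bound on \<open>X\<^sub>n\<close> makes the product of the formal solution with \<open>\<theta>(t / \<mu>)\<close> meaningful for the
  coefficients of index \<open>n \<le> n\<^sub>1\<close>; these define \<open>w\<^sub>n\<close> for \<open>n \<le> n\<^sub>1\<close> (they are values of the formal \<open>q\<close>-Borel
  transform along \<open>\<lambda> q\<^sup>n\<close>), and the recursion defines the others. In both the Gevrey bound and the convergence of
  \<open>G\<close> the derivatives in \<open>z\<close> come with a factor geometric in \<open>n\<close>, which pays for the Cauchy estimates on
  shrinking polydiscs.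
\<close>

subsection \<open>Functions with complex-linear derivative\<close>

text \<open>The expansion needs no summation theory of its own. Theta times (\<open>W\<close> minus
  a partial sum) is a Laurent series whose coefficients are tails of geometrically convergent series
  up to \<open>n1\<close> and are estimated termwise beyond. They are compared with a shifted copy
  of the positive series \<open>Theta\<close> at y = |t / \<mu>|, whose sum is
  \<open>Theta y * y ^ N / gs (- int N)\<close>. Here \<open>Theta y\<close> cancels against a lower
  bound |theta| \<ge> c \<epsilon> \<open>Theta y\<close>, the only source of 1 / \<epsilon>, and
  \<open>1 / gs (- int N)\<close> is at most a q-factorial times a geometric factor. That lower
  bound is the reason for proving a product formula: it isolates the zeros of theta. The recursion
  is triangular because the Newton polygon lets no later coefficient enter. Derivatives in z fall on
  strictly earlier coefficients and never accompany the highest dilation, and it is the lower order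
  of their dilation that yields the geometric gain. Division by the leading factor requires one
  polydisc for infinitely many indices: large ones are settled by the top coefficient, the finitely
  many others by taking the smallest radius.\<close>

lemma norm_summable_tail:
  fixes f :: "'i \<Rightarrow> 'e \<Rightarrow> 'b::banach"
  assumes M: "M summable_on A" and fM: "\<And>n p. n \<in> A \<Longrightarrow> p \<in> D \<Longrightarrow> norm (f n p) \<le> M n" and e: "e > 0"
  shows "\<exists>F0. finite F0 \<and> F0 \<subseteq> A \<and> (\<forall>F p. finite F \<longrightarrow> F0 \<subseteq> F \<longrightarrow> F \<subseteq> A \<longrightarrow> p \<in> D \<longrightarrow>
           norm ((\<Sum>\<^sub>\<infinity>n\<in>A. f n p) - (\<Sum>n\<in>F. f n p)) \<le> e)"
proof (cases "D = {}")
  case False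
  then have M0: "M n \<ge> 0" if "n \<in> A" for n using fM[OF that] by (meson equals0I norm_ge_zero order_trans)
  \<comment> \<open>\<open>F0\<close> depends on the majorant alone, hence works for all
    \<open>p\<close> at once. Nonnegativity of \<open>M\<close> on \<open>A\<close>, used to enlarge
    the index set of the tail, comes from a point of \<open>D\<close>.\<close>
  obtain F0 where F0: "finite F0" "F0 \<subseteq> A" "dist (sum M F0) (infsum M A) \<le> e"
    using infsum_finite_approximation[OF M e] by blast
  have "norm ((\<Sum>\<^sub>\<infinity>n\<in>A. f n p) - (\<Sum>n\<in>F. f n p)) \<le> e"
    if F: "finite F" "F0 \<subseteq> F" "F \<subseteq> A" "p \<in> D" for F p
  proof -
    have fs: "(\<lambda>n. norm (f n p)) summable_on A"
      by (rule Infinite_Sum.abs_summable_on_comparison_test'[OF M]) (use fM that in auto)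
    have MF: "M summable_on A - F" "M summable_on A - F0"
      using M summable_on_subset_banach by blast+
    have "(\<Sum>\<^sub>\<infinity>n\<in>A. f n p) - (\<Sum>n\<in>F. f n p) = (\<Sum>\<^sub>\<infinity>n\<in>A - F. f n p)"
      using infsum_Diff[of "\<lambda>n. f n p" A F] F abs_summable_summable[OF fs] by simp
    also have "norm \<dots> \<le> (\<Sum>\<^sub>\<infinity>n\<in>A - F. M n)"
      by (rule norm_infsum_le[OF has_sum_infsum has_sum_infsum])
        (use fM that MF summable_on_subset_banach[OF abs_summable_summable[OF fs], of "A - F"] in auto)
    also have "\<dots> \<le> (\<Sum>\<^sub>\<infinity>n\<in>A - F0. M n)"
      by (rule infsum_mono_neutral) (use MF F M0 in auto)
    also have "\<dots> = infsum M A - sum M F0"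
      using infsum_Diff[of M A F0] F0 M by simp
    also have "\<dots> \<le> e" using F0(3) by (simp add: dist_norm)
    finally show ?thesis .
  qed
  then show ?thesis using F0 by blast
qed auto

text \<open>
  The map \<open>scl\<close> is multiplication by complex scalars, so that \<open>hol\<close> covers both \<^const>\<open>holo_z\<close> and
  \<^const>\<open>holo_tz\<close>.
\<close>

locale complex_scaling =
  fixes scl :: "complex \<Rightarrow> 'e \<Rightarrow> 'e :: real_normed_vector"
  assumes scl_add: "scl (a + b) v = scl a v + scl b v"
    and scl_scaleR: "scl (r *\<^sub>R a) v = r *\<^sub>R scl a v"
    and scl_norm: "norm (scl a v) = cmod a * norm v"
begin

definition hol :: "('e \<Rightarrow> complex) \<Rightarrow> 'e set \<Rightarrow> bool" where
  "hol f D \<longleftrightarrow> (\<forall>p\<in>D. \<exists>f'. (f has_derivative f') (at p) \<and> (\<forall>a v. f' (scl a v) = a * f' v))"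

lemma holD:
  assumes "hol f D" "p \<in> D"
  shows "(f has_derivative frechet_derivative f (at p)) (at p)"
    and "frechet_derivative f (at p) (scl a v) = a * frechet_derivative f (at p) v"
proof -
  obtain f' where f': "(f has_derivative f') (at p)" "\<And>a v. f' (scl a v) = a * f' v"
    using assms unfolding hol_def by blast
  have "f' = frechet_derivative f (at p)" by (rule frechet_derivative_at[OF f'(1)])
  then show "(f has_derivative frechet_derivative f (at p)) (at p)"
    "frechet_derivative f (at p) (scl a v) = a * frechet_derivative f (at p) v"
    using f' by auto
qed

lemma hol_subset: "hol f D \<Longrightarrow> D' \<subseteq> D \<Longrightarrow> hol f D'"
  unfolding hol_def by blast

lemma bounded_linear_scl: "bounded_linear (\<lambda>a. scl a v)"
  by (rule bounded_linear_intro[where K = "norm v"]) (auto simp: scl_add scl_scaleR scl_norm)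

lemma scl_zero [simp]: "scl 0 v = 0"
  using scl_norm[of 0 v] by simp

lemma hol_imp_continuous_on: "hol f D \<Longrightarrow> continuous_on D f"
  unfolding hol_def by (meson continuous_at_imp_continuous_on has_derivative_continuous)

text \<open>The chain rule along the complex line \<open>p + scl a v\<close>, together with complex
  homogeneity of the derivative, gives an ordinary complex derivative. This is the passage by which
  one-variable theorems are applied.\<close>

lemma hol_line:
  assumes "hol f D" "p + scl a v \<in> D"
  shows "((\<lambda>a. f (p + scl a v)) has_field_derivative frechet_derivative f (at (p + scl a v)) v) (at a)"
proof -
  have 1: "((\<lambda>a. p + scl a v) has_derivative (\<lambda>a. scl a v)) (at a)"
    using bounded_linear_imp_has_derivative[OF bounded_linear_scl] by (auto intro!: derivative_eq_intros)
  have "((\<lambda>a. f (p + scl a v)) has_derivative (\<lambda>b. frechet_derivative f (at (p + scl a v)) (scl b v))) (at a)"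
    using has_derivative_compose[OF 1 holD(1)[OF assms]] by simp
  then show ?thesis
    unfolding has_field_derivative_def holD(2)[OF assms]
    by (simp only: mult.commute[of _ "frechet_derivative f (at (p + scl a v)) v"])
qed

lemma hol_line_holomorphic:
  assumes "hol f D" "\<And>a. a \<in> A \<Longrightarrow> p + scl a v \<in> D"
  shows "(\<lambda>a. f (p + scl a v)) holomorphic_on A"
  unfolding holomorphic_on_def field_differentiable_def
  using hol_line[OF assms(1) assms(2)] has_field_derivative_at_within by blast

text \<open>One-variable Cauchy inequality on the line through \<open>p\<close> in direction
  \<open>v\<close>, where the parameter disc has radius \<open>r / norm v\<close>.\<close>

lemma Cauchy_est:
  assumes f: "hol f D" and sub: "ball p r \<subseteq> D" and r: "r > 0"
    and M: "\<And>y. y \<in> ball p r \<Longrightarrow> cmod (f y) \<le> M"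
  shows "cmod (frechet_derivative f (at p) v) \<le> M / r * norm v"
proof (cases "v = 0")
  case True
  have "bounded_linear (frechet_derivative f (at p))"
    using holD(1)[OF f] sub r by (meson centre_in_ball has_derivative_bounded_linear subsetD)
  then show ?thesis using True by (simp add: linear_simps)
next
  case False
  then have nv: "norm v > 0" by simp
  let ?\<rho> = "r / norm v"
  have in_ball: "p + scl a v \<in> ball p r" if "cmod a < ?\<rho>" for a
    using that nv by (simp add: dist_norm scl_norm field_simps)
  have hol: "(\<lambda>a. f (p + scl a v)) holomorphic_on ball 0 ?\<rho>"
    by (rule hol_line_holomorphic[OF f]) (use in_ball sub in auto)
  have "cmod (deriv (\<lambda>a. f (p + scl a v)) 0) \<le> M / d" if d: "0 < d" "d < ?\<rho>" for d
  proof -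
    have "cmod ((deriv ^^ 1) (\<lambda>a. f (p + scl a v)) 0) \<le> fact 1 * M / d ^ 1"
    proof (rule Cauchy_inequality)
      show "(\<lambda>a. f (p + scl a v)) holomorphic_on ball 0 d"
        by (rule holomorphic_on_subset[OF hol]) (use d in auto)
      show "continuous_on (cball 0 d) (\<lambda>a. f (p + scl a v))"
        by (rule continuous_on_subset[OF holomorphic_on_imp_continuous_on[OF hol]]) (use d in auto)
    qed (use d in_ball M in auto)
    then show ?thesis by simp
  qed
  moreover have "deriv (\<lambda>a. f (p + scl a v)) 0 = frechet_derivative f (at p) v"
    using DERIV_imp_deriv[OF hol_line[OF f, of p 0 v]] sub r by (simp add: subset_iff)
  ultimately have *: "cmod (frechet_derivative f (at p) v) \<le> M / d" if "0 < d" "d < ?\<rho>" for d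
    using that by simp
  \<comment> \<open>The function is controlled on the open ball only, so the bound is known for
    parameter radii below \<open>r / norm v\<close>; the limit from the left gives the full
    radius.\<close>
  have "((\<lambda>d. M / d) \<longlongrightarrow> M / ?\<rho>) (at_left ?\<rho>)"
    by (intro tendsto_intros) (use r nv in auto)
  moreover have "\<forall>\<^sub>F d in at_left ?\<rho>. cmod (frechet_derivative f (at p) v) \<le> M / d"
    by (rule eventually_at_leftI[of 0]) (use * r nv in auto)
  ultimately have "cmod (frechet_derivative f (at p) v) \<le> M / ?\<rho>"
    by (intro tendsto_lowerbound) auto
  then show ?thesis by simp
qed

lemma hol_diff: "hol f D \<Longrightarrow> hol g D \<Longrightarrow> hol (\<lambda>p. f p - g p) D"
  unfolding hol_def
proof (intro ballI, goal_cases)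
  case (1 p)
  then obtain f' g' where "(f has_derivative f') (at p)" "\<forall>a v. f' (scl a v) = a * f' v"
     "(g has_derivative g') (at p)" "\<forall>a v. g' (scl a v) = a * g' v" by metis
  then show ?case
    by (intro exI[of _ "\<lambda>v. f' v - g' v"]) (auto intro!: derivative_eq_intros simp: algebra_simps)
qed

lemma hol_add: "hol f D \<Longrightarrow> hol g D \<Longrightarrow> hol (\<lambda>p. f p + g p) D"
  unfolding hol_def
proof (intro ballI, goal_cases)
  case (1 p)
  then obtain f' g' where "(f has_derivative f') (at p)" "\<forall>a v. f' (scl a v) = a * f' v"
     "(g has_derivative g') (at p)" "\<forall>a v. g' (scl a v) = a * g' v" by metis
  then show ?case
    by (intro exI[of _ "\<lambda>v. f' v + g' v"]) (auto intro!: derivative_eq_intros simp: algebra_simps)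
qed

lemma hol_mult: "hol f D \<Longrightarrow> hol g D \<Longrightarrow> hol (\<lambda>p. f p * g p) D"
  unfolding hol_def
proof (intro ballI, goal_cases)
  case (1 p)
  then obtain f' g' where "(f has_derivative f') (at p)" "\<forall>a v. f' (scl a v) = a * f' v"
     "(g has_derivative g') (at p)" "\<forall>a v. g' (scl a v) = a * g' v" by metis
  then show ?case
    by (intro exI[of _ "\<lambda>v. f p * g' v + f' v * g p"]) (auto intro!: derivative_eq_intros simp: algebra_simps)
qed

lemma hol_inverse: "hol f D \<Longrightarrow> (\<And>p. p \<in> D \<Longrightarrow> f p \<noteq> 0) \<Longrightarrow> hol (\<lambda>p. inverse (f p)) D"
  unfolding hol_def
proof (intro ballI, goal_cases)
  case (1 p)
  then obtain f' where "(f has_derivative f') (at p)" "\<forall>a v. f' (scl a v) = a * f' v" by metis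
  then show ?case using 1
    by (intro exI[of _ "\<lambda>v. - (inverse (f p) * f' v * inverse (f p))"])
       (auto intro!: derivative_eq_intros simp: algebra_simps)
qed

lemma hol_const: "hol (\<lambda>p. c) D"
  unfolding hol_def by (auto intro!: exI[of _ "\<lambda>v. 0"])

lemma hol_divide: "hol f D \<Longrightarrow> hol g D \<Longrightarrow> (\<And>p. p \<in> D \<Longrightarrow> g p \<noteq> 0) \<Longrightarrow> hol (\<lambda>p. f p / g p) D"
  unfolding divide_inverse by (intro hol_mult hol_inverse)

lemma hol_sum: "(\<And>i. i \<in> I \<Longrightarrow> hol (f i) D) \<Longrightarrow> hol (\<lambda>p. \<Sum>i\<in>I. f i p) D"
  by (induction I rule: infinite_finite_induct) (auto intro: hol_const hol_add)

lemma hol_cong: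
  assumes "open D" "\<And>p. p \<in> D \<Longrightarrow> f p = g p" "hol f D" shows "hol g D"
  unfolding hol_def
proof
  fix p assume "p \<in> D"
  then obtain f' where "(f has_derivative f') (at p)" "\<forall>a v. f' (scl a v) = a * f' v"
    using assms(3) unfolding hol_def by blast
  then show "\<exists>f'. (g has_derivative f') (at p) \<and> (\<forall>a v. f' (scl a v) = a * f' v)"
    using has_derivative_transform_within_open[OF _ assms(1) \<open>p \<in> D\<close>, of f f' UNIV g] assms(2) by auto
qed

lemma hol_translate:
  assumes "hol f D" "\<And>x. x \<in> S \<Longrightarrow> x + y \<in> D" shows "hol (\<lambda>x. f (x + y)) S"
  unfolding hol_def
proof
  fix p assume "p \<in> S"
  then obtain f' where f': "(f has_derivative f') (at (p + y))" "\<forall>a v. f' (scl a v) = a * f' v"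
    using assms unfolding hol_def by blast
  have "((\<lambda>x. f (x + y)) has_derivative f') (at p)"
    by (rule has_derivative_compose[of "\<lambda>x. x + y" "\<lambda>v. v" p UNIV f f'])
      (use f'(1) in \<open>auto intro!: derivative_eq_intros\<close>)
  then show "\<exists>f'. ((\<lambda>x. f (x + y)) has_derivative f') (at p) \<and> (\<forall>a v. f' (scl a v) = a * f' v)"
    using f'(2) by blast
qed

text \<open>Weierstrass' theorem. \<open>Cauchy_est\<close>, applied to differences
  \<open>f m - f n\<close>, makes the derivatives uniformly Cauchy near \<open>p\<close>;
  \<open>has_derivative_sequence\<close> then differentiates the limit, and homogeneity passes to
  the limit pointwise.\<close>

lemma hol_limit:
  assumes D: "open D" and f: "\<And>n. hol (f n) D"
    and lim: "\<And>p. p \<in> D \<Longrightarrow> \<exists>r>0. ball p r \<subseteq> D \<and> uniform_limit (ball p r) f g sequentially"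
  shows "hol g D"
  unfolding hol_def
proof
  fix p assume "p \<in> D"
  then obtain r where r: "r > 0" "ball p r \<subseteq> D" "uniform_limit (ball p r) f g sequentially"
    using lim by blast
  \<comment> \<open>Half the radius: every point of this ball keeps a ball of radius
    \<open>r / 2\<close> inside \<open>ball p r\<close>, as \<open>Cauchy_est\<close> requires.
    Convexity of the ball is needed for \<open>has_derivative_sequence\<close>.\<close>
  define B where "B = ball p (r / 2)"
  define f' where "f' n x = frechet_derivative (f n) (at x)" for n x
  have BD: "B \<subseteq> D" using r subset_ball[of "r / 2" r p] unfolding B_def by auto
  have subB: "ball x (r / 2) \<subseteq> ball p r" if "x \<in> B" for x
  proof
    fix y assume "y \<in> ball x (r/2)"
    then show "y \<in> ball p r" using that dist_triangle[of p y x] by (auto simp: B_def)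
  qed
  have der: "(f n has_derivative f' n x) (at x)" if "x \<in> B" for n x
    unfolding f'_def using holD(1)[OF f] that BD by blast
  have diff: "cmod (f' m x h - f' n x h) \<le> 2 * e / r * norm h"
    if "x \<in> B" "\<And>y. y \<in> ball p r \<Longrightarrow> cmod (f m y - f n y) \<le> e" for x h m n e
  proof -
    have "frechet_derivative (\<lambda>y. f m y - f n y) (at x) = (\<lambda>h. f' m x h - f' n x h)"
      by (rule frechet_derivative_at[symmetric]) (intro derivative_intros der that)
    moreover have "cmod (frechet_derivative (\<lambda>y. f m y - f n y) (at x) h) \<le> e / (r / 2) * norm h"
      by (rule Cauchy_est[OF hol_diff[OF f f]]) (use r subB[OF that(1)] that(2) in auto)
    ultimately show ?thesis by (simp add: mult.commute)
  qed
  have Cauchy: "\<exists>N. \<forall>m\<ge>N. \<forall>n\<ge>N. \<forall>x\<in>B. \<forall>h. cmod (f' m x h - f' n x h) \<le> e * norm h" if e: "e > 0" for e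
  proof -
    have "uniformly_Cauchy_on (ball p r) f"
      using r(3) uniformly_convergent_Cauchy uniformly_convergent_on_def by blast
    then obtain N where "\<And>m n y. m \<ge> N \<Longrightarrow> n \<ge> N \<Longrightarrow> y \<in> ball p r \<Longrightarrow> dist (f m y) (f n y) < e * r / 2"
      unfolding uniformly_Cauchy_on_def using e r(1) by (meson half_gt_zero mult_pos_pos)
    then have "\<forall>m\<ge>N. \<forall>n\<ge>N. \<forall>x\<in>B. \<forall>h. cmod (f' m x h - f' n x h) \<le> 2 * (e * r / 2) / r * norm h"
      by (intro allI impI ballI diff) (auto simp: dist_norm less_imp_le)
    then show ?thesis using r(1) by auto
  qed
  have "\<exists>l. (\<lambda>n. f' n x h) \<longlonglongrightarrow> l" if "x \<in> B" for x h
  proof -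
    have "Cauchy (\<lambda>n. f' n x h)"
    proof (rule metric_CauchyI)
      fix e :: real assume e: "e > 0"
      define e' where "e' = e / (2 * (norm h + 1))"
      have "e' > 0" using e by (simp add: e'_def add_nonneg_pos)
      then obtain N where N: "\<forall>m\<ge>N. \<forall>n\<ge>N. \<forall>x\<in>B. \<forall>h. cmod (f' m x h - f' n x h) \<le> e' * norm h"
        using Cauchy by blast
      have "e' * norm h < e"
      proof -
        have "e' * norm h \<le> e' * (norm h + 1)" using \<open>e' > 0\<close> by simp
        also have "\<dots> = e / 2" unfolding e'_def
        proof -
          have "norm h + 1 \<noteq> 0" using norm_ge_zero[of h] by linarith
          then show "e / (2 * (norm h + 1)) * (norm h + 1) = e / 2" by (simp del: distrib_left_numeral)
        qed
        finally show ?thesis using e by simp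
      qed
      then show "\<exists>M. \<forall>m\<ge>M. \<forall>n\<ge>M. dist (f' m x h) (f' n x h) < e"
        using N that unfolding dist_norm by (meson le_less_trans)
    qed
    then show ?thesis by (simp add: Cauchy_convergent_iff convergent_def)
  qed
  then obtain g' where g': "\<And>x h. x \<in> B \<Longrightarrow> (\<lambda>n. f' n x h) \<longlonglongrightarrow> g' x h" by metis
  have nle: "\<forall>\<^sub>F n in sequentially. \<forall>x\<in>B. \<forall>h. norm (f' n x h - g' x h) \<le> e * norm h" if e: "e > 0" for e
  proof -
    obtain N where N: "\<forall>m\<ge>N. \<forall>n\<ge>N. \<forall>x\<in>B. \<forall>h. cmod (f' m x h - f' n x h) \<le> e * norm h"
      using Cauchy[OF e] by blast
    have "norm (f' n x h - g' x h) \<le> e * norm h" if "n \<ge> N" "x \<in> B" for n x h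
    proof (rule LIMSEQ_le_const2)
      show "(\<lambda>k. norm (f' n x h - f' k x h)) \<longlonglongrightarrow> norm (f' n x h - g' x h)"
        by (intro tendsto_intros g' that)
    qed (use N that in blast)
    then show ?thesis unfolding eventually_sequentially by blast
  qed
  have pB: "p \<in> B" using r by (simp add: B_def)
  have fg: "(\<lambda>n. f n x) \<longlonglongrightarrow> g x" if "x \<in> B" for x
  proof -
    have "x \<in> ball p r" using that r(1) by (auto simp: B_def)
    then show ?thesis using tendsto_uniform_limitI[OF r(3)] by blast
  qed
  obtain G where G: "\<forall>x\<in>B. (\<lambda>n. f n x) \<longlonglongrightarrow> G x \<and> (G has_derivative g' x) (at x within B)"
    using has_derivative_sequence[where f = f and f' = f' and g' = g' and S = B, OF _ _ nle pB fg[OF pB]]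
      der has_derivative_at_withinI unfolding B_def by (metis convex_ball)
  have "G x = g x" if "x \<in> B" for x using G fg that LIMSEQ_unique by blast
  then have "(g has_derivative g' p) (at p within B)"
    using G pB by (metis has_derivative_transform)
  then have "(g has_derivative g' p) (at p)"
    using pB at_within_open[of p B] unfolding B_def by simp
  moreover have "g' p (scl a v) = a * g' p v" for a v
  proof -
    have "(\<lambda>n. f' n p (scl a v)) \<longlonglongrightarrow> g' p (scl a v)" by (rule g'[OF pB])
    moreover have "f' n p (scl a v) = a * f' n p v" for n
      unfolding f'_def using holD(2)[OF f] \<open>p \<in> D\<close> by blast
    moreover have "(\<lambda>n. a * f' n p v) \<longlonglongrightarrow> a * g' p v" by (intro tendsto_intros g' pB)
    ultimately show ?thesis using LIMSEQ_unique by force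
  qed
  ultimately show "\<exists>f'. (g has_derivative f') (at p) \<and> (\<forall>a v. f' (scl a v) = a * f' v)" by blast
qed

text \<open>First-order Taylor formula. The second derivative on the disc of radius \<open>d\<close>
  is bounded by Cauchy's estimate on discs of radius \<open>d / 2\<close>, whence 2 (M + 1) / (d /
  2)^2 = 8 (M + 1) / d^2. The summand 1 puts the values into an open ball.\<close>

lemma line_remainder:
  assumes hol: "\<phi> holomorphic_on ball 0 (2 * d)" and d: "d > 0" and M: "\<And>w. cmod w < 2 * d \<Longrightarrow> cmod (\<phi> w) \<le> M"
    and h: "cmod h < d"
  shows "cmod (\<phi> h - \<phi> 0 - deriv \<phi> 0 * h) \<le> 8 * (M + 1) / d ^ 2 * cmod h ^ 2"
proof -
  have hol_n: "(deriv ^^ n) \<phi> holomorphic_on ball 0 (2 * d)" for n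
    by (rule holomorphic_higher_deriv[OF hol]) auto
  have "cmod ((deriv ^^ 0) \<phi> h - (\<Sum>i\<le>1. (deriv ^^ i) \<phi> 0 * (h - 0) ^ i / fact i))
      \<le> 8 * (M + 1) / d ^ 2 * cmod (h - 0) ^ Suc 1 / fact 1"
  proof (rule complex_Taylor[where S = "ball 0 d"])
    fix i x assume x: "x \<in> ball (0::complex) d"
    have "x \<in> ball 0 (2*d)" using x d by auto
    then have "((deriv ^^ i) \<phi> has_field_derivative deriv ((deriv ^^ i) \<phi>) x) (at x)"
      by (rule holomorphic_derivI[OF hol_n open_ball])
    then show "((deriv ^^ i) \<phi> has_field_derivative (deriv ^^ Suc i) \<phi> x) (at x within ball 0 d)"
      using has_field_derivative_at_within by force
  next
    fix x assume x: "x \<in> ball (0::complex) d"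
    have sub: "cball x (d/2) \<subseteq> ball 0 (2 * d)"
    proof
      fix y assume "y \<in> cball x (d/2)"
      then have "cmod (y - x) \<le> d / 2" by (simp add: dist_norm norm_minus_commute)
      then show "y \<in> ball 0 (2*d)" using x d norm_triangle_ineq[of "y - x" x] by simp
    qed
    have "cmod ((deriv ^^ 2) \<phi> x) \<le> fact 2 * (M + 1) / (d/2) ^ 2"
    proof (rule Cauchy_higher_deriv_bound[where y = 0])
      show "\<phi> holomorphic_on ball x (d/2)" using hol sub by (meson ball_subset_cball holomorphic_on_subset)
      show "continuous_on (cball x (d/2)) \<phi>" using hol sub
        by (meson continuous_on_subset holomorphic_on_imp_continuous_on)
      fix w assume "w \<in> ball x (d/2)"
      then have "w \<in> ball 0 (2*d)" using sub ball_subset_cball by blast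
      then have "cmod (\<phi> w) \<le> M" using M by auto
      then show "\<phi> w \<in> ball 0 (M + 1)" by simp
    qed (use d in auto)
    then show "cmod ((deriv ^^ Suc 1) \<phi> x) \<le> 8 * (M + 1) / d ^ 2"
      by (simp add: numeral_2_eq_2 power2_eq_square field_simps)
  qed (use h d in auto)
  then show ?thesis by (simp add: algebra_simps power2_eq_square)
qed

text \<open>The difference quotients in direction \<open>v\<close> converge locally uniformly, and \<open>hol\<close> is closed under such limits.\<close>

lemma hol_directional:
  assumes f: "hol f D" and D: "open D"
  shows "hol (\<lambda>p. frechet_derivative f (at p) v) D"
proof (cases "v = 0")
  case True
  have "hol (\<lambda>p. 0) D" by (rule hol_const)
  then show ?thesis
  proof (rule hol_cong[OF D, rotated])
    fix p assume "p \<in> D"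
    then have "bounded_linear (frechet_derivative f (at p))"
      using holD(1)[OF f] has_derivative_bounded_linear by blast
    then show "0 = frechet_derivative f (at p) v" using True by (simp add: linear_simps)
  qed
next
  case False
  then have nv: "norm v > 0" by simp
  have loc: "\<exists>r>0. ball p r \<subseteq> D \<and> hol (\<lambda>p. frechet_derivative f (at p) v) (ball p r)" if p: "p \<in> D" for p
  proof -
    obtain r0 where r0: "r0 > 0" "ball p r0 \<subseteq> D" using D p openE by blast
    have "isCont f p" using hol_imp_continuous_on[OF f] D p continuous_on_eq_continuous_at by blast
    then obtain r1 where r1: "r1 > 0" "\<And>x. dist x p < r1 \<Longrightarrow> dist (f x) (f p) < 1"
      unfolding continuous_at_eps_delta by (metis zero_less_one)
    define r where "r = min r0 r1 / 2"
    define M where "M = cmod (f p) + 1"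
    have r: "r > 0" "ball p (2 * r) \<subseteq> D" using r0 r1 unfolding r_def by auto
    have M: "cmod (f x) \<le> M" if "x \<in> ball p (2*r)" for x
    proof -
      have "dist (f x) (f p) < 1" by (rule r1(2)) (use that in \<open>auto simp: r_def dist_commute\<close>)
      then show ?thesis unfolding M_def dist_norm using norm_triangle_ineq2[of "f x" "f p"] by linarith
    qed
    \<comment> \<open>With this \<open>d\<close>, parameters below \<open>2 * d\<close> move a point
      by less than \<open>r\<close>, so the lines through points of \<open>ball p r\<close> stay in
      \<open>ball p (2 * r)\<close>, where \<open>M\<close> bounds \<open>f\<close>.\<close>
    define d where "d = r / (2 * norm v)"
    have d: "d > 0" using r nv by (simp add: d_def)
    have inb: "x + scl a v \<in> ball p (2*r)" if "x \<in> ball p r" "cmod a < 2 * d" for x a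
    proof -
      have "norm (scl a v) < r" using that nv by (simp add: scl_norm d_def field_simps)
      then have "dist x (x + scl a v) < r" by (simp add: dist_norm)
      then show ?thesis using that dist_triangle[of p "x + scl a v" x] by simp
    qed
    \<comment> \<open>Nonzero steps tending to 0; the 2 keeps even the first of them strictly below
      \<open>d\<close>.\<close>
    define h where "h n = complex_of_real (d / (real n + 2))" for n :: nat
    have h: "cmod (h n) < d" "h n \<noteq> 0" for n
    proof -
    have "d * 1 < d * (real n + 2)" using d by (intro mult_strict_left_mono) auto
    then have "d / (real n + 2) < d" by (simp add: divide_less_eq)
    moreover have "d / (real n + 2) > 0" using d by simp
    ultimately show "cmod (h n) < d" "h n \<noteq> 0" unfolding h_def norm_of_real of_real_eq_0_iff by auto
  qed
    have hlim: "h \<longlonglongrightarrow> 0" unfolding h_def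
    proof -
      have "(\<lambda>n. d / (real n + 2)) \<longlonglongrightarrow> 0" by real_asymp
      from tendsto_of_real[OF this, where 'a = complex] show "(\<lambda>n. complex_of_real (d / (real n + 2))) \<longlonglongrightarrow> 0" by simp
    qed
    have "hol (\<lambda>x. frechet_derivative f (at x) v) (ball p r)"
    proof (rule hol_limit[where f = "\<lambda>n x. (f (x + scl (h n) v) - f x) / h n"])
      fix n
      have "hol (\<lambda>x. f (x + scl (h n) v)) (ball p r)"
        by (rule hol_translate[OF f]) (use inb[of _ "h n"] h[of n] r d in auto)
      moreover have "hol f (ball p r)" using hol_subset[OF f, of "ball p r"] r subset_ball[of r "2 * r" p] by auto
      ultimately show "hol (\<lambda>x. (f (x + scl (h n) v) - f x) / h n) (ball p r)"
        by (intro hol_divide hol_diff hol_const) (use h in auto)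
    next
      have est: "cmod ((f (x + scl (h n) v) - f x) / h n - frechet_derivative f (at x) v) \<le> 8 * (M + 1) / d ^ 2 * cmod (h n)"
        if x: "x \<in> ball p r" for x n
      proof -
        let ?\<phi> = "\<lambda>a. f (x + scl a v)"
        have "cmod (?\<phi> (h n) - ?\<phi> 0 - deriv ?\<phi> 0 * h n) \<le> 8 * (M + 1) / d ^ 2 * cmod (h n) ^ 2"
        proof (rule line_remainder)
          show "?\<phi> holomorphic_on ball 0 (2*d)"
            by (rule hol_line_holomorphic[OF f]) (use inb[OF x] r in auto)
        qed (use d h M inb[OF x] in auto)
        moreover have "deriv ?\<phi> 0 = frechet_derivative f (at x) v"
          using DERIV_imp_deriv[OF hol_line[OF f, of x 0 v]] inb[OF x, of 0] r d by auto
        moreover have "(?\<phi> (h n) - ?\<phi> 0) / h n - frechet_derivative f (at x) v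
            = (?\<phi> (h n) - ?\<phi> 0 - frechet_derivative f (at x) v * h n) / h n"
          using h(2)[of n] by (simp add: field_simps)
        ultimately show ?thesis using h(2)[of n]
          by (simp add: norm_divide divide_le_eq power2_eq_square mult.assoc)
      qed
      have "uniform_limit (ball p r) (\<lambda>n x. (f (x + scl (h n) v) - f x) / h n) (\<lambda>x. frechet_derivative f (at x) v) sequentially"
      proof (rule uniform_limitI)
        fix e :: real assume "e > 0"
        have "(\<lambda>n. 8 * (M + 1) / d ^ 2 * cmod (h n)) \<longlonglongrightarrow> 8 * (M + 1) / d ^ 2 * cmod 0"
          by (intro tendsto_intros hlim)
        then have "\<forall>\<^sub>F n in sequentially. 8 * (M + 1) / d ^ 2 * cmod (h n) < e"
          using \<open>e > 0\<close> by (intro order_tendstoD(2)) auto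
        then show "\<forall>\<^sub>F n in sequentially. \<forall>x\<in>ball p r.
            dist ((f (x + scl (h n) v) - f x) / h n) (frechet_derivative f (at x) v) < e"
          by eventually_elim (auto simp: dist_norm intro: le_less_trans[OF est])
      qed
      then show "\<And>y. y \<in> ball p r \<Longrightarrow> \<exists>e>0. ball y e \<subseteq> ball p r \<and> uniform_limit (ball y e)
         (\<lambda>n x. (f (x + scl (h n) v) - f x) / h n) (\<lambda>x. frechet_derivative f (at x) v) sequentially"
        by (meson open_ball openE uniform_limit_on_subset)
    qed auto
    then show ?thesis using r by (intro exI[of _ r]) (auto simp: subset_ball dest: subsetD)
  qed
  show ?thesis
    unfolding hol_def
  proof
    fix p assume "p \<in> D"
    from loc[OF this] obtain r where "r > 0" "hol (\<lambda>p. frechet_derivative f (at p) v) (ball p r)" by blast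
    then show "\<exists>f'. ((\<lambda>p. frechet_derivative f (at p) v) has_derivative f') (at p) \<and> (\<forall>a v. f' (scl a v) = a * f' v)"
      unfolding hol_def by auto
  qed
qed

text \<open>The sum over \<open>A\<close> is a limit along the finite subsets, while
  \<open>hol_limit\<close> wants a sequence; finite sets \<open>F k\<close> with uniform error
  \<open>1 / (k + 1)\<close> provide one.\<close>

lemma hol_infsum:
  assumes D: "open D" and f: "\<And>n. n \<in> A \<Longrightarrow> hol (f n) D" and M: "M summable_on A"
    and fM: "\<And>n p. n \<in> A \<Longrightarrow> p \<in> D \<Longrightarrow> cmod (f n p) \<le> M n"
  shows "hol (\<lambda>p. \<Sum>\<^sub>\<infinity>n\<in>A. f n p) D"
proof -
  have "\<exists>F. finite F \<and> F \<subseteq> A \<and> (\<forall>p\<in>D. cmod ((\<Sum>\<^sub>\<infinity>n\<in>A. f n p) - (\<Sum>n\<in>F. f n p)) \<le> inverse (real (Suc k)))" for k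
  proof -
    have "inverse (real (Suc k)) > 0" by simp
    from norm_summable_tail[where f = f and D = D, OF M fM this] show ?thesis by blast
  qed
  then obtain F where F: "\<And>k. finite (F k)" "\<And>k. F k \<subseteq> A"
    "\<And>k p. p \<in> D \<Longrightarrow> cmod ((\<Sum>\<^sub>\<infinity>n\<in>A. f n p) - (\<Sum>n\<in>F k. f n p)) \<le> inverse (real (Suc k))" by metis
  have "uniform_limit D (\<lambda>k p. \<Sum>n\<in>F k. f n p) (\<lambda>p. \<Sum>\<^sub>\<infinity>n\<in>A. f n p) sequentially"
  proof (rule uniform_limitI)
    fix e :: real assume "e > 0"
    then have "\<forall>\<^sub>F k in sequentially. inverse (real (Suc k)) < e"
      using LIMSEQ_inverse_real_of_nat order_tendstoD(2) by blast
    then show "\<forall>\<^sub>F k in sequentially. \<forall>p\<in>D. dist (\<Sum>n\<in>F k. f n p) (\<Sum>\<^sub>\<infinity>n\<in>A. f n p) < e"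
      by eventually_elim (auto simp: dist_norm norm_minus_commute intro: le_less_trans[OF F(3)])
  qed
  note ul = this
  show ?thesis
  proof (rule hol_limit[OF D])
    show "hol (\<lambda>p. \<Sum>n\<in>F k. f n p) D" for k
      using F(2) f by (intro hol_sum) blast
    show "\<exists>r>0. ball p r \<subseteq> D \<and> uniform_limit (ball p r) (\<lambda>k p. \<Sum>n\<in>F k. f n p) (\<lambda>p. \<Sum>\<^sub>\<infinity>n\<in>A. f n p) sequentially"
      if "p \<in> D" for p
      using openE[OF D that] uniform_limit_on_subset[OF ul] by metis
  qed
qed

end

subsection \<open>Holomorphic functions on polydiscs\<close>

interpretation Z: complex_scaling "\<lambda>a (v::complex^'d). a *s v"
proof
  show "norm (a *s v) = cmod a * norm v" for a :: complex and v :: "complex^'d"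
    by (simp add: norm_vec_def norm_mult L2_set_right_distrib)
qed (auto simp: vec_eq_iff algebra_simps)

interpretation TZ: complex_scaling "\<lambda>a (p :: complex \<times> (complex^'d)). (a * fst p, a *s snd p)"
proof
  show "norm (a * fst p, a *s snd p) = cmod a * norm p" for a :: complex and p :: "complex \<times> (complex^'d)"
  proof -
    have "(cmod a * norm p)^2 = (cmod (a * fst p))^2 + (norm (a *s snd p))^2"
      by (simp add: norm_prod_def[of p] Z.scl_norm norm_mult power_mult_distrib algebra_simps)
    then show ?thesis by (simp add: norm_Pair real_sqrt_unique)
  qed
qed (auto simp: vec_eq_iff algebra_simps)

text \<open>A complex-linear map is determined by its values on the standard basis, which supply the
  coefficients: \<open>g i = f' (axis i 1)\<close>.\<close>

lemma holo_z_iff_hol: "holo_z f D \<longleftrightarrow> Z.hol f D"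
proof
  assume f: "holo_z f D"
  show "Z.hol f D" unfolding Z.hol_def
  proof
    fix p assume "p \<in> D"
    then obtain g where "(f has_derivative (\<lambda>v. \<Sum>i\<in>UNIV. g i * v $ i)) (at p)"
      using f unfolding holo_z_def by blast
    then show "\<exists>f'. (f has_derivative f') (at p) \<and> (\<forall>a v. f' (a *s v) = a * f' v)"
      by (intro exI conjI) (auto simp: sum_distrib_left algebra_simps)
  qed
next
  assume f: "Z.hol f D"
  show "holo_z f D" unfolding holo_z_def
  proof
    fix p assume "p \<in> D"
    then obtain f' where f': "(f has_derivative f') (at p)" "\<And>a v. f' (a *s v) = a * f' v"
      using f unfolding Z.hol_def by blast
    have "f' v = (\<Sum>i\<in>UNIV. f' (axis i 1) * v $ i)" for v
    proof -
      have "f' v = f' (\<Sum>i\<in>UNIV. v $ i *s axis i 1)" by (simp add: basis_expansion)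
      also have "\<dots> = (\<Sum>i\<in>UNIV. f' (v $ i *s axis i 1))"
        using linear_sum[OF has_derivative_linear[OF f'(1)]] by simp
      finally show ?thesis by (simp add: f'(2) mult.commute)
    qed
    then have "f' = (\<lambda>v. \<Sum>i\<in>UNIV. f' (axis i 1) * v $ i)" by blast
    then show "\<exists>g. (f has_derivative (\<lambda>v. \<Sum>i\<in>UNIV. g i * v $ i)) (at p)"
      using f'(1) by metis
  qed
qed

lemma holo_tz_iff_hol: "holo_tz f D \<longleftrightarrow> TZ.hol f D"
proof
  assume f: "holo_tz f D"
  show "TZ.hol f D" unfolding TZ.hol_def
  proof
    fix p assume "p \<in> D"
    then obtain c g where "(f has_derivative (\<lambda>(s, v). c * s + (\<Sum>i\<in>UNIV. g i * v $ i))) (at p)"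
      using f unfolding holo_tz_def by blast
    then show "\<exists>f'. (f has_derivative f') (at p) \<and> (\<forall>a v. f' (a * fst v, a *s snd v) = a * f' v)"
      by (intro exI conjI) (auto simp: sum_distrib_left algebra_simps)
  qed
next
  assume f: "TZ.hol f D"
  show "holo_tz f D" unfolding holo_tz_def
  proof
    fix p assume "p \<in> D"
    then obtain f' where f': "(f has_derivative f') (at p)" "\<And>a v. f' (a * fst v, a *s snd v) = a * f' v"
      using f unfolding TZ.hol_def by blast
    have lin: "linear f'" by (rule has_derivative_linear[OF f'(1)])
    have "f' (s, v) = f' (1, 0) * s + (\<Sum>i\<in>UNIV. f' (0, axis i 1) * v $ i)" for s v
    proof -
      have "(s, v) = (s * fst (1, 0::complex^'a), s *s snd (1::complex, 0)) + (\<Sum>i\<in>UNIV. (v $ i * fst (0, axis i 1 :: complex^'a), v $ i *s snd (0::complex, axis i 1)))"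
        by (simp add: prod_eq_iff fst_sum snd_sum basis_expansion)
      then have "f' (s, v) = f' ((s * fst (1, 0::complex^'a), s *s snd (1::complex, 0)) + (\<Sum>i\<in>UNIV. (v $ i * fst (0, axis i 1 :: complex^'a), v $ i *s snd (0::complex, axis i 1))))"
        by (rule arg_cong)
      also have "\<dots> = f' (s * fst (1, 0::complex^'a), s *s snd (1::complex, 0)) + (\<Sum>i\<in>UNIV. f' (v $ i * fst (0, axis i 1 :: complex^'a), v $ i *s snd (0::complex, axis i 1)))"
        by (simp only: linear_add[OF lin] linear_sum[OF lin])
      finally show ?thesis unfolding f'(2) by (simp add: mult.commute)
    qed
    note eq = this
    have "(case p of (s, v) \<Rightarrow> f' (1, 0) * s + (\<Sum>i\<in>UNIV. f' (0, axis i 1) * v $ i)) = f' p" for p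
      by (cases p) (simp only: split eq[symmetric])
    then have "(\<lambda>(s, v). f' (1, 0) * s + (\<Sum>i\<in>UNIV. f' (0, axis i 1) * v $ i)) = f'" by (rule ext)
    with f'(1) have "(f has_derivative (\<lambda>(s, v). f' (1, 0) * s + (\<Sum>i\<in>UNIV. f' (0, axis i 1) * v $ i))) (at p)"
      by (simp only:)
    then show "\<exists>c g. (f has_derivative (\<lambda>(s, v). c * s + (\<Sum>i\<in>UNIV. g i * v $ i))) (at p)"
      by (intro exI)
  qed
qed

lemma open_polydisc: "open (polydisc R :: (complex^'d) set)"
proof -
  have "polydisc R = (\<Inter>i. (\<lambda>z::complex^'d. cmod (z $ i)) -` {..<R})"
    by (auto simp: polydisc_def)
  moreover have "open ((\<lambda>z::complex^'d. cmod (z $ i)) -` {..<R})" for i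
    by (intro open_vimage continuous_intros open_lessThan)
  ultimately show ?thesis by (auto intro!: open_INT)
qed

lemma polydisc_mono: "R' \<le> R \<Longrightarrow> polydisc R' \<subseteq> polydisc R"
  by (auto simp: polydisc_def intro: less_le_trans)

lemma zero_in_polydisc: "R > 0 \<Longrightarrow> 0 \<in> polydisc R"
  by (simp add: polydisc_def)

text \<open>Coordinates are bounded by the Euclidean norm; thus \<open>Cauchy_est\<close>, which
  speaks of balls, yields estimates between nested polydiscs with gap \<open>R - R'\<close>.\<close>

lemma ball_subset_polydisc: "z \<in> polydisc R' \<Longrightarrow> ball z (R - R') \<subseteq> polydisc R"
proof
  fix y assume z: "z \<in> polydisc R'" and y: "y \<in> ball z (R - R')"
  have "cmod (y $ i) < R" for i
  proof -
    have "cmod (y $ i) \<le> cmod (z $ i) + cmod ((y - z) $ i)" using norm_triangle_ineq[of "z $ i" "(y-z) $ i"] by simp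
    moreover have "cmod ((y - z) $ i) \<le> norm (y - z)" by (rule Finite_Cartesian_Product.norm_nth_le)
    moreover have "norm (y - z) < R - R'" using y by (simp add: dist_norm norm_minus_commute)
    moreover have "cmod (z $ i) < R'" using z by (simp add: polydisc_def)
    ultimately show ?thesis by linarith
  qed
  then show "y \<in> polydisc R" by (simp add: polydisc_def)
qed

section \<open>Partial derivatives and Cauchy estimates on polydiscs\<close>

lemma partial_z_frechet:
  assumes "holo_z f D" "z \<in> D"
  shows "partial_z i f z = frechet_derivative f (at z) (axis i 1)"
proof -
  have eq: "(\<chi> k. if k = i then w else z $ k) = z + (w - z $ i) *s axis i 1" for w
    by (auto simp: vec_eq_iff axis_def)
  have "((\<lambda>a. f (z + a *s axis i 1)) has_field_derivative frechet_derivative f (at z) (axis i 1)) (at (z $ i - z $ i))"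
    using Z.hol_line[of f D z 0 "axis i 1"] assms by (simp add: holo_z_iff_hol)
  then have "((\<lambda>w. f (z + (w - z $ i) *s axis i 1)) has_field_derivative frechet_derivative f (at z) (axis i 1) * 1) (at (z $ i))"
    by (rule DERIV_chain2) (auto intro!: derivative_eq_intros)
  then show ?thesis unfolding partial_z_def eq using DERIV_imp_deriv by force
qed

lemma holo_z_cong: "open D \<Longrightarrow> (\<And>z. z \<in> D \<Longrightarrow> f z = g z) \<Longrightarrow> holo_z f D \<Longrightarrow> holo_z g D"
  unfolding holo_z_iff_hol by (rule Z.hol_cong)

lemma holo_z_partial_z: "open D \<Longrightarrow> holo_z f D \<Longrightarrow> holo_z (partial_z i f) D"
  by (rule holo_z_cong[of D "\<lambda>z. frechet_derivative f (at z) (axis i 1)"])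
    (auto simp: partial_z_frechet Z.hol_directional holo_z_iff_hol)

lemma partial_z_cong:
  assumes "open D" "z \<in> D" "\<And>y. y \<in> D \<Longrightarrow> f y = g y"
  shows "partial_z i f z = partial_z i g z"
  unfolding partial_z_def
proof (rule deriv_cong_ev)
  have eq: "(\<chi> k. if k = i then w else z $ k) = z + (w - z $ i) *s axis i 1" for w
    by (auto simp: vec_eq_iff axis_def)
  have "((\<lambda>w. z + (w - z $ i) *s axis i 1) \<longlongrightarrow> z + 0) (nhds (z $ i))"
  proof (rule tendsto_add[OF tendsto_const], rule tendsto_norm_zero_cancel)
    have "((\<lambda>w. cmod (w - z $ i) * norm (axis i 1 :: (complex,'a) vec)) \<longlongrightarrow> cmod (z $ i - z $ i) * norm (axis i 1 :: (complex,'a) vec)) (nhds (z $ i))"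
      by (intro tendsto_intros filterlim_ident)
    then show "((\<lambda>w. norm ((w - z $ i) *s axis i 1)) \<longlongrightarrow> 0) (nhds (z $ i))"
      unfolding Z.scl_norm by simp
  qed
  then have "\<forall>\<^sub>F w in nhds (z $ i). (\<chi> k. if k = i then w else z $ k) \<in> D"
    unfolding eq using assms(1,2) topological_tendstoD by fastforce
  then show "\<forall>\<^sub>F w in nhds (z $ i). f (\<chi> k. if k = i then w else z $ k) = g (\<chi> k. if k = i then w else z $ k)"
    by eventually_elim (rule assms(3))
qed simp

lemma partial_z_bound:
  assumes f: "holo_z f (polydisc R)" and M: "\<And>z. z \<in> polydisc R \<Longrightarrow> cmod (f z) \<le> M"
    and R: "R' < R" and z: "z \<in> polydisc R'"
  shows "cmod (partial_z i f z) \<le> M / (R - R')"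
proof -
  have "z \<in> polydisc R" using z R polydisc_mono[of R' R] by auto
  then have "partial_z i f z = frechet_derivative f (at z) (axis i 1)" by (rule partial_z_frechet[OF f])
  moreover have "cmod (frechet_derivative f (at z) (axis i 1)) \<le> M / (R - R') * norm (axis i 1 :: complex^'a)"
  proof (rule Z.Cauchy_est[where D = "polydisc R"])
    show "Z.hol f (polydisc R)" using f by (simp add: holo_z_iff_hol)
    show "cmod (f y) \<le> M" if "y \<in> ball z (R - R')" for y
      using M ball_subset_polydisc[OF z, of R] that by blast
  qed (use R ball_subset_polydisc[OF z] in auto)
  ultimately show ?thesis by simp
qed

lemma foldr_partial_z_cong:
  assumes "open D" "\<And>y. y \<in> D \<Longrightarrow> f y = g y" "z \<in> D"
  shows "foldr partial_z is f z = foldr partial_z is g z"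
  using assms(3) by (induction "is" arbitrary: z) (auto simp: assms(2) intro!: partial_z_cong[OF assms(1)])

lemma holo_z_foldr: "open D \<Longrightarrow> holo_z f D \<Longrightarrow> holo_z (foldr partial_z is f) D"
  by (induction "is") (auto intro: holo_z_partial_z)

text \<open>Every single derivative gives up \<open>d\<close> of the radius and costs a factor
  \<open>1 / d\<close>.\<close>

lemma foldr_partial_z_bound:
  assumes f: "holo_z f (polydisc R)" and M: "\<And>z. z \<in> polydisc R \<Longrightarrow> cmod (f z) \<le> M"
    and d: "d > 0" and z: "z \<in> polydisc (R - real (length is) * d)"
  shows "cmod (foldr partial_z is f z) \<le> M / d ^ length is"
  using z
proof (induction "is" arbitrary: z)
  case Nil
  then show ?case using M by simp
next
  case (Cons i "is")
  let ?R = "R - real (length is) * d"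
  have "?R \<le> R" using d by simp
  then have "holo_z (foldr partial_z is f) (polydisc ?R)"
    using holo_z_foldr[OF open_polydisc f] polydisc_mono Z.hol_subset unfolding holo_z_iff_hol by blast
  then have "cmod (partial_z i (foldr partial_z is f) z) \<le> (M / d ^ length is) / (?R - (R - real (length (i # is)) * d))"
    by (rule partial_z_bound) (use Cons d in \<open>auto simp: algebra_simps\<close>)
  then show ?case by (simp add: algebra_simps)
qed

text \<open>The multi-index written as a word in the coordinates, so that facts about one
  \<open>partial_z\<close> extend to \<open>multi_partial_z\<close> by list induction.\<close>

definition partials_list :: "('d :: {finite,linorder} \<Rightarrow> nat) \<Rightarrow> 'd list" where
  "partials_list \<alpha> = concat (map (\<lambda>i. replicate (\<alpha> i) i) (sorted_list_of_set UNIV))"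

lemma multi_partial_z_foldr:
  fixes \<alpha> :: "'d :: {finite,linorder} \<Rightarrow> nat"
  shows "multi_partial_z \<alpha> f = foldr partial_z (partials_list \<alpha>) f"
proof -
  have rep: "foldr partial_z (replicate n i) g = (partial_z i ^^ n) g" for n i and g :: "(complex, 'd) vec \<Rightarrow> complex"
    by (induction n) auto
  have "foldr (\<lambda>i. partial_z i ^^ \<alpha> i) xs f = foldr partial_z (concat (map (\<lambda>i. replicate (\<alpha> i) i) xs)) f" for xs
    by (induction xs) (auto simp: rep)
  then show ?thesis by (simp add: multi_partial_z_def partials_list_def)
qed

lemma length_partials_list: "length (partials_list \<alpha>) = mlen \<alpha>"
proof -
  have "length (partials_list \<alpha>) = sum_list (map \<alpha> (sorted_list_of_set UNIV))"
    by (simp add: partials_list_def length_concat o_def)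
  then show ?thesis by (simp add: mlen_def sum_list_distinct_conv_sum_set)
qed

lemma holo_z_multi_partial_z: "open D \<Longrightarrow> holo_z f D \<Longrightarrow> holo_z (multi_partial_z \<alpha> f) D"
  unfolding multi_partial_z_foldr by (rule holo_z_foldr)

text \<open>The gap \<open>R - R'\<close> is divided equally among the \<open>mlen \<alpha>\<close>
  derivatives. For \<open>mlen \<alpha> = 0\<close> there is nothing to divide, and the bound reads
  \<open>M\<close> because a power with exponent 0 is 1.\<close>

lemma multi_partial_z_bound:
  assumes f: "holo_z f (polydisc R)" and M: "\<And>z. z \<in> polydisc R \<Longrightarrow> cmod (f z) \<le> M"
    and R: "R' < R" and z: "z \<in> polydisc R'"
  shows "cmod (multi_partial_z \<alpha> f z) \<le> M * (real (mlen \<alpha>) / (R - R')) ^ mlen \<alpha>"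
proof (cases "mlen \<alpha> = 0")
  case True
  then have "partials_list \<alpha> = []" using length_partials_list[of \<alpha>] by simp
  then show ?thesis using True M z R polydisc_mono[of R' R] by (auto simp: multi_partial_z_foldr)
next
  case False
  let ?d = "(R - R') / real (mlen \<alpha>)"
  have "cmod (multi_partial_z \<alpha> f z) \<le> M / ?d ^ mlen \<alpha>"
    unfolding multi_partial_z_foldr
    using foldr_partial_z_bound[OF f M, of ?d z "partials_list \<alpha>"] R z False by (simp add: length_partials_list)
  then show ?thesis by (simp add: power_divide)
qed

lemma multi_partial_z_zero: "mlen \<alpha> = 0 \<Longrightarrow> multi_partial_z \<alpha> f = f"
  using length_partials_list[of \<alpha>] by (simp add: multi_partial_z_foldr)

lemma partial_z_linear:
  assumes "holo_z f D" "holo_z g D" "z \<in> D"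
  shows "partial_z i (\<lambda>z. c * f z + d * g z) z = c * partial_z i f z + d * partial_z i g z"
proof -
  have h: "holo_z (\<lambda>z. c * f z + d * g z) D"
    using assms unfolding holo_z_iff_hol by (intro Z.hol_add Z.hol_mult Z.hol_const)
  have "frechet_derivative (\<lambda>z. c * f z + d * g z) (at z) =
     (\<lambda>v. c * frechet_derivative f (at z) v + d * frechet_derivative g (at z) v)"
    by (rule frechet_derivative_at[symmetric])
      (use assms Z.holD(1) in \<open>auto intro!: derivative_eq_intros simp: holo_z_iff_hol\<close>)
  then show ?thesis using partial_z_frechet[OF h assms(3)] partial_z_frechet[OF assms(1,3)] partial_z_frechet[OF assms(2,3)] by simp
qed

lemma multi_partial_z_linear:
  assumes "open D" "holo_z f D" "holo_z g D" "z \<in> D"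
  shows "multi_partial_z \<alpha> (\<lambda>z. c * f z + d * g z) z = c * multi_partial_z \<alpha> f z + d * multi_partial_z \<alpha> g z"
proof -
  have "foldr partial_z is (\<lambda>z. c * f z + d * g z) z = c * foldr partial_z is f z + d * foldr partial_z is g z" for "is"
    using assms(4)
  proof (induction "is" arbitrary: z)
    case (Cons i "is")
    have "partial_z i (foldr partial_z is (\<lambda>z. c * f z + d * g z)) z
       = partial_z i (\<lambda>z. c * foldr partial_z is f z + d * foldr partial_z is g z) z"
      by (rule partial_z_cong[OF assms(1) Cons.prems Cons.IH])
    also have "\<dots> = c * partial_z i (foldr partial_z is f) z + d * partial_z i (foldr partial_z is g) z"
      by (rule partial_z_linear[OF holo_z_foldr holo_z_foldr Cons.prems]) (use assms in auto)
    finally show ?case by simp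
  qed simp
  then show ?thesis by (simp add: multi_partial_z_foldr)
qed

lemma holo_z_const: "holo_z (\<lambda>_. c) D"
  and holo_z_add: "holo_z f D \<Longrightarrow> holo_z g D \<Longrightarrow> holo_z (\<lambda>z. f z + g z) D"
  and holo_z_diff: "holo_z f D \<Longrightarrow> holo_z g D \<Longrightarrow> holo_z (\<lambda>z. f z - g z) D"
  and holo_z_mult: "holo_z f D \<Longrightarrow> holo_z g D \<Longrightarrow> holo_z (\<lambda>z. f z * g z) D"
  and holo_z_divide: "holo_z f D \<Longrightarrow> holo_z g D \<Longrightarrow> (\<And>z. z \<in> D \<Longrightarrow> g z \<noteq> 0) \<Longrightarrow> holo_z (\<lambda>z. f z / g z) D"
  and holo_z_subset: "holo_z f D \<Longrightarrow> D' \<subseteq> D \<Longrightarrow> holo_z f D'"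
  and holo_z_imp_continuous_on: "holo_z f D \<Longrightarrow> continuous_on D f"
  unfolding holo_z_iff_hol
  by (rule Z.hol_const Z.hol_add Z.hol_diff Z.hol_mult Z.hol_divide Z.hol_subset Z.hol_imp_continuous_on; assumption)+

lemma holo_z_sum: "(\<And>i. i \<in> I \<Longrightarrow> holo_z (f i) D) \<Longrightarrow> holo_z (\<lambda>z. \<Sum>i\<in>I. f i z) D"
  unfolding holo_z_iff_hol by (rule Z.hol_sum)

lemma multi_partial_z_scale:
  assumes "open D" "holo_z f D" "z \<in> D"
  shows "multi_partial_z \<alpha> (\<lambda>z. c * f z) z = c * multi_partial_z \<alpha> f z"
  using multi_partial_z_linear[OF assms(1,2,2,3), of \<alpha> c 0] by simp

lemma multi_partial_z_diff:
  assumes "open D" "holo_z f D" "holo_z g D" "z \<in> D"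
  shows "multi_partial_z \<alpha> (\<lambda>z. f z - g z) z = multi_partial_z \<alpha> f z - multi_partial_z \<alpha> g z"
  using multi_partial_z_linear[OF assms, of \<alpha> 1 "-1"] by simp

lemma multi_partial_z_const_zero:
  "multi_partial_z \<alpha> (\<lambda>z. 0) z = 0"
  using multi_partial_z_scale[of UNIV "\<lambda>z. 0" z \<alpha> 0] by (simp add: holo_z_const)

lemma multi_partial_z_sum:
  assumes "open D" "\<And>n. n \<in> A \<Longrightarrow> holo_z (f n) D" "z \<in> D"
  shows "multi_partial_z \<alpha> (\<lambda>z. \<Sum>n\<in>A. f n z) z = (\<Sum>n\<in>A. multi_partial_z \<alpha> (f n) z)"
  using assms(2)
proof (induction A rule: infinite_finite_induct)
  case (insert x F)
  have "multi_partial_z \<alpha> (\<lambda>z. 1 * f x z + 1 * (\<Sum>n\<in>F. f n z)) z = 1 * multi_partial_z \<alpha> (f x) z + 1 * multi_partial_z \<alpha> (\<lambda>z. \<Sum>n\<in>F. f n z) z"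
    by (rule multi_partial_z_linear[OF assms(1)]) (use insert assms in \<open>auto intro: holo_z_sum\<close>)
  then show ?case using insert by simp
qed (auto simp: multi_partial_z_const_zero)

lemma holo_z_infsum:
  assumes "\<And>n. n \<in> A \<Longrightarrow> holo_z (f n) (polydisc R)" "M summable_on A"
    and "\<And>n z. n \<in> A \<Longrightarrow> z \<in> polydisc R \<Longrightarrow> cmod (f n z) \<le> M n"
  shows "holo_z (\<lambda>z. \<Sum>\<^sub>\<infinity>n\<in>A. f n z) (polydisc R)"
  using Z.hol_infsum[OF open_polydisc] assms unfolding holo_z_iff_hol by blast

text \<open>Termwise differentiation: the Cauchy bound for the derivative is applied to the
  remainder of the sum, which is uniformly small by \<open>norm_summable_tail\<close>.\<close>

lemma multi_partial_z_has_sum: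
  assumes f: "\<And>n. n \<in> A \<Longrightarrow> holo_z (f n) (polydisc R)" and M: "M summable_on A"
    and fM: "\<And>n z. n \<in> A \<Longrightarrow> z \<in> polydisc R \<Longrightarrow> cmod (f n z) \<le> M n"
    and z: "z \<in> polydisc R"
  shows "((\<lambda>n. multi_partial_z \<alpha> (f n) z) has_sum multi_partial_z \<alpha> (\<lambda>z. \<Sum>\<^sub>\<infinity>n\<in>A. f n z) z) A"
proof -
  \<comment> \<open>A radius strictly between the largest coordinate of \<open>z\<close> and
    \<open>R\<close>, so that a positive gap is left for the derivative bound.\<close>
  define R' where "R' = (Max (range (\<lambda>i. cmod (z $ i))) + R) / 2"
  have "Max (range (\<lambda>i. cmod (z $ i))) < R" using z by (simp add: polydisc_def)
  then have R': "R' < R" "Max (range (\<lambda>i. cmod (z $ i))) < R'" by (auto simp: R'_def)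
  then have zR': "z \<in> polydisc R'" by (simp add: polydisc_def)
  define K where "K = (real (mlen \<alpha>) / (R - R')) ^ mlen \<alpha>"
  have K: "K \<ge> 0" using R' by (simp add: K_def)
  have hs: "holo_z (\<lambda>z. \<Sum>\<^sub>\<infinity>n\<in>A. f n z) (polydisc R)" by (rule holo_z_infsum[OF f M fM])
  show ?thesis
    unfolding has_sum_def tendsto_iff eventually_finite_subsets_at_top
  proof (intro allI impI)
    fix e :: real assume e: "e > 0"
    define e' where "e' = e / (2 * (K + 1))"
    have "e' > 0" using e K by (simp add: e'_def)
    from norm_summable_tail[where f = f and D = "polydisc R", OF M fM this]
    obtain F0 where F0: "finite F0" "F0 \<subseteq> A"
      and est: "\<And>F z. finite F \<Longrightarrow> F0 \<subseteq> F \<Longrightarrow> F \<subseteq> A \<Longrightarrow> z \<in> polydisc R \<Longrightarrow>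
           cmod ((\<Sum>\<^sub>\<infinity>n\<in>A. f n z) - (\<Sum>n\<in>F. f n z)) \<le> e'" by blast
    show "\<exists>X. finite X \<and> X \<subseteq> A \<and> (\<forall>Y. finite Y \<and> X \<subseteq> Y \<and> Y \<subseteq> A \<longrightarrow>
            dist (\<Sum>n\<in>Y. multi_partial_z \<alpha> (f n) z) (multi_partial_z \<alpha> (\<lambda>z. \<Sum>\<^sub>\<infinity>n\<in>A. f n z) z) < e)"
    proof (intro exI[of _ F0] conjI allI impI)
      fix Y assume Y: "finite Y \<and> F0 \<subseteq> Y \<and> Y \<subseteq> A"
      have fY: "holo_z (f n) (polydisc R)" if "n \<in> Y" for n using Y f that by blast
      have hY: "holo_z (\<lambda>z. \<Sum>n\<in>Y. f n z) (polydisc R)" by (intro holo_z_sum fY)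
      have "cmod (multi_partial_z \<alpha> (\<lambda>z. (\<Sum>\<^sub>\<infinity>n\<in>A. f n z) - (\<Sum>n\<in>Y. f n z)) z) \<le> e' * K"
        unfolding K_def by (rule multi_partial_z_bound[OF holo_z_diff[OF hs hY] _ R'(1) zR']) (use est Y in auto)
      also have "multi_partial_z \<alpha> (\<lambda>z. (\<Sum>\<^sub>\<infinity>n\<in>A. f n z) - (\<Sum>n\<in>Y. f n z)) z
          = multi_partial_z \<alpha> (\<lambda>z. \<Sum>\<^sub>\<infinity>n\<in>A. f n z) z - (\<Sum>n\<in>Y. multi_partial_z \<alpha> (f n) z)"
        using multi_partial_z_diff[OF open_polydisc hs hY z] multi_partial_z_sum[OF open_polydisc fY z] by simp
      also have "e' * K < e"
      proof -
        have "e' * K \<le> e' * (K + 1)" using \<open>e' > 0\<close> by simp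
        also have "e' * (K + 1) = e / 2" using K by (simp add: e'_def field_simps)
        finally show ?thesis using e by simp
      qed
      finally show "dist (\<Sum>n\<in>Y. multi_partial_z \<alpha> (f n) z) (multi_partial_z \<alpha> (\<lambda>z. \<Sum>\<^sub>\<infinity>n\<in>A. f n z) z) < e"
        by (simp add: dist_norm norm_minus_commute)
    qed (use F0 in auto)
  qed
qed

section \<open>Taylor coefficients in t\<close>

lemma holo_tz_t_line:
  assumes "holo_tz b Q" "(t, z) \<in> Q"
  shows "((\<lambda>s. b (s, z)) has_field_derivative frechet_derivative b (at (t, z)) (1, 0)) (at t)"
  using TZ.hol_line[of b Q "(0, z)" t "(1, 0)"] assms by (simp add: holo_tz_iff_hol)

lemma holo_tz_t_deriv:
  assumes "open Q" "holo_tz b Q"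
  shows "holo_tz (\<lambda>(t, z). deriv (\<lambda>s. b (s, z)) t) Q"
  unfolding holo_tz_iff_hol
proof (rule TZ.hol_cong[OF assms(1)])
  show "TZ.hol (\<lambda>p. frechet_derivative b (at p) (1, 0)) Q"
    using TZ.hol_directional[OF _ assms(1)] assms(2) by (simp add: holo_tz_iff_hol)
qed (auto simp: DERIV_imp_deriv[OF holo_tz_t_line[OF assms(2)]])

lemma holo_tz_higher_t_deriv:
  assumes "open Q" "holo_tz b Q"
  shows "holo_tz (\<lambda>(t, z). (deriv ^^ k) (\<lambda>s. b (s, z)) t) Q"
proof (induction k)
  case 0
  then show ?case using assms by simp
next
  case (Suc k)
  from holo_tz_t_deriv[OF assms(1) this] show ?case by simp
qed

lemma holo_z_slice:
  assumes "holo_tz b Q" "\<And>z. z \<in> D \<Longrightarrow> (t, z) \<in> Q"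
  shows "holo_z (\<lambda>z. b (t, z)) D"
  unfolding holo_z_iff_hol Z.hol_def
proof
  fix z assume z: "z \<in> D"
  have "TZ.hol b Q" using assms(1) by (simp add: holo_tz_iff_hol)
  note h = TZ.holD[OF this assms(2)[OF z]]
  have "((\<lambda>z. b (t, z)) has_derivative (\<lambda>v. frechet_derivative b (at (t, z)) (0, v))) (at z)"
    by (rule has_derivative_compose[of "\<lambda>z. (t, z)" "\<lambda>v. (0, v)" z UNIV b])
      (use h(1) in \<open>auto intro!: derivative_eq_intros\<close>)
  moreover have "frechet_derivative b (at (t, z)) (0, a *s v) = a * frechet_derivative b (at (t, z)) (0, v)" for a v
    using h(2)[of a "(0, v)"] by simp
  ultimately show "\<exists>f'. ((\<lambda>z. b (t, z)) has_derivative f') (at z) \<and> (\<forall>a v. f' (a *s v) = a * f' v)"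
    by blast
qed

definition tcoef :: "(complex \<times> (complex ^ 'd) \<Rightarrow> complex) \<Rightarrow> nat \<Rightarrow> complex ^ 'd \<Rightarrow> complex" where
  "tcoef b k z = (deriv ^^ k) (\<lambda>s. b (s, z)) 0 / fact k"

context
  fixes b :: "complex \<times> (complex ^ 'd) \<Rightarrow> complex" and \<rho> R M :: real
  assumes b: "holo_tz b (ball 0 \<rho> \<times> polydisc R)" and \<rho>: "\<rho> > 0"
    and M: "\<And>t z. t \<in> ball 0 \<rho> \<Longrightarrow> z \<in> polydisc R \<Longrightarrow> cmod (b (t, z)) \<le> M"
begin

text \<open>Derivatives in \<open>t\<close> of a jointly holomorphic function are again jointly
  holomorphic; their restriction to \<open>t = 0\<close> is a holomorphic function of
  \<open>z\<close>.\<close>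

lemma holo_z_tcoef: "holo_z (tcoef b k) (polydisc R)"
proof -
  have "holo_tz (\<lambda>(t, z). (deriv ^^ k) (\<lambda>s. b (s, z)) t) (ball 0 \<rho> \<times> polydisc R)"
    by (intro holo_tz_higher_t_deriv b open_Times open_polydisc) auto
  from holo_z_slice[OF this, of "polydisc R" 0] \<rho>
  have "holo_z (\<lambda>z. (deriv ^^ k) (\<lambda>s. b (s, z)) 0) (polydisc R)" by simp
  from holo_z_divide[OF this holo_z_const[of "fact k"]] show ?thesis by (simp add: tcoef_def[abs_def])
qed

lemma t_slice_holomorphic: "z \<in> polydisc R \<Longrightarrow> (\<lambda>s. b (s, z)) holomorphic_on ball 0 \<rho>"
  unfolding holomorphic_on_def field_differentiable_def
  using holo_tz_t_line[OF b] has_field_derivative_at_within by blast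

lemma tcoef_bound:
  assumes z: "z \<in> polydisc R" and r: "0 < r" "r < \<rho>"
  shows "cmod (tcoef b k z) \<le> M / r ^ k"
proof -
  have "cmod ((deriv ^^ k) (\<lambda>s. b (s, z)) 0) \<le> fact k * M / r ^ k"
  proof (rule Cauchy_inequality)
    show "(\<lambda>s. b (s, z)) holomorphic_on ball 0 r"
      by (rule holomorphic_on_subset[OF t_slice_holomorphic[OF z]]) (use r in auto)
    show "continuous_on (cball 0 r) (\<lambda>s. b (s, z))"
      by (rule continuous_on_subset[OF holomorphic_on_imp_continuous_on[OF t_slice_holomorphic[OF z]]]) (use r in auto)
  qed (use r M z in auto)
  then show ?thesis by (simp add: tcoef_def norm_divide field_simps)
qed

lemma tcoef_summable:
  assumes z: "z \<in> polydisc R" and t: "cmod t < \<rho>"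
  shows "(\<lambda>k. cmod (tcoef b k z * t ^ k)) summable_on UNIV"
proof -
  define r where "r = (cmod t + \<rho>) / 2"
  have r: "0 < r" "r < \<rho>" "cmod t < r" using t \<rho> add_nonneg_pos[OF norm_ge_zero[of t] \<rho>] unfolding r_def by auto
  have geo: "summable (\<lambda>k. M * (cmod t / r) ^ k)"
    by (intro summable_mult summable_geometric) (use r in auto)
  have le: "cmod (tcoef b k z * t ^ k) \<le> M * (cmod t / r) ^ k" for k
  proof -
    have "cmod (tcoef b k z * t ^ k) \<le> M / r ^ k * cmod t ^ k"
      unfolding norm_mult norm_power by (intro mult_right_mono tcoef_bound z r) auto
    then show ?thesis by (simp add: power_divide)
  qed
  have "summable (\<lambda>k. cmod (tcoef b k z * t ^ k))"
    by (rule summable_comparison_test'[OF geo, of 0]) (use le in auto)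
  then show ?thesis by (subst summable_on_UNIV_nonneg_real_iff) auto
qed

lemma tcoef_has_sum:
  assumes z: "z \<in> polydisc R" and t: "cmod t < \<rho>"
  shows "((\<lambda>k. tcoef b k z * t ^ k) has_sum b (t, z)) UNIV"
proof -
  have "(\<lambda>k. (deriv ^^ k) (\<lambda>s. b (s, z)) 0 / fact k * (t - 0) ^ k) sums b (t, z)"
    by (rule holomorphic_power_series[OF t_slice_holomorphic[OF z]]) (use t in auto)
  then have s: "(\<lambda>k. tcoef b k z * t ^ k) sums b (t, z)" by (simp add: tcoef_def)
  moreover have "summable (\<lambda>k. cmod (tcoef b k z * t ^ k))"
    using tcoef_summable[OF assms] summable_on_imp_summable by blast
  ultimately show ?thesis by (intro norm_summable_imp_has_sum)
qed

end

lemma polydisc_small: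
  assumes "e > 0" shows "\<exists>R>0. \<forall>z::complex^'d. z \<in> polydisc R \<longrightarrow> norm z < e"
proof (intro exI conjI allI impI)
  let ?R = "e / (real CARD('d) + 1)"
  show "?R > 0" using assms by (simp add: add_nonneg_pos)
  fix z :: "complex^'d" assume z: "z \<in> polydisc ?R"
  have "norm z \<le> (\<Sum>i\<in>UNIV. cmod (z $ i))" unfolding norm_vec_def by (rule L2_set_le_sum) auto
  also have "\<dots> \<le> (\<Sum>i\<in>(UNIV::'d set). ?R)" using z by (intro sum_mono) (auto simp: polydisc_def less_imp_le)
  also have "\<dots> = real CARD('d) * ?R" by simp
  also have "\<dots> < e" using assms by (simp add: field_simps)
  finally show "norm z < e" .
qed

lemma eventually_nhds_z_polydisc:
  assumes "\<forall>\<^sub>F z in nhds (0::complex^'d). P z"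
  shows "\<exists>R>0. \<forall>z\<in>polydisc R. P z"
proof -
  obtain e where e: "e > 0" "\<And>z. dist z 0 < e \<Longrightarrow> P z" using assms unfolding eventually_nhds_metric by blast
  obtain R where "R > 0" "\<forall>z::complex^'d. z \<in> polydisc R \<longrightarrow> norm z < e" using polydisc_small[OF e(1)] by blast
  then show ?thesis using e(2) by (intro exI[of _ R]) auto
qed

lemma eventually_nhds_tz_box:
  assumes "\<forall>\<^sub>F p in nhds (0::complex, 0::complex^'d). P p"
  shows "\<exists>\<rho>>0. \<exists>R>0. \<forall>t\<in>ball 0 \<rho>. \<forall>z\<in>polydisc R. P (t, z)"
proof -
  have "\<forall>\<^sub>F p in nhds (0::complex) \<times>\<^sub>F nhds (0::complex^'d). P p" using assms by (simp add: nhds_prod)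
  then obtain P1 P2 where P: "eventually P1 (nhds 0)" "eventually P2 (nhds 0)" "\<And>t z. P1 t \<Longrightarrow> P2 z \<Longrightarrow> P (t, z)"
    unfolding eventually_prod_filter by blast
  obtain e where e: "e > 0" "\<And>t. dist t 0 < e \<Longrightarrow> P1 t" using P(1) unfolding eventually_nhds_metric by blast
  obtain R where "R > 0" "\<forall>z\<in>polydisc R. P2 z" using eventually_nhds_z_polydisc[OF P(2)] by blast
  then show ?thesis using e P(3) by (intro exI[of _ e] exI[of _ R]) (auto simp: dist_commute)
qed

lemma holo_tz_prod:
  assumes f: "f holomorphic_on T" "open T" and w: "holo_z w D"
  shows "holo_tz (\<lambda>(t, z). f t * w z) (T \<times> D)"
  unfolding holo_tz_iff_hol TZ.hol_def
proof (clarify)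
  fix t z assume tz: "t \<in> T" "z \<in> D"
  obtain w' where w': "(w has_derivative w') (at z)" "\<And>a v. w' (a *s v) = a * w' v"
    using w tz unfolding holo_z_iff_hol Z.hol_def by blast
  have "(f has_derivative (\<lambda>h. deriv f t * h)) (at t)"
    using holomorphic_derivI[OF f tz(1)] by (simp add: has_field_derivative_def)
  then have 1: "((\<lambda>p. f (fst p)) has_derivative (\<lambda>p. deriv f t * fst p)) (at (t, z))"
    using has_derivative_compose[of fst fst "(t, z)" UNIV f "\<lambda>h. deriv f t * h"]
    by (simp add: has_derivative_fst[OF has_derivative_ident])
  have 2: "((\<lambda>p. w (snd p)) has_derivative (\<lambda>p. w' (snd p))) (at (t, z))"
    using has_derivative_compose[of snd snd "(t, z)" UNIV w w'] w'(1)
    by (simp add: has_derivative_snd[OF has_derivative_ident])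
  have "((\<lambda>p. f (fst p) * w (snd p)) has_derivative (\<lambda>h. f t * w' (snd h) + deriv f t * fst h * w z)) (at (t, z))"
    using has_derivative_mult[OF 1 2] by simp
  moreover have "f t * w' (snd (a * fst v, a *s snd v)) + deriv f t * fst (a * fst v, a *s snd v) * w z =
      a * (f t * w' (snd v) + deriv f t * fst v * w z)" for a v
    by (simp add: w'(2) algebra_simps)
  ultimately show "\<exists>f'. ((\<lambda>(t, z). f t * w z) has_derivative f') (at (t, z)) \<and> (\<forall>a v. f' (a * fst v, a *s snd v) = a * f' v)"
    unfolding case_prod_beta by blast
qed

text \<open>On an annulus \<open>x < cmod t < y\<close> both signs of the exponent are controlled by
  \<open>cmod t powi n \<le> x powi n + y powi n\<close>, which gives a summable majorant near each
  point.\<close>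

lemma holo_tz_laurent:
  fixes w :: "int \<Rightarrow> complex^'d \<Rightarrow> complex"
  assumes w: "\<And>n. holo_z (w n) (polydisc R)"
    and B: "\<And>n z. z \<in> polydisc R \<Longrightarrow> cmod (w n z) \<le> B n"
    and s: "\<And>x. 0 < x \<Longrightarrow> x < r \<Longrightarrow> (\<lambda>n. B n * x powi n) summable_on UNIV"
  shows "holo_tz (\<lambda>(t, z). \<Sum>\<^sub>\<infinity>n. w n z * t powi n) (punctured_disc r \<times> polydisc R)"
  unfolding holo_tz_iff_hol TZ.hol_def
proof
  fix p :: "complex \<times> (complex^'d)" assume p: "p \<in> punctured_disc r \<times> polydisc R"
  obtain t0 z0 where p_eq: "p = (t0, z0)" by (cases p)
  have t0: "0 < cmod t0" "cmod t0 < r" and z0: "z0 \<in> polydisc R" using p by (auto simp: p_eq punctured_disc_def)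
  have B0: "B n \<ge> 0" for n using B[OF z0, of n] norm_ge_zero order_trans by blast
  define x y where "x = cmod t0 / 2" and "y = (cmod t0 + r) / 2"
  define T where "T = {t::complex. x < cmod t} \<inter> {t. cmod t < y}"
  have xy: "0 < x" "x < r" "0 < y" "y < r"
  proof -
    have "r > 0" using t0 by linarith
    then have "cmod t0 < r * 2" "0 < cmod t0 + r" "cmod t0 + r < r * 2" using t0 by linarith+
    then show "0 < x" "x < r" "0 < y" "y < r" using t0 by (simp_all (no_asm_simp) add: x_def y_def del: zero_less_norm_iff)
  qed
  have T: "open T" unfolding T_def by (intro open_Int open_Collect_less continuous_intros)
  have le: "cmod (w n z * t powi n) \<le> B n * x powi n + B n * y powi n" if "t \<in> T" "z \<in> polydisc R" for t z n
  proof -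
    have "cmod t powi n \<le> x powi n + y powi n"
    proof (cases "n \<ge> 0")
      case True
      then have "cmod t powi n \<le> y powi n" using that xy by (auto simp: T_def power_int_def intro!: power_mono)
      moreover have "x powi n \<ge> 0" using xy by simp
      ultimately show ?thesis by linarith
    next
      case False
      then have "cmod t powi n \<le> x powi n" using that xy by (auto simp: T_def power_int_def intro!: power_mono le_imp_inverse_le)
      moreover have "y powi n \<ge> 0" using xy by simp
      ultimately show ?thesis by linarith
    qed
    then have "cmod (w n z) * cmod t powi n \<le> B n * (x powi n + y powi n)"
      using B[OF that(2)] B0 by (intro mult_mono) auto
    then show ?thesis by (simp add: norm_mult norm_power_int distrib_left)
  qed
  have "TZ.hol (\<lambda>p. \<Sum>\<^sub>\<infinity>n. (case p of (t, z) \<Rightarrow> t powi n * w n z)) (T \<times> polydisc R)"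
  proof (rule TZ.hol_infsum)
    show "open (T \<times> polydisc R)" by (intro open_Times T open_polydisc)
    fix n
    have "(\<lambda>t. t powi n) holomorphic_on T" using xy by (intro holomorphic_intros) (auto simp: T_def)
    from holo_tz_prod[OF this T w[of n]]
    show "TZ.hol (\<lambda>p. case p of (t, z) \<Rightarrow> t powi n * w n z) (T \<times> polydisc R)" by (simp add: holo_tz_iff_hol)
  next
    show "(\<lambda>n. B n * x powi n + B n * y powi n) summable_on UNIV"
      by (intro summable_on_add s xy)
  next
    show "\<And>n p. p \<in> T \<times> polydisc R \<Longrightarrow> cmod (case p of (t, z) \<Rightarrow> t powi n * w n z) \<le> B n * x powi n + B n * y powi n"
      using le by (auto simp: mult.commute)
  qed
  moreover have "p \<in> T \<times> polydisc R" using t0 z0 by (auto simp: p_eq T_def x_def y_def)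
  ultimately show "\<exists>f'. ((\<lambda>(t, z). \<Sum>\<^sub>\<infinity>n. w n z * t powi n) has_derivative f') (at p) \<and> (\<forall>a v. f' (a * fst v, a *s snd v) = a * f' v)"
    unfolding TZ.hol_def case_prod_beta by (simp only: mult.commute[of "w _ _"])
qed

subsection \<open>The theta function\<close>

lemma summable_on_int_iff_nat:
  fixes f :: "int \<Rightarrow> real"
  assumes "\<And>n. f n \<ge> 0" "summable (\<lambda>k. f (int k))" "summable (\<lambda>k. f (- int k))"
  shows "f summable_on UNIV"
proof -
  have 1: "f summable_on range int"
    by (subst summable_on_reindex) (auto simp: o_def summable_on_UNIV_nonneg_real_iff assms)
  have 2: "f summable_on range (\<lambda>k. - int k)"
    by (subst summable_on_reindex) (auto simp: o_def summable_on_UNIV_nonneg_real_iff assms inj_def)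
  have "n \<in> range int \<union> range (\<lambda>k. - int k)" for n
    by (cases n rule: int_cases2) auto
  then have "range int \<union> range (\<lambda>k. - int k) = UNIV" by blast
  then show ?thesis using summable_on_union[OF 1 2] by simp
qed

lemma has_sum_int_shift: "((\<lambda>n. f (n + c)) has_sum S) UNIV \<longleftrightarrow> (f has_sum S) (UNIV :: int set)"
  by (rule has_sum_reindex_bij_witness[of _ "\<lambda>n. n - c" "\<lambda>n. n + c"]) auto

text \<open>For fixed \<open>k\<close> the shifted family \<open>f (l - k)\<close> has the same sum
  of norms as \<open>f\<close>; hence the double family is absolutely summable and the order of
  summation may be changed. This is the product of two bilateral series.\<close>

lemma convolution_int:
  fixes f g :: "int \<Rightarrow> complex"
  assumes f: "(\<lambda>n. cmod (f n)) summable_on UNIV" and g: "(\<lambda>n. cmod (g n)) summable_on UNIV"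
  shows "(\<lambda>(l, k). cmod (f (l - k) * g k)) summable_on UNIV"
    and "(\<lambda>k. cmod (f (l - k) * g k)) summable_on UNIV"
    and "(\<lambda>l. cmod (\<Sum>\<^sub>\<infinity>k. f (l - k) * g k)) summable_on UNIV"
    and "((\<lambda>l. \<Sum>\<^sub>\<infinity>k. f (l - k) * g k) has_sum (infsum f UNIV * infsum g UNIV)) UNIV"
proof -
  have kl: "(\<lambda>(k, l). cmod (f (l - k) * g k)) summable_on UNIV \<times> UNIV"
  proof (rule summable_on_SigmaI)
    fix k :: int
    have "((\<lambda>l. cmod (f l)) has_sum infsum (\<lambda>l. cmod (f l)) UNIV) UNIV" using f by simp
    then have "((\<lambda>l. cmod (f (l - k))) has_sum infsum (\<lambda>l. cmod (f l)) UNIV) UNIV"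
      using has_sum_int_shift[of "\<lambda>l. cmod (f l)" "- k"] by simp
    from has_sum_cmult_left[OF this, of "cmod (g k)"]
    show "((\<lambda>l. case (k, l) of (k, l) \<Rightarrow> cmod (f (l - k) * g k)) has_sum infsum (\<lambda>l. cmod (f l)) UNIV * cmod (g k)) UNIV"
      by (simp add: norm_mult)
  qed (auto intro!: summable_on_cmult_right g)
  have swap: "(\<lambda>(l, k). F k l) summable_on UNIV \<times> UNIV \<longleftrightarrow> (\<lambda>(k, l). F k l) summable_on UNIV \<times> UNIV"
    for F :: "int \<Rightarrow> int \<Rightarrow> 'b::{topological_comm_monoid_add,t2_space}"
    by (rule summable_on_reindex_bij_witness[of _ prod.swap prod.swap]) auto
  show lk: "(\<lambda>(l, k). cmod (f (l - k) * g k)) summable_on UNIV" using kl swap[of "\<lambda>k l. cmod (f (l - k) * g k)"] by simp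
  then have lk': "(\<lambda>p. cmod (case p of (l, k) \<Rightarrow> f (l - k) * g k)) summable_on UNIV \<times> UNIV"
    by (simp add: case_prod_unfold)
  have inner: "(\<lambda>k. cmod (f (l - k) * g k)) summable_on UNIV" for l
    using summable_on_SigmaD1[of "\<lambda>l k. cmod (f (l - k) * g k)" UNIV "\<lambda>_. UNIV" l] lk by simp
  then show "(\<lambda>k. cmod (f (l - k) * g k)) summable_on UNIV" .
  have "(\<lambda>l. \<Sum>\<^sub>\<infinity>k. cmod (f (l - k) * g k)) summable_on UNIV"
    using summable_on_Sigma_banach[of "\<lambda>l k. cmod (f (l - k) * g k)" UNIV "\<lambda>_. UNIV"] lk by simp
  then show "(\<lambda>l. cmod (\<Sum>\<^sub>\<infinity>k. f (l - k) * g k)) summable_on UNIV"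
    by (rule summable_on_comparison_test) (auto intro!: norm_infsum_bound inner)
  have s: "(\<lambda>(l, k). f (l - k) * g k) summable_on UNIV \<times> UNIV" using abs_summable_summable[OF lk'] by simp
  have "(\<Sum>\<^sub>\<infinity>l. \<Sum>\<^sub>\<infinity>k. f (l - k) * g k) = (\<Sum>\<^sub>\<infinity>k. \<Sum>\<^sub>\<infinity>l. f (l - k) * g k)"
    by (rule infsum_swap_banach[OF s])
  also have "\<dots> = (\<Sum>\<^sub>\<infinity>k. infsum f UNIV * g k)"
  proof (rule infsum_cong)
    fix k :: int
    have "((\<lambda>l. f l) has_sum infsum f UNIV) UNIV" using abs_summable_summable[OF f] by simp
    then have "((\<lambda>l. f (l - k)) has_sum infsum f UNIV) UNIV"
      using has_sum_int_shift[of f "- k"] by simp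
    from has_sum_cmult_left[OF this, of "g k"] show "(\<Sum>\<^sub>\<infinity>l. f (l - k) * g k) = infsum f UNIV * g k"
      using infsumI by blast
  qed
  also have "\<dots> = infsum f UNIV * infsum g UNIV"
    by (rule infsum_cmult_right) (use abs_summable_summable[OF g] in auto)
  finally have eq: "(\<Sum>\<^sub>\<infinity>l. \<Sum>\<^sub>\<infinity>k. f (l - k) * g k) = infsum f UNIV * infsum g UNIV" .
  have "(\<lambda>l. \<Sum>\<^sub>\<infinity>k. f (l - k) * g k) summable_on UNIV"
    using summable_on_Sigma_banach[of "\<lambda>l k. f (l - k) * g k" UNIV "\<lambda>_. UNIV"] s by simp
  then show "((\<lambda>l. \<Sum>\<^sub>\<infinity>k. f (l - k) * g k) has_sum (infsum f UNIV * infsum g UNIV)) UNIV"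
    unfolding eq[symmetric] by (rule has_sum_infsum)
qed

locale q_greater_one =
  fixes q :: real
  assumes q1: "q > 1"
begin

lemma q0: "q > 0" using q1 by simp

lemma q_nz [simp]: "q \<noteq> 0" using q0 by simp

text \<open>A real power, so that exponent identities need no integrality of
  \<open>n * (n - 1) / 2\<close>. In both directions the weight beats every geometric
  sequence.\<close>

definition gs :: "int \<Rightarrow> real" where
  "gs n = q powr (- (of_int n * (of_int n - 1)) / 2)"

lemma gs_pos: "gs n > 0" using q0 by (simp add: gs_def)

lemma gs_0 [simp]: "gs 0 = 1" by (simp add: gs_def q0)

lemma gs_diff: "gs (n - l) = gs n * q powr (of_int n * of_int l - of_int l * (of_int l + 1) / 2)"
  unfolding gs_def powr_add[symmetric] by (rule arg_cong[where f = "(powr) q"]) (simp add: field_simps)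

lemma gs_Suc: "gs (n + 1) = gs n * q powi (- n)"
proof -
  have "q powi (- n) = q powr (of_int (- n))" using q0 by (subst powr_real_of_int') auto
  then show ?thesis using gs_diff[of n "-1"] by simp
qed

lemma gs_summable_nat:
  assumes "x > 0"
  shows "summable (\<lambda>k. gs (int k) * x powi int k)" "summable (\<lambda>k. gs (- int k) * x powi (- int k))"
proof -
  have lim: "\<exists>N. \<forall>n\<ge>N. y * (1 / q) ^ n \<le> 1 / 2" for y
  proof -
    have "(\<lambda>n. y * (1 / q) ^ n) \<longlonglongrightarrow> y * 0"
      by (intro tendsto_intros LIMSEQ_power_zero) (use q1 in auto)
    then have "\<forall>\<^sub>F n in sequentially. y * (1 / q) ^ n < 1 / 2" by (intro order_tendstoD(2)) auto
    then show ?thesis unfolding eventually_sequentially by (meson less_imp_le)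
  qed
  have pow: "q powi (- int n) = (1 / q) ^ n" for n
    by (simp add: power_int_minus power_one_over field_simps)
  obtain N where N: "\<And>n. n \<ge> N \<Longrightarrow> x * (1 / q) ^ n \<le> 1 / 2" using lim by blast
  show "summable (\<lambda>k. gs (int k) * x powi int k)"
  proof (rule summable_ratio_test[where c = "1/2" and N = N])
    fix n assume "n \<ge> N"
    have "gs (int (Suc n)) * x powi int (Suc n) = (gs (int n) * x powi int n) * (x * (1 / q) ^ n)"
      using gs_Suc[of "int n"] assms by (simp add: pow power_int_add algebra_simps)
    also have "\<dots> \<le> (gs (int n) * x powi int n) * (1 / 2)"
      by (intro mult_left_mono N \<open>n \<ge> N\<close>) (use assms gs_pos[of "int n"] in auto)
    finally show "norm (gs (int (Suc n)) * x powi int (Suc n)) \<le> 1 / 2 * norm (gs (int n) * x powi int n)"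
      using assms by (simp add: abs_mult abs_of_pos[OF gs_pos])
  qed simp
  obtain N where N: "\<And>n. n \<ge> N \<Longrightarrow> inverse x * (1 / q) ^ n \<le> 1 / 2" using lim by blast
  show "summable (\<lambda>k. gs (- int k) * x powi (- int k))"
  proof (rule summable_ratio_test[where c = "1/2" and N = N])
    fix n assume n: "n \<ge> N"
    have "gs (- int n) = gs (- int (Suc n)) * q ^ Suc n"
      using gs_Suc[of "- int (Suc n)"] by (simp only: minus_minus power_int_of_nat) simp
    then have "gs (- int (Suc n)) = gs (- int n) * (1 / q) ^ Suc n" using q0 by (simp add: field_simps)
    then have "gs (- int (Suc n)) * x powi (- int (Suc n)) = (gs (- int n) * x powi (- int n)) * (inverse x * (1 / q) ^ Suc n)"
      using assms by (simp only: power_int_minus power_int_of_nat power_Suc) (simp add: field_simps)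
    also have "\<dots> \<le> (gs (- int n) * x powi (- int n)) * (1 / 2)"
      by (intro mult_left_mono N) (use n assms gs_pos[of "- int n"] in auto)
    finally show "norm (gs (- int (Suc n)) * x powi (- int (Suc n))) \<le> 1 / 2 * norm (gs (- int n) * x powi (- int n))"
      using assms by (simp add: abs_mult abs_of_pos[OF gs_pos])
  qed simp
qed

lemma gs_summable: "x > 0 \<Longrightarrow> (\<lambda>n. gs n * x powi n) summable_on UNIV"
  by (intro summable_on_int_iff_nat gs_summable_nat) (simp_all add: gs_pos less_imp_le)

definition theta :: "complex \<Rightarrow> complex" where
  "theta t = (\<Sum>\<^sub>\<infinity>n. of_real (gs n) * t powi n)"

text \<open>Termwise majorant of \<open>theta\<close> on the circle of radius \<open>x\<close>, and
  also the value of \<open>theta\<close> at \<open>x\<close>.\<close>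

definition Theta :: "real \<Rightarrow> real" where
  "Theta x = (\<Sum>\<^sub>\<infinity>n. gs n * x powi n)"

lemma gs_norm_summable: "t \<noteq> 0 \<Longrightarrow> (\<lambda>n. cmod (of_real (gs n) * t powi n)) summable_on UNIV"
  using gs_summable[of "cmod t"] by (simp add: norm_mult norm_power_int gs_pos less_imp_le)

lemma theta_has_sum: "t \<noteq> 0 \<Longrightarrow> ((\<lambda>n. of_real (gs n) * t powi n) has_sum theta t) UNIV"
  unfolding theta_def using abs_summable_summable[OF gs_norm_summable] by simp

lemma Theta_has_sum: "x > 0 \<Longrightarrow> ((\<lambda>n. gs n * x powi n) has_sum Theta x) UNIV"
  unfolding Theta_def using gs_summable by simp

lemma Theta_ge: "x > 0 \<Longrightarrow> gs n * x powi n \<le> Theta x"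
  using finite_sum_le_has_sum[OF Theta_has_sum, of x "{n}"] by (simp add: gs_pos less_imp_le)

lemma Theta_pos: "x > 0 \<Longrightarrow> Theta x > 0"
  using Theta_ge[of x 0] by simp

lemma theta_q: assumes "t \<noteq> 0" shows "theta (of_real q * t) = of_real q * t * theta t"
proof -
  have "((\<lambda>n. of_real (gs n) * (of_real q * t) powi n) has_sum theta (of_real q * t)) UNIV"
    by (rule theta_has_sum) (use assms q0 in auto)
  then have 1: "((\<lambda>n. of_real (gs (n + 1)) * (of_real q * t) powi (n + 1)) has_sum theta (of_real q * t)) UNIV"
    using has_sum_int_shift[of "\<lambda>n. of_real (gs n) * (of_real q * t) powi n" 1] by simp
  have "of_real (gs (n + 1)) * (of_real q * t) powi (n + 1) = of_real q * t * (of_real (gs n) * t powi n)" for n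
    using assms q0 by (simp add: gs_Suc power_int_mult_distrib power_int_add power_int_minus)
  with 1 have "((\<lambda>n. of_real q * t * (of_real (gs n) * t powi n)) has_sum theta (of_real q * t)) UNIV" by simp
  then show ?thesis using has_sum_cmult_right[OF theta_has_sum[OF assms], of "of_real q * t"] has_sum_unique by blast
qed

lemma Theta_eq_theta: "x > 0 \<Longrightarrow> theta (of_real x) = of_real (Theta x)"
  using has_sum_of_real[OF Theta_has_sum, of x, where 'a = complex] theta_has_sum[of "of_real x"] has_sum_unique
  by fastforce

lemma Theta_q: "x > 0 \<Longrightarrow> Theta (q * x) = q * x * Theta x"
  using theta_q[of "of_real x"] Theta_eq_theta[of x] Theta_eq_theta[of "q * x"] q0
  by (simp flip: of_real_mult add: of_real_eq_iff)

section \<open>The q-exponential and Jacobi's triple product\<close>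

text \<open>
  The \<open>q\<close>-exponential \<open>Ec\<close> equals \<open>\<Prod>(1 + t q\<^sup>-\<^sup>k)\<close> over \<open>k \<ge> 1\<close>. The product of \<open>Ec (q t)\<close> and \<open>Ec (1/t)\<close> has Laurent
  coefficients \<open>cc\<close>; their identification with multiples of \<open>gs\<close> is Jacobi's triple product formula.
\<close>

definition ec :: "nat \<Rightarrow> real" where
  "ec n = (\<Prod>k=1..n. 1 / (q ^ k - 1))"

lemma ec_pos: "ec n > 0"
  unfolding ec_def by (intro prod_pos) (use q1 in auto)

lemma ec_0 [simp]: "ec 0 = 1" by (simp add: ec_def)

lemma ec_Suc: "ec (Suc n) * (q ^ Suc n - 1) = ec n"
proof -
  have "q ^ Suc n > 1" using q1 one_less_power[of q "Suc n"] by blast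
  then show ?thesis by (simp add: ec_def del: power_Suc)
qed

lemma ec_summable: assumes "x \<ge> 0" shows "summable (\<lambda>n. ec n * x ^ n)"
proof -
  have "(\<lambda>n. x / (q ^ Suc n - 1)) \<longlonglongrightarrow> 0" using q1 by real_asymp
  then have "\<forall>\<^sub>F n in sequentially. x / (q ^ Suc n - 1) < 1 / 2" by (intro order_tendstoD(2)) auto
  then obtain N where N: "\<And>n. n \<ge> N \<Longrightarrow> x / (q ^ Suc n - 1) < 1 / 2" unfolding eventually_sequentially by blast
  show ?thesis
  proof (rule summable_ratio_test[where c = "1/2" and N = N])
    fix n assume n: "n \<ge> N"
    have q: "q ^ Suc n > 1" using q1 one_less_power[of q "Suc n"] by blast
    have "ec (Suc n) = ec n / (q ^ Suc n - 1)" using ec_Suc[of n] q by (simp add: field_simps del: power_Suc)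
    then have "ec (Suc n) * x ^ Suc n = (ec n * x ^ n) * (x / (q ^ Suc n - 1))" by simp
    also have "\<dots> \<le> (ec n * x ^ n) * (1 / 2)"
      by (intro mult_left_mono less_imp_le[OF N] n) (use assms ec_pos[of n] in auto)
    finally show "norm (ec (Suc n) * x ^ Suc n) \<le> 1 / 2 * norm (ec n * x ^ n)"
      using assms by (simp add: abs_mult abs_of_pos[OF ec_pos])
  qed simp
qed

definition Ec :: "complex \<Rightarrow> complex" where
  "Ec t = (\<Sum>n. of_real (ec n) * t ^ n)"

lemma Ec_norm_summable: "summable (\<lambda>n. cmod (of_real (ec n) * t ^ n))"
  using ec_summable[of "cmod t"] by (simp add: norm_mult norm_power abs_of_pos[OF ec_pos])

lemma Ec_sums: "(\<lambda>n. of_real (ec n) * t ^ n) sums Ec t"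
  unfolding Ec_def using summable_norm_cancel[OF Ec_norm_summable] by (rule summable_sums)

lemma Ec_q: "Ec (of_real q * t) = (1 + t) * Ec t"
proof -
  have "(\<lambda>n. of_real (ec (Suc n)) * (of_real q * t) ^ Suc n) sums (Ec (of_real q * t) - 1)"
    using Ec_sums[of "of_real q * t"] by (subst sums_Suc_iff) simp
  moreover have "(\<lambda>n. of_real (ec (Suc n)) * t ^ Suc n + t * (of_real (ec n) * t ^ n)) sums ((Ec t - 1) + t * Ec t)"
  proof (intro sums_add sums_mult Ec_sums)
    show "(\<lambda>n. of_real (ec (Suc n)) * t ^ Suc n) sums (Ec t - 1)"
      using Ec_sums[of t] by (subst sums_Suc_iff) simp
  qed
  moreover have "of_real (ec (Suc n)) * (of_real q * t) ^ Suc n = of_real (ec (Suc n)) * t ^ Suc n + t * (of_real (ec n) * t ^ n)" for n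
  proof -
    have "complex_of_real (ec n) = of_real (ec (Suc n)) * (of_real q ^ Suc n - 1)"
      unfolding ec_Suc[symmetric, of n] by simp
    then show ?thesis by (simp only: power_mult_distrib) (simp add: algebra_simps)
  qed
  ultimately have "Ec (of_real q * t) - 1 = (Ec t - 1) + t * Ec t" using sums_unique2 by (simp only:)
  then show ?thesis by (simp add: algebra_simps)
qed

lemma Ec_0 [simp]: "Ec 0 = 1"
  using powser_sums_zero[of "\<lambda>n. of_real (ec n)"] Ec_sums[of 0] sums_unique2 by fastforce

lemma continuous_Ec: "continuous_on UNIV Ec"
proof -
  have "isCont Ec t" for t
    unfolding Ec_def[abs_def]
    by (rule isCont_powser_converges_everywhere) (use summable_norm_cancel[OF Ec_norm_summable] in auto)
  then show ?thesis by (simp add: continuous_at_imp_continuous_on)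
qed

text \<open>A zero at \<open>t\<close> would propagate by \<open>Ec_q\<close> to all
  \<open>t / q ^ n\<close>, because no factor \<open>1 + t / q ^ k\<close> vanishes, and by
  continuity to 0, where \<open>Ec\<close> is 1. This argument takes the place of the infinite
  product.\<close>

lemma Ec_nonzero:
  assumes "\<And>k. k \<ge> 1 \<Longrightarrow> t \<noteq> - (of_real q ^ k)"
  shows "Ec t \<noteq> 0"
proof
  assume 0: "Ec t = 0"
  have zero: "Ec (t / of_real q ^ n) = 0" for n
  proof (induction n)
    case (Suc n)
    have "of_real q * (t / of_real q ^ Suc n) = t / of_real q ^ n" by simp
    then have "(1 + t / of_real q ^ Suc n) * Ec (t / of_real q ^ Suc n) = 0" using Ec_q[of "t / of_real q ^ Suc n"] Suc by simp
    moreover have "1 + t / of_real q ^ Suc n \<noteq> 0"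
    proof
      assume "1 + t / of_real q ^ Suc n = 0"
      then have "t / of_real q ^ Suc n = -1" by (simp add: eq_neg_iff_add_eq_0 add.commute)
      then have "t = - (of_real q ^ Suc n)" by (simp add: field_simps)
      then show False using assms[of "Suc n"] by simp
    qed
    ultimately show ?case by simp
  qed (use 0 in simp)
  have "(\<lambda>n. t / of_real q ^ n) \<longlonglongrightarrow> 0"
  proof -
    have "(\<lambda>n. t * (1 / of_real q) ^ n) \<longlonglongrightarrow> t * 0"
      by (intro tendsto_intros LIMSEQ_power_zero) (use q1 in \<open>auto simp: norm_divide\<close>)
    then show ?thesis by (simp add: power_one_over field_simps)
  qed
  then have "(\<lambda>n. Ec (t / of_real q ^ n)) \<longlonglongrightarrow> Ec 0"
    using continuous_Ec by (intro isCont_tendsto_compose[of 0 Ec]) (auto simp: continuous_on_eq_continuous_at)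
  then show False using zero LIMSEQ_unique by fastforce
qed

text \<open>Coefficients of \<open>Ec (q t)\<close> and \<open>Ec (1 / t)\<close>, extended by zero
  to all integers, so that the product of the two functions is a bilateral convolution.\<close>

definition Ac :: "int \<Rightarrow> real" where "Ac n = (if n \<ge> 0 then ec (nat n) * q ^ nat n else 0)"
definition Bc :: "int \<Rightarrow> real" where "Bc n = (if n \<le> 0 then ec (nat (- n)) else 0)"
definition cc :: "int \<Rightarrow> real" where "cc l = (\<Sum>\<^sub>\<infinity>k. Ac (l - k) * Bc k)"

lemma Ac_nonneg: "Ac n \<ge> 0" and Bc_nonneg: "Bc n \<ge> 0"
  using ec_pos q0 by (auto simp: Ac_def Bc_def less_imp_le)

lemma Ac_has_sum:
  assumes "t \<noteq> 0" shows "((\<lambda>n. of_real (Ac n) * t powi n) has_sum Ec (of_real q * t)) UNIV"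
    and "(\<lambda>n. cmod (of_real (Ac n) * t powi n)) summable_on UNIV"
proof -
  have "((\<lambda>n. of_real (ec n) * (of_real q * t) ^ n) has_sum Ec (of_real q * t)) UNIV"
    by (rule norm_summable_imp_has_sum[OF Ec_norm_summable Ec_sums])
  also have "?this \<longleftrightarrow> ((\<lambda>n. of_real (Ac n) * t powi n) has_sum Ec (of_real q * t)) {0..}"
    by (rule has_sum_reindex_bij_witness[of _ nat int]) (auto simp: Ac_def power_mult_distrib power_int_def)
  also have "\<dots> \<longleftrightarrow> ((\<lambda>n. of_real (Ac n) * t powi n) has_sum Ec (of_real q * t)) UNIV"
    by (rule has_sum_cong_neutral) (auto simp: Ac_def)
  finally show "((\<lambda>n. of_real (Ac n) * t powi n) has_sum Ec (of_real q * t)) UNIV" .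
  have "(\<lambda>n. cmod (of_real (ec n) * (of_real q * t) ^ n)) summable_on UNIV"
    by (subst summable_on_UNIV_nonneg_real_iff) (auto intro: Ec_norm_summable)
  also have "?this \<longleftrightarrow> (\<lambda>n. cmod (of_real (Ac n) * t powi n)) summable_on {0..}"
    by (rule summable_on_reindex_bij_witness[of _ nat int]) (auto simp: Ac_def power_mult_distrib power_int_def norm_mult)
  also have "\<dots> \<longleftrightarrow> (\<lambda>n. cmod (of_real (Ac n) * t powi n)) summable_on UNIV"
    by (rule summable_on_cong_neutral) (auto simp: Ac_def)
  finally show "(\<lambda>n. cmod (of_real (Ac n) * t powi n)) summable_on UNIV" .
qed

lemma Bc_has_sum:
  assumes "t \<noteq> 0" shows "((\<lambda>n. of_real (Bc n) * t powi n) has_sum Ec (1 / t)) UNIV"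
    and "(\<lambda>n. cmod (of_real (Bc n) * t powi n)) summable_on UNIV"
proof -
  have eq: "t powi (- int a) = (1 / t) ^ a" for a
    by (simp add: power_int_minus power_one_over inverse_eq_divide)
  have "((\<lambda>n. of_real (ec n) * (1 / t) ^ n) has_sum Ec (1 / t)) UNIV"
    by (rule norm_summable_imp_has_sum[OF Ec_norm_summable Ec_sums])
  also have "?this \<longleftrightarrow> ((\<lambda>n. of_real (Bc n) * t powi n) has_sum Ec (1 / t)) {..0}"
    by (rule has_sum_reindex_bij_witness[of _ "\<lambda>n. nat (- n)" "\<lambda>k. - int k"]) (auto simp: Bc_def eq simp del: power_int_minus)
  also have "\<dots> \<longleftrightarrow> ((\<lambda>n. of_real (Bc n) * t powi n) has_sum Ec (1 / t)) UNIV"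
    by (rule has_sum_cong_neutral) (auto simp: Bc_def)
  finally show "((\<lambda>n. of_real (Bc n) * t powi n) has_sum Ec (1 / t)) UNIV" .
  have "(\<lambda>n. cmod (of_real (ec n) * (1 / t) ^ n)) summable_on UNIV"
    by (subst summable_on_UNIV_nonneg_real_iff) (auto intro: Ec_norm_summable)
  also have "?this \<longleftrightarrow> (\<lambda>n. cmod (of_real (Bc n) * t powi n)) summable_on {..0}"
    by (rule summable_on_reindex_bij_witness[of _ "\<lambda>n. nat (- n)" "\<lambda>k. - int k"]) (auto simp: Bc_def eq simp del: power_int_minus)
  also have "\<dots> \<longleftrightarrow> (\<lambda>n. cmod (of_real (Bc n) * t powi n)) summable_on UNIV"
    by (rule summable_on_cong_neutral) (auto simp: Bc_def)
  finally show "(\<lambda>n. cmod (of_real (Bc n) * t powi n)) summable_on UNIV" .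
qed

text \<open>The weight is absorbed by \<open>Bc\<close>, whose series converges at every nonzero
  point. Besides \<open>x = 1\<close>, the value \<open>x = 1 / q\<close> is needed, for the
  auxiliary sum in \<open>cc_rec\<close>.\<close>

lemma AB_summable: assumes "x > 0" shows "(\<lambda>k. x powi k * (Ac (l - k) * Bc k)) summable_on UNIV"
proof -
  have A: "(\<lambda>n. cmod (of_real (Ac n))) summable_on UNIV" using Ac_has_sum(2)[of 1] by simp
  have B: "(\<lambda>n. cmod (of_real (Bc n * x powi n))) summable_on UNIV"
    using Bc_has_sum(2)[of "of_real x"] assms by (simp add: norm_mult norm_power_int abs_mult)
  have "(\<lambda>k. cmod (of_real (Ac (l - k)) * of_real (Bc k * x powi k))) summable_on UNIV"
    by (rule convolution_int(2)[OF A B])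
  moreover have "cmod (of_real (Ac (l - k)) * of_real (Bc k * x powi k)) = x powi k * (Ac (l - k) * Bc k)" for k
  proof -
    have "cmod (of_real (Ac (l - k)) * of_real (Bc k * x powi k)) = \<bar>Ac (l - k)\<bar> * \<bar>Bc k * x powi k\<bar>"
      unfolding norm_mult norm_of_real ..
    then show ?thesis using assms by (simp add: abs_mult Ac_nonneg Bc_nonneg mult_ac)
  qed
  ultimately show ?thesis by simp
qed

lemma cc_has_sum: "((\<lambda>k. Ac (l - k) * Bc k) has_sum cc l) UNIV"
  unfolding cc_def using AB_summable[of 1 l] by simp

lemma Ec_product:
  assumes "t \<noteq> 0"
  shows "((\<lambda>l. of_real (cc l) * t powi l) has_sum (Ec (of_real q * t) * Ec (1 / t))) UNIV"
    and "(\<lambda>l. cmod (of_real (cc l) * t powi l)) summable_on UNIV"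
proof -
  have "(\<Sum>\<^sub>\<infinity>k. of_real (Ac (l - k)) * t powi (l - k) * (of_real (Bc k) * t powi k)) = of_real (cc l) * t powi l" for l
  proof (rule infsumI)
    have "((\<lambda>k. of_real (Ac (l - k) * Bc k) * t powi l) has_sum of_real (cc l) * t powi l) UNIV"
      by (intro has_sum_cmult_left has_sum_of_real cc_has_sum)
    moreover have "of_real (Ac (l - k)) * t powi (l - k) * (of_real (Bc k) * t powi k) = of_real (Ac (l - k) * Bc k) * t powi l" for k
      using assms by (simp add: power_int_diff)
    ultimately show "((\<lambda>k. of_real (Ac (l - k)) * t powi (l - k) * (of_real (Bc k) * t powi k)) has_sum of_real (cc l) * t powi l) UNIV"
      by (simp only:)
  qed
  then show "((\<lambda>l. of_real (cc l) * t powi l) has_sum (Ec (of_real q * t) * Ec (1 / t))) UNIV"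
    "(\<lambda>l. cmod (of_real (cc l) * t powi l)) summable_on UNIV"
    using convolution_int(3,4)[OF Ac_has_sum(2) Bc_has_sum(2), OF assms assms]
      infsumI[OF Ac_has_sum(1)[OF assms]] infsumI[OF Bc_has_sum(1)[OF assms]] by simp_all
qed

lemma Ac_rec: "(q powi n - 1) * Ac n = q * Ac (n - 1)"
proof -
  consider "n < 0" | "n = 0" | k where "n = int (Suc k)"
    by (metis not_less_iff_gr_or_eq gr0_conv_Suc zero_less_imp_eq_int)
  then show ?thesis
  proof cases
    case 3
    then have *: "nat n = Suc k" "nat (n - 1) = k" "q powi n = q ^ Suc k" "n \<ge> 0" "n - 1 \<ge> 0"
      by (auto simp del: power_Suc simp flip: power_int_of_nat)
    show ?thesis unfolding Ac_def if_P[OF *(4)] if_P[OF *(5)] * ec_Suc[of k, symmetric] by (simp add: mult_ac)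
  qed (auto simp: Ac_def)
qed

lemma Bc_rec: "(q powi (- n) - 1) * Bc n = Bc (n + 1)"
proof -
  consider "n > 0" | "n = 0" | k where "n = - int (Suc k)"
    by (metis not_less_iff_gr_or_eq gr0_conv_Suc zero_less_imp_eq_int neg_0_less_iff_less minus_minus)
  then show ?thesis
  proof cases
    case 3
    then have "- n = int (Suc k)" by simp
    then have *: "nat (- n) = Suc k" "nat (- (n + 1)) = k" "q powi (- n) = q ^ Suc k" "n \<le> 0" "n + 1 \<le> 0"
      using 3 by (auto simp del: power_Suc of_nat_Suc simp flip: power_int_of_nat)
    show ?thesis unfolding Bc_def if_P[OF *(4)] if_P[OF *(5)] * ec_Suc[of k, symmetric] by simp
  qed (auto simp: Bc_def)
qed

text \<open>The auxiliary sum \<open>S\<close> carries the weight \<open>q powi (- k)\<close>. The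
  recursion of \<open>Bc\<close> evaluates it as \<open>cc (l + 1) + cc l\<close>, that of
  \<open>Ac\<close> evaluates \<open>q powi l * S\<close> as \<open>q * cc (l - 1) + cc l\<close>;
  eliminating \<open>S\<close> gives the relation.\<close>

lemma cc_rec: "q powi l * cc (l + 1) + q powi l * cc l = q * cc (l - 1) + cc l"
proof -
  define S where "S = (\<Sum>\<^sub>\<infinity>k. (1/q) powi k * (Ac (l - k) * Bc k))"
  have S: "((\<lambda>k. (1/q) powi k * (Ac (l - k) * Bc k)) has_sum S) UNIV"
    unfolding S_def using AB_summable[of "1/q" l] q0 by simp
  have inv: "(1/q) powi k = q powi (- k)" for k by (simp add: power_int_minus power_int_one_over inverse_eq_divide power_int_divide_distrib)
  have "((\<lambda>k. (1/q) powi k * (Ac (l - k) * Bc k) - Ac (l - k) * Bc k) has_sum S - cc l) UNIV"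
    using has_sum_add[OF S has_sum_uminusI[OF cc_has_sum[of l]]] by simp
  moreover have "(1/q) powi k * (Ac (l - k) * Bc k) - Ac (l - k) * Bc k = Ac ((l + 1) - (k + 1)) * Bc (k + 1)" for k
    unfolding Bc_rec[symmetric] inv by (simp add: algebra_simps)
  moreover have "((\<lambda>k. Ac ((l + 1) - (k + 1)) * Bc (k + 1)) has_sum cc (l + 1)) UNIV"
    using has_sum_int_shift[of "\<lambda>k. Ac ((l + 1) - k) * Bc k" 1] cc_has_sum[of "l + 1"] by simp
  ultimately have 1: "cc (l + 1) = S - cc l" using has_sum_unique by (metis (no_types, lifting) has_sum_cong)
  have "((\<lambda>k. q powi l * ((1/q) powi k * (Ac (l - k) * Bc k)) - Ac (l - k) * Bc k) has_sum q powi l * S - cc l) UNIV"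
    using has_sum_add[OF has_sum_cmult_right[OF S, of "q powi l"] has_sum_uminusI[OF cc_has_sum[of l]]] by simp
  moreover have "q powi l * ((1/q) powi k * (Ac (l - k) * Bc k)) - Ac (l - k) * Bc k = q * (Ac (l - 1 - k) * Bc k)" for k
  proof -
    have "q powi l * q powi (- k) = q powi (l - k)" by (simp add: power_int_diff power_int_minus field_simps)
    then have "q powi l * ((1/q) powi k * (Ac (l - k) * Bc k)) - Ac (l - k) * Bc k = (q powi (l - k) - 1) * Ac (l - k) * Bc k"
      unfolding inv by (simp add: algebra_simps)
    also have "\<dots> = q * (Ac (l - 1 - k) * Bc k)" unfolding Ac_rec by (simp add: algebra_simps)
    finally show ?thesis .
  qed
  moreover have "((\<lambda>k. q * (Ac (l - 1 - k) * Bc k)) has_sum q * cc (l - 1)) UNIV"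
    by (intro has_sum_cmult_right cc_has_sum)
  ultimately have 2: "q * cc (l - 1) = q powi l * S - cc l" using has_sum_unique by (metis (no_types, lifting) has_sum_cong)
  show ?thesis unfolding 1 2 by (simp add: algebra_simps)
qed

lemma cc_Suc: "cc (l + 1) = q powi (- l) * cc l"
proof -
  \<comment> \<open>The defect \<open>D\<close> is multiplied by \<open>-q\<close> in each step but tends to \<open>0\<close>.\<close>
  define D where "D l = q powi l * cc (l + 1) - cc l" for l
  have step: "D l = - q * D (l - 1)" for l
  proof -
    have "q * q powi (l - 1) = q powi l" by (simp add: power_int_diff)
    then have "q * D (l - 1) = q powi l * cc l - q * cc (l - 1)"
      unfolding D_def by (simp add: algebra_simps flip: mult.assoc)
    then show ?thesis using cc_rec[of l] unfolding D_def by linarith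
  qed
  have Dn: "D (l + int n) = (- q) ^ n * D l" for l n
  proof (induction n)
    case (Suc n)
    then show ?case using step[of "l + int (Suc n)"] by (simp add: algebra_simps)
  qed simp
  have lim: "(\<lambda>n. cc (l + int n) * x ^ n) \<longlonglongrightarrow> 0" if x: "x > 0" for l x
  proof -
    have "(\<lambda>n. cmod (of_real (cc n) * (of_real x) powi n)) summable_on UNIV" using x by (intro Ec_product) auto
    then have "(\<lambda>n. cmod (of_real (cc n) * (of_real x) powi n)) summable_on range (\<lambda>k. l + int k)"
      using summable_on_subset_banach by blast
    then have "(\<lambda>k. \<bar>cc (l + int k)\<bar> * x powi (l + int k)) summable_on UNIV"
      by (subst (asm) summable_on_reindex) (use x in \<open>auto simp: o_def inj_def norm_mult norm_power_int\<close>)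
    then have "(\<lambda>k. \<bar>cc (l + int k)\<bar> * x powi (l + int k)) \<longlonglongrightarrow> 0"
      using summable_on_imp_summable summable_LIMSEQ_zero by blast
    then have "(\<lambda>k. x powi (- l) * (\<bar>cc (l + int k)\<bar> * x powi (l + int k))) \<longlonglongrightarrow> x powi (- l) * 0"
      by (intro tendsto_intros)
    moreover have "x powi (- l) * (\<bar>cc (l + int k)\<bar> * x powi (l + int k)) = \<bar>cc (l + int k) * x ^ k\<bar>" for k
      using x by (simp add: power_int_add power_int_minus abs_mult field_simps)
    ultimately have "(\<lambda>k. \<bar>cc (l + int k) * x ^ k\<bar>) \<longlonglongrightarrow> 0" by simp
    then show ?thesis by (rule tendsto_rabs_zero_cancel)
  qed
  have "D 0 = 0"
  proof -
    have "(\<lambda>n. cc (1 + int n) * q ^ n - cc (0 + int n) * 1 ^ n) \<longlonglongrightarrow> 0 - 0"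
      by (intro tendsto_diff lim) (use q0 in auto)
    moreover have "cc (1 + int n) * q ^ n - cc (0 + int n) * 1 ^ n = (- q) ^ n * D 0" for n
      using Dn[of 0 n] unfolding D_def by (simp add: algebra_simps)
    ultimately have "(\<lambda>n. (- q) ^ n * D 0) \<longlonglongrightarrow> 0" by simp
    then have "(\<lambda>n. \<bar>(- q) ^ n * D 0\<bar>) \<longlonglongrightarrow> \<bar>0\<bar>" by (rule tendsto_rabs)
    moreover have "\<bar>D 0\<bar> \<le> \<bar>(- q) ^ n * D 0\<bar>" for n
      using q1 one_le_power[of q n] by (simp add: abs_mult power_abs mult_le_cancel_right1)
    ultimately have "\<bar>D 0\<bar> \<le> \<bar>0\<bar>" by (intro LIMSEQ_le_const) auto
    then show ?thesis by simp
  qed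
  then have "D l = 0"
  proof (cases "l \<ge> 0")
    case True
    then show ?thesis using Dn[of 0 "nat l"] \<open>D 0 = 0\<close> by simp
  next
    case False
    then show ?thesis using Dn[of l "nat (- l)"] \<open>D 0 = 0\<close> by simp
  qed
  then show ?thesis unfolding D_def by (simp add: power_int_minus field_simps)
qed

text \<open>Both sequences satisfy the same first-order recursion, so they are proportional. This is
  the triple product formula for the coefficients; the constant \<open>cc 0\<close> is not
  evaluated, later arguments use its sign.\<close>

lemma cc_gs: "cc l = cc 0 * gs l"
proof (induction l rule: int_induct[where k = 0])
  case (step1 i)
  then show ?case using cc_Suc[of i] gs_Suc[of i] by simp
next
  case (step2 i)
  have "cc i = q powi (- (i - 1)) * cc (i - 1)" "gs i = gs (i - 1) * q powi (- (i - 1))"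
    using cc_Suc[of "i - 1"] gs_Suc[of "i - 1"] by simp_all
  then have "q powi (- (i - 1)) * cc (i - 1) = q powi (- (i - 1)) * (cc 0 * gs (i - 1))" using step2 by simp
  then show ?case by simp
qed simp

lemma cc0_pos: "cc 0 > 0"
proof -
  have "(\<Sum>k\<in>{0}. Ac (0 - k) * Bc k) \<le> cc 0"
    by (rule finite_sum_le_has_sum[OF cc_has_sum]) (auto simp: Ac_nonneg Bc_nonneg)
  then show ?thesis by (simp add: Ac_def Bc_def)
qed

lemma theta_product: "t \<noteq> 0 \<Longrightarrow> of_real (cc 0) * theta t = Ec (of_real q * t) * Ec (1 / t)"
  using has_sum_cmult_right[OF theta_has_sum, of t "of_real (cc 0)"] Ec_product(1)[of t] cc_gs
  by (metis (no_types, lifting) has_sum_cong has_sum_unique mult.assoc of_real_mult)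

section \<open>Lower bound for theta away from its zeros\<close>

lemma theta_lower_annulus:
  "\<exists>c>0. \<forall>t. 1 \<le> cmod t \<and> cmod t \<le> q \<longrightarrow> cmod (theta t) \<ge> c * cmod (1 + t) * cmod (1 + t / of_real q)"
proof -
  define K where "K = {t. 1 \<le> cmod t \<and> cmod t \<le> q}"
  have "K = cball 0 q \<inter> - ball 0 1" by (auto simp: K_def)
  moreover have "closed (- ball (0::complex) 1)" by (simp add: closed_Compl)
  ultimately have K: "compact K" using compact_Int_closed[OF compact_cball] by metis
  have "1 \<in> K" using q1 by (simp add: K_def)
  then have Kne: "K \<noteq> {}" by blast
  \<comment> \<open>The factors \<open>1 + t\<close> and \<open>1 + t / q\<close> carry the zeros of
    theta in the annulus. What remains is zero-free there, since zeros of \<open>Ec\<close> can only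
    have modulus at least \<open>q\<close> while \<open>t / q\<close> and \<open>1 / t\<close> have
    modulus at most 1. Compactness gives a positive minimum.\<close>
  have "continuous_on K (\<lambda>t. cmod (Ec (t / of_real q) * Ec (1 / t)))"
    by (intro continuous_intros continuous_on_compose2[OF continuous_Ec]) (auto simp: K_def)
  then obtain t0 where t0: "t0 \<in> K" "\<And>t. t \<in> K \<Longrightarrow> cmod (Ec (t0 / of_real q) * Ec (1 / t0)) \<le> cmod (Ec (t / of_real q) * Ec (1 / t))"
    using continuous_attains_inf[OF K Kne] by blast
  have big: "x \<noteq> - (of_real q ^ k)" if "k \<ge> 1" "cmod x \<le> 1" for x k
  proof
    assume "x = - (of_real q ^ k)"
    then have "cmod x = q ^ k" using q0 by (simp add: norm_power)
    moreover have "q ^ k > 1" using that q1 by (intro one_less_power) auto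
    ultimately show False using that by simp
  qed
  have "Ec (t0 / of_real q) \<noteq> 0" "Ec (1 / t0) \<noteq> 0"
    by (rule Ec_nonzero; rule big; use t0(1) q0 in \<open>auto simp: K_def norm_divide intro!: divide_le_eq_1[THEN iffD2]\<close>)+
  define d where "d = cmod (Ec (t0 / of_real q) * Ec (1 / t0))"
  have d: "d > 0" using \<open>Ec (t0 / of_real q) \<noteq> 0\<close> \<open>Ec (1 / t0) \<noteq> 0\<close> by (simp add: d_def)
  show ?thesis
  proof (intro exI[of _ "d / cc 0"] conjI allI impI)
    fix t :: complex assume t: "1 \<le> cmod t \<and> cmod t \<le> q"
    then have "t \<noteq> 0" by auto
    have "of_real (cc 0) * theta t = (1 + t) * ((1 + t / of_real q) * Ec (t / of_real q)) * Ec (1 / t)"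
      using theta_product[OF \<open>t \<noteq> 0\<close>] Ec_q[of t] Ec_q[of "t / of_real q"] by simp
    then have "cc 0 * cmod (theta t) = cmod (1 + t) * cmod (1 + t / of_real q) * cmod (Ec (t / of_real q) * Ec (1 / t))"
      using cc0_pos by (metis (no_types, opaque_lifting) norm_mult mult.assoc norm_of_real abs_of_pos)
    also have "\<dots> \<ge> cmod (1 + t) * cmod (1 + t / of_real q) * d"
      unfolding d_def by (intro mult_left_mono t0(2)) (use t in \<open>auto simp: K_def\<close>)
    finally show "d / cc 0 * cmod (1 + t) * cmod (1 + t / of_real q) \<le> cmod (theta t)"
      using cc0_pos by (simp add: field_simps)
  qed (use d cc0_pos in auto)
qed

text \<open>Invariance under one dilation, used in both directions, reaches the whole orbit of
  \<open>u\<close> under powers of \<open>q\<close>.\<close>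

lemma theta_qpow:
  fixes u :: complex
  assumes "u \<noteq> 0" and P: "\<And>t. t \<noteq> 0 \<Longrightarrow> P (of_real q * t) \<longleftrightarrow> P t"
  shows "P (of_real (q powi n) * u) \<longleftrightarrow> P u"
proof (induction n rule: int_induct[where k = 0])
  case (step1 i)
  have "of_real (q powi (i + 1)) * u = of_real q * (of_real (q powi i) * u)" by (simp add: power_int_add)
  moreover have "of_real (q powi i) * u \<noteq> 0" using assms(1) by simp
  ultimately show ?case using step1 P[of "of_real (q powi i) * u"] by (simp only: not_False_eq_True simp_thms)
next
  case (step2 i)
  have "of_real (q powi i) * u = of_real q * (of_real (q powi (i - 1)) * u)" by (simp add: power_int_diff)
  moreover have "of_real (q powi (i - 1)) * u \<noteq> 0" using assms(1) by simp
  ultimately show ?case using step2 P[of "of_real (q powi (i - 1)) * u"] by (simp only: not_False_eq_True simp_thms)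
qed simp

lemma exists_qpow:
  assumes "t \<noteq> (0::complex)"
  shows "\<exists>n u. t = of_real (q powi n) * u \<and> 1 \<le> cmod u \<and> cmod u \<le> q"
proof -
  define n where "n = \<lfloor>log q (cmod t)\<rfloor>"
  have t: "cmod t > 0" using assms by simp
  have "of_int n \<le> log q (cmod t)" "log q (cmod t) \<le> of_int n + 1" unfolding n_def by linarith+
  then have "q powr of_int n \<le> cmod t" "cmod t \<le> q powr (of_int n + 1)"
    using t q1 by (simp_all add: powr_le_iff le_powr_iff)
  then have "q powi n \<le> cmod t" "cmod t \<le> q powi n * q" using q0
    by (simp_all add: powr_real_of_int' powr_add)
  moreover have "q powi n > 0" using q0 by simp
  ultimately have "1 \<le> cmod (t / of_real (q powi n))" "cmod (t / of_real (q powi n)) \<le> q"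
    by (simp_all add: norm_divide field_simps norm_power_int abs_of_pos[OF q0])
  then show ?thesis by (intro exI[of _ n] exI[of _ "t / of_real (q powi n)"]) simp
qed

text \<open>Both sides are multiplied by the same factor under \<open>t \<mapsto> q t\<close>, so one annulus suffices.\<close>

theorem theta_lower:
  "\<exists>c>0. \<forall>\<epsilon> t. t \<noteq> 0 \<longrightarrow> \<epsilon> > 0 \<longrightarrow> (\<forall>k::int. cmod (t + of_real (q powi k)) \<ge> \<epsilon> * cmod t) \<longrightarrow>
     cmod (theta t) \<ge> c * \<epsilon> * Theta (cmod t)"
proof -
  obtain c where c: "c > 0" "\<And>t. 1 \<le> cmod t \<Longrightarrow> cmod t \<le> q \<Longrightarrow> cmod (theta t) \<ge> c * cmod (1 + t) * cmod (1 + t / of_real q)"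
    using theta_lower_annulus by blast
  have TTbound: "\<exists>T>0. \<forall>u. 1 \<le> cmod u \<and> cmod u \<le> q \<longrightarrow> Theta (cmod u) \<le> T"
  proof (intro exI[of _ "Theta 1 + Theta q"] conjI allI impI)
    show "Theta 1 + Theta q > 0" using Theta_pos[of 1] Theta_pos[of q] q0 by simp
    fix u assume u: "1 \<le> cmod u \<and> cmod u \<le> q"
    show "Theta (cmod u) \<le> Theta 1 + Theta q"
    proof (rule has_sum_mono[OF Theta_has_sum has_sum_add[OF Theta_has_sum Theta_has_sum]])
      fix n :: int
      have "cmod u powi n \<le> 1 powi n + q powi n"
      proof (cases "n \<ge> 0")
        case True
        then have "cmod u powi n \<le> q powi n" using u by (auto simp: power_int_def intro!: power_mono)
        then show ?thesis by simp
      next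
        case False
        then have "cmod u powi n \<le> 1" using u
          by (auto simp: power_int_def intro!: power_le_one inverse_le_1_iff[THEN iffD2])
        moreover have "q powi n \<ge> 0" using q0 by simp
        ultimately show ?thesis by simp
      qed
      then have "gs n * cmod u powi n \<le> gs n * (1 powi n + q powi n)"
        using gs_pos[of n] by (intro mult_left_mono) auto
      then show "gs n * cmod u powi n \<le> gs n * 1 powi n + gs n * q powi n" by (simp add: distrib_left)
    qed (use u q0 in auto)
  qed
  then obtain T where T: "T > 0" "\<And>u. 1 \<le> cmod u \<Longrightarrow> cmod u \<le> q \<Longrightarrow> Theta (cmod u) \<le> T" by blast
  \<comment> \<open>\<open>T\<close> bounds \<open>Theta\<close> on the annulus; the factor
    \<open>(q - 1) / (2 * q)\<close> comes from the case distinction in \<open>prod\<close>.\<close>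
  define c' where "c' = c * (q - 1) / (2 * q) / T"
  have c': "c' > 0" using c T q1 by (simp add: c'_def)
  show ?thesis
  proof (intro exI[of _ c'] conjI allI impI c')
    fix \<epsilon> :: real and t :: complex
    assume t: "t \<noteq> 0" and e: "\<epsilon> > 0" and far: "\<forall>k::int. cmod (t + of_real (q powi k)) \<ge> \<epsilon> * cmod t"
    obtain n u where tu: "t = of_real (q powi n) * u" and u: "1 \<le> cmod u" "cmod u \<le> q"
      using exists_qpow[OF t] by blast
    then have u0: "u \<noteq> 0" by auto
    have faru: "cmod (u + of_real (q powi k)) \<ge> \<epsilon> * cmod u" for k
    proof -
      have "t + of_real (q powi (n + k)) = of_real (q powi n) * (u + of_real (q powi k))"
        by (simp add: tu power_int_add distrib_left)
      then have "q powi n * cmod (u + of_real (q powi k)) \<ge> \<epsilon> * (q powi n * cmod u)"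
        using far[rule_format, of "n + k"] q0 by (simp add: tu norm_mult norm_power_int abs_of_pos[OF q0])
      moreover have "q powi n > 0" using q0 by simp
      ultimately show ?thesis by (simp add: mult.left_commute)
    qed
    have "cmod (1 + u) \<ge> \<epsilon> * cmod u" using faru[of 0] by (simp add: add.commute)
    moreover have "\<epsilon> * cmod u \<ge> \<epsilon>" using e u by simp
    ultimately have f1: "cmod (1 + u) \<ge> \<epsilon>" by linarith
    have "cmod (u + of_real q) \<ge> \<epsilon> * cmod u" using faru[of 1] by simp
    then have f2': "cmod (u + of_real q) \<ge> \<epsilon>" using \<open>\<epsilon> * cmod u \<ge> \<epsilon>\<close> by linarith
    have uq: "cmod (1 + u / of_real q) = cmod (u + of_real q) / q"
    proof -
      have "1 + u / of_real q = (u + of_real q) / of_real q" by (simp add: field_simps)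
      then show ?thesis using q0 by (simp add: norm_divide)
    qed
    \<comment> \<open>The points -1 and -q are at distance \<open>q - 1\<close>, so \<open>u\<close>
      is at least \<open>(q - 1) / 2\<close> away from one of them; from the other one it is at
      least \<open>\<epsilon>\<close> away.\<close>
    have prod: "cmod (1 + u) * cmod (1 + u / of_real q) \<ge> \<epsilon> * ((q - 1) / (2 * q))"
    proof (cases "cmod (1 + u) \<ge> (q - 1) / 2")
      case True
      then have "(q - 1) / 2 * (\<epsilon> / q) \<le> cmod (1 + u) * (cmod (u + of_real q) / q)"
        using f2' e q0 q1 by (intro mult_mono divide_right_mono) auto
      then show ?thesis unfolding uq by (simp add: mult.commute)
    next
      case False
      have "cmod (of_real (q - 1) :: complex) \<le> cmod (u + of_real q) + cmod (1 + u)"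
        using norm_triangle_ineq4[of "u + of_real q" "1 + u"] by simp
      moreover have "cmod (of_real (q - 1) :: complex) = q - 1" using q1 by (simp only: norm_of_real)
      ultimately have "cmod (u + of_real q) \<ge> (q - 1) / 2" using False by argo
      then have "\<epsilon> * ((q - 1) / 2 / q) \<le> cmod (1 + u) * (cmod (u + of_real q) / q)"
        using f1 e q0 q1 by (intro mult_mono divide_right_mono) auto
      then show ?thesis unfolding uq by simp
    qed
    have "c' * \<epsilon> * Theta (cmod u) \<le> c' * \<epsilon> * T"
      using c' e T(2)[OF u] by (intro mult_left_mono) auto
    also have "\<dots> = c * (\<epsilon> * ((q - 1) / (2 * q)))" using T(1) by (simp add: c'_def)
    also have "\<dots> \<le> c * (cmod (1 + u) * cmod (1 + u / of_real q))" using c(1) prod by (intro mult_left_mono) auto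
    also have "\<dots> \<le> cmod (theta u)" using c(2)[OF u] by (simp add: mult.assoc)
    finally have goal_u: "cmod (theta u) \<ge> c' * \<epsilon> * Theta (cmod u)" .
    have "(cmod (theta (of_real (q powi n) * u)) \<ge> c' * \<epsilon> * Theta (cmod (of_real (q powi n) * u))) \<longleftrightarrow>
          (cmod (theta u) \<ge> c' * \<epsilon> * Theta (cmod u))"
    proof (rule theta_qpow[OF u0, where P = "\<lambda>t. cmod (theta t) \<ge> c' * \<epsilon> * Theta (cmod t)"])
      fix t :: complex assume "t \<noteq> 0"
      then have pos: "q * cmod t > 0" using q0 by simp
      have 1: "cmod (theta (of_real q * t)) = (q * cmod t) * cmod (theta t)"
        using theta_q[OF \<open>t \<noteq> 0\<close>] q0 by (simp add: norm_mult)
      have "cmod (of_real q * t) = q * cmod t" using q0 by (simp add: norm_mult)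
      then have 2: "Theta (cmod (of_real q * t)) = (q * cmod t) * Theta (cmod t)"
        using Theta_q[of "cmod t"] \<open>t \<noteq> 0\<close> by simp
      have "c' * \<epsilon> * ((q * cmod t) * Theta (cmod t)) = (q * cmod t) * (c' * \<epsilon> * Theta (cmod t))" by (simp only: mult_ac)
      then show "(c' * \<epsilon> * Theta (cmod (of_real q * t)) \<le> cmod (theta (of_real q * t))) = (c' * \<epsilon> * Theta (cmod t) \<le> cmod (theta t))"
        unfolding 1 2 by (simp only: mult_le_cancel_left_pos[OF pos])
    qed
    then show "cmod (theta t) \<ge> c' * \<epsilon> * Theta (cmod t)" using goal_u tu by simp
  qed
qed

lemma theta_nonzero:
  assumes "t \<noteq> 0" "\<And>k::int. t \<noteq> - of_real (q powi k)" shows "theta t \<noteq> 0"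
proof -
  have "Ec (of_real q * t) \<noteq> 0"
  proof (rule Ec_nonzero)
    fix k :: nat
    show "of_real q * t \<noteq> - (of_real q ^ k)"
    proof
      assume "of_real q * t = - (of_real q ^ k)"
      then have "t = - of_real (q powi (int k - 1))" by (simp add: power_int_diff field_simps)
      then show False using assms(2) by blast
    qed
  qed
  moreover have "Ec (1 / t) \<noteq> 0"
  proof (rule Ec_nonzero)
    fix k :: nat
    show "1 / t \<noteq> - (of_real q ^ k)"
    proof
      assume "1 / t = - (of_real q ^ k)"
      then have "t = 1 / (- (of_real q ^ k))" using assms(1) by (metis divide_divide_eq_right div_by_1 mult_1)
      then have "t = - of_real (q powi (- int k))" by (simp add: power_int_minus field_simps)
      then show False using assms(2) by blast
    qed
  qed
  ultimately show ?thesis using theta_product[OF assms(1)] by auto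
qed

text \<open>Read off from the product formula, since \<open>Ec\<close> is entire; the bilateral
  series is not differentiated.\<close>

lemma theta_holomorphic: "theta holomorphic_on (- {0})"
proof -
  have Ec: "Ec holomorphic_on UNIV"
  proof -
    have "(Ec has_field_derivative (\<Sum>n. diffs (\<lambda>n. of_real (ec n)) n * z ^ n)) (at z)" for z
      unfolding Ec_def[abs_def]
      by (rule termdiffs_strong_converges_everywhere) (use summable_norm_cancel[OF Ec_norm_summable] in auto)
    then show ?thesis unfolding holomorphic_on_def field_differentiable_def
      using has_field_derivative_at_within by blast
  qed
  have "(\<lambda>t. Ec (of_real q * t) * Ec (1 / t) / of_real (cc 0)) holomorphic_on (- {0})"
  proof (intro holomorphic_intros)
    show "(\<lambda>t. Ec (of_real q * t)) holomorphic_on - {0}"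
      using holomorphic_on_compose_gen[of "\<lambda>t. of_real q * t" "- {0}" Ec UNIV] Ec
      by (auto simp: o_def intro!: holomorphic_intros)
    show "(\<lambda>t. Ec (1 / t)) holomorphic_on - {0}"
    proof -
      have "(\<lambda>t::complex. 1 / t) holomorphic_on - {0}" by (intro holomorphic_intros) auto
      then show ?thesis using holomorphic_on_compose_gen[of "\<lambda>t. 1 / t" "- {0}" Ec UNIV] Ec by (auto simp: o_def)
    qed
  qed (use cc0_pos in auto)
  then show ?thesis
    by (rule holomorphic_transform) (use theta_product cc0_pos in \<open>auto simp: field_simps\<close>)
qed

end

subsection \<open>Holomorphic sequences defined by recursion\<close>

text \<open>
  The bound at step \<open>j\<close> is proved on the polydisc of radius \<open>R / 2 * (1 + u ^ j)\<close>, where \<open>u\<close> is chosen such that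
  the loss \<open>u ^ (- L * j)\<close> of at most \<open>L\<close> derivatives is absorbed by \<open>s ^ j\<close>.
\<close>

lemma holomorphic_recursion_bound:
  fixes h :: "nat \<Rightarrow> (complex, 'd :: {finite,linorder}) vec \<Rightarrow> complex"
    and \<A> :: "('d \<Rightarrow> nat) set"
  assumes h: "\<And>j. holo_z (h j) (polydisc R)" and R: "R > 0"
    and bdd: "\<And>j. \<exists>M. \<forall>z\<in>polydisc R. cmod (h j z) \<le> M"
    and s: "0 < s" "s < 1" and \<tau>: "\<tau> \<ge> 1" and K: "K \<ge> 0" and fin: "finite \<A>"
    and rec: "\<And>j z. j \<ge> j0 \<Longrightarrow> z \<in> polydisc R \<Longrightarrow>
      cmod (h j z) \<le> K * \<tau> ^ j + K * (\<Sum>e=1..j. \<tau> ^ e *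
         (cmod (h (j - e) z) + s ^ j * (\<Sum>\<alpha>\<in>\<A>. cmod (multi_partial_z \<alpha> (h (j - e)) z))))"
  shows "\<exists>C>0. \<exists>T\<ge>1. \<forall>j. \<forall>z\<in>polydisc (R / 2). cmod (h j z) \<le> C * T ^ j"
proof -
  \<comment> \<open>A crude common bound for the orders of all derivatives in
    \<open>\<A>\<close>.\<close>
  define L where "L = (\<Sum>\<alpha>\<in>\<A>. mlen \<alpha>)"
  have L: "mlen \<alpha> \<le> L" if "\<alpha> \<in> \<A>" for \<alpha> using member_le_sum[of \<alpha> \<A> mlen] that fin by (simp add: L_def)
  \<comment> \<open>\<open>Suc L\<close> rather than \<open>L\<close>: it also covers
    \<open>L = 0\<close> and leaves a spare factor \<open>u ^ j \<le> 1\<close>.\<close>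
  define u where "u = s powr (1 / real (Suc L))"
  have u: "0 < u" "u < 1" "u ^ Suc L = s"
  proof -
    show "0 < u" using s by (simp add: u_def)
    have "s powr (1 / real (Suc L)) < 1 powr (1 / real (Suc L))" by (rule powr_less_mono2) (use s in auto)
    then show "u < 1" by (simp add: u_def)
    have "u ^ Suc L = u powr real (Suc L)" using \<open>0 < u\<close> by (simp only: powr_realpow)
    also have "\<dots> = s" using s by (simp add: u_def powr_powr)
    finally show "u ^ Suc L = s" .
  qed
  define r where "r j = R / 2 * (1 + u ^ j)" for j
  have r0: "r 0 = R" by (simp add: r_def)
  have r_mono: "r j \<le> r i" if "i \<le> j" for i j
    unfolding r_def using that u R by (intro mult_left_mono add_left_mono power_decreasing) auto
  have r_half: "R / 2 \<le> r j" for j unfolding r_def using u R by simp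
  define c where "c = R / 2 * (1 - u)"
  have c: "c > 0" using R u by (simp add: c_def)
  \<comment> \<open>The smallest gap is the one from \<open>j - 1\<close> to \<open>j\<close>;
    monotonicity of \<open>r\<close> covers the earlier indices.\<close>
  have gap: "r (j - e) - r j \<ge> c * u ^ j" if "1 \<le> e" "e \<le> j" for j e
  proof -
    have "r (j - 1) \<le> r (j - e)" by (rule r_mono) (use that in auto)
    moreover have "r (j - 1) - r j = c * u ^ (j - 1)"
    proof -
      have "u ^ j = u * u ^ (j - 1)" using that by (metis One_nat_def Suc_pred le_trans less_le_trans power_Suc zero_less_one)
      then show ?thesis by (simp add: r_def c_def algebra_simps)
    qed
    moreover have "c * u ^ j \<le> c * u ^ (j - 1)" using c u by (intro mult_left_mono power_decreasing) auto
    ultimately show ?thesis by linarith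
  qed
  \<comment> \<open>The maximum with 1 allows the exponent \<open>mlen \<alpha>\<close> to be raised
    to \<open>L\<close>.\<close>
  define D where "D = max 1 (real L / c) ^ L"
  have D: "D \<ge> 1" unfolding D_def by (intro one_le_power) auto
  have deriv_fac: "s ^ j * (real (mlen \<alpha>) / (r (j - e) - r j)) ^ mlen \<alpha> \<le> D"
    if "\<alpha> \<in> \<A>" "1 \<le> e" "e \<le> j" for \<alpha> e j
  proof -
    have "real (mlen \<alpha>) / (r (j - e) - r j) \<le> real L / (c * u ^ j)"
      using L[OF that(1)] gap[OF that(2,3)] c u by (intro frac_le) auto
    also have "\<dots> = (real L / c) * (1 / u ^ j)" by simp
    also have "\<dots> \<le> max 1 (real L / c) * (1 / u ^ j)" using u by (intro mult_right_mono) auto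
    finally have 1: "real (mlen \<alpha>) / (r (j - e) - r j) \<le> max 1 (real L / c) * (1 / u ^ j)" .
    have g0: "r (j - e) - r j \<ge> 0" using gap[OF that(2,3)] c u by (meson less_imp_le mult_pos_pos order_trans zero_less_power)
    have "1 \<le> max 1 (real L / c) * (1 / u ^ j)"
    proof -
      have "1 * 1 \<le> max 1 (real L / c) * (1 / u ^ j)"
        using u by (intro mult_mono) (auto simp: power_le_one)
      then show ?thesis by simp
    qed
    then have "(max 1 (real L / c) * (1 / u ^ j)) ^ mlen \<alpha> \<le> (max 1 (real L / c) * (1 / u ^ j)) ^ L"
      by (intro power_increasing L that)
    moreover have "(real (mlen \<alpha>) / (r (j - e) - r j)) ^ mlen \<alpha> \<le> (max 1 (real L / c) * (1 / u ^ j)) ^ mlen \<alpha>"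
      by (intro power_mono 1 divide_nonneg_nonneg g0) auto
    ultimately have "(real (mlen \<alpha>) / (r (j - e) - r j)) ^ mlen \<alpha> \<le> (max 1 (real L / c) * (1 / u ^ j)) ^ L" by linarith
    also have "\<dots> = D / (u ^ j) ^ L" by (simp add: D_def power_mult_distrib power_divide)
    finally have "s ^ j * (real (mlen \<alpha>) / (r (j - e) - r j)) ^ mlen \<alpha> \<le> s ^ j * (D / (u ^ j) ^ L)"
      using s by (intro mult_left_mono) auto
    also have "s ^ j * (D / (u ^ j) ^ L) = u ^ j * D"
    proof -
      have "s ^ j = u ^ j * (u ^ j) ^ L"
        unfolding u(3)[symmetric] by (simp add: power_mult_distrib mult.commute flip: power_mult)
      then show ?thesis using u(1) by simp
    qed
    also have "\<dots> \<le> 1 * D" using u D by (intro mult_right_mono power_le_one) auto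
    finally show ?thesis by simp
  qed
  define Q where "Q = 1 + real (card \<A>) * D"
  have Q: "Q \<ge> 1" using D by (simp add: Q_def)
  \<comment> \<open>The first summand makes \<open>\<tau> / T \<le> 1 / 2\<close>, so that the
    geometric sum is at most \<open>2 * (\<tau> / T)\<close>; the second makes the sum over
    \<open>e\<close> contribute at most half of \<open>C * T ^ j\<close>.\<close>
  define T where "T = 2 * \<tau> + 4 * K * Q * \<tau>"
  have T: "T \<ge> 2 * \<tau>" "T \<ge> 4 * K * Q * \<tau>" "T \<ge> 1"
  proof -
    have 0: "4 * K * Q * \<tau> \<ge> 0" using \<tau> K Q by simp
    show "T \<ge> 2 * \<tau>" "T \<ge> 4 * K * Q * \<tau>" "T \<ge> 1" using 0 \<tau> unfolding T_def by linarith+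
  qed
  obtain M where M: "\<And>j z. z \<in> polydisc R \<Longrightarrow> cmod (h j z) \<le> M j" using bdd by metis
  \<comment> \<open>\<open>2 * K\<close> reserves the other half for the inhomogeneous term; the sum
    of the bounds \<open>M j\<close> covers the finitely many indices below \<open>j0\<close>, where
    no recursion is assumed.\<close>
  define C where "C = 1 + 2 * K + (\<Sum>j<j0. \<bar>M j\<bar>)"
  have C: "C > 0" "2 * K \<le> C" "j < j0 \<Longrightarrow> M j \<le> C" for j
  proof -
    have S: "(\<Sum>j<j0. \<bar>M j\<bar>) \<ge> 0" by (simp add: sum_nonneg)
    show "C > 0" "2 * K \<le> C" using S K unfolding C_def by linarith+
    assume "j < j0"
    then have "\<bar>M j\<bar> \<le> (\<Sum>j<j0. \<bar>M j\<bar>)" using member_le_sum[of j "{..<j0}" "\<lambda>j. \<bar>M j\<bar>"] by simp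
    then show "M j \<le> C" using K by (simp add: C_def)
  qed
  have geo: "(\<Sum>e=1..j. (\<tau> / T) ^ e) \<le> 2 * (\<tau> / T)" for j
  proof -
    have x: "0 \<le> \<tau> / T" "\<tau> / T \<le> 1 / 2" using \<tau> T by (auto simp: field_simps)
    have "(\<Sum>e=1..j. (\<tau> / T) ^ e) \<le> 2 * (\<tau> / T) * (1 - (1/2) ^ j)"
    proof (induction j)
      case (Suc j)
      have "(\<tau> / T) * (\<tau> / T) ^ j \<le> (\<tau> / T) * (1/2) ^ j" using x by (intro mult_left_mono power_mono)
      moreover have "(\<Sum>e=1..Suc j. (\<tau> / T) ^ e) = (\<Sum>e=1..j. (\<tau> / T) ^ e) + (\<tau> / T) * (\<tau> / T) ^ j" by simp
      moreover have "2 * (\<tau> / T) * (1 - (1/2) ^ Suc j) = 2 * (\<tau> / T) * (1 - (1/2) ^ j) + (\<tau> / T) * (1/2) ^ j"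
        by (simp add: algebra_simps)
      ultimately show ?case using Suc by linarith
    qed simp
    also have "\<dots> \<le> 2 * (\<tau> / T) * 1" using x by (intro mult_left_mono) auto
    finally show ?thesis by simp
  qed
  have main: "\<forall>z\<in>polydisc (r j). cmod (h j z) \<le> C * T ^ j" for j
  proof (induction j rule: less_induct)
    case (less j)
    show ?case
    proof
      fix z :: "(complex, 'd) vec" assume z: "z \<in> polydisc (r j)"
      have zR: "z \<in> polydisc R" using z r_mono[of 0 j] polydisc_mono[of "r j" R] r0 by auto
      show "cmod (h j z) \<le> C * T ^ j"
      proof (cases "j < j0")
        case True
        have "cmod (h j z) \<le> C * 1" using M[OF zR, of j] C(3)[OF True] by linarith
        also have "\<dots> \<le> C * T ^ j" using C(1) T by (intro mult_left_mono one_le_power) auto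
        finally show ?thesis .
      next
        case False
        have tbd: "\<tau> ^ e * (cmod (h (j - e) z) + s ^ j * (\<Sum>\<alpha>\<in>\<A>. cmod (multi_partial_z \<alpha> (h (j - e)) z)))
            \<le> C * T ^ j * Q * (\<tau> / T) ^ e" if e: "e \<in> {1..j}" for e
        proof -
          have IH: "cmod (h (j - e) y) \<le> C * T ^ (j - e)" if "y \<in> polydisc (r (j - e))" for y
            using less e that by auto
          have zr: "z \<in> polydisc (r (j - e))" using z polydisc_mono[OF r_mono[of "j - e" j]] by auto
          have gap0: "r j < r (j - e)"
          proof -
            have "c * u ^ j > 0" using c u by simp
            then show ?thesis using gap[of e j] e by simp
          qed
          have hsub: "holo_z (h (j - e)) (polydisc (r (j - e)))"
            by (rule holo_z_subset[OF h]) (use polydisc_mono r_mono[of 0] r0 in auto)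
          have "s ^ j * cmod (multi_partial_z \<alpha> (h (j - e)) z) \<le> C * T ^ (j - e) * D" if "\<alpha> \<in> \<A>" for \<alpha>
          proof -
            have "cmod (multi_partial_z \<alpha> (h (j - e)) z) \<le> C * T ^ (j - e) * (real (mlen \<alpha>) / (r (j - e) - r j)) ^ mlen \<alpha>"
              by (rule multi_partial_z_bound[OF hsub IH gap0 z])
            then have "s ^ j * cmod (multi_partial_z \<alpha> (h (j - e)) z) \<le> s ^ j * (C * T ^ (j - e) * (real (mlen \<alpha>) / (r (j - e) - r j)) ^ mlen \<alpha>)"
              using s by (intro mult_left_mono) auto
            also have "\<dots> = C * T ^ (j - e) * (s ^ j * (real (mlen \<alpha>) / (r (j - e) - r j)) ^ mlen \<alpha>)" by (simp only: mult_ac)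
            also have "\<dots> \<le> C * T ^ (j - e) * D"
              by (intro mult_left_mono deriv_fac that) (use e C T in auto)
            finally show ?thesis .
          qed
          then have "s ^ j * (\<Sum>\<alpha>\<in>\<A>. cmod (multi_partial_z \<alpha> (h (j - e)) z)) \<le> (\<Sum>\<alpha>\<in>\<A>. C * T ^ (j - e) * D)"
            unfolding sum_distrib_left by (intro sum_mono)
          then have "cmod (h (j - e) z) + s ^ j * (\<Sum>\<alpha>\<in>\<A>. cmod (multi_partial_z \<alpha> (h (j - e)) z)) \<le> C * T ^ (j - e) * Q"
            using IH[OF zr] by (simp add: Q_def algebra_simps)
          then have "\<tau> ^ e * (cmod (h (j - e) z) + s ^ j * (\<Sum>\<alpha>\<in>\<A>. cmod (multi_partial_z \<alpha> (h (j - e)) z))) \<le> \<tau> ^ e * (C * T ^ (j - e) * Q)"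
            using \<tau> by (intro mult_left_mono) auto
          also have "T ^ (j - e) = T ^ j / T ^ e" using e T by (intro power_diff) auto
          also have "\<tau> ^ e * (C * (T ^ j / T ^ e) * Q) = C * T ^ j * Q * (\<tau> / T) ^ e" by (simp add: power_divide)
          finally show ?thesis .
        qed
        have "cmod (h j z) \<le> K * \<tau> ^ j + K * (\<Sum>e=1..j. \<tau> ^ e * (cmod (h (j - e) z) + s ^ j * (\<Sum>\<alpha>\<in>\<A>. cmod (multi_partial_z \<alpha> (h (j - e)) z))))"
          using rec[of j z] False zR by simp
        also have "\<dots> \<le> K * \<tau> ^ j + K * (\<Sum>e=1..j. C * T ^ j * Q * (\<tau> / T) ^ e)"
          using K by (intro add_left_mono mult_left_mono sum_mono tbd) auto
        also have "\<dots> \<le> K * T ^ j + K * (C * T ^ j * Q * (2 * (\<tau> / T)))"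
          unfolding sum_distrib_left[symmetric]
          using K C T Q \<tau> by (intro add_mono mult_left_mono power_mono geo) auto
        also have "K * T ^ j \<le> C / 2 * T ^ j" using C(2) T by (intro mult_right_mono) auto
        also have "K * (C * T ^ j * Q * (2 * (\<tau> / T))) = C * T ^ j * (2 * K * Q * \<tau> / T)" by simp
        also have "\<dots> \<le> C * T ^ j * (1 / 2)"
          using C T \<tau> by (intro mult_left_mono) (auto simp: field_simps)
        finally show ?thesis by simp
      qed
    qed
  qed
  have "\<forall>j. \<forall>z\<in>polydisc (R / 2). cmod (h j z) \<le> C * T ^ j"
    using main polydisc_mono[OF r_half] by blast
  then show ?thesis using C(1) T(3) by blast
qed

lemma holo_z_bounded_smaller:
  fixes f :: "complex^'d \<Rightarrow> complex"
  assumes f: "holo_z f (polydisc R)" and R: "R' < R"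
  shows "\<exists>M. \<forall>z\<in>polydisc R'. cmod (f z) \<le> M"
proof -
  define K where "K = {z::complex^'d. \<forall>i. cmod (z $ i) \<le> R'}"
  have "closed K"
  proof -
    have "K = (\<Inter>i. {z. cmod (z $ i) \<le> R'})" by (auto simp: K_def)
    moreover have "closed {z::complex^'d. cmod (z $ i) \<le> R'}" for i by (intro closed_Collect_le continuous_intros)
    ultimately show ?thesis by (auto intro!: closed_INT)
  qed
  moreover have "bounded K"
  proof -
    have "norm z \<le> (\<Sum>i\<in>(UNIV::'d set). R')" if "z \<in> K" for z
    proof -
      have "norm z \<le> (\<Sum>i\<in>UNIV. cmod (z $ i))" unfolding norm_vec_def by (rule L2_set_le_sum) auto
      also have "\<dots> \<le> (\<Sum>i\<in>(UNIV::'d set). R')" using that by (intro sum_mono) (auto simp: K_def)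
      finally show ?thesis .
    qed
    then show ?thesis unfolding bounded_iff by blast
  qed
  ultimately have "compact K" by (simp add: compact_eq_bounded_closed)
  moreover have sub: "K \<subseteq> polydisc R" using R by (auto simp: K_def polydisc_def intro: le_less_trans)
  moreover have "continuous_on K f" using holo_z_imp_continuous_on[OF f] sub continuous_on_subset by blast
  ultimately have "bounded (f ` K)" using compact_continuous_image compact_imp_bounded by blast
  then obtain M where "\<forall>z\<in>K. cmod (f z) \<le> M" unfolding bounded_iff by auto
  moreover have "polydisc R' \<subseteq> K" by (auto simp: K_def polydisc_def less_imp_le)
  ultimately show ?thesis by blast
qed

lemma holo_z_nonzero_near:
  assumes f: "holo_z f (polydisc R)" and R: "R > 0" and f0: "f 0 \<noteq> 0"
  shows "\<exists>R'>0. R' \<le> R \<and> (\<exists>d>0. \<forall>z\<in>polydisc R'. cmod (f z) \<ge> d)"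
proof -
  have "isCont f 0" using holo_z_imp_continuous_on[OF f] zero_in_polydisc[OF R]
    unfolding continuous_on_eq_continuous_at[OF open_polydisc] by blast
  then have "(f \<longlongrightarrow> f 0) (nhds 0)" by (simp add: isCont_def tendsto_at_iff_tendsto_nhds)
  then have "((\<lambda>z. cmod (f z)) \<longlongrightarrow> cmod (f 0)) (nhds 0)" by (rule tendsto_norm)
  then have "\<forall>\<^sub>F z in nhds 0. cmod (f z) > cmod (f 0) / 2" by (rule order_tendstoD) (use f0 in auto)
  then obtain R' where "R' > 0" "\<forall>z\<in>polydisc R'. cmod (f z) > cmod (f 0) / 2" using eventually_nhds_z_polydisc by blast
  then show ?thesis using f0 R polydisc_mono[of "min R R'" R']
    by (intro exI[of _ "min R R'"] conjI exI[of _ "cmod (f 0) / 2"]) (auto intro: less_imp_le)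
qed

subsection \<open>Gevrey estimate for the formal solution\<close>

text \<open>The terms below the top one add up to at most \<open>p * C * x ^ (p - 1)\<close>, which
  \<open>big\<close> bounds by \<open>d * x ^ p\<close>, while the top term is at least twice that.
  It serves for polynomials in \<open>q ^ n\<close> with \<open>n\<close> large.\<close>

lemma dominant_term:
  fixes a :: "nat \<Rightarrow> complex" and x :: real
  assumes x: "x \<ge> 1" and C: "\<And>i. i < p \<Longrightarrow> cmod (a i) \<le> C" and d: "cmod (a p) \<ge> 2 * d"
    and big: "real p * C \<le> x * d"
  shows "cmod (\<Sum>i\<le>p. a i * of_real (x ^ i)) \<ge> d * x ^ p"
proof (cases p)
  case 0
  then have "(\<Sum>i\<le>p. a i * of_real (x ^ i)) = a p" "x ^ p = 1" by simp_all
  moreover have "d \<le> cmod (a p)" using d norm_ge_zero[of "a p"] by linarith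
  ultimately show ?thesis by simp
next
  case (Suc p')
  have C0: "C \<ge> 0" using C[of 0] Suc norm_ge_zero order_trans by blast
  have xp: "x ^ p = x * x ^ p'" by (simp add: Suc)
  have "cmod (\<Sum>i<p. a i * of_real (x ^ i)) \<le> (\<Sum>i<p. C * x ^ p')"
  proof (rule sum_norm_le)
    fix i assume i: "i \<in> {..<p}"
    have "cmod (a i) * x ^ i \<le> C * x ^ p'"
      using i C C0 x Suc by (intro mult_mono power_increasing) auto
    then show "cmod (a i * of_real (x ^ i)) \<le> C * x ^ p'"
      using x by (simp add: norm_mult norm_power)
  qed
  also have "\<dots> = (real p * C) * x ^ p'" by simp
  also have "\<dots> \<le> (x * d) * x ^ p'" using x by (intro mult_right_mono big) auto
  finally have 1: "cmod (\<Sum>i<p. a i * of_real (x ^ i)) \<le> d * x ^ p" by (simp add: xp mult_ac)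
  have 2: "cmod (a p * of_real (x ^ p)) \<ge> 2 * d * x ^ p"
    using d x by (simp add: norm_mult norm_power mult_right_mono)
  have "(\<Sum>i\<le>p. a i * of_real (x ^ i)) = (\<Sum>i<p. a i * of_real (x ^ i)) + a p * of_real (x ^ p)"
    by (simp add: lessThan_Suc_atMost[symmetric])
  then have "cmod (a p * of_real (x ^ p)) \<le> cmod (\<Sum>i\<le>p. a i * of_real (x ^ i)) + cmod (\<Sum>i<p. a i * of_real (x ^ i))"
    using norm_triangle_ineq4[of "\<Sum>i\<le>p. a i * of_real (x ^ i)" "\<Sum>i<p. a i * of_real (x ^ i)"] by simp
  then show ?thesis using 1 2 by linarith
qed

context q_greater_one
begin

lemma gs_add: "gs (a + b) = gs a * gs b * q powi (- (a * b))"
proof -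
  have "q powi (- (a * b)) = q powr of_int (- (a * b))" using q0 by (subst powr_real_of_int') auto
  then show ?thesis
    unfolding gs_def powr_add[symmetric]
    by (simp only: powr_add[symmetric]) (rule arg_cong[where f = "(powr) q"], simp add: field_simps)
qed

lemma gs_neg: "gs (- n) = gs n * q powi (- n)"
  using gs_add[of n "- n"] gs_add[of n 1] unfolding gs_def
  using q0 by (simp add: powr_real_of_int'[symmetric] powr_add[symmetric] field_simps)

text \<open>\<open>X n\<close> will be normalised by the factor \<open>gs n\<close>. A term with
  \<open>t ^ k\<close> and dilation of order \<open>i\<close> then carries the weight on the left,
  to be compared with the leading weight \<open>q ^ (m0 * N)\<close>. For
  \<open>i \<le> k + m0\<close>, the Newton polygon condition, nothing is lost; for a strict
  inequality a factor \<open>(q powr (-1/2)) ^ N\<close> is gained, and it pays for the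
  z-derivatives.\<close>

lemma gs_weight:
  assumes k: "1 \<le> k" "k \<le> N"
  shows "i \<le> k + m0 \<Longrightarrow> gs (int N) / gs (int (N - k)) * q ^ (i * (N - k)) \<le> q ^ (m0 * N)"
    and "i < k + m0 \<Longrightarrow> gs (int N) / gs (int (N - k)) * q ^ (i * (N - k)) \<le> q * (q powr (-1/2)) ^ N * q ^ (m0 * N)"
proof -
  define E where "E = - (real N * (real N - 1)) / 2 + (real (N - k) * (real (N - k) - 1)) / 2 + real (i * (N - k))"
  have eq: "gs (int N) / gs (int (N - k)) * q ^ (i * (N - k)) = q powr E"
  proof -
    have "q ^ (i * (N - k)) = q powr real (i * (N - k))" using q0 by (simp only: powr_realpow)
    then show ?thesis
      unfolding gs_def E_def powr_diff[symmetric]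
      by (simp only: powr_add[symmetric]) (rule arg_cong[where f = "(powr) q"], simp)
  qed
  have E: "E = real m0 * real N - (real (k + m0) - real i) * (real N - real k) - real k * (real k - 1) / 2 - real m0 * real k"
    using k unfolding E_def by (simp add: field_simps of_nat_diff)
  \<comment> \<open>In the strict case the gain comes from \<open>N - k\<close> for small
    \<open>k\<close> and from \<open>k * (k - 1) / 2\<close> for \<open>k\<close> close to
    \<open>N\<close>; together they give at least \<open>(N - 1) / 2\<close>.\<close>
  have kk: "real k * (real k - 1) \<ge> 0" "real k * (real k - 1) \<ge> real k - 1"
    using k by (auto simp: mult_le_cancel_right1)
  have m0k: "real m0 * real k \<ge> 0" by simp
  {
    assume "i \<le> k + m0"
    then have "(real (k + m0) - real i) * (real N - real k) \<ge> 0" using k by simp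
    then have "E \<le> real m0 * real N" using E kk m0k by linarith
    then have "E \<le> real (m0 * N)" by simp
    then show "gs (int N) / gs (int (N - k)) * q ^ (i * (N - k)) \<le> q ^ (m0 * N)"
      unfolding eq using q1 q0 powr_mono[of E "real (m0 * N)" q] by (simp add: powr_realpow del: of_nat_mult)
  next
    assume "i < k + m0"
    then have "real (k + m0) - real i \<ge> 1" by simp
    then have "(real (k + m0) - real i) * (real N - real k) \<ge> 1 * (real N - real k)"
      using k by (intro mult_right_mono) auto
    moreover have "real k \<le> real N" using k by simp
    moreover define Y where "Y = (real (k + m0) - real i) * (real N - real k)"
    moreover define Z where "Z = real k * (real k - 1)"
    moreover define V where "V = real m0 * real k"
    moreover define U where "U = real m0 * real N"
    ultimately have "E \<le> 1 - real N / 2 + U" using E kk m0k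
      unfolding Y_def[symmetric] Z_def[symmetric] V_def[symmetric] U_def[symmetric] by simp
    then have "E \<le> 1 + (-1/2) * real N + real m0 * real N" by (simp add: U_def)
    then have "E \<le> 1 + (-1/2) * real N + real (m0 * N)" by simp
    then have "q powr E \<le> q powr (1 + (-1/2) * real N + real (m0 * N))" using q1 by simp
    also have "\<dots> = q * (q powr (-1/2)) ^ N * q ^ (m0 * N)"
    proof -
      have "(q powr (-1/2)) ^ N = q powr ((-1/2) * real N)"
        using q0 by (simp add: powr_realpow[symmetric] powr_powr)
      moreover have "q ^ (m0 * N) = q powr real (m0 * N)" using q0 by (simp only: powr_realpow)
      ultimately show ?thesis using q0 by (simp only: powr_add) simp
    qed
    finally show "gs (int N) / gs (int (N - k)) * q ^ (i * (N - k)) \<le> q * (q powr (-1/2)) ^ N * q ^ (m0 * N)"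
      unfolding eq .
  }
qed

text \<open>The functional equation gives \<open>theta (q ^ i * t / \<mu>) * gs (- i) = (t / \<mu>)
  ^ i * theta (t / \<mu>)\<close>. So dilation of order \<open>i\<close>, applied to
  \<open>t powi n / theta (t / \<mu>)\<close>, amounts to multiplication by
  \<open>kp \<mu> i n * t powi (- i)\<close>.\<close>

definition kp :: "complex \<Rightarrow> nat \<Rightarrow> int \<Rightarrow> complex" where
  "kp \<mu> i n = \<mu> ^ i * of_real (gs (- int i) * q powi (int i * n))"

text \<open>Laurent coefficients of \<open>theta (t / \<mu>)\<close>.\<close>

definition th :: "complex \<Rightarrow> int \<Rightarrow> complex" where
  "th \<mu> n = of_real (gs n) * \<mu> powi (- n)"

text \<open>On the product of \<open>t ^ l\<close> with theta, the factor \<open>kp\<close> acts as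
  dilation of \<open>t ^ l\<close> alone, by \<open>q ^ (i * l)\<close>, with the index lowered by
  \<open>i\<close>. Through this identity the formal equation passes to the coefficients of the
  product.\<close>

lemma kp_th: assumes "\<mu> \<noteq> 0" shows "kp \<mu> i n * th \<mu> (n - l) = of_real (q powi (int i * l)) * th \<mu> (n - l - int i)"
proof -
  have "gs (n - l - int i) = gs (n - l) * gs (- int i) * q powi ((n - l) * int i)"
    using gs_add[of "n - l" "- int i"] by simp
  moreover have "q powi (int i * n) = q powi (int i * l) * q powi ((n - l) * int i)"
    by (subst power_int_add[symmetric]) (auto simp: algebra_simps)
  moreover have "\<mu> powi (- (n - l - int i)) = \<mu> powi (- (n - l)) * \<mu> ^ i"
    using assms power_int_add[of \<mu> "- (n - l)" "int i"] by (simp add: algebra_simps)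
  ultimately show ?thesis by (simp add: kp_def th_def mult_ac)
qed

lemma norm_kp: "cmod (kp \<mu> i n) = cmod \<mu> ^ i * gs (- int i) * q powi (int i * n)"
  using q0 by (simp add: kp_def norm_mult norm_power norm_power_int abs_of_pos[OF gs_pos])

lemma norm_th: "cmod (th \<mu> n) = gs n * cmod \<mu> powi (- n)"
  by (simp add: th_def norm_mult norm_power_int abs_of_pos[OF gs_pos])

end

abbreviation (input) zidx :: "'d \<Rightarrow> nat" where "zidx \<equiv> (\<lambda>_. 0)"

text \<open>
  The operator is written as \<open>\<Sum> A i \<alpha> k z * t ^ k * \<sigma> ^ i * \<partial>\<^sup>\<alpha>\<close> with \<open>\<sigma>\<close> the dilation \<open>t \<mapsto> q t\<close>, and the formal series
  by coefficients. The conditions \<open>A_van1\<close>, \<open>A_van2\<close> and \<open>A_van3\<close> express the position of the Newton polygon;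
  \<open>leadP\<close> is the condition on the direction \<open>\<lambda> = \<mu> / (q - 1)\<close>.
\<close>

locale formal_q_equation = q_greater_one q for q :: real +
  fixes m m0 :: nat and \<mu> :: complex and \<A> :: "('d::{finite,linorder} \<Rightarrow> nat) set"
    and A :: "nat \<Rightarrow> ('d \<Rightarrow> nat) \<Rightarrow> nat \<Rightarrow> (complex,'d) vec \<Rightarrow> complex"
    and F X :: "nat \<Rightarrow> (complex,'d) vec \<Rightarrow> complex"
    and R C0 \<kappa> :: real
  assumes m0m: "m0 < m" and fin: "finite \<A>" and zin: "zidx \<in> \<A>"
    and mu: "\<mu> \<noteq> 0" and R: "R > 0" and C0: "C0 > 0" and \<kappa>: "\<kappa> \<ge> 1"
    and A_holo: "\<And>i \<alpha> k. i \<le> m \<Longrightarrow> \<alpha> \<in> \<A> \<Longrightarrow> holo_z (A i \<alpha> k) (polydisc R)"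
    and A_bound: "\<And>i \<alpha> k z. i \<le> m \<Longrightarrow> \<alpha> \<in> \<A> \<Longrightarrow> z \<in> polydisc R \<Longrightarrow> cmod (A i \<alpha> k z) \<le> C0 * \<kappa> ^ k"
    and F_holo: "\<And>k. holo_z (F k) (polydisc R)"
    and F_bound: "\<And>k z. z \<in> polydisc R \<Longrightarrow> cmod (F k z) \<le> C0 * \<kappa> ^ k"
    and X_holo: "\<And>k. holo_z (X k) (polydisc R)"
    and A_van1: "\<And>i \<alpha> k z. i \<le> m \<Longrightarrow> \<alpha> \<in> \<A> \<Longrightarrow> z \<in> polydisc R \<Longrightarrow> k + m0 < i \<Longrightarrow> A i \<alpha> k z = 0"
    and A_van2: "\<And>i \<alpha> k z. i \<le> m \<Longrightarrow> \<alpha> \<in> \<A> \<Longrightarrow> \<alpha> \<noteq> zidx \<Longrightarrow> z \<in> polydisc R \<Longrightarrow> k = 0 \<or> k + m0 \<le> i \<Longrightarrow> A i \<alpha> k z = 0"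
    and A_van3: "\<And>\<alpha> k z. \<alpha> \<in> \<A> \<Longrightarrow> \<alpha> \<noteq> zidx \<Longrightarrow> z \<in> polydisc R \<Longrightarrow> A m \<alpha> k z = 0"
    and formal: "\<And>z N. z \<in> polydisc R \<Longrightarrow>
        (\<Sum>k\<le>N. \<Sum>i\<le>m. \<Sum>\<alpha>\<in>\<A>. A i \<alpha> k z * of_real (q ^ (i * (N - k))) * multi_partial_z \<alpha> (X (N - k)) z) = F N z"
    and lead0: "A m0 zidx 0 0 \<noteq> 0" and lead1: "A m zidx (m - m0) 0 \<noteq> 0"
    and leadP: "\<And>n. (\<Sum>i=m0..m. A i zidx (i - m0) 0 * kp \<mu> i n) \<noteq> 0"
begin

lemma multi_zidx [simp]: "multi_partial_z zidx f = f"
  by (rule multi_partial_z_zero) (simp add: mlen_def)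

text \<open>This sum is the factor of \<open>X N\<close> itself in the formal equation.
  \<open>A m0 zidx 0\<close> does not vanish at the origin, so the highest power of
  \<open>q ^ N\<close> dominates for large \<open>N\<close>.\<close>

lemma Gevrey_leading_lower:
  "\<exists>R1>0. R1 \<le> R \<and> (\<exists>d>0. \<exists>N0. \<forall>N\<ge>N0. \<forall>z\<in>polydisc R1.
     cmod (\<Sum>i\<le>m0. A i zidx 0 z * of_real (q ^ (i * N))) \<ge> d * q ^ (m0 * N))"
proof -
  have "holo_z (A m0 zidx 0) (polydisc R)" using A_holo m0m zin by simp
  from holo_z_nonzero_near[OF this R lead0] obtain R1 d where R1: "R1 > 0" "R1 \<le> R" "d > 0"
    and low: "\<And>z. z \<in> polydisc R1 \<Longrightarrow> cmod (A m0 zidx 0 z) \<ge> d" by blast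
  obtain N0 where N0: "real m0 * C0 / (d / 2) < q ^ N0" using real_arch_pow[OF q1] by blast
  have "cmod (\<Sum>i\<le>m0. A i zidx 0 z * of_real (q ^ (i * N))) \<ge> d / 2 * q ^ (m0 * N)"
    if N: "N \<ge> N0" and z: "z \<in> polydisc R1" for N z
  proof -
    have zR: "z \<in> polydisc R" using z R1 polydisc_mono by blast
    have "cmod (\<Sum>i\<le>m0. A i zidx 0 z * of_real ((q ^ N) ^ i)) \<ge> d / 2 * (q ^ N) ^ m0"
    proof (rule dominant_term[where C = C0])
      show "1 \<le> q ^ N" using q1 by simp
      show "cmod (A i zidx 0 z) \<le> C0" if "i < m0" for i
        using A_bound[of i zidx z 0] that m0m zin zR by simp
      show "2 * (d / 2) \<le> cmod (A m0 zidx 0 z)" using low[OF z] by simp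
      have "q ^ N0 \<le> q ^ N" using N q1 by (intro power_increasing) auto
      then show "real m0 * C0 \<le> q ^ N * (d / 2)" using N0 R1(3)
        by (meson less_eq_real_def less_le_trans pos_divide_less_eq half_gt_zero)
    qed
    then show ?thesis by (simp add: power_mult[symmetric] mult.commute)
  qed
  then show ?thesis using R1 by (intro exI[of _ R1] conjI exI[of _ "d / 2"] exI[of _ N0]) auto
qed

text \<open>The formal equation is solved for \<open>X N\<close>. After normalisation by
  \<open>gs\<close> the earlier terms have bounded weights, and those with z-derivatives carry the
  additional factor \<open>s ^ N\<close> from \<open>gs_weight\<close>; this is the form required by
  \<open>holomorphic_recursion_bound\<close>.\<close>

theorem Gevrey_estimate:
  "\<exists>R1 A0 B. 0 < R1 \<and> R1 < R \<and> A0 > 0 \<and> B \<ge> 1 \<and> (\<forall>n. \<forall>z\<in>polydisc R1. cmod (X n z) \<le> A0 * B ^ n / gs (int n))"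
proof -
  obtain R2' d N0 where R2': "R2' > 0" "R2' \<le> R" "d > 0"
    and low': "\<And>N z. N \<ge> N0 \<Longrightarrow> z \<in> polydisc R2' \<Longrightarrow> cmod (\<Sum>i\<le>m0. A i zidx 0 z * of_real (q ^ (i * N))) \<ge> d * q ^ (m0 * N)"
    using Gevrey_leading_lower by blast
  \<comment> \<open>Halving makes the radius strictly smaller than \<open>R\<close>, so that each
    single \<open>h j\<close> is bounded on the polydisc.\<close>
  define R2 where "R2 = R2' / 2"
  have R2: "R2 > 0" "R2 < R" "R2 < R2'" using R2' by (auto simp: R2_def)
  have low: "cmod (\<Sum>i\<le>m0. A i zidx 0 z * of_real (q ^ (i * N))) \<ge> d * q ^ (m0 * N)"
    if "N \<ge> N0" "z \<in> polydisc R2" for N z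
    using low'[OF that(1)] that(2) polydisc_mono[of R2 R2'] R2 by auto
  have sub: "z \<in> polydisc R" if "z \<in> polydisc R2" for z using that polydisc_mono[of R2 R] R2 by auto
  define h where "h j z = of_real (gs (int j)) * X j z" for j z
  define s where "s = q powr (-1/2)"
  have s: "0 < s" "s < 1" using q1 q0 powr_less_mono[of "-1/2" 0 q] by (auto simp: s_def)
  \<comment> \<open>The factors are the number of dilation orders, the bound of the coefficients,
    the constant of \<open>gs_weight\<close> and the lower bound \<open>d\<close> of the leading
    factor.\<close>
  define K where "K = (real m + 1) * C0 * q / d"
  have K: "K > 0" "K \<ge> C0 / d"
  proof -
    show "K > 0" using C0 q0 R2' by (simp add: K_def add_pos_nonneg)
    have "1 * C0 * 1 \<le> (real m + 1) * C0 * q" using C0 q1 by (intro mult_mono) auto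
    then show "K \<ge> C0 / d" unfolding K_def using R2' by (intro divide_right_mono) auto
  qed
  have multi_h: "multi_partial_z \<alpha> (h j) z = of_real (gs (int j)) * multi_partial_z \<alpha> (X j) z" if "z \<in> polydisc R" for \<alpha> j z
    unfolding h_def[abs_def] by (rule multi_partial_z_scale[OF open_polydisc X_holo that])
  have "\<exists>C>0. \<exists>T\<ge>1. \<forall>j. \<forall>z\<in>polydisc (R2 / 2). cmod (h j z) \<le> C * T ^ j"
  proof (rule holomorphic_recursion_bound[where s = s and \<tau> = \<kappa> and K = K and \<A> = \<A> and ?j0.0 = "max 1 N0"])
    show hh: "holo_z (h j) (polydisc R2)" for j unfolding h_def[abs_def]
      by (intro holo_z_mult holo_z_const holo_z_subset[OF X_holo]) (use sub in auto)
    show "\<exists>M. \<forall>z\<in>polydisc R2. cmod (h j z) \<le> M" for j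
    proof -
      have "holo_z (h j) (polydisc R)" unfolding h_def[abs_def] by (intro holo_z_mult holo_z_const X_holo)
      then show ?thesis using holo_z_bounded_smaller R2 by blast
    qed
    fix N :: nat and z :: "(complex,'d) vec"
    assume N: "N \<ge> max 1 N0" and z: "z \<in> polydisc R2"
    have zR: "z \<in> polydisc R" using sub z by blast
    let ?t = "\<lambda>k i \<alpha>. A i \<alpha> k z * of_real (q ^ (i * (N - k))) * multi_partial_z \<alpha> (X (N - k)) z"
    let ?L = "\<Sum>i\<le>m0. A i zidx 0 z * of_real (q ^ (i * N))"
    \<comment> \<open>For \<open>k = 0\<close> only the undifferentiated terms with
      \<open>i \<le> m0\<close> survive; they form the factor of \<open>X N\<close>.\<close>
    have k0: "(\<Sum>i\<le>m. \<Sum>\<alpha>\<in>\<A>. ?t 0 i \<alpha>) = ?L * X N z"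
    proof -
      have "(\<Sum>\<alpha>\<in>\<A>. ?t 0 i \<alpha>) = (if i \<le> m0 then A i zidx 0 z * of_real (q ^ (i * N)) * X N z else 0)" if "i \<le> m" for i
      proof -
        have "(\<Sum>\<alpha>\<in>\<A>. ?t 0 i \<alpha>) = (\<Sum>\<alpha>\<in>{zidx}. ?t 0 i \<alpha>)"
          by (rule sum.mono_neutral_right) (use fin zin A_van2[OF that _ _ zR, of _ 0] in auto)
        then show ?thesis using A_van1[OF that zin zR, of 0] by auto
      qed
      then have "(\<Sum>i\<le>m. \<Sum>\<alpha>\<in>\<A>. ?t 0 i \<alpha>) = (\<Sum>i\<le>m. if i \<le> m0 then A i zidx 0 z * of_real (q ^ (i * N)) * X N z else 0)"
        by (intro sum.cong) auto
      also have "\<dots> = (\<Sum>i\<le>m0. A i zidx 0 z * of_real (q ^ (i * N)) * X N z)"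
        by (rule sum.mono_neutral_cong_right) (use m0m in auto)
      finally show ?thesis by (simp add: sum_distrib_right)
    qed
    have eq: "?L * X N z = F N z - (\<Sum>k=1..N. \<Sum>i\<le>m. \<Sum>\<alpha>\<in>\<A>. ?t k i \<alpha>)"
    proof -
      have sp: "(\<Sum>k\<le>N. f k) = f 0 + (\<Sum>k=1..N. f k)" for f :: "nat \<Rightarrow> complex"
        by (simp add: atMost_atLeast0 sum.atLeast_Suc_atMost)
      have "F N z = ?L * X N z + (\<Sum>k=1..N. \<Sum>i\<le>m. \<Sum>\<alpha>\<in>\<A>. ?t k i \<alpha>)"
        unfolding formal[OF zR, of N, symmetric] sp k0 ..
      then show ?thesis by (simp only: add_diff_cancel_right')
    qed
    \<comment> \<open>Multiplication by this factor turns \<open>X N\<close> into \<open>h N\<close>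
      and cancels the leading weight.\<close>
    let ?g = "gs (int N) / q ^ (m0 * N)"
    have g: "?g > 0" "?g \<le> 1"
    proof -
      show "?g > 0" using gs_pos q0 by simp
      have "gs (int N) \<le> 1" unfolding gs_def using q1 powr_mono[of "- (real_of_int (int N) * (real_of_int (int N) - 1)) / 2" 0 q] N by simp
      moreover have "q ^ (m0 * N) \<ge> 1" using q1 by simp
      ultimately show "?g \<le> 1" using gs_pos[of "int N"] by (simp add: divide_le_eq)
    qed
    have tb: "?g * cmod (?t k i \<alpha>) \<le> C0 * q * \<kappa> ^ k * (if \<alpha> = zidx then cmod (h (N - k) z) else s ^ N * cmod (multi_partial_z \<alpha> (h (N - k)) z))"
      if "k \<in> {1..N}" "i \<le> m" "\<alpha> \<in> \<A>" for k i \<alpha>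
    proof (cases "A i \<alpha> k z = 0")
      case True
      then show ?thesis using C0 q0 \<kappa> s by (simp add: sum_nonneg)
    next
      case False
      have k: "1 \<le> k" "k \<le> N" using that by auto
      let ?w = "gs (int N) / gs (int (N - k)) * q ^ (i * (N - k))"
      have "?g * cmod (?t k i \<alpha>) = cmod (A i \<alpha> k z) * (?w / q ^ (m0 * N)) * cmod (multi_partial_z \<alpha> (h (N - k)) z)"
        using gs_pos[of "int (N - k)"] q0 unfolding multi_h[OF zR]
        by (simp add: norm_mult norm_power abs_of_pos[OF gs_pos])
      \<comment> \<open>Without a derivative the weight would even be at most 1; the value
        \<open>q\<close> gives both cases the same constant.\<close>
      also have "\<dots> \<le> (C0 * \<kappa> ^ k) * (if \<alpha> = zidx then q else q * s ^ N) * cmod (multi_partial_z \<alpha> (h (N - k)) z)"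
      proof (intro mult_right_mono mult_mono)
        show "cmod (A i \<alpha> k z) \<le> C0 * \<kappa> ^ k" by (rule A_bound[OF that(2,3) zR])
        have "i \<le> k + m0" using A_van1[OF that(2,3) zR, of k] False by linarith
        have qm: "q ^ (m0 * N) > 0" using q0 by simp
        show "?w / q ^ (m0 * N) \<le> (if \<alpha> = zidx then q else q * s ^ N)"
        proof (cases "\<alpha> = zidx")
          case True
          have "?w \<le> q ^ (m0 * N)" by (rule gs_weight(1)[OF k \<open>i \<le> k + m0\<close>])
          then have "?w / q ^ (m0 * N) \<le> 1" by (simp only: divide_le_eq_1_pos[OF qm])
          then show ?thesis using True q1 by simp
        next
          case nz: False
          have "i < k + m0" using A_van2[OF that(2,3) nz zR, of k] False by linarith
          from gs_weight(2)[OF k this] show ?thesis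
            unfolding s_def if_not_P[OF nz] pos_divide_le_eq[OF qm] .
        qed
      qed (use C0 \<kappa> gs_pos q0 in \<open>auto intro!: divide_nonneg_nonneg mult_nonneg_nonneg less_imp_le[OF gs_pos]\<close>)
      also have "\<dots> = C0 * q * \<kappa> ^ k * (if \<alpha> = zidx then cmod (h (N - k) z) else s ^ N * cmod (multi_partial_z \<alpha> (h (N - k)) z))"
        by simp
      finally show ?thesis .
    qed
    have sum_tb: "?g * cmod (\<Sum>k=1..N. \<Sum>i\<le>m. \<Sum>\<alpha>\<in>\<A>. ?t k i \<alpha>)
        \<le> (real m + 1) * C0 * q * (\<Sum>k=1..N. \<kappa> ^ k * (cmod (h (N - k) z) + s ^ N * (\<Sum>\<alpha>\<in>\<A>. cmod (multi_partial_z \<alpha> (h (N - k)) z))))"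
    proof -
      have "?g * cmod (\<Sum>k=1..N. \<Sum>i\<le>m. \<Sum>\<alpha>\<in>\<A>. ?t k i \<alpha>) \<le> ?g * (\<Sum>k=1..N. \<Sum>i\<le>m. \<Sum>\<alpha>\<in>\<A>. cmod (?t k i \<alpha>))"
        using g by (intro mult_left_mono order_trans[OF norm_sum] sum_mono order_refl) auto
      also have "\<dots> = (\<Sum>k=1..N. \<Sum>i\<le>m. \<Sum>\<alpha>\<in>\<A>. ?g * cmod (?t k i \<alpha>))" by (simp only: sum_distrib_left)
      also have "\<dots> \<le> (\<Sum>k=1..N. \<Sum>i\<le>m. C0 * q * \<kappa> ^ k * (cmod (h (N - k) z) + s ^ N * (\<Sum>\<alpha>\<in>\<A>. cmod (multi_partial_z \<alpha> (h (N - k)) z))))"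
      proof (intro sum_mono)
        fix k i assume ki: "k \<in> {1..N}" "i \<in> {..m}"
        have "(\<Sum>\<alpha>\<in>\<A>. ?g * cmod (?t k i \<alpha>)) \<le> (\<Sum>\<alpha>\<in>\<A>. C0 * q * \<kappa> ^ k * (if \<alpha> = zidx then cmod (h (N - k) z) else s ^ N * cmod (multi_partial_z \<alpha> (h (N - k)) z)))"
          using ki by (intro sum_mono tb) auto
        also have "\<dots> \<le> (\<Sum>\<alpha>\<in>\<A>. C0 * q * \<kappa> ^ k * ((if \<alpha> = zidx then cmod (h (N - k) z) else 0) + s ^ N * cmod (multi_partial_z \<alpha> (h (N - k)) z)))"
          using C0 q0 \<kappa> s by (intro sum_mono mult_left_mono) auto
        also have "\<dots> = C0 * q * \<kappa> ^ k * (cmod (h (N - k) z) + s ^ N * (\<Sum>\<alpha>\<in>\<A>. cmod (multi_partial_z \<alpha> (h (N - k)) z)))"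
          using fin zin by (simp add: sum_distrib_left[symmetric] sum.distrib sum.delta)
        finally show "(\<Sum>\<alpha>\<in>\<A>. ?g * cmod (?t k i \<alpha>)) \<le> C0 * q * \<kappa> ^ k * (cmod (h (N - k) z) + s ^ N * (\<Sum>\<alpha>\<in>\<A>. cmod (multi_partial_z \<alpha> (h (N - k)) z)))" .
      qed
      also have "\<dots> = (real m + 1) * C0 * q * (\<Sum>k=1..N. \<kappa> ^ k * (cmod (h (N - k) z) + s ^ N * (\<Sum>\<alpha>\<in>\<A>. cmod (multi_partial_z \<alpha> (h (N - k)) z))))"
        by (simp add: sum_distrib_left mult_ac add.commute)
      finally show ?thesis .
    qed
    have "d * q ^ (m0 * N) * cmod (X N z) \<le> cmod (?L * X N z)"
      unfolding norm_mult using low[OF _ z, of N] N by (intro mult_right_mono) auto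
    also have "\<dots> \<le> cmod (F N z) + cmod (\<Sum>k=1..N. \<Sum>i\<le>m. \<Sum>\<alpha>\<in>\<A>. ?t k i \<alpha>)"
      unfolding eq by (rule norm_triangle_ineq4)
    finally have "?g * (d * q ^ (m0 * N) * cmod (X N z)) \<le> ?g * (cmod (F N z) + cmod (\<Sum>k=1..N. \<Sum>i\<le>m. \<Sum>\<alpha>\<in>\<A>. ?t k i \<alpha>))"
      using g by (intro mult_left_mono) auto
    also have "?g * (d * q ^ (m0 * N) * cmod (X N z)) = d * cmod (h N z)"
      using q0 by (simp add: h_def norm_mult abs_of_pos[OF gs_pos])
    also have "?g * (cmod (F N z) + cmod (\<Sum>k=1..N. \<Sum>i\<le>m. \<Sum>\<alpha>\<in>\<A>. ?t k i \<alpha>)) \<le>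
        C0 * \<kappa> ^ N + (real m + 1) * C0 * q * (\<Sum>k=1..N. \<kappa> ^ k * (cmod (h (N - k) z) + s ^ N * (\<Sum>\<alpha>\<in>\<A>. cmod (multi_partial_z \<alpha> (h (N - k)) z))))"
    proof -
      have "?g * cmod (F N z) \<le> 1 * (C0 * \<kappa> ^ N)" using g F_bound[OF zR, of N] by (intro mult_mono) auto
      then show ?thesis using sum_tb unfolding distrib_left by linarith
    qed
    finally have "cmod (h N z) \<le> (C0 * \<kappa> ^ N + (real m + 1) * C0 * q * (\<Sum>k=1..N. \<kappa> ^ k * (cmod (h (N - k) z) + s ^ N * (\<Sum>\<alpha>\<in>\<A>. cmod (multi_partial_z \<alpha> (h (N - k)) z))))) / d"
      using R2'(3) by (simp add: pos_le_divide_eq mult.commute)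
    also have "\<dots> = C0 / d * \<kappa> ^ N + K * (\<Sum>k=1..N. \<kappa> ^ k * (cmod (h (N - k) z) + s ^ N * (\<Sum>\<alpha>\<in>\<A>. cmod (multi_partial_z \<alpha> (h (N - k)) z))))"
      by (simp add: K_def add_divide_distrib)
    also have "\<dots> \<le> K * \<kappa> ^ N + K * (\<Sum>k=1..N. \<kappa> ^ k * (cmod (h (N - k) z) + s ^ N * (\<Sum>\<alpha>\<in>\<A>. cmod (multi_partial_z \<alpha> (h (N - k)) z))))"
      using K \<kappa> by (intro add_right_mono mult_right_mono) auto
    finally show "cmod (h N z) \<le> K * \<kappa> ^ N + K * (\<Sum>k=1..N. \<kappa> ^ k * (cmod (h (N - k) z) + s ^ N * (\<Sum>\<alpha>\<in>\<A>. cmod (multi_partial_z \<alpha> (h (N - k)) z))))" .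
  qed (use R2 s \<kappa> K fin in auto)
  then obtain C T where CT: "C > 0" "T \<ge> 1" "\<And>j z. z \<in> polydisc (R2 / 2) \<Longrightarrow> cmod (h j z) \<le> C * T ^ j" by blast
  have "cmod (X n z) \<le> C * T ^ n / gs (int n)" if "z \<in> polydisc (R2 / 2)" for n z
    using CT(3)[OF that, of n] gs_pos[of "int n"] by (simp add: h_def norm_mult abs_of_pos[OF gs_pos] field_simps)
  then show ?thesis using CT(1,2) R2 by (intro exI[of _ "R2/2"] exI[of _ C] exI[of _ T]) auto
qed

end

context formal_q_equation begin

subsection \<open>The Laurent coefficients of the numerator\<close>

definition P :: "int \<Rightarrow> (complex,'d) vec \<Rightarrow> complex" where
  "P n z = (\<Sum>i=m0..m. A i zidx (i - m0) z * kp \<mu> i n)"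

lemma P_holo: "holo_z (P n) (polydisc R)"
  unfolding P_def[abs_def] by (intro holo_z_sum holo_z_mult holo_z_const A_holo zin) auto

text \<open>One polydisc has to serve infinitely many \<open>n\<close>. For large \<open>n\<close>
  the term \<open>i = m\<close> dominates uniformly in \<open>z\<close>, because of
  \<open>lead1\<close>; only finitely many \<open>n\<close> from \<open>n1\<close> on remain, and
  each of them has its own radius by \<open>leadP\<close>.\<close>

lemma P_lower:
  assumes n1: "n1 \<le> 0" and R1: "R1 > 0" "R1 \<le> R"
  shows "\<exists>R2>0. R2 < R1 \<and> (\<exists>d>0. \<forall>n\<ge>n1. \<forall>z\<in>polydisc R2. cmod (P n z) \<ge> d * q powi (int m * n))"
proof -
  \<comment> \<open>\<open>P n z\<close> becomes a polynomial in \<open>q powi n\<close> whose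
    coefficients do not depend on \<open>n\<close>.\<close>
  define a where "a i z = (if m0 \<le> i then A i zidx (i - m0) z * (\<mu> ^ i * of_real (gs (- int i))) else 0)" for i z
  define C where "C = (\<Sum>i\<le>m. C0 * \<kappa> ^ m * (cmod \<mu> ^ i * gs (- int i)))"
  have aC: "cmod (a i z) \<le> C" if "i \<le> m" "z \<in> polydisc R" for i z
  proof -
    have nn: "0 \<le> C0 * \<kappa> ^ m * (cmod \<mu> ^ i * gs (- int i))" for i
      using C0 \<kappa> gs_pos[of "- int i"] by simp
    have "cmod (a i z) \<le> C0 * \<kappa> ^ m * (cmod \<mu> ^ i * gs (- int i))"
    proof (cases "m0 \<le> i")
      case True
      have "cmod (A i zidx (i - m0) z) \<le> C0 * \<kappa> ^ (i - m0)" using A_bound[OF that(1) zin that(2)] .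
      also have "\<dots> \<le> C0 * \<kappa> ^ m" using C0 \<kappa> that by (intro mult_left_mono power_increasing) auto
      finally show ?thesis using True gs_pos[of "- int i"]
        by (simp add: a_def norm_mult norm_power abs_of_pos[OF gs_pos] mult_right_mono)
    qed (use nn in \<open>simp add: a_def\<close>)
    also have "\<dots> \<le> C" unfolding C_def by (rule member_le_sum) (use nn that in auto)
    finally show ?thesis .
  qed
  have Pa: "P n z = (\<Sum>i\<le>m. a i z * of_real (q powi n) ^ i)" for n z
  proof -
    have "P n z = (\<Sum>i=m0..m. a i z * of_real (q powi n) ^ i)"
      unfolding P_def
    proof (rule sum.cong)
      fix i assume "i \<in> {m0..m}"
      moreover have "q powi (int i * n) = (q powi n) ^ i" by (simp add: power_int_mult mult.commute)
      ultimately show "A i zidx (i - m0) z * kp \<mu> i n = a i z * of_real (q powi n) ^ i"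
        by (simp add: a_def kp_def)
    qed simp
    also have "\<dots> = (\<Sum>i\<le>m. a i z * of_real (q powi n) ^ i)"
      by (rule sum.mono_neutral_left) (auto simp: a_def)
    finally show ?thesis .
  qed
  have "holo_z (a m) (polydisc R)"
    using m0m A_holo[OF _ zin] unfolding a_def[abs_def] by (auto intro!: holo_z_mult holo_z_const)
  moreover have "a m 0 \<noteq> 0" using lead1 m0m mu gs_pos[of "- int m"] by (simp add: a_def)
  ultimately obtain r0 d0 where r0: "r0 > 0" "d0 > 0" "\<And>z. z \<in> polydisc r0 \<Longrightarrow> cmod (a m z) \<ge> d0"
    using holo_z_nonzero_near[OF _ R] by metis
  obtain N where N: "real m * C / (d0 / 2) < q ^ N" using real_arch_pow[OF q1] by blast
  have "\<exists>r>0. \<exists>d>0. \<forall>z\<in>polydisc r. cmod (P n z) \<ge> d" for n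
  proof -
    have "P n 0 \<noteq> 0" using leadP[of n] by (simp add: P_def)
    then show ?thesis using holo_z_nonzero_near[OF P_holo R] by metis
  qed
  then obtain rr dd where rr: "\<And>n. rr n > 0" "\<And>n. dd n > 0" "\<And>n z. z \<in> polydisc (rr n) \<Longrightarrow> cmod (P n z) \<ge> dd n"
    by metis
  define S where "S = {n1..int N}"
  have S: "finite S" by (simp add: S_def)
  define R2 where "R2 = Min (insert (R1/2) (insert r0 (rr ` S)))"
  define d where "d = Min (insert (d0 / 2) ((\<lambda>n. dd n / q powi (int m * n)) ` S))"
  have fins: "finite (insert (R1/2) (insert r0 (rr ` S)))" "finite (insert (d0 / 2) ((\<lambda>n. dd n / q powi (int m * n)) ` S))"
    using S by auto
  have R2: "R2 \<le> R1/2" "R2 \<le> r0" "\<And>n. n \<in> S \<Longrightarrow> R2 \<le> rr n"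
    unfolding R2_def by (rule Min_le[OF fins(1)]; simp)+
  have R2pos: "R2 > 0" unfolding R2_def using S R1 r0 rr by auto
  have d: "d \<le> d0 / 2" "\<And>n. n \<in> S \<Longrightarrow> d \<le> dd n / q powi (int m * n)"
    unfolding d_def by (rule Min_le[OF fins(2)]; simp)+
  have dpos: "d > 0" unfolding d_def using S r0 rr q0 by auto
  have "cmod (P n z) \<ge> d * q powi (int m * n)" if n: "n \<ge> n1" and z: "z \<in> polydisc R2" for n z
  proof (cases "n \<in> S")
    case True
    have "d * q powi (int m * n) \<le> dd n" using d(2)[OF True] q0 by (simp add: pos_le_divide_eq)
    also have "\<dots> \<le> cmod (P n z)" using rr(3)[of z n] z polydisc_mono[OF R2(3)[OF True]] by blast
    finally show ?thesis .
  next
    case False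
    then have nN: "n > int N" using n by (auto simp: S_def)
    then obtain k where k: "n = int k" by (metis nonneg_int_cases of_nat_0_le_iff order_trans less_imp_le)
    have zR: "z \<in> polydisc R" using z polydisc_mono[of R2 R] R2(1) R1 by auto
    have "cmod (\<Sum>i\<le>m. a i z * of_real ((q ^ k) ^ i)) \<ge> d0 / 2 * (q ^ k) ^ m"
    proof (rule dominant_term[where C = C])
      show "1 \<le> q ^ k" using q1 by simp
      show "cmod (a i z) \<le> C" if "i < m" for i using aC that zR by simp
      show "2 * (d0 / 2) \<le> cmod (a m z)" using r0(3)[of z] z polydisc_mono[OF R2(2)] by auto
      have "q ^ N \<le> q ^ k" using nN k q1 by (intro power_increasing) auto
      then show "real m * C \<le> q ^ k * (d0 / 2)" using N r0(2)
        by (meson less_eq_real_def less_le_trans pos_divide_less_eq half_gt_zero)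
    qed
    moreover have "P n z = (\<Sum>i\<le>m. a i z * of_real ((q ^ k) ^ i))" unfolding Pa by (simp add: k)
    moreover have "q powi (int m * n) = (q ^ k) ^ m"
      by (metis k mult.commute of_nat_mult power_int_of_nat power_mult)
    moreover have "d * (q ^ k) ^ m \<le> d0 / 2 * (q ^ k) ^ m" using d(1) q0 by (intro mult_right_mono) auto
    ultimately show ?thesis by (metis order_trans)
  qed
  then show ?thesis using R2(1) R2pos dpos R1 by (intro exI[of _ R2] conjI exI[of _ d]) auto
qed

lemma exists_threshold: "\<exists>n1\<le>0. B * cmod \<mu> * q powi (n1 - 1) \<le> 1 / 2"
proof -
  obtain N where N: "2 * \<bar>B * cmod \<mu>\<bar> < q ^ N" using real_arch_pow[OF q1] by blast
  have "q ^ N * (B * cmod \<mu> * q powi (- int N - 1)) = B * cmod \<mu> / q"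
    using q0 by (simp add: power_int_diff power_int_minus field_simps)
  also have "\<dots> \<le> \<bar>B * cmod \<mu>\<bar> / 1" using q1 by (intro frac_le) auto
  also have "\<dots> \<le> q ^ N * (1 / 2)" using N by simp
  finally have "B * cmod \<mu> * q powi (- int N - 1) \<le> 1 / 2" using q0 by simp
  then show ?thesis by (intro exI[of _ "- int N"]) simp
qed

end

text \<open>The condition on \<open>n1\<close> makes the series for the coefficients up to
  \<open>n1\<close> geometric with ratio at most 1/2. Of the three radii, \<open>R\<close> carries
  the equation, \<open>R1\<close> the Gevrey bound and \<open>R2\<close> the lower bound of
  \<open>P\<close>; the gap between \<open>R1\<close> and \<open>R2\<close> pays for the derivatives
  of these series.\<close>

locale theta_quotient = formal_q_equation q m m0 \<mu> \<A> A F X R C0 \<kappa>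
  for q :: real and m m0 :: nat and \<mu> :: complex and \<A> :: "('d::{finite,linorder} \<Rightarrow> nat) set"
    and A F X R C0 \<kappa> +
  fixes R1 A0 B R2 d :: real and n1 :: int
  assumes R1: "0 < R1" "R1 < R" and A0: "A0 > 0" and B: "B \<ge> 1"
    and XG: "\<And>n z. z \<in> polydisc R1 \<Longrightarrow> cmod (X n z) \<le> A0 * B ^ n / gs (int n)"
    and n1: "n1 \<le> 0" "B * cmod \<mu> * q powi (n1 - 1) \<le> 1 / 2"
    and R2: "0 < R2" "R2 < R1" and d: "d > 0"
    and PL: "\<And>n z. n \<ge> n1 \<Longrightarrow> z \<in> polydisc R2 \<Longrightarrow> cmod (P n z) \<ge> d * q powi (int m * n)"
begin

lemma subR1: "z \<in> polydisc R1 \<Longrightarrow> z \<in> polydisc R" and subR2: "z \<in> polydisc R2 \<Longrightarrow> z \<in> polydisc R1"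
  using polydisc_mono[of R1 R] polydisc_mono[of R2 R1] R1 R2 by auto

section \<open>Coefficients up to the threshold and the right-hand side\<close>

definition vn :: "int \<Rightarrow> real" where "vn n = gs n * cmod \<mu> powi (- n)"

lemma vn_pos: "vn n > 0" using mu gs_pos by (simp add: vn_def)

lemma vn_summable: "x > 0 \<Longrightarrow> (\<lambda>n. x powi n * vn n) summable_on UNIV"
  using gs_summable[of "x / cmod \<mu>"] mu
  by (simp add: vn_def power_int_mult_distrib power_int_inverse power_int_minus divide_inverse mult_ac)

lemma norm_th': "cmod (th \<mu> n) = vn n" by (simp add: norm_th vn_def)

text \<open>The Gaussian factor of \<open>th\<close> at \<open>n - l\<close> cancels
  \<open>1 / gs l\<close> and leaves the ratio \<open>B * cmod \<mu> * q powi (n - 1)\<close>, at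
  most 1/2 by the choice of \<open>n1\<close>. \<open>Y\<close> is arbitrary so that z-derivatives
  of \<open>X l\<close> are covered as well.\<close>

lemma Xth_bound:
  assumes n: "n \<le> n1" and Y: "cmod Y \<le> c * (B ^ l / gs (int l))" and c: "c \<ge> 0"
  shows "cmod (Y * th \<mu> (n - int l)) \<le> c * vn n * (1 / 2) ^ l"
proof -
  have g: "gs (n - int l) = gs n * (gs (int l) * q powi (- int l)) * q powi (n * int l)"
    using gs_add[of n "- int l"] gs_neg[of "int l"] by simp
  have m: "cmod \<mu> powi (- (n - int l)) = cmod \<mu> powi (- n) * cmod \<mu> ^ l"
    using mu power_int_add[of "cmod \<mu>" "- n" "int l"] by (simp add: algebra_simps)
  have "q powi (- int l) * q powi (n * int l) = (q powi (n - 1)) ^ l"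
  proof -
    have "q powi (- int l) * q powi (n * int l) = q powi ((n - 1) * int l)"
      by (subst power_int_add[symmetric]) (auto simp: algebra_simps)
    then show ?thesis by (simp add: power_int_mult)
  qed
  then have v: "vn (n - int l) = vn n * gs (int l) * (cmod \<mu> * q powi (n - 1)) ^ l"
    unfolding vn_def g m by (simp add: power_mult_distrib mult_ac)
  have "cmod (Y * th \<mu> (n - int l)) \<le> c * (B ^ l / gs (int l)) * vn (n - int l)"
    unfolding norm_mult norm_th' using Y vn_pos[of "n - int l"] by (intro mult_right_mono) auto
  also have "\<dots> = c * vn n * (B * cmod \<mu> * q powi (n - 1)) ^ l"
    using gs_pos[of "int l"] by (simp add: v power_mult_distrib mult_ac)
  also have "\<dots> \<le> c * vn n * (1 / 2) ^ l"
  proof (intro mult_left_mono power_mono)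
    have "q powi (n - 1) \<le> q powi (n1 - 1)" using n q1 by (intro power_int_increasing) auto
    then have "B * cmod \<mu> * q powi (n - 1) \<le> B * cmod \<mu> * q powi (n1 - 1)"
      using B by (intro mult_left_mono) auto
    then show "B * cmod \<mu> * q powi (n - 1) \<le> 1 / 2" using n1 by linarith
  qed (use B q0 c vn_pos[of n] in auto)
  finally show ?thesis .
qed

lemma half_summable: "(\<lambda>l. c * (1 / 2 :: real) ^ l) summable_on (UNIV :: nat set)"
  by (intro summable_on_cmult_right) (subst summable_on_UNIV_nonneg_real_iff, auto intro!: summable_geometric)

lemma half_infsum: "infsum (\<lambda>l. c * (1 / 2 :: real) ^ l) (UNIV :: nat set) = 2 * c"
proof (rule infsumI)
  have "((\<lambda>l. (1 / 2 :: real) ^ l) has_sum 2) UNIV"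
    using geometric_sums[of "1 / 2 :: real"] by (intro sums_nonneg_imp_has_sum) auto
  from has_sum_cmult_right[OF this, of c] show "((\<lambda>l. c * (1 / 2 :: real) ^ l) has_sum 2 * c) UNIV"
    by (simp add: mult.commute)
qed

lemma norm_infsum_half:
  assumes "\<And>l::nat. cmod (g l) \<le> c * (1 / 2) ^ l"
  shows "cmod (infsum g UNIV) \<le> 2 * c" "g summable_on UNIV" "(\<lambda>l. cmod (g l)) summable_on UNIV"
    "(\<Sum>\<^sub>\<infinity>l. cmod (g l)) \<le> 2 * c"
proof -
  show abs: "(\<lambda>l. cmod (g l)) summable_on UNIV"
    by (rule summable_on_comparison_test[OF half_summable]) (use assms in auto)
  then show s: "g summable_on UNIV" by (rule abs_summable_summable)
  show "cmod (infsum g UNIV) \<le> 2 * c"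
    unfolding half_infsum[symmetric]
    by (rule norm_infsum_le[OF has_sum_infsum[OF s] has_sum_infsum[OF half_summable]]) (use assms in auto)
  show "(\<Sum>\<^sub>\<infinity>l. cmod (g l)) \<le> 2 * c"
    unfolding half_infsum[symmetric] by (rule infsum_mono[OF abs half_summable assms])
qed

definition base :: "int \<Rightarrow> (complex,'d) vec \<Rightarrow> complex" where
  "base n z = (\<Sum>\<^sub>\<infinity>l. X l z * th \<mu> (n - int l))"

lemma base_term: "n \<le> n1 \<Longrightarrow> z \<in> polydisc R1 \<Longrightarrow> cmod (X l z * th \<mu> (n - int l)) \<le> A0 * vn n * (1 / 2) ^ l"
  using Xth_bound[of n "X l z" A0 l] XG[of z l] A0 by simp

lemma X_holo1: "holo_z (X l) (polydisc R1)"
  by (rule holo_z_subset[OF X_holo]) (use subR1 in auto)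

lemma base_holo: "n \<le> n1 \<Longrightarrow> holo_z (base n) (polydisc R1)"
  unfolding base_def[abs_def]
  by (rule holo_z_infsum[OF _ half_summable base_term]) (auto intro!: holo_z_mult holo_z_const X_holo1)

lemma base_bound: "n \<le> n1 \<Longrightarrow> z \<in> polydisc R1 \<Longrightarrow> cmod (base n z) \<le> 2 * (A0 * vn n)"
  unfolding base_def by (rule norm_infsum_half(1)[OF base_term])

lemma multi_base_has_sum:
  assumes n: "n \<le> n1" and z: "z \<in> polydisc R1"
  shows "((\<lambda>l. multi_partial_z \<alpha> (X l) z * th \<mu> (n - int l)) has_sum multi_partial_z \<alpha> (base n) z) UNIV"
proof -
  have "((\<lambda>l. multi_partial_z \<alpha> (\<lambda>z. X l z * th \<mu> (n - int l)) z) has_sum multi_partial_z \<alpha> (base n) z) UNIV"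
    unfolding base_def[abs_def]
    by (rule multi_partial_z_has_sum[OF _ half_summable base_term[OF n] z]) (auto intro!: holo_z_mult holo_z_const X_holo1)
  moreover have "multi_partial_z \<alpha> (\<lambda>z. X l z * th \<mu> (n - int l)) z = multi_partial_z \<alpha> (X l) z * th \<mu> (n - int l)" for l
    using multi_partial_z_scale[OF open_polydisc X_holo1 z, of \<alpha> "th \<mu> (n - int l)" l] by (simp add: mult.commute)
  ultimately show ?thesis by simp
qed

text \<open>One Cauchy constant for all derivatives in \<open>\<A>\<close>, on passing from
  \<open>R1\<close> to \<open>R2\<close>.\<close>

definition KD :: real where
  "KD = (\<Sum>\<alpha>\<in>\<A>. (real (mlen \<alpha>) / (R1 - R2)) ^ mlen \<alpha>)"

lemma KD_ge: "\<alpha> \<in> \<A> \<Longrightarrow> (real (mlen \<alpha>) / (R1 - R2)) ^ mlen \<alpha> \<le> KD"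
  unfolding KD_def by (rule member_le_sum) (use fin R2 in auto)

lemma KD_nonneg: "KD \<ge> 0"
  unfolding KD_def using R2 by (intro sum_nonneg) auto

lemma multi_KD:
  assumes "holo_z g (polydisc R1)" "\<And>z. z \<in> polydisc R1 \<Longrightarrow> cmod (g z) \<le> M" "\<alpha> \<in> \<A>" "z \<in> polydisc R2"
  shows "cmod (multi_partial_z \<alpha> g z) \<le> KD * M"
proof -
  have "M \<ge> 0" using assms(2)[OF subR2[OF assms(4)]] norm_ge_zero order_trans by blast
  have "cmod (multi_partial_z \<alpha> g z) \<le> M * (real (mlen \<alpha>) / (R1 - R2)) ^ mlen \<alpha>"
    by (rule multi_partial_z_bound[OF assms(1,2) R2(2) assms(4)])
  also have "\<dots> \<le> M * KD" using KD_ge[OF assms(3)] \<open>M \<ge> 0\<close> by (intro mult_left_mono)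
  finally show ?thesis by (simp add: mult.commute)
qed

lemma multi_base_bound:
  "n \<le> n1 \<Longrightarrow> \<alpha> \<in> \<A> \<Longrightarrow> z \<in> polydisc R2 \<Longrightarrow> cmod (multi_partial_z \<alpha> (base n) z) \<le> KD * (2 * (A0 * vn n))"
  by (rule multi_KD[OF base_holo base_bound])

text \<open>Laurent coefficients of \<open>F\<close> times \<open>theta (t / \<mu>)\<close>. The
  Taylor series of \<open>F\<close> converges, so they exist for every index, without a
  threshold.\<close>

definition f :: "int \<Rightarrow> (complex,'d) vec \<Rightarrow> complex" where
  "f N z = (\<Sum>\<^sub>\<infinity>l. F l z * th \<mu> (N - int l))"

definition Cf :: real where "Cf = C0 * Theta (1 / (2 * \<kappa> * cmod \<mu>))"

lemma Cf_pos: "Cf > 0"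
  unfolding Cf_def using C0 Theta_pos mu \<kappa> by simp

text \<open>A single term of the positive series \<open>Theta\<close> is at most its sum. Taking the
  radius \<open>1 / (2 * \<kappa>)\<close>, half of what the coefficients of \<open>F\<close> allow,
  produces the factor \<open>(1 / 2) ^ l\<close>.\<close>

lemma f_term:
  assumes "z \<in> polydisc R" shows "cmod (F l z * th \<mu> (N - int l)) \<le> Cf * (2 * \<kappa>) powi N * (1 / 2) ^ l"
proof -
  have k: "2 * \<kappa> > 0" using \<kappa> by simp
  have "vn (N - int l) * (1 / (2 * \<kappa>)) powi (N - int l) \<le> Theta (1 / (2 * \<kappa> * cmod \<mu>))"
  proof -
    have "(1 / (2 * \<kappa> * cmod \<mu>)) powi (N - int l) = (1 / (2 * \<kappa>)) powi (N - int l) * cmod \<mu> powi (- (N - int l))"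
    proof -
      have "1 / (2 * \<kappa> * cmod \<mu>) = (1 / (2 * \<kappa>)) * inverse (cmod \<mu>)"
        by (simp only: divide_inverse inverse_mult_distrib mult_1_left mult.assoc)
      then show ?thesis by (simp only: power_int_mult_distrib power_int_inverse power_int_minus)
    qed
    then show ?thesis using Theta_ge[of "1 / (2 * \<kappa> * cmod \<mu>)" "N - int l"] mu \<kappa> by (simp add: vn_def mult_ac)
  qed
  then have "vn (N - int l) \<le> Theta (1 / (2 * \<kappa> * cmod \<mu>)) * (2 * \<kappa>) powi (N - int l)"
    using k by (simp add: power_int_divide_distrib divide_le_eq)
  moreover have "cmod (F l z) \<le> C0 * \<kappa> ^ l" by (rule F_bound[OF assms])
  ultimately have "cmod (F l z * th \<mu> (N - int l)) \<le> (C0 * \<kappa> ^ l) * (Theta (1 / (2 * \<kappa> * cmod \<mu>)) * (2 * \<kappa>) powi (N - int l))"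
    unfolding norm_mult norm_th' using vn_pos[of "N - int l"] C0 \<kappa> by (intro mult_mono) auto
  also have "(2 * \<kappa>) powi (N - int l) = (2 * \<kappa>) powi N / (2 * \<kappa>) ^ l" using k by (simp add: power_int_diff)
  also have "(C0 * \<kappa> ^ l) * (Theta (1 / (2 * \<kappa> * cmod \<mu>)) * ((2 * \<kappa>) powi N / (2 * \<kappa>) ^ l)) = Cf * (2 * \<kappa>) powi N * (1 / 2) ^ l"
    using \<kappa> by (simp add: Cf_def power_mult_distrib power_divide)
  finally show ?thesis .
qed

lemma f_holo: "holo_z (f N) (polydisc R)"
  unfolding f_def[abs_def]
  by (rule holo_z_infsum[OF _ half_summable f_term]) (auto intro!: holo_z_mult holo_z_const F_holo)

lemma f_bound: "z \<in> polydisc R \<Longrightarrow> cmod (f N z) \<le> 2 * (Cf * (2 * \<kappa>) powi N)"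
  unfolding f_def by (rule norm_infsum_half(1)[OF f_term])

section \<open>The triangular system for the coefficients\<close>

definition Ai :: "nat \<Rightarrow> ('d \<Rightarrow> nat) \<Rightarrow> int \<Rightarrow> (complex,'d) vec \<Rightarrow> complex" where
  "Ai i \<alpha> k z = (if k < 0 then 0 else A i \<alpha> (nat k) z)"

lemma Ai_bound:
  assumes "i \<le> m" "\<alpha> \<in> \<A>" "z \<in> polydisc R" shows "cmod (Ai i \<alpha> k z) \<le> C0 * \<kappa> powi k"
proof (cases "k < 0")
  case True
  then show ?thesis using C0 \<kappa> by (simp add: Ai_def)
next
  case False
  then have "\<kappa> powi k = \<kappa> ^ nat k" by (simp add: power_int_def)
  then show ?thesis using A_bound[OF assms, of "nat k"] False by (simp add: Ai_def)
qed

text \<open>Factor of a derivative of \<open>w n'\<close> in the relation of index \<open>n\<close>.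
  The equation is multiplied by \<open>t ^ m0 * theta (t / \<mu>)\<close>. Since dilation of order
  \<open>i\<close> lowers the power of \<open>t\<close> by \<open>i\<close>, the part
  \<open>t ^ k\<close> of a coefficient contributes when \<open>n = n' + k + m0 - i\<close>.\<close>

definition cf :: "nat \<Rightarrow> ('d \<Rightarrow> nat) \<Rightarrow> int \<Rightarrow> int \<Rightarrow> (complex,'d) vec \<Rightarrow> complex" where
  "cf i \<alpha> n n' z = Ai i \<alpha> (n - int m0 + int i - n') z * kp \<mu> i n'"

lemma cf_holo: "i \<le> m \<Longrightarrow> \<alpha> \<in> \<A> \<Longrightarrow> holo_z (cf i \<alpha> n n') (polydisc R)"
  unfolding cf_def[abs_def] Ai_def[abs_def]
  by (cases "n - int m0 + int i - n' < 0") (auto intro!: holo_z_mult holo_z_const A_holo)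

text \<open>The Newton polygon in the new indexing: no later coefficient enters, z-derivatives fall
  on strictly earlier coefficients, and they never occur with the highest dilation.\<close>

lemma cf_zero:
  assumes "i \<le> m" "\<alpha> \<in> \<A>" "z \<in> polydisc R"
  shows "n' > n \<Longrightarrow> cf i \<alpha> n n' z = 0" "\<alpha> \<noteq> zidx \<Longrightarrow> n' \<ge> n \<Longrightarrow> cf i \<alpha> n n' z = 0" "\<alpha> \<noteq> zidx \<Longrightarrow> i = m \<Longrightarrow> cf i \<alpha> n n' z = 0"
proof -
  let ?k = "n - int m0 + int i - n'"
  show "cf i \<alpha> n n' z = 0" if "n' > n"
  proof (cases "?k < 0")
    case False
    then have "nat ?k + m0 < i" using that by linarith
    then show ?thesis using A_van1[OF assms, of "nat ?k"] by (simp add: cf_def Ai_def)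
  qed (simp add: cf_def Ai_def)
  show "cf i \<alpha> n n' z = 0" if "\<alpha> \<noteq> zidx" "n' \<ge> n"
  proof (cases "?k < 0")
    case False
    then have "nat ?k + m0 \<le> i" using that by linarith
    then show ?thesis using A_van2[OF assms(1,2) that(1) assms(3), of "nat ?k"] by (simp add: cf_def Ai_def)
  qed (simp add: cf_def Ai_def)
  show "cf i \<alpha> n n' z = 0" if "\<alpha> \<noteq> zidx" "i = m"
    using A_van3[OF assms(2) that(1) assms(3)] that by (simp add: cf_def Ai_def)
qed

definition c1 :: real where "c1 = C0 * \<kappa> ^ m * (\<Sum>i\<le>m. cmod \<mu> ^ i * gs (- int i))"

lemma c1_nonneg: "c1 \<ge> 0"
  unfolding c1_def using C0 \<kappa> gs_pos by (intro mult_nonneg_nonneg sum_nonneg) (auto simp: less_imp_le)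

lemma cf_bound:
  assumes "i \<le> m" "\<alpha> \<in> \<A>" "z \<in> polydisc R"
  shows "cmod (cf i \<alpha> n n' z) \<le> c1 * \<kappa> powi (n - n') * q powi (int i * n')"
proof -
  have "\<kappa> powi (n - int m0 + int i - n') \<le> \<kappa> powi (n - n' + int m)"
    by (rule power_int_increasing) (use \<kappa> assms in auto)
  also have "\<dots> = \<kappa> powi (n - n') * \<kappa> ^ m" using \<kappa> by (subst power_int_add) auto
  finally have 1: "cmod (Ai i \<alpha> (n - int m0 + int i - n') z) \<le> C0 * (\<kappa> powi (n - n') * \<kappa> ^ m)"
    using Ai_bound[OF assms, of "n - int m0 + int i - n'"] C0 by (meson mult_left_mono less_imp_le order_trans)
  have "cmod \<mu> ^ i * gs (- int i) \<le> (\<Sum>i\<le>m. cmod \<mu> ^ i * gs (- int i))"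
    by (rule member_le_sum) (use assms gs_pos in \<open>auto simp: less_imp_le\<close>)
  then have 2: "cmod (kp \<mu> i n') \<le> (\<Sum>i\<le>m. cmod \<mu> ^ i * gs (- int i)) * q powi (int i * n')"
    unfolding norm_kp using q0 by (intro mult_right_mono) auto
  have "cmod (cf i \<alpha> n n' z) \<le> (C0 * (\<kappa> powi (n - n') * \<kappa> ^ m)) * ((\<Sum>i\<le>m. cmod \<mu> ^ i * gs (- int i)) * q powi (int i * n'))"
    unfolding cf_def norm_mult using 1 2 C0 \<kappa> by (intro mult_mono) auto
  then show ?thesis by (simp add: c1_def mult_ac)
qed

text \<open>On the diagonal all z-derivatives drop out and the power of \<open>t\<close> in the
  coefficient becomes \<open>i - m0\<close>, which gives the terms of \<open>P\<close>. The factor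
  \<open>g\<close> stands for the derivatives of \<open>w n\<close>.\<close>

lemma P_cf:
  assumes z: "z \<in> polydisc R" shows "(\<Sum>i\<le>m. \<Sum>\<alpha>\<in>\<A>. cf i \<alpha> n n z * g i \<alpha>) = (\<Sum>i=m0..m. A i zidx (i - m0) z * kp \<mu> i n * g i zidx)"
proof -
  have "(\<Sum>\<alpha>\<in>\<A>. cf i \<alpha> n n z * g i \<alpha>) = cf i zidx n n z * g i zidx" if "i \<le> m" for i
  proof -
    have "(\<Sum>\<alpha>\<in>\<A>. cf i \<alpha> n n z * g i \<alpha>) = (\<Sum>\<alpha>\<in>{zidx}. cf i \<alpha> n n z * g i \<alpha>)"
      by (rule sum.mono_neutral_right) (use fin zin cf_zero(2)[OF that _ z] in auto)
    then show ?thesis by simp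
  qed
  then have "(\<Sum>i\<le>m. \<Sum>\<alpha>\<in>\<A>. cf i \<alpha> n n z * g i \<alpha>) = (\<Sum>i\<le>m. cf i zidx n n z * g i zidx)" by simp
  also have "\<dots> = (\<Sum>i=m0..m. A i zidx (i - m0) z * kp \<mu> i n * g i zidx)"
  proof (rule sum.mono_neutral_cong_right)
    show "\<forall>i\<in>{..m} - {m0..m}. cf i zidx n n z * g i zidx = 0" by (auto simp: cf_def Ai_def)
    fix i assume "i \<in> {m0..m}"
    then have "n - int m0 + int i - n = int (i - m0)" by auto
    then have "cf i zidx n n z = Ai i zidx (int (i - m0)) z * kp \<mu> i n" by (simp only: cf_def)
    then show "cf i zidx n n z * g i zidx = A i zidx (i - m0) z * kp \<mu> i n * g i zidx"
      unfolding Ai_def by simp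
  qed auto
  finally show ?thesis .
qed

definition TS :: "(int \<Rightarrow> (complex,'d) vec \<Rightarrow> complex) \<Rightarrow> int \<Rightarrow> int \<Rightarrow> (complex,'d) vec \<Rightarrow> complex" where
  "TS w n n' z = (\<Sum>i\<le>m. \<Sum>\<alpha>\<in>\<A>. cf i \<alpha> n n' z * multi_partial_z \<alpha> (w n') z)"

text \<open>Everything below the diagonal, cut at \<open>n1\<close>. For \<open>w\<close> the
  infinite part involves only coefficients given by \<open>base\<close>, so its convergence does not
  depend on the recursion.\<close>

definition S :: "(int \<Rightarrow> (complex,'d) vec \<Rightarrow> complex) \<Rightarrow> int \<Rightarrow> (complex,'d) vec \<Rightarrow> complex" where
  "S w n z = (\<Sum>\<^sub>\<infinity>n'\<in>{..<n1}. TS w n n' z) + (\<Sum>n'\<in>{n1..<n}. TS w n n' z)"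

text \<open>The values \<open>Wst j n\<close> are meaningful only for \<open>n \<le> n1 + j\<close>.\<close>

primrec Wst :: "nat \<Rightarrow> int \<Rightarrow> (complex,'d) vec \<Rightarrow> complex" where
  "Wst 0 = base"
| "Wst (Suc j) = (Wst j)(n1 + int (Suc j) := (\<lambda>z. (f (n1 + int (Suc j) - int m0) z - S (Wst j) (n1 + int (Suc j)) z) / P (n1 + int (Suc j)) z))"

definition w :: "int \<Rightarrow> (complex,'d) vec \<Rightarrow> complex" where
  "w n = Wst (nat (n - n1)) n"

lemma Wst_stable: "n \<le> n1 + int j \<Longrightarrow> Wst j n = w n"
proof (induction j)
  case 0
  then show ?case by (simp add: w_def)
next
  case (Suc j)
  show ?case
  proof (cases "n = n1 + int (Suc j)")
    case True
    then have "nat (n - n1) = Suc j" by simp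
    then show ?thesis by (simp only: w_def)
  next
    case False
    then show ?thesis using Suc by simp
  qed
qed

lemma w_base: "n \<le> n1 \<Longrightarrow> w n = base n"
  using Wst_stable[of n 0] by simp

lemma S_cong: "(\<And>n'. n' < n \<Longrightarrow> u n' = v n') \<Longrightarrow> n1 \<le> n \<Longrightarrow> S u n z = S v n z"
  unfolding S_def TS_def by (intro arg_cong2[where f = "(+)"] infsum_cong sum.cong) auto

lemma w_rec:
  assumes "n > n1" shows "w n z = (f (n - int m0) z - S w n z) / P n z"
proof -
  obtain j where j: "n = n1 + int (Suc j)"
    using assms zless_iff_Suc_zadd[of n1 n] by (metis)
  have "w n = Wst (Suc j) n" using Wst_stable[of n "Suc j"] j by simp
  moreover have "S (Wst j) n z = S w n z"
    by (rule S_cong) (use Wst_stable[of _ j] j in auto)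
  ultimately show ?thesis by (simp add: j)
qed

section \<open>Growth of the coefficients beyond the threshold\<close>

definition Kt :: real where "Kt = (real m + 1) * real (card \<A>) * (c1 * (KD * (2 * A0)))"

lemma Kt_nonneg: "Kt \<ge> 0"
  unfolding Kt_def using c1_nonneg KD_nonneg A0 by simp

text \<open>For \<open>n' \<le> n1 \<le> 0\<close> the dilation factor is at most 1, and the growth
  of \<open>\<kappa> powi (n - n')\<close> as \<open>n'\<close> decreases is outweighed by the
  Gaussian \<open>vn n'\<close>.\<close>

lemma tail_term_i:
  assumes "n' \<le> n1" "z \<in> polydisc R2" "i \<le> m" "\<alpha> \<in> \<A>"
  shows "cmod (cf i \<alpha> n n' z * multi_partial_z \<alpha> (base n') z) \<le> c1 * (KD * (2 * A0)) * \<kappa> powi n * ((1 / \<kappa>) powi n' * vn n')"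
proof -
  have zR: "z \<in> polydisc R" using assms subR1 subR2 by blast
  have "q powi (int i * n') \<le> q powi 0" by (rule power_int_increasing) (use assms n1 q1 in \<open>auto simp: mult_nonneg_nonpos\<close>)
  then have "c1 * \<kappa> powi (n - n') * q powi (int i * n') \<le> c1 * \<kappa> powi (n - n') * 1"
    using c1_nonneg \<kappa> by (intro mult_left_mono) auto
  then have 1: "cmod (cf i \<alpha> n n' z) \<le> c1 * \<kappa> powi (n - n')" using cf_bound[OF assms(3,4) zR, of n n'] by linarith
  have "cmod (cf i \<alpha> n n' z * multi_partial_z \<alpha> (base n') z) \<le> (c1 * \<kappa> powi (n - n')) * (KD * (2 * (A0 * vn n')))"
    unfolding norm_mult using 1 multi_base_bound[OF assms(1,4,2)] c1_nonneg \<kappa> by (intro mult_mono) auto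
  also have "\<kappa> powi (n - n') = \<kappa> powi n * (1 / \<kappa>) powi n'"
    using \<kappa> by (simp add: power_int_diff power_int_divide_distrib)
  finally show ?thesis by (simp add: mult_ac)
qed

lemma tail_term:
  assumes "n' \<le> n1" "z \<in> polydisc R2"
  shows "cmod (TS base n n' z) \<le> Kt * \<kappa> powi n * ((1 / \<kappa>) powi n' * vn n')"
proof -
  have "cmod (TS base n n' z) \<le> (\<Sum>i\<le>m. \<Sum>\<alpha>\<in>\<A>. c1 * (KD * (2 * A0)) * \<kappa> powi n * ((1 / \<kappa>) powi n' * vn n'))"
    unfolding TS_def by (intro order_trans[OF norm_sum] sum_mono tail_term_i assms) auto
  also have "\<dots> = Kt * \<kappa> powi n * ((1 / \<kappa>) powi n' * vn n')" by (simp add: Kt_def mult_ac)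
  finally show ?thesis .
qed

lemma tail_summable: "(\<lambda>n'. c * ((1 / \<kappa>) powi n' * vn n')) summable_on D"
  by (intro summable_on_cmult_right summable_on_subset_banach[OF vn_summable]) (use \<kappa> in auto)

definition Kv :: real where "Kv = (\<Sum>\<^sub>\<infinity>n'. (1 / \<kappa>) powi n' * vn n')"

lemma TS_base_holo: "n' \<le> n1 \<Longrightarrow> holo_z (TS base n n') (polydisc R2)"
  unfolding TS_def[abs_def]
  by (intro holo_z_sum holo_z_mult holo_z_subset[OF cf_holo] holo_z_multi_partial_z open_polydisc holo_z_subset[OF base_holo])
    (use subR1 subR2 in auto)

lemma tail_holo: "holo_z (\<lambda>z. \<Sum>\<^sub>\<infinity>n'\<in>{..<n1}. TS base n n' z) (polydisc R2)"
  by (rule holo_z_infsum[OF TS_base_holo tail_summable tail_term]) auto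

lemma tail_bound:
  assumes "z \<in> polydisc R2"
  shows "cmod (\<Sum>\<^sub>\<infinity>n'\<in>{..<n1}. TS base n n' z) \<le> Kt * Kv * \<kappa> powi n"
proof -
  have abs: "(\<lambda>n'. cmod (TS base n n' z)) summable_on {..<n1}"
    by (rule summable_on_comparison_test[OF tail_summable[of "Kt * \<kappa> powi n"]]) (use tail_term assms in auto)
  have "cmod (\<Sum>\<^sub>\<infinity>n'\<in>{..<n1}. TS base n n' z) \<le> (\<Sum>\<^sub>\<infinity>n'\<in>{..<n1}. cmod (TS base n n' z))"
    by (rule norm_infsum_bound[OF abs])
  also have "\<dots> \<le> (\<Sum>\<^sub>\<infinity>n'. Kt * \<kappa> powi n * ((1 / \<kappa>) powi n' * vn n'))"
    by (rule infsum_mono_neutral[OF abs tail_summable])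
      (use tail_term assms Kt_nonneg \<kappa> vn_pos in \<open>auto simp: less_imp_le\<close>)
  also have "\<dots> = Kt * Kv * \<kappa> powi n"
    unfolding Kv_def by (subst infsum_cmult_right) (use vn_summable[of "1/\<kappa>"] \<kappa> in auto)
  finally show ?thesis .
qed

lemma Kv_nonneg: "Kv \<ge> 0"
  unfolding Kv_def by (intro infsum_nonneg mult_nonneg_nonneg) (use \<kappa> vn_pos in \<open>auto simp: less_imp_le\<close>)

lemma S_w: "n \<ge> n1 \<Longrightarrow> S w n z = (\<Sum>\<^sub>\<infinity>n'\<in>{..<n1}. TS base n n' z) + (\<Sum>n'\<in>{n1..<n}. TS w n n' z)"
  unfolding S_def TS_def by (intro arg_cong2[where f = "(+)"] infsum_cong refl) (simp add: w_base)

lemma P_nz: "n \<ge> n1 \<Longrightarrow> z \<in> polydisc R2 \<Longrightarrow> P n z \<noteq> 0"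
  using PL[of n z] d q0 by (metis mult_pos_pos norm_zero not_le zero_less_power_int)

lemma w_holo: "holo_z (w n) (polydisc R2)"
proof (induction "nat (n - n1)" arbitrary: n rule: less_induct)
  case less
  show ?case
  proof (cases "n \<le> n1")
    case True
    have "holo_z (base n) (polydisc R2)" by (rule holo_z_subset[OF base_holo[OF True]]) (use subR2 in auto)
    then show ?thesis by (simp only: w_base[OF True])
  next
    case False
    have TS: "holo_z (TS w n n') (polydisc R2)" if "n' \<in> {n1..<n}" for n'
    proof -
      have wh: "holo_z (w n') (polydisc R2)" by (rule less) (use that in auto)
      show ?thesis unfolding TS_def[abs_def]
        by (intro holo_z_sum holo_z_mult holo_z_subset[OF cf_holo] holo_z_multi_partial_z open_polydisc wh)
          (use subR1 subR2 in auto)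
    qed
    have "holo_z (\<lambda>z. (f (n - int m0) z - ((\<Sum>\<^sub>\<infinity>n'\<in>{..<n1}. TS base n n' z) + (\<Sum>n'\<in>{n1..<n}. TS w n n' z))) / P n z) (polydisc R2)"
      by (intro holo_z_divide holo_z_diff holo_z_add tail_holo holo_z_sum TS holo_z_subset[OF f_holo] holo_z_subset[OF P_holo] P_nz)
        (use False subR1 subR2 in auto)
    moreover have "w n = (\<lambda>z. (f (n - int m0) z - ((\<Sum>\<^sub>\<infinity>n'\<in>{..<n1}. TS base n n' z) + (\<Sum>n'\<in>{n1..<n}. TS w n n' z))) / P n z)"
      using w_rec[of n] S_w[of n] False by (intro ext) simp
    ultimately show ?thesis by simp
  qed
qed

text \<open>Division by \<open>P n\<close>, of size at least \<open>d * q powi (m * n)\<close>,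
  leaves a factor \<open>s ^ j\<close> with \<open>s = 1 / q\<close> in all terms with
  \<open>i < m\<close>; the terms with \<open>i = m\<close> have no such factor but also no
  z-derivatives. So \<open>holomorphic_recursion_bound\<close> applies.\<close>

theorem w_bound: "\<exists>C>0. \<exists>T\<ge>1. \<forall>j. \<forall>z\<in>polydisc (R2 / 4). cmod (w (n1 + int j) z) \<le> C * T ^ j"
proof -
  \<comment> \<open>The loss caused by starting at the nonpositive index \<open>n1\<close> instead
    of 0.\<close>
  define Q0 where "Q0 = q powi (int m * (- n1))"
  have Q0: "Q0 > 0" using q0 by (simp add: Q0_def)
  define K where "K = (2 * Cf + Kt * Kv + (real m + 1) * c1) * Q0 / d"
  have K: "K \<ge> 0" unfolding K_def using Cf_pos Kt_nonneg Kv_nonneg c1_nonneg Q0 d by simp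
  define s where "s = 1 / q"
  have s: "0 < s" "s < 1" using q1 by (auto simp: s_def)
  define h where "h j = w (n1 + int j)" for j
  \<comment> \<open>The shift by \<open>e\<close> and the summand \<open>i * n1\<close> only lower
    the exponent; what remains is at most \<open>- m * n1 - (m - i) * j\<close>.\<close>
  have fac: "q powi (int i * (n1 + int j - int e)) / q powi (int m * (n1 + int j)) \<le> Q0 * (if i = m then 1 else s ^ j)"
    if "i \<le> m" for i j e
  proof -
    have eq: "q powi (int i * (n1 + int j - int e)) / q powi (int m * (n1 + int j)) = q powi (int i * (n1 + int j - int e) - int m * (n1 + int j))"
      by (simp add: power_int_diff)
    have ie: "int i * int e \<ge> 0" by simp
    have "int i * n1 \<le> 0" using n1 by (intro mult_nonneg_nonpos) auto
    then have "int i * n1 \<le> int i * int e" using ie by linarith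
    then have e1: "int i * (n1 + int j - int e) - int m * (n1 + int j) \<le> int m * (- n1) - (int m - int i) * int j"
      by (simp add: algebra_simps)
    show ?thesis
    proof (cases "i = m")
      case True
      then show ?thesis unfolding eq Q0_def using e1 q1 by (simp add: power_int_increasing)
    next
      case False
      then have "(int m - int i) * int j \<ge> 1 * int j" using that by (intro mult_right_mono) auto
      then have "int i * (n1 + int j - int e) - int m * (n1 + int j) \<le> int m * (- n1) - int j" using e1 by linarith
      then have "q powi (int i * (n1 + int j - int e) - int m * (n1 + int j)) \<le> q powi (int m * (- n1) - int j)"
        using q1 by (intro power_int_increasing) auto
      also have "\<dots> = Q0 * s ^ j" by (simp add: Q0_def s_def power_int_diff power_divide)
      finally show ?thesis unfolding eq using False by simp
    qed
  qed
  have "\<exists>C>0. \<exists>T\<ge>1. \<forall>j. \<forall>z\<in>polydisc (R2 / 2 / 2). cmod (h j z) \<le> C * T ^ j"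
  \<comment> \<open>\<open>\<tau> = 2 * \<kappa>\<close> because the bound of \<open>f\<close> grows
    like powers of \<open>2 * \<kappa>\<close>; this dominates the rate \<open>\<kappa>\<close> of
    the coefficients.\<close>
  proof (rule holomorphic_recursion_bound[where s = s and \<tau> = "2 * \<kappa>" and K = K and \<A> = \<A> and ?j0.0 = 1])
    show "holo_z (h j) (polydisc (R2 / 2))" for j unfolding h_def
      by (rule holo_z_subset[OF w_holo]) (use polydisc_mono[of "R2/2" R2] R2 in auto)
    show "\<exists>M. \<forall>z\<in>polydisc (R2 / 2). cmod (h j z) \<le> M" for j
      unfolding h_def by (rule holo_z_bounded_smaller[OF w_holo]) (use R2 in auto)
    fix j :: nat and z :: "(complex,'d) vec"
    assume j: "j \<ge> 1" and z': "z \<in> polydisc (R2 / 2)"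
    have z: "z \<in> polydisc R2" using z' polydisc_mono[of "R2/2" R2] R2 by auto
    have zR: "z \<in> polydisc R" using z subR1 subR2 by blast
    define n where "n = n1 + int j"
    have n: "n > n1" using j by (simp add: n_def)
    define Qn where "Qn = q powi (int m * n)"
    have Qn: "Qn > 0" using q0 by (simp add: Qn_def)
    let ?E = "\<lambda>e. cmod (h (j - e) z) + s ^ j * (\<Sum>\<alpha>\<in>\<A>. cmod (multi_partial_z \<alpha> (h (j - e)) z))"
    have k1: "2 * \<kappa> \<ge> 1" using \<kappa> by simp
    have Qn_inv: "1 / Qn \<le> Q0"
    proof -
      have "q powi (- (int m * n)) \<le> q powi (int m * (- n1))"
      proof (rule power_int_increasing)
        have "int m * int j \<ge> 0" by simp
        then show "- (int m * n) \<le> int m * - n1" by (simp add: n_def algebra_simps)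
      qed (use q1 in auto)
      then show ?thesis by (simp add: Qn_def Q0_def power_int_minus inverse_eq_divide)
    qed
    have finite_part: "cmod (\<Sum>n'\<in>{n1..<n}. TS w n n' z) / Qn \<le> (real m + 1) * c1 * Q0 * (\<Sum>e=1..j. (2 * \<kappa>) ^ e * ?E e)"
    proof -
      have "(\<Sum>n'\<in>{n1..<n}. TS w n n' z) = (\<Sum>e=1..j. TS w n (n - int e) z)"
        by (rule sum.reindex_bij_witness[of _ "\<lambda>e. n - int e" "\<lambda>n'. nat (n - n')"]) (auto simp: n_def)
      then have "cmod (\<Sum>n'\<in>{n1..<n}. TS w n n' z) / Qn \<le> (\<Sum>e=1..j. cmod (TS w n (n - int e) z)) / Qn"
        using Qn by (intro divide_right_mono) (auto intro: norm_sum)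
      also have "\<dots> = (\<Sum>e=1..j. cmod (TS w n (n - int e) z) / Qn)" by (simp add: sum_divide_distrib)
      also have "\<dots> \<le> (\<Sum>e=1..j. (real m + 1) * c1 * Q0 * ((2 * \<kappa>) ^ e * ?E e))"
      proof (rule sum_mono)
        fix e assume e: "e \<in> {1..j}"
        have he: "w (n - int e) = h (j - e)" using e by (simp add: h_def n_def of_nat_diff algebra_simps)
        have tb: "cmod (cf i \<alpha> n (n - int e) z * multi_partial_z \<alpha> (w (n - int e)) z) / Qn
           \<le> c1 * Q0 * (2 * \<kappa>) ^ e * ((if \<alpha> = zidx then cmod (h (j - e) z) else 0) + s ^ j * cmod (multi_partial_z \<alpha> (h (j - e)) z))"
          if i: "i \<le> m" and a: "\<alpha> \<in> \<A>" for i \<alpha>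
        \<comment> \<open>A z-derivative together with \<open>i = m\<close> is ruled out, since the
          coefficient vanishes. Otherwise either there is no derivative or the factor
          \<open>s ^ j\<close> is present.\<close>
        proof (cases "\<alpha> \<noteq> zidx \<and> i = m")
          case True
          then have "cf i \<alpha> n (n - int e) z = 0" using cf_zero(3)[OF i a zR] by simp
          then show ?thesis using c1_nonneg Q0 \<kappa> s by simp
        next
          case False
          have "cmod (cf i \<alpha> n (n - int e) z) / Qn \<le> c1 * \<kappa> ^ e * (q powi (int i * (n - int e)) / Qn)"
            using cf_bound[OF i a zR, of n "n - int e"] Qn by (simp add: divide_right_mono)
          also have "\<dots> \<le> c1 * \<kappa> ^ e * (Q0 * (if i = m then 1 else s ^ j))"
            using fac[OF i, of j e] c1_nonneg \<kappa> unfolding Qn_def n_def by (intro mult_left_mono) auto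
          also have "\<dots> \<le> c1 * (2 * \<kappa>) ^ e * (Q0 * (if i = m then 1 else s ^ j))"
            using c1_nonneg \<kappa> Q0 s by (intro mult_right_mono mult_left_mono power_mono) auto
          finally have "cmod (cf i \<alpha> n (n - int e) z) / Qn * cmod (multi_partial_z \<alpha> (h (j - e)) z) \<le>
             c1 * (2 * \<kappa>) ^ e * (Q0 * (if i = m then 1 else s ^ j)) * cmod (multi_partial_z \<alpha> (h (j - e)) z)"
            by (rule mult_right_mono) simp
          also have "\<dots> = c1 * Q0 * (2 * \<kappa>) ^ e * ((if i = m then 1 else s ^ j) * cmod (multi_partial_z \<alpha> (h (j - e)) z))"
            by simp
          also have "\<dots> \<le> c1 * Q0 * (2 * \<kappa>) ^ e * ((if \<alpha> = zidx then cmod (h (j - e) z) else 0) + s ^ j * cmod (multi_partial_z \<alpha> (h (j - e)) z))"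
            using False c1_nonneg Q0 \<kappa> s by (intro mult_left_mono) auto
          finally show ?thesis by (simp add: norm_mult he)
        qed
        have "cmod (TS w n (n - int e) z) / Qn \<le> (\<Sum>i\<le>m. \<Sum>\<alpha>\<in>\<A>. cmod (cf i \<alpha> n (n - int e) z * multi_partial_z \<alpha> (w (n - int e)) z)) / Qn"
          unfolding TS_def using Qn by (intro divide_right_mono order_trans[OF norm_sum] sum_mono order_refl) auto
        also have "\<dots> = (\<Sum>i\<le>m. \<Sum>\<alpha>\<in>\<A>. cmod (cf i \<alpha> n (n - int e) z * multi_partial_z \<alpha> (w (n - int e)) z) / Qn)"
          by (simp add: sum_divide_distrib)
        also have "\<dots> \<le> (\<Sum>i\<le>m. \<Sum>\<alpha>\<in>\<A>. c1 * Q0 * (2 * \<kappa>) ^ e * ((if \<alpha> = zidx then cmod (h (j - e) z) else 0) + s ^ j * cmod (multi_partial_z \<alpha> (h (j - e)) z)))"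
          by (intro sum_mono tb) auto
        also have "\<dots> = (\<Sum>i\<le>m. c1 * Q0 * (2 * \<kappa>) ^ e * ?E e)"
          using fin zin by (simp add: sum_distrib_left[symmetric] sum.distrib sum.delta)
        also have "\<dots> = (real m + 1) * c1 * Q0 * ((2 * \<kappa>) ^ e * ?E e)" by simp
        finally show "cmod (TS w n (n - int e) z) / Qn \<le> (real m + 1) * c1 * Q0 * ((2 * \<kappa>) ^ e * ?E e)" .
      qed
      also have "\<dots> = (real m + 1) * c1 * Q0 * (\<Sum>e=1..j. (2 * \<kappa>) ^ e * ?E e)" by (simp add: sum_distrib_left)
      finally show ?thesis .
    qed
    have fb: "cmod (f (n - int m0) z) / Qn \<le> 2 * Cf * (2 * \<kappa>) ^ j * Q0"
    proof -
      have "(2 * \<kappa>) powi (n - int m0) \<le> (2 * \<kappa>) powi (int j)"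
        by (rule power_int_increasing) (use n1 k1 in \<open>auto simp: n_def\<close>)
      then have "2 * Cf * (2 * \<kappa>) powi (n - int m0) \<le> 2 * Cf * (2 * \<kappa>) ^ j"
        using Cf_pos by (intro mult_left_mono) auto
      then have "cmod (f (n - int m0) z) \<le> 2 * Cf * (2 * \<kappa>) ^ j"
        using f_bound[OF zR, of "n - int m0"] by (simp add: mult.assoc)
      then have "cmod (f (n - int m0) z) * (1 / Qn) \<le> 2 * Cf * (2 * \<kappa>) ^ j * Q0"
        using Qn_inv Qn Cf_pos \<kappa> by (intro mult_mono) auto
      then show ?thesis by simp
    qed
    have tlb: "cmod (\<Sum>\<^sub>\<infinity>n'\<in>{..<n1}. TS base n n' z) / Qn \<le> Kt * Kv * (2 * \<kappa>) ^ j * Q0"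
    proof -
      have "\<kappa> powi n \<le> \<kappa> powi (int j)"
        by (rule power_int_increasing) (use n1 \<kappa> in \<open>auto simp: n_def\<close>)
      also have "\<dots> \<le> (2 * \<kappa>) ^ j" using \<kappa> by (auto intro: power_mono)
      finally have "Kt * Kv * \<kappa> powi n \<le> Kt * Kv * (2 * \<kappa>) ^ j"
        using Kt_nonneg Kv_nonneg by (intro mult_left_mono) auto
      then have "cmod (\<Sum>\<^sub>\<infinity>n'\<in>{..<n1}. TS base n n' z) \<le> Kt * Kv * (2 * \<kappa>) ^ j"
        using tail_bound[OF z, of n] by linarith
      then have "cmod (\<Sum>\<^sub>\<infinity>n'\<in>{..<n1}. TS base n n' z) * (1 / Qn) \<le> Kt * Kv * (2 * \<kappa>) ^ j * Q0"
        using Qn_inv Qn Kt_nonneg Kv_nonneg \<kappa> by (intro mult_mono) auto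
      then show ?thesis by simp
    qed
    have "d * Qn * cmod (w n z) \<le> cmod (P n z) * cmod (w n z)"
      using PL[of n z] n z unfolding Qn_def by (intro mult_right_mono) auto
    also have "\<dots> = cmod (f (n - int m0) z - S w n z)"
      using w_rec[OF n, of z] P_nz[of n z] n z by (simp add: norm_divide)
    also have "\<dots> \<le> cmod (f (n - int m0) z) + (cmod (\<Sum>\<^sub>\<infinity>n'\<in>{..<n1}. TS base n n' z) + cmod (\<Sum>n'\<in>{n1..<n}. TS w n n' z))"
      unfolding S_w[OF less_imp_le[OF n]]
      by (intro order_trans[OF norm_triangle_ineq4] add_left_mono norm_triangle_ineq)
    finally have "cmod (w n z) \<le> (cmod (f (n - int m0) z) + (cmod (\<Sum>\<^sub>\<infinity>n'\<in>{..<n1}. TS base n n' z) + cmod (\<Sum>n'\<in>{n1..<n}. TS w n n' z))) / (d * Qn)"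
      using d Qn by (simp add: pos_le_divide_eq mult.commute)
    also have "\<dots> = (cmod (f (n - int m0) z) / Qn + (cmod (\<Sum>\<^sub>\<infinity>n'\<in>{..<n1}. TS base n n' z) / Qn + cmod (\<Sum>n'\<in>{n1..<n}. TS w n n' z) / Qn)) / d"
      by (simp add: add_divide_distrib mult.commute)
    also have "\<dots> \<le> (2 * Cf * (2 * \<kappa>) ^ j * Q0 + (Kt * Kv * (2 * \<kappa>) ^ j * Q0 + (real m + 1) * c1 * Q0 * (\<Sum>e=1..j. (2 * \<kappa>) ^ e * ?E e))) / d"
      using d by (intro divide_right_mono add_mono fb tlb finite_part) auto
    also have "\<dots> \<le> K * (2 * \<kappa>) ^ j + K * (\<Sum>e=1..j. (2 * \<kappa>) ^ e * ?E e)"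
    proof -
      define U where "U = (2 * \<kappa>) ^ j"
      define V where "V = (\<Sum>e=1..j. (2 * \<kappa>) ^ e * ?E e)"
      have U: "U \<ge> 0" and V: "V \<ge> 0" using \<kappa> s by (auto simp: U_def V_def intro!: sum_nonneg mult_nonneg_nonneg add_nonneg_nonneg)
      have "(2 * Cf * U * Q0 + (Kt * Kv * U * Q0 + (real m + 1) * c1 * Q0 * V)) \<le> (2 * Cf + Kt * Kv + (real m + 1) * c1) * Q0 * U + (2 * Cf + Kt * Kv + (real m + 1) * c1) * Q0 * V"
      proof -
        have "0 \<le> (real m + 1) * c1 * Q0 * U" "0 \<le> (2 * Cf + Kt * Kv) * Q0 * V"
          using c1_nonneg Q0 U V Cf_pos Kt_nonneg Kv_nonneg by auto
        then show ?thesis by (simp add: algebra_simps)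
      qed
      then have "(2 * Cf * U * Q0 + (Kt * Kv * U * Q0 + (real m + 1) * c1 * Q0 * V)) / d \<le> ((2 * Cf + Kt * Kv + (real m + 1) * c1) * Q0 * U + (2 * Cf + Kt * Kv + (real m + 1) * c1) * Q0 * V) / d"
        using d by (intro divide_right_mono) auto
      also have "\<dots> = K * U + K * V" by (simp add: K_def add_divide_distrib)
      finally show ?thesis by (simp only: U_def V_def)
    qed
    finally show "cmod (h j z) \<le> K * (2 * \<kappa>) ^ j + K * (\<Sum>e=1..j. (2 * \<kappa>) ^ e * ?E e)"
      by (simp add: h_def n_def)
  qed (use R2 s \<kappa> K fin in auto)
  then show ?thesis by (simp add: h_def)
qed

end

subsection \<open>The quotient solution and its asymptotic expansion\<close>

lemma has_sum_finite_sum: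
  fixes g :: "'i \<Rightarrow> 'a \<Rightarrow> 'b::topological_comm_monoid_add"
  assumes "\<And>i. i \<in> I \<Longrightarrow> (g i has_sum S i) D"
  shows "((\<lambda>x. \<Sum>i\<in>I. g i x) has_sum (\<Sum>i\<in>I. S i)) D"
  using assms by (induction I rule: infinite_finite_induct) (auto intro: has_sum_add)

lemma has_sum_norm_summable:
  fixes g :: "'i \<Rightarrow> complex"
  assumes "(g has_sum S) D" shows "(\<lambda>x. cmod (g x)) summable_on D"
  using has_sum_imp_summable[OF assms] unfolding summable_on_iff_abs_summable_on_complex .

context q_greater_one
begin

lemma theta_qpow_mult:
  assumes "t \<noteq> 0" shows "theta (of_real (q ^ i) * t) * of_real (gs (- int i)) = t ^ i * theta t"
proof (induction i)
  case (Suc i)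
  have g: "gs (- int i) = gs (- int (Suc i)) * q ^ Suc i"
    using gs_Suc[of "- int (Suc i)"] by (simp only: minus_minus power_int_of_nat) simp
  have "theta (of_real (q ^ Suc i) * t) = of_real q * (of_real (q ^ i) * t) * theta (of_real (q ^ i) * t)"
    using theta_q[of "of_real (q ^ i) * t"] assms by (simp add: mult.assoc)
  then have "theta (of_real (q ^ Suc i) * t) * of_real (gs (- int (Suc i))) =
      t * (theta (of_real (q ^ i) * t) * of_real (gs (- int (Suc i)) * q ^ Suc i))"
    by (simp add: mult_ac)
  also have "\<dots> = t ^ Suc i * theta t" unfolding g[symmetric] Suc.IH by simp
  finally show ?case .
qed simp

text \<open>Induction from \<open>qnum q (Suc n) \<ge> q ^ n\<close>. It converts the Gaussian
  factor \<open>1 / gs (- N)\<close> into the q-factorial of the definition, at the price of a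
  geometric factor.\<close>

lemma qfact_ge: "q ^ N / gs (- int N) \<le> q ^ (2 * N) * qfact q N"
proof (induction N)
  case (Suc N)
  have g: "gs (- int N) = gs (- int (Suc N)) * q ^ Suc N"
    using gs_Suc[of "- int (Suc N)"] by (simp only: minus_minus power_int_of_nat) simp
  have n: "qnum q (Suc N) \<ge> q ^ N"
  proof -
    have "q ^ N * (q - 1) \<le> q ^ Suc N - 1" using q1 by (simp add: algebra_simps)
    then show ?thesis using q1 by (simp add: qnum_def pos_le_divide_eq)
  qed
  have qf: "qfact q (Suc N) = qfact q N * qnum q (Suc N)" by (simp add: qfact_def)
  have "q ^ Suc N / gs (- int (Suc N)) = q * (q ^ N / gs (- int N)) * q ^ Suc N"
    using gs_pos[of "- int (Suc N)"] g by (simp add: field_simps)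
  also have "\<dots> \<le> q * (q ^ (2 * N) * qfact q N) * q ^ Suc N"
    using q0 Suc by (intro mult_right_mono mult_left_mono) auto
  also have "\<dots> = q ^ (2 * Suc N) * (qfact q N * q ^ N)" by (simp add: power_mult power2_eq_square power_mult_distrib)
  also have "\<dots> \<le> q ^ (2 * Suc N) * (qfact q N * qnum q (Suc N))"
  proof -
    have "qfact q N \<ge> 0" unfolding qfact_def qnum_def using q1 by (intro prod_nonneg) auto
    then show ?thesis using n q0 by (intro mult_left_mono) auto
  qed
  finally show ?case by (simp add: qf)
qed (simp add: qfact_def)

end

context theta_quotient
begin

section \<open>The recursion for all indices\<close>

definition dw :: "('d \<Rightarrow> nat) \<Rightarrow> int \<Rightarrow> (complex,'d) vec \<Rightarrow> complex" where
  "dw \<alpha> n z = multi_partial_z \<alpha> (w n) z"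

lemma dw_base: "n \<le> n1 \<Longrightarrow> dw \<alpha> n z = multi_partial_z \<alpha> (base n) z"
  by (simp add: dw_def w_base)

text \<open>Infinitely many terms occur only up to \<open>n1\<close>, where the Gaussian tail bound
  applies; finitely many lie between \<open>n1\<close> and \<open>n\<close>, and those above
  \<open>n\<close> vanish.\<close>

lemma cf_dw_summable:
  assumes z: "z \<in> polydisc R2" and i: "i \<le> m" and a: "\<alpha> \<in> \<A>"
  shows "(\<lambda>n'. cmod (cf i \<alpha> n n' z * dw \<alpha> n' z)) summable_on UNIV"
proof -
  have zR: "z \<in> polydisc R" using z subR1 subR2 by blast
  have "(\<lambda>n'. cmod (cf i \<alpha> n n' z * dw \<alpha> n' z)) summable_on {..n1}"
    by (rule summable_on_comparison_test[OF tail_summable[of "c1 * (KD * (2 * A0)) * \<kappa> powi n"]])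
      (use tail_term_i[OF _ z i a] dw_base in auto)
  moreover have "(\<lambda>n'. cmod (cf i \<alpha> n n' z * dw \<alpha> n' z)) summable_on {n1<..max n n1}" by simp
  ultimately have "(\<lambda>n'. cmod (cf i \<alpha> n n' z * dw \<alpha> n' z)) summable_on ({..n1} \<union> {n1<..max n n1})"
    by (rule summable_on_union)
  also have "{..n1} \<union> {n1<..max n n1} = {..max n n1}" by auto
  also have "(\<lambda>n'. cmod (cf i \<alpha> n n' z * dw \<alpha> n' z)) summable_on {..max n n1} \<longleftrightarrow>
      (\<lambda>n'. cmod (cf i \<alpha> n n' z * dw \<alpha> n' z)) summable_on UNIV"
    by (rule summable_on_cong_neutral) (use cf_zero(1)[OF i a zR] in auto)
  finally show ?thesis .
qed

lemma w_recursion_above: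
  assumes n: "n > n1" and z: "z \<in> polydisc R2"
  shows "((\<lambda>n'. TS w n n' z) has_sum f (n - int m0) z) UNIV"
proof -
  have zR: "z \<in> polydisc R" using z subR1 subR2 by blast
  have "(\<lambda>n'. cmod (TS base n n' z)) summable_on {..<n1}"
    by (rule summable_on_comparison_test[OF tail_summable[of "Kt * \<kappa> powi n"]]) (use tail_term z in auto)
  then have "((\<lambda>n'. TS base n n' z) has_sum (\<Sum>\<^sub>\<infinity>n'\<in>{..<n1}. TS base n n' z)) {..<n1}"
    using has_sum_infsum[OF abs_summable_summable, of "\<lambda>n'. TS base n n' z" "{..<n1}"] by simp
  then have 1: "((\<lambda>n'. TS w n n' z) has_sum (\<Sum>\<^sub>\<infinity>n'\<in>{..<n1}. TS base n n' z)) {..<n1}"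
    by (rule has_sum_cong[THEN iffD1, rotated]) (simp add: TS_def w_base)
  have 2: "((\<lambda>n'. TS w n n' z) has_sum (\<Sum>n'\<in>{n1..n}. TS w n n' z)) {n1..n}" by (rule has_sum_finite) simp
  have "((\<lambda>n'. TS w n n' z) has_sum ((\<Sum>\<^sub>\<infinity>n'\<in>{..<n1}. TS base n n' z) + (\<Sum>n'\<in>{n1..n}. TS w n n' z))) ({..<n1} \<union> {n1..n})"
    by (rule has_sum_Un_disjoint[OF 1 2]) auto
  also have "{..<n1} \<union> {n1..n} = {..n}" using n by auto
  also have "(\<Sum>n'\<in>{n1..n}. TS w n n' z) = (\<Sum>n'\<in>{n1..<n}. TS w n n' z) + TS w n n z"
  proof -
    have "{n1..n} = insert n {n1..<n}" using n by auto
    then show ?thesis by (simp add: add.commute)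
  qed
  also have "TS w n n z = P n z * w n z"
    unfolding TS_def P_cf[OF zR, of n "\<lambda>i \<alpha>. multi_partial_z \<alpha> (w n) z"] by (simp add: P_def sum_distrib_right)
  also have "(\<Sum>\<^sub>\<infinity>n'\<in>{..<n1}. TS base n n' z) + ((\<Sum>n'\<in>{n1..<n}. TS w n n' z) + P n z * w n z) = f (n - int m0) z"
    using w_rec[OF n, of z] S_w[of n z] P_nz[of n z] n z by (simp add: field_simps)
  also have "((\<lambda>n'. TS w n n' z) has_sum f (n - int m0) z) {..n} \<longleftrightarrow> ((\<lambda>n'. TS w n n' z) has_sum f (n - int m0) z) UNIV"
    by (rule has_sum_cong_neutral) (auto simp: TS_def cf_zero(1)[OF _ _ zR])
  finally show ?thesis .
qed

text \<open>For \<open>n \<le> n1\<close> all coefficients that enter are given by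
  \<open>base\<close>. Inserting these series and substituting \<open>k = n - m0 + i - n'\<close>
  leads to a double sum over the power \<open>k\<close> in the coefficient and the power
  \<open>l\<close> in the formal solution. \<open>kp_th\<close> produces the factor
  \<open>q ^ (i * l)\<close>, and summation along \<open>p = k + l\<close> recovers the coefficient
  of \<open>t ^ p\<close> in the formal equation.\<close>

lemma base_recursion_term:
  assumes n: "n \<le> n1" and z: "z \<in> polydisc R2" and i: "i \<le> m" and a: "\<alpha> \<in> \<A>"
  shows "((\<lambda>p. (\<Sum>k\<le>p. A i \<alpha> k z * of_real (q ^ (i * (p - k))) * multi_partial_z \<alpha> (X (p - k)) z) * th \<mu> (n - int m0 - int p))
      has_sum (\<Sum>\<^sub>\<infinity>n'. cf i \<alpha> n n' z * dw \<alpha> n' z)) UNIV"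
proof -
  have z1: "z \<in> polydisc R1" and zR: "z \<in> polydisc R" using z subR1 subR2 by blast+
  define N where "N = n - int m0"
  define D where "D l = multi_partial_z \<alpha> (X l) z" for l
  define \<phi> where "\<phi> = (\<lambda>(n', l). cf i \<alpha> n n' z * (D l * th \<mu> (n' - int l)))"
  define \<psi> where "\<psi> = (\<lambda>(k, l). A i \<alpha> k z * of_real (q ^ (i * l)) * D l * th \<mu> (N - int k - int l))"
  define S0 where "S0 = (\<Sum>\<^sub>\<infinity>n'. cf i \<alpha> n n' z * dw \<alpha> n' z)"
  have S0: "((\<lambda>n'. cf i \<alpha> n n' z * dw \<alpha> n' z) has_sum S0) UNIV"
    unfolding S0_def using abs_summable_summable[OF cf_dw_summable[OF z i a]] by simp
  then have S0': "((\<lambda>n'. cf i \<alpha> n n' z * dw \<alpha> n' z) has_sum S0) {..n}"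
    by (rule has_sum_cong_neutral[THEN iffD1, rotated -1]) (use cf_zero(1)[OF i a zR] in auto)
  \<comment> \<open>The derivatives of \<open>X l\<close> satisfy the same Gevrey bound with the
    constant \<open>KD * A0\<close>.\<close>
  have Db: "cmod (D l) \<le> KD * A0 * (B ^ l / gs (int l))" for l
    unfolding D_def using multi_KD[of "X l" "A0 * B ^ l / gs (int l)", OF X_holo1 XG a z] by (simp add: mult.assoc)
  have Dth: "cmod (D l * th \<mu> (n' - int l)) \<le> KD * A0 * vn n' * (1 / 2) ^ l" if "n' \<le> n1" for n' l
    by (rule Xth_bound[OF that Db]) (use KD_nonneg A0 in auto)
  have inner: "((\<lambda>l. \<phi> (n', l)) has_sum cf i \<alpha> n n' z * dw \<alpha> n' z) UNIV" if "n' \<le> n" for n'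
    unfolding \<phi>_def prod.case using multi_base_has_sum[OF _ z1, of n' \<alpha>] that n
    by (intro has_sum_cmult_right) (simp add: D_def dw_base)
  have zb: "cmod (cf i \<alpha> n n' z) * vn n' \<le> c1 * \<kappa> powi n * ((1 / \<kappa>) powi n' * vn n')" if "n' \<le> n" for n'
  proof -
    have "q powi (int i * n') \<le> q powi 0" by (rule power_int_increasing) (use that n n1 q1 in \<open>auto simp: mult_nonneg_nonpos\<close>)
    then have "c1 * \<kappa> powi (n - n') * q powi (int i * n') \<le> c1 * \<kappa> powi (n - n') * 1"
      using c1_nonneg \<kappa> by (intro mult_left_mono) auto
    then have 1: "cmod (cf i \<alpha> n n' z) \<le> c1 * \<kappa> powi (n - n')" using cf_bound[OF i a zR, of n n'] by linarith
    also have "\<kappa> powi (n - n') = \<kappa> powi n * (1 / \<kappa>) powi n'"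
      using \<kappa> by (simp add: power_int_diff power_int_divide_distrib)
    finally show ?thesis using vn_pos[of n'] by (simp add: mult.assoc[symmetric] mult_right_mono)
  qed
  \<comment> \<open>Absolute convergence of the double sum, which the regrouping requires: geometric
    in \<open>l\<close>, Gaussian in \<open>n'\<close>.\<close>
  have "(\<lambda>p. cmod (\<phi> p)) summable_on ({..n} \<times> UNIV)"
  proof (rule summable_on_comparison_test)
    show "(\<lambda>(n', l). KD * A0 * (c1 * \<kappa> powi n) * ((1 / \<kappa>) powi n' * vn n') * (1/2) ^ l) summable_on ({..n} \<times> (UNIV :: nat set))"
    proof (rule summable_on_SigmaI)
      fix n' assume "n' \<in> {..n}"
      have "((\<lambda>l. KD * A0 * (c1 * \<kappa> powi n) * ((1 / \<kappa>) powi n' * vn n') * (1/2) ^ l) has_sum 2 * (KD * A0 * (c1 * \<kappa> powi n) * ((1 / \<kappa>) powi n' * vn n'))) (UNIV :: nat set)"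
        using has_sum_infsum[OF half_summable] unfolding half_infsum .
      then show "((\<lambda>l. case (n', l) of (n', l) \<Rightarrow> KD * A0 * (c1 * \<kappa> powi n) * ((1 / \<kappa>) powi n' * vn n') * (1/2) ^ l) has_sum 2 * (KD * A0 * (c1 * \<kappa> powi n)) * ((1 / \<kappa>) powi n' * vn n')) (UNIV :: nat set)"
        by (simp add: mult.assoc)
    next
      show "(\<lambda>n'. 2 * (KD * A0 * (c1 * \<kappa> powi n)) * ((1 / \<kappa>) powi n' * vn n')) summable_on {..n}" by (rule tail_summable)
    qed (use KD_nonneg A0 c1_nonneg \<kappa> vn_pos in \<open>auto simp: less_imp_le\<close>)
    fix p assume p: "p \<in> {..n} \<times> (UNIV :: nat set)"
    obtain n' l where pl: "p = (n', l)" by (cases p)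
    have n': "n' \<le> n" using p pl by auto
    have "cmod (\<phi> p) \<le> cmod (cf i \<alpha> n n' z) * (KD * A0 * vn n' * (1 / 2) ^ l)"
      unfolding pl \<phi>_def prod.case norm_mult[of "cf i \<alpha> n n' z"] using n' n by (intro mult_left_mono Dth) auto
    also have "\<dots> = KD * A0 * (cmod (cf i \<alpha> n n' z) * vn n') * (1/2) ^ l" by simp
    also have "\<dots> \<le> KD * A0 * (c1 * \<kappa> powi n * ((1 / \<kappa>) powi n' * vn n')) * (1/2) ^ l"
      using KD_nonneg A0 by (intro mult_right_mono mult_left_mono zb n') auto
    finally show "cmod (\<phi> p) \<le> (case p of (n', l) \<Rightarrow> KD * A0 * (c1 * \<kappa> powi n) * ((1 / \<kappa>) powi n' * vn n') * (1/2) ^ l)"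
      by (simp add: pl mult.assoc)
  qed auto
  then have \<phi>s: "\<phi> summable_on ({..n} \<times> UNIV)" by (rule abs_summable_summable)
  have "(\<phi> has_sum S0) ({..n} \<times> UNIV)"
    by (rule has_sum_SigmaI[OF inner S0' \<phi>s]) auto
  \<comment> \<open>The substitution needs \<open>n' \<le> N + i\<close>, that is
    \<open>k \<ge> 0\<close>. Between the two bounds the coefficients vanish, by the convention in
    \<open>Ai\<close> or by the Newton polygon, depending on which bound is larger.\<close>
  also have "?this \<longleftrightarrow> (\<phi> has_sum S0) ({..N + int i} \<times> UNIV)"
  proof -
    have cf0: "cf i \<alpha> n n' z = 0" if "n' > n \<or> n' > N + int i" for n'
      using that cf_zero(1)[OF i a zR, of n n'] by (auto simp: cf_def Ai_def N_def)
    have z: "\<phi> p = 0" if "p \<in> {..n} \<times> UNIV - {..N + int i} \<times> UNIV \<or> p \<in> {..N + int i} \<times> UNIV - {..n} \<times> UNIV" for p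
    proof (cases p)
      case (Pair n' l)
      then have "cf i \<alpha> n n' z = 0" using that by (intro cf0) auto
      then show ?thesis unfolding Pair \<phi>_def by (simp only: prod.case mult_zero_left)
    qed
    show ?thesis by (rule has_sum_cong_neutral) (use z in \<open>blast+\<close>)
  qed
  also have "\<dots> \<longleftrightarrow> (\<psi> has_sum S0) (UNIV \<times> UNIV)"
  proof (rule has_sum_reindex_bij_witness[of _ "\<lambda>(k, l). (N + int i - int k, l)" "\<lambda>(n', l). (nat (N + int i - n'), l)"])
    fix p assume p: "p \<in> {..N + int i} \<times> (UNIV :: nat set)"
    obtain n' l where pl: "p = (n', l)" by (cases p)
    define k where "k = nat (N + int i - n')"
    have n': "n' = N + int i - int k" using p pl by (simp add: k_def)
    have "cf i \<alpha> n n' z = A i \<alpha> k z * kp \<mu> i n'" by (simp add: cf_def Ai_def n' N_def[symmetric])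
    then have "\<phi> p = A i \<alpha> k z * D l * (kp \<mu> i n' * th \<mu> (n' - int l))" by (simp add: pl \<phi>_def)
    also have "\<dots> = A i \<alpha> k z * D l * (of_real (q powi (int i * int l)) * th \<mu> (n' - int l - int i))"
      by (simp only: kp_th[OF mu])
    also have "n' - int l - int i = N - int k - int l" by (simp add: n')
    also have "q powi (int i * int l) = q ^ (i * l)" by (metis of_nat_mult power_int_of_nat)
    finally show "\<psi> (case p of (n', l) \<Rightarrow> (nat (N + int i - n'), l)) = \<phi> p"
      by (simp add: pl \<psi>_def k_def[symmetric])
  qed auto
  also have "\<dots> \<longleftrightarrow> ((\<lambda>(p, k). \<psi> (k, p - k)) has_sum S0) (Sigma UNIV (\<lambda>p. {..p}))"
    by (rule has_sum_reindex_bij_witness[of _ "\<lambda>(p, k). (k, p - k)" "\<lambda>(k, l). (k + l, k)"]) auto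
  finally have "((\<lambda>(p, k). \<psi> (k, p - k)) has_sum S0) (Sigma UNIV (\<lambda>p. {..p}))" .
  then have "((\<lambda>p. \<Sum>k\<le>p. \<psi> (k, p - k)) has_sum S0) UNIV"
    by (rule has_sum_SigmaD) (auto intro!: has_sum_finite)
  moreover have "(\<Sum>k\<le>p. \<psi> (k, p - k)) = (\<Sum>k\<le>p. A i \<alpha> k z * of_real (q ^ (i * (p - k))) * multi_partial_z \<alpha> (X (p - k)) z) * th \<mu> (n - int m0 - int p)" for p
    unfolding sum_distrib_right \<psi>_def prod.case D_def
  proof (intro sum.cong refl)
    fix k assume "k \<in> {..p}"
    then have "N - int k - int (p - k) = n - int m0 - int p" by (auto simp: N_def)
    then show "A i \<alpha> k z * of_real (q ^ (i * (p - k))) * multi_partial_z \<alpha> (X (p - k)) z * th \<mu> (N - int k - int (p - k)) =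
      A i \<alpha> k z * of_real (q ^ (i * (p - k))) * multi_partial_z \<alpha> (X (p - k)) z * th \<mu> (n - int m0 - int p)" by (simp only:)
  qed
  ultimately show ?thesis unfolding S0_def by simp
qed

text \<open>Up to \<open>n1\<close> this is the formal equation, multiplied by theta and read
  coefficientwise; beyond \<open>n1\<close> it is the defining recursion of
  \<open>w n\<close>.\<close>

lemma w_recursion:
  assumes z: "z \<in> polydisc R2"
  shows "(\<Sum>i\<le>m. \<Sum>\<alpha>\<in>\<A>. \<Sum>\<^sub>\<infinity>n'. cf i \<alpha> n n' z * dw \<alpha> n' z) = f (n - int m0) z"
proof (cases "n \<le> n1")
  case True
  have zR: "z \<in> polydisc R" using z subR1 subR2 by blast
  have "((\<lambda>p. \<Sum>i\<le>m. \<Sum>\<alpha>\<in>\<A>. (\<Sum>k\<le>p. A i \<alpha> k z * of_real (q ^ (i * (p - k))) * multi_partial_z \<alpha> (X (p - k)) z) * th \<mu> (n - int m0 - int p))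
      has_sum (\<Sum>i\<le>m. \<Sum>\<alpha>\<in>\<A>. \<Sum>\<^sub>\<infinity>n'. cf i \<alpha> n n' z * dw \<alpha> n' z)) UNIV"
    by (intro has_sum_finite_sum base_recursion_term[OF True z]) auto
  moreover have "(\<Sum>i\<le>m. \<Sum>\<alpha>\<in>\<A>. (\<Sum>k\<le>p. A i \<alpha> k z * of_real (q ^ (i * (p - k))) * multi_partial_z \<alpha> (X (p - k)) z) * th \<mu> (n - int m0 - int p))
      = F p z * th \<mu> (n - int m0 - int p)" for p
  proof -
    have "(\<Sum>i\<le>m. \<Sum>\<alpha>\<in>\<A>. \<Sum>k\<le>p. A i \<alpha> k z * of_real (q ^ (i * (p - k))) * multi_partial_z \<alpha> (X (p - k)) z)
      = (\<Sum>i\<le>m. \<Sum>k\<le>p. \<Sum>\<alpha>\<in>\<A>. A i \<alpha> k z * of_real (q ^ (i * (p - k))) * multi_partial_z \<alpha> (X (p - k)) z)"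
      by (intro sum.cong refl sum.swap)
    also have "\<dots> = F p z" unfolding formal[OF zR, of p, symmetric] by (rule sum.swap)
    finally show ?thesis by (simp add: sum_distrib_right[symmetric])
  qed
  ultimately have "((\<lambda>p. F p z * th \<mu> (n - int m0 - int p)) has_sum (\<Sum>i\<le>m. \<Sum>\<alpha>\<in>\<A>. \<Sum>\<^sub>\<infinity>n'. cf i \<alpha> n n' z * dw \<alpha> n' z)) UNIV"
    by simp
  then show ?thesis unfolding f_def using infsumI by fastforce
next
  case False
  have "((\<lambda>n'. \<Sum>i\<le>m. \<Sum>\<alpha>\<in>\<A>. cf i \<alpha> n n' z * dw \<alpha> n' z) has_sum (\<Sum>i\<le>m. \<Sum>\<alpha>\<in>\<A>. \<Sum>\<^sub>\<infinity>n'. cf i \<alpha> n n' z * dw \<alpha> n' z)) UNIV"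
    by (intro has_sum_finite_sum has_sum_infsum abs_summable_summable[OF cf_dw_summable[OF z]]) auto
  moreover have "((\<lambda>n'. TS w n n' z) has_sum f (n - int m0) z) UNIV" by (rule w_recursion_above) (use False z in auto)
  ultimately show ?thesis unfolding TS_def dw_def using has_sum_unique by blast
qed

section \<open>The quotient and the equation\<close>

definition G :: "complex \<Rightarrow> (complex,'d) vec \<Rightarrow> complex" where
  "G t z = (\<Sum>\<^sub>\<infinity>n. w n z * t powi n)"

definition W :: "complex \<times> (complex,'d) vec \<Rightarrow> complex" where
  "W = (\<lambda>(t, z). G t z / theta (t / \<mu>))"

text \<open>Majorant of \<open>w n\<close>: Gaussian up to \<open>n1\<close>, hence harmless at
  every nonzero \<open>t\<close>; geometric beyond, which limits \<open>t\<close> to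
  \<open>cmod t < 1 / T\<close>.\<close>

definition Bd :: "real \<Rightarrow> real \<Rightarrow> int \<Rightarrow> real" where
  "Bd C T n = (if n \<le> n1 then 2 * (A0 * vn n) else C * T ^ nat (n - n1))"

lemma Bd_summable:
  assumes C: "C > 0" and T: "T \<ge> 1" and x: "0 < x" "x < 1 / T"
  shows "(\<lambda>n. Bd C T n * x powi n) summable_on UNIV"
proof -
  have "(\<lambda>n. 2 * A0 * (x powi n * vn n)) summable_on {..n1}"
    by (intro summable_on_cmult_right summable_on_subset_banach[OF vn_summable[OF x(1)]]) auto
  then have 1: "(\<lambda>n. Bd C T n * x powi n) summable_on {..n1}"
    by (rule summable_on_cong[THEN iffD1, rotated]) (auto simp: Bd_def)
  have Tx: "T * x < 1" "T * x \<ge> 0" using x T by (auto simp: field_simps)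
  have "summable (\<lambda>k. C * x powi n1 * (T * x) ^ k)" by (intro summable_mult summable_geometric) (use Tx in auto)
  then have "(\<lambda>k. C * x powi n1 * (T * x) ^ k) summable_on UNIV"
    by (subst summable_on_UNIV_nonneg_real_iff) (use C x Tx in auto)
  then have "(\<lambda>k. C * x powi n1 * (T * x) ^ k) summable_on {0<..}" by (rule summable_on_subset_banach) auto
  also have "?this \<longleftrightarrow> (\<lambda>n. Bd C T n * x powi n) summable_on {n1<..}"
    by (rule summable_on_reindex_bij_witness[of _ "\<lambda>n. nat (n - n1)" "\<lambda>k. n1 + int k"])
      (use x in \<open>auto simp: Bd_def power_int_add power_mult_distrib\<close>)
  finally have 2: "(\<lambda>n. Bd C T n * x powi n) summable_on {n1<..}" .
  have "{..n1} \<union> {n1<..} = (UNIV :: int set)" by auto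
  then show ?thesis using summable_on_union[OF 1 2] by simp
qed

lemma w_Bd:
  assumes "\<And>j z. z \<in> polydisc (R2 / 4) \<Longrightarrow> cmod (w (n1 + int j) z) \<le> C * T ^ j" and z: "z \<in> polydisc (R2 / 4)"
  shows "cmod (w n z) \<le> Bd C T n"
proof (cases "n \<le> n1")
  case True
  have "z \<in> polydisc R1" using z polydisc_mono[of "R2/4" R2] R2 subR2 by auto
  then show ?thesis using base_bound[OF True] True by (simp add: Bd_def w_base)
next
  case False
  then show ?thesis using assms(1)[OF z, of "nat (n - n1)"] by (simp add: Bd_def)
qed

lemma w_holo4: "holo_z (w n) (polydisc (R2 / 4))"
  by (rule holo_z_subset[OF w_holo]) (use polydisc_mono[of "R2/4" R2] R2 in auto)

context
  fixes C T :: real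
  assumes CT: "C > 0" "T \<ge> 1" "\<And>j z. z \<in> polydisc (R2 / 4) \<Longrightarrow> cmod (w (n1 + int j) z) \<le> C * T ^ j"
begin

lemma G_term_bound: "z \<in> polydisc (R2 / 4) \<Longrightarrow> cmod (w n z * t powi n) \<le> Bd C T n * cmod t powi n"
  unfolding norm_mult norm_power_int using w_Bd[OF CT(3)] by (intro mult_right_mono) auto

lemma W_holo:
  "holo_tz W ((punctured_disc (1 / T) - {t. \<exists>k::int. t = - \<mu> * of_real (q powi k)}) \<times> polydisc (R2 / 4))"
proof -
  let ?D = "(punctured_disc (1 / T) - {t. \<exists>k::int. t = - \<mu> * of_real (q powi k)}) \<times> (polydisc (R2 / 4) :: (complex,'d) vec set)"
  have "holo_tz (\<lambda>(t, z). \<Sum>\<^sub>\<infinity>n. w n z * t powi n) (punctured_disc (1 / T) \<times> polydisc (R2 / 4))"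
    by (rule holo_tz_laurent[OF w_holo4 w_Bd[OF CT(3)]]) (use Bd_summable[OF CT(1,2)] in auto)
  then have 1: "TZ.hol (\<lambda>(t, z). G t z) ?D"
    unfolding G_def[abs_def] holo_tz_iff_hol by (rule TZ.hol_subset) auto
  have "(\<lambda>t. theta (t / \<mu>)) holomorphic_on (- {0})"
  proof -
    have "(\<lambda>t. t / \<mu>) holomorphic_on (- {0})" by (intro holomorphic_intros) (use mu in auto)
    moreover have "(\<lambda>t. t / \<mu>) ` (- {0}) \<subseteq> - {0}" using mu by auto
    ultimately show ?thesis using holomorphic_on_compose_gen[OF _ theta_holomorphic] unfolding o_def by blast
  qed
  note th = this
  have "open (- {0::complex})" by (simp add: open_Compl)
  from holo_tz_prod[OF th this holo_z_const[of 1 UNIV]]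
  have "TZ.hol (\<lambda>(t, z). theta (t / \<mu>)) ((- {0}) \<times> (UNIV :: (complex,'d) vec set))" by (simp add: holo_tz_iff_hol)
  then have 2: "TZ.hol (\<lambda>(t, z). theta (t / \<mu>)) ?D"
    by (rule TZ.hol_subset) (auto simp: punctured_disc_def)
  have "TZ.hol (\<lambda>p. (case p of (t, z) \<Rightarrow> G t z) / (case p of (t, z) \<Rightarrow> theta (t / \<mu>))) ?D"
  proof (rule TZ.hol_divide[OF 1 2])
    fix p assume p: "p \<in> ?D"
    obtain t z where pt: "p = (t, z)" by (cases p)
    have "t \<noteq> 0" "\<And>k::int. t \<noteq> - \<mu> * of_real (q powi k)" using p pt by (auto simp: punctured_disc_def)
    then have "theta (t / \<mu>) \<noteq> 0" using mu by (intro theta_nonzero) (auto simp: field_simps)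
    then show "(case p of (t, z) \<Rightarrow> theta (t / \<mu>)) \<noteq> 0" by (simp add: pt)
  qed
  moreover have "W = (\<lambda>p. (case p of (t, z) \<Rightarrow> G t z) / (case p of (t, z) \<Rightarrow> theta (t / \<mu>)))"
    by (rule ext) (simp add: W_def split: prod.split)
  ultimately show ?thesis unfolding holo_tz_iff_hol by (simp only:)
qed

lemma dw_G_has_sum:
  assumes t: "0 < cmod t" "cmod t < 1 / T" and z: "z \<in> polydisc (R2 / 4)"
  shows "((\<lambda>n. dw \<alpha> n z * t powi n) has_sum multi_partial_z \<alpha> (G t) z) UNIV"
proof -
  have "((\<lambda>n. multi_partial_z \<alpha> (\<lambda>z. w n z * t powi n) z) has_sum multi_partial_z \<alpha> (G t) z) UNIV"
    unfolding G_def[abs_def]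
    by (rule multi_partial_z_has_sum[OF _ Bd_summable[OF CT(1,2) t] G_term_bound z]) (auto intro!: holo_z_mult holo_z_const w_holo4)
  moreover have "multi_partial_z \<alpha> (\<lambda>z. w n z * t powi n) z = dw \<alpha> n z * t powi n" for n
    using multi_partial_z_scale[OF open_polydisc w_holo4 z, of \<alpha> "t powi n" n] by (simp add: mult.commute dw_def)
  ultimately show ?thesis by simp
qed

lemma W_multi:
  assumes z: "z \<in> polydisc (R2 / 4)" and t: "0 < cmod t" "cmod t < 1 / T"
  shows "multi_partial_z \<alpha> (\<lambda>y. W (t, y)) z = multi_partial_z \<alpha> (G t) z / theta (t / \<mu>)"
proof -
  have "holo_z (G t) (polydisc (R2 / 4))"
    unfolding G_def[abs_def]
    by (rule holo_z_infsum[OF _ Bd_summable[OF CT(1,2) t] G_term_bound]) (auto intro!: holo_z_mult holo_z_const w_holo4)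
  from multi_partial_z_scale[OF open_polydisc this z, of \<alpha> "1 / theta (t / \<mu>)"]
  show ?thesis by (simp add: W_def)
qed

text \<open>After multiplication by \<open>t ^ m0 * theta (t / \<mu>)\<close> both sides are
  bilateral series whose coefficients agree by \<open>w_recursion\<close>. The bound on all
  \<open>q ^ i * t\<close> keeps the dilated points in the domain of \<open>G\<close>.\<close>

lemma W_solves:
  assumes z: "z \<in> polydisc (R2 / 4)" and t: "t \<noteq> 0" "\<And>i. i \<le> m \<Longrightarrow> cmod (of_real (q ^ i) * t) < 1 / T"
    and tk: "cmod t * \<kappa> < 1" and th0: "theta (t / \<mu>) \<noteq> 0"
  shows "(\<Sum>i\<le>m. \<Sum>\<alpha>\<in>\<A>. (\<Sum>\<^sub>\<infinity>k. A i \<alpha> k z * t ^ k) * multi_partial_z \<alpha> (\<lambda>y. W (of_real (q ^ i) * t, y)) z)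
       = (\<Sum>\<^sub>\<infinity>k. F k z * t ^ k)"
proof -
  have z2: "z \<in> polydisc R2" and zR: "z \<in> polydisc R" using z polydisc_mono[of "R2/4" R2] R2 subR1 subR2 by auto
  have pow_summable: "(\<lambda>k. cmod (a k * t ^ k)) summable_on (UNIV :: nat set)" if "\<And>k. cmod (a k) \<le> C0 * \<kappa> ^ k" for a
  proof (rule summable_on_comparison_test)
    have "summable (\<lambda>k. C0 * (cmod t * \<kappa>) ^ k)" by (intro summable_mult summable_geometric) (use tk \<kappa> in auto)
    then show "(\<lambda>k. C0 * (cmod t * \<kappa>) ^ k) summable_on UNIV"
      by (subst summable_on_UNIV_nonneg_real_iff) (use C0 \<kappa> in auto)
    fix k show "cmod (a k * t ^ k) \<le> C0 * (cmod t * \<kappa>) ^ k"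
      using mult_right_mono[OF that[of k], of "cmod t ^ k"] by (simp add: norm_mult norm_power power_mult_distrib mult_ac)
  qed auto
  \<comment> \<open>Power series are extended by zero to negative indices, so that products become
    bilateral convolutions.\<close>
  have ext: "((\<lambda>k. (if k < 0 then 0 else a (nat k)) * t powi k) has_sum (\<Sum>\<^sub>\<infinity>k. a k * t ^ k)) (UNIV :: int set)"
    "(\<lambda>k. cmod ((if k < 0 then 0 else a (nat k)) * t powi k)) summable_on (UNIV :: int set)"
    if "\<And>k. cmod (a k) \<le> C0 * \<kappa> ^ k" for a
  proof -
    have s: "((\<lambda>k. a k * t ^ k) has_sum (\<Sum>\<^sub>\<infinity>k. a k * t ^ k)) UNIV"
      using abs_summable_summable[OF pow_summable[OF that]] by simp
    also have "?this \<longleftrightarrow> ((\<lambda>k. (if k < 0 then 0 else a (nat k)) * t powi k) has_sum (\<Sum>\<^sub>\<infinity>k. a k * t ^ k)) {0..}"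
      by (rule has_sum_reindex_bij_witness[of _ nat int]) (auto simp: power_int_def)
    also have "\<dots> \<longleftrightarrow> ((\<lambda>k. (if k < 0 then 0 else a (nat k)) * t powi k) has_sum (\<Sum>\<^sub>\<infinity>k. a k * t ^ k)) UNIV"
      by (rule has_sum_cong_neutral) auto
    finally show h: "((\<lambda>k. (if k < 0 then 0 else a (nat k)) * t powi k) has_sum (\<Sum>\<^sub>\<infinity>k. a k * t ^ k)) (UNIV :: int set)" .
    then show "(\<lambda>k. cmod ((if k < 0 then 0 else a (nat k)) * t powi k)) summable_on (UNIV :: int set)"
      by (rule has_sum_norm_summable)
  qed
  define As where "As i \<alpha> = (\<Sum>\<^sub>\<infinity>k. A i \<alpha> k z * t ^ k)" for i \<alpha>
  define Fs where "Fs = (\<Sum>\<^sub>\<infinity>k. F k z * t ^ k)"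
  define M where "M i \<alpha> = multi_partial_z \<alpha> (G (of_real (q ^ i) * t)) z" for i \<alpha>
  \<comment> \<open>One term of the equation as a Laurent series: the convolution of the coefficient
    with the dilated \<open>G\<close>, shifted by \<open>m0 - i\<close>.\<close>
  have one: "((\<lambda>n. (\<Sum>\<^sub>\<infinity>n'. cf i \<alpha> n n' z * dw \<alpha> n' z) * t powi n) has_sum
      t powi (int m0 - int i) * (As i \<alpha> * (\<mu> ^ i * of_real (gs (- int i)) * M i \<alpha>))) UNIV"
    if i: "i \<le> m" and a: "\<alpha> \<in> \<A>" for i \<alpha>
  proof -
    let ?a = "\<lambda>k. Ai i \<alpha> k z * t powi k"
    let ?b = "\<lambda>n. kp \<mu> i n * dw \<alpha> n z * t powi n"
    have ha: "(?a has_sum As i \<alpha>) UNIV" "(\<lambda>k. cmod (?a k)) summable_on UNIV"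
      unfolding As_def Ai_def by (rule ext[OF A_bound[OF i a zR]])+
    have qt: "0 < cmod (of_real (q ^ i) * t)" "cmod (of_real (q ^ i) * t) < 1 / T" using t i q0 by auto
    have beq: "?b n = \<mu> ^ i * of_real (gs (- int i)) * (dw \<alpha> n z * (of_real (q ^ i) * t) powi n)" for n
    proof -
      have "q powi (int i * n) = (q ^ i) powi n" by (simp only: power_int_mult power_int_of_nat)
      then show ?thesis by (simp add: kp_def power_int_mult_distrib mult_ac)
    qed
    have hb: "(?b has_sum (\<mu> ^ i * of_real (gs (- int i)) * M i \<alpha>)) UNIV"
      unfolding beq M_def by (intro has_sum_cmult_right dw_G_has_sum qt z)
    then have hb': "(\<lambda>n. cmod (?b n)) summable_on UNIV" by (rule has_sum_norm_summable)
    have "((\<lambda>l. \<Sum>\<^sub>\<infinity>k. ?a (l - k) * ?b k) has_sum (As i \<alpha> * (\<mu> ^ i * of_real (gs (- int i)) * M i \<alpha>))) UNIV"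
      using convolution_int(4)[OF ha(2) hb'] infsumI[OF ha(1)] infsumI[OF hb] by simp
    then have "((\<lambda>n. \<Sum>\<^sub>\<infinity>k. ?a (n + (int i - int m0) - k) * ?b k) has_sum (As i \<alpha> * (\<mu> ^ i * of_real (gs (- int i)) * M i \<alpha>))) UNIV"
      using has_sum_int_shift[of "\<lambda>l. \<Sum>\<^sub>\<infinity>k. ?a (l - k) * ?b k" "int i - int m0"] by simp
    from has_sum_cmult_right[OF this, of "t powi (int m0 - int i)"]
    have "((\<lambda>n. t powi (int m0 - int i) * (\<Sum>\<^sub>\<infinity>k. ?a (n + (int i - int m0) - k) * ?b k)) has_sum
        t powi (int m0 - int i) * (As i \<alpha> * (\<mu> ^ i * of_real (gs (- int i)) * M i \<alpha>))) UNIV" .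
    moreover have "t powi (int m0 - int i) * (\<Sum>\<^sub>\<infinity>k. ?a (n + (int i - int m0) - k) * ?b k) = (\<Sum>\<^sub>\<infinity>n'. cf i \<alpha> n n' z * dw \<alpha> n' z) * t powi n" for n
    proof -
      have "t powi (int m0 - int i) * (?a (n + (int i - int m0) - k) * ?b k) = (cf i \<alpha> n k z * dw \<alpha> k z) * t powi n" for k
      proof -
        have e: "n + (int i - int m0) - k = n - int m0 + int i - k" by simp
        have "t powi (int m0 - int i) * t powi (n - int m0 + int i - k) * t powi k = t powi n"
          using t(1) by (simp add: power_int_add[symmetric])
        then have "(Ai i \<alpha> (n - int m0 + int i - k) z * kp \<mu> i k * dw \<alpha> k z) * t powi n =
          (Ai i \<alpha> (n - int m0 + int i - k) z * kp \<mu> i k * dw \<alpha> k z) * (t powi (int m0 - int i) * t powi (n - int m0 + int i - k) * t powi k)"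
          by (simp only:)
        then show ?thesis unfolding cf_def e by (simp only: mult_ac)
      qed
      then have "(\<Sum>\<^sub>\<infinity>k. t powi (int m0 - int i) * (?a (n + (int i - int m0) - k) * ?b k)) = (\<Sum>\<^sub>\<infinity>k. (cf i \<alpha> n k z * dw \<alpha> k z) * t powi n)"
        by (intro infsum_cong) simp
      then show ?thesis by (simp add: infsum_cmult_right' infsum_cmult_left')
    qed
    ultimately show ?thesis by simp
  qed
  have "((\<lambda>n. \<Sum>i\<le>m. \<Sum>\<alpha>\<in>\<A>. (\<Sum>\<^sub>\<infinity>n'. cf i \<alpha> n n' z * dw \<alpha> n' z) * t powi n) has_sum
      (\<Sum>i\<le>m. \<Sum>\<alpha>\<in>\<A>. t powi (int m0 - int i) * (As i \<alpha> * (\<mu> ^ i * of_real (gs (- int i)) * M i \<alpha>)))) UNIV"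
    by (intro has_sum_finite_sum one) auto
  then have L: "((\<lambda>n. f (n - int m0) z * t powi n) has_sum
      (\<Sum>i\<le>m. \<Sum>\<alpha>\<in>\<A>. t powi (int m0 - int i) * (As i \<alpha> * (\<mu> ^ i * of_real (gs (- int i)) * M i \<alpha>)))) UNIV"
    by (simp add: sum_distrib_right[symmetric] w_recursion[OF z2])
  let ?h = "\<lambda>n. th \<mu> n * t powi n"
  let ?g = "\<lambda>k::int. (if k < 0 then 0 else F (nat k) z) * t powi k"
  have heq: "?h n = of_real (gs n) * (t / \<mu>) powi n" for n
    using mu by (simp add: th_def power_int_divide_distrib power_int_minus field_simps)
  have hh: "(?h has_sum theta (t / \<mu>)) UNIV" "(\<lambda>n. cmod (?h n)) summable_on UNIV"
    unfolding heq using theta_has_sum[of "t / \<mu>"] gs_norm_summable[of "t / \<mu>"] t(1) mu by auto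
  have gg: "(?g has_sum Fs) UNIV" "(\<lambda>k. cmod (?g k)) summable_on UNIV"
    unfolding Fs_def by (rule ext[OF F_bound[OF zR]])+
  \<comment> \<open>The right-hand side times theta; its coefficients are \<open>f\<close> by
    definition.\<close>
  have conv: "((\<lambda>l. \<Sum>\<^sub>\<infinity>k. ?h (l - k) * ?g k) has_sum (theta (t / \<mu>) * Fs)) UNIV"
    using convolution_int(4)[OF hh(2) gg(2)] infsumI[OF hh(1)] infsumI[OF gg(1)] by simp
  have fl: "(\<Sum>\<^sub>\<infinity>k. ?h (l - k) * ?g k) = f l z * t powi l" for l
  proof -
    have "((\<lambda>k. F k z * th \<mu> (l - int k)) has_sum f l z) UNIV"
      unfolding f_def by (intro has_sum_infsum norm_infsum_half(2)[OF f_term[OF zR]])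
    from has_sum_cmult_left[OF this, of "t powi l"]
    have "((\<lambda>k. F k z * th \<mu> (l - int k) * t powi l) has_sum f l z * t powi l) UNIV" .
    also have "?this \<longleftrightarrow> ((\<lambda>k. ?h (l - k) * ?g k) has_sum f l z * t powi l) {0..}"
      by (rule has_sum_reindex_bij_witness[of _ nat int]) (use t(1) in \<open>auto simp: power_int_diff\<close>)
    also have "\<dots> \<longleftrightarrow> ((\<lambda>k. ?h (l - k) * ?g k) has_sum f l z * t powi l) UNIV"
      by (rule has_sum_cong_neutral) auto
    finally show ?thesis by (rule infsumI)
  qed
  have "((\<lambda>l. f l z * t powi l) has_sum (theta (t / \<mu>) * Fs)) UNIV" using conv unfolding fl .
  then have "((\<lambda>n. f (n - int m0) z * t powi (n - int m0)) has_sum (theta (t / \<mu>) * Fs)) UNIV"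
    using has_sum_int_shift[of "\<lambda>l. f l z * t powi l" "- int m0"] by simp
  from has_sum_cmult_left[OF this, of "t ^ m0"]
  have "((\<lambda>n. f (n - int m0) z * t powi (n - int m0) * t ^ m0) has_sum (theta (t / \<mu>) * Fs * t ^ m0)) UNIV" .
  moreover have "f (n - int m0) z * t powi (n - int m0) * t ^ m0 = f (n - int m0) z * t powi n" for n
    using t(1) by (simp add: power_int_diff)
  ultimately have "((\<lambda>n. f (n - int m0) z * t powi n) has_sum (theta (t / \<mu>) * Fs * t ^ m0)) UNIV" by simp
  with L have main: "(\<Sum>i\<le>m. \<Sum>\<alpha>\<in>\<A>. t powi (int m0 - int i) * (As i \<alpha> * (\<mu> ^ i * of_real (gs (- int i)) * M i \<alpha>))) = theta (t / \<mu>) * Fs * t ^ m0"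
    by (rule has_sum_unique)
  \<comment> \<open>\<open>theta_qpow_mult\<close> exchanges theta at the dilated point for theta at
    \<open>t\<close>; the powers of \<open>\<mu>\<close> and \<open>t\<close> then cancel up to
    \<open>t ^ m0\<close>.\<close>
  have summand: "t powi (int m0 - int i) * (As i \<alpha> * (\<mu> ^ i * of_real (gs (- int i)) * M i \<alpha>)) =
      (theta (t / \<mu>) * t ^ m0) * (As i \<alpha> * multi_partial_z \<alpha> (\<lambda>y. W (of_real (q ^ i) * t, y)) z)"
    if i: "i \<le> m" for i \<alpha>
  proof -
    have qt: "0 < cmod (of_real (q ^ i) * t)" "cmod (of_real (q ^ i) * t) < 1 / T" using t i q0 by auto
    have tm: "t / \<mu> \<noteq> 0" using t(1) mu by simp
    have thq: "theta (of_real (q ^ i) * t / \<mu>) * of_real (gs (- int i)) = (t / \<mu>) ^ i * theta (t / \<mu>)"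
      using theta_qpow_mult[OF tm, of i] by simp
    have "(t / \<mu>) ^ i * theta (t / \<mu>) \<noteq> 0" using tm th0 by simp
    then have nz: "theta (of_real (q ^ i) * t / \<mu>) \<noteq> 0" using thq by auto
    have "t powi (int m0 - int i) * (\<mu> ^ i * of_real (gs (- int i))) * theta (of_real (q ^ i) * t / \<mu>) =
        t powi (int m0 - int i) * \<mu> ^ i * ((t / \<mu>) ^ i * theta (t / \<mu>))"
      unfolding thq[symmetric] by (simp only: mult_ac)
    also have "\<dots> = theta (t / \<mu>) * t ^ m0" using t(1) mu by (simp add: power_int_diff power_divide)
    finally have "t powi (int m0 - int i) * (\<mu> ^ i * of_real (gs (- int i))) = theta (t / \<mu>) * t ^ m0 / theta (of_real (q ^ i) * t / \<mu>)"
      using nz by (simp add: eq_divide_eq)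
    moreover have "multi_partial_z \<alpha> (\<lambda>y. W (of_real (q ^ i) * t, y)) z = M i \<alpha> / theta (of_real (q ^ i) * t / \<mu>)"
      unfolding M_def by (rule W_multi[OF z qt])
    moreover have "t powi (int m0 - int i) * (As i \<alpha> * (\<mu> ^ i * of_real (gs (- int i)) * M i \<alpha>)) =
        (t powi (int m0 - int i) * (\<mu> ^ i * of_real (gs (- int i)))) * (As i \<alpha> * M i \<alpha>)" by (simp only: mult_ac)
    ultimately show ?thesis by simp
  qed
  have "(theta (t / \<mu>) * t ^ m0) * (\<Sum>i\<le>m. \<Sum>\<alpha>\<in>\<A>. As i \<alpha> * multi_partial_z \<alpha> (\<lambda>y. W (of_real (q ^ i) * t, y)) z)
      = (\<Sum>i\<le>m. \<Sum>\<alpha>\<in>\<A>. t powi (int m0 - int i) * (As i \<alpha> * (\<mu> ^ i * of_real (gs (- int i)) * M i \<alpha>)))"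
    unfolding sum_distrib_left by (intro sum.cong refl summand[symmetric]) auto
  also have "\<dots> = (theta (t / \<mu>) * t ^ m0) * Fs" unfolding main by simp
  finally show ?thesis using th0 t(1) unfolding As_def Fs_def by simp
qed

text \<open>Let \<open>rr n\<close> be the coefficients of theta times the remainder. Up to
  \<open>n1\<close> they are tails of \<open>base\<close>; beyond it, \<open>w n\<close> and the
  partial sum are bounded separately. All bounds are multiples of \<open>\<Phi> n\<close>, except
  the part \<open>Sw n\<close> due to the growth of \<open>w n\<close>, which is traced back to the
  single term \<open>\<Phi> n1\<close>.\<close>

lemma W_asymptotic:
  "\<exists>M>0. \<exists>H>0. \<forall>\<epsilon>>0. \<forall>N. \<forall>t z. 0 < cmod t \<longrightarrow> cmod t < 1 / (2 * T) \<longrightarrow> z \<in> polydisc (R2 / 4) \<longrightarrow>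
     (\<forall>k::int. cmod (t + \<mu> * of_real (q powi k)) \<ge> \<epsilon> * cmod t) \<longrightarrow>
     cmod (W (t, z) - (\<Sum>l<N. X l z * t ^ l)) \<le> M * H ^ N / \<epsilon> * qfact q N * cmod t ^ N"
proof -
  obtain c where c: "c > 0" and thl: "\<And>\<epsilon> t. t \<noteq> 0 \<Longrightarrow> \<epsilon> > 0 \<Longrightarrow> (\<And>k::int. cmod (t + of_real (q powi k)) \<ge> \<epsilon> * cmod t) \<Longrightarrow>
     cmod (theta t) \<ge> c * \<epsilon> * Theta (cmod t)"
    using theta_lower by blast
  have am: "cmod \<mu> > 0" using mu by simp
  \<comment> \<open>\<open>H1 * q powi n\<close> is the ratio of the series \<open>base n\<close>.
    \<open>max 1 H1\<close> and \<open>q powi (- n1)\<close> allow an exponent \<open>l < N\<close>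
    to be raised to \<open>N\<close> when \<open>n > n1\<close>; the factor 2 in \<open>H3\<close>
    absorbs the number \<open>N\<close> of terms.\<close>
  define H1 where "H1 = B * cmod \<mu> / q"
  define H2 where "H2 = max 1 H1 * q powi (- n1)"
  define H3 where "H3 = 2 * H2"
  have H1: "H1 > 0" using B am q0 by (simp add: H1_def)
  have qn1: "q powi (- n1) \<ge> 1" using n1 q1 power_int_increasing[of 0 "- n1" q] by simp
  have H2: "H2 \<ge> H1" "H2 \<ge> 1" "H2 \<ge> q powi (- n1)"
  proof -
    have "max 1 H1 * 1 \<le> H2" unfolding H2_def using qn1 by (intro mult_left_mono) auto
    then show "H2 \<ge> H1" "H2 \<ge> 1" by auto
    have "1 * q powi (- n1) \<le> H2" unfolding H2_def using q0 by (intro mult_right_mono) auto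
    then show "H2 \<ge> q powi (- n1)" by simp
  qed
  define M where "M = 2 * A0 + C / vn n1"
  have M: "M > 0" using A0 CT(1) vn_pos[of n1] by (simp add: M_def add_pos_pos)
  have Xth: "cmod (X l z * th \<mu> (n - int l)) \<le> A0 * vn n * (H1 * q powi n) ^ l" if "z \<in> polydisc R1" for l z n
  proof -
    have g: "gs (n - int l) = gs n * (gs (int l) * q powi (- int l)) * q powi (n * int l)"
      using gs_add[of n "- int l"] gs_neg[of "int l"] by simp
    have m: "cmod \<mu> powi (- (n - int l)) = cmod \<mu> powi (- n) * cmod \<mu> ^ l"
      using mu power_int_add[of "cmod \<mu>" "- n" "int l"] by (simp add: algebra_simps)
    have v: "vn (n - int l) = vn n * gs (int l) * (cmod \<mu> / q * q powi n) ^ l"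
      unfolding vn_def g m by (simp add: power_mult_distrib power_int_mult power_int_minus divide_inverse power_inverse mult_ac)
    have "cmod (X l z * th \<mu> (n - int l)) \<le> (A0 * B ^ l / gs (int l)) * vn (n - int l)"
      unfolding norm_mult norm_th' using XG[OF that, of l] vn_pos[of "n - int l"] by (intro mult_right_mono) auto
    also have "\<dots> = A0 * vn n * (H1 * q powi n) ^ l"
      using gs_pos[of "int l"] by (simp add: v H1_def power_mult_distrib power_divide)
    finally show ?thesis .
  qed
  have main: "cmod (W (t, z) - (\<Sum>l<N. X l z * t ^ l)) \<le> (M / c) * (H3 * q\<^sup>2 / (cmod \<mu> * q)) ^ N / \<epsilon> * qfact q N * cmod t ^ N"
    if e: "\<epsilon> > 0" and t: "0 < cmod t" "cmod t < 1 / (2 * T)" and z: "z \<in> polydisc (R2 / 4)"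
      and far: "\<And>k::int. cmod (t + \<mu> * of_real (q powi k)) \<ge> \<epsilon> * cmod t" for \<epsilon> N t z
  proof -
    have z1: "z \<in> polydisc R1" using z polydisc_mono[of "R2/4" R2] R2 subR2 by auto
    have t0: "t \<noteq> 0" using t by auto
    have tT: "cmod t < 1 / T" "T * cmod t \<le> 1 / 2" using t CT(2) by (auto simp: field_simps intro: less_le_trans)
    define y where "y = cmod t / cmod \<mu>"
    have y: "y > 0" using t am by (simp add: y_def)
    have tmu: "cmod (t / \<mu>) = y" by (simp add: y_def norm_divide)
    \<comment> \<open>Up to a factor independent of \<open>n\<close>, the term of index
      \<open>n - N\<close> of the positive theta series at \<open>y\<close>; this explains the
      closed form \<open>\<Phi>s\<close> of the sum.\<close>
    define \<Phi> where "\<Phi> n = vn n * q powi (n * int N) * cmod t powi n" for n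
    have \<Phi>0: "\<Phi> n > 0" for n using vn_pos q0 t by (simp add: \<Phi>_def)
    define \<Phi>s where "\<Phi>s = y ^ N * Theta y / gs (- int N)"
    have \<Phi>sum: "(\<Phi> has_sum \<Phi>s) UNIV"
    proof -
      have "((\<lambda>n. gs (n - int N) * y powi (n - int N)) has_sum Theta y) UNIV"
        using Theta_has_sum[OF y] has_sum_int_shift[of "\<lambda>n. gs n * y powi n" "- int N"] by simp
      from has_sum_cmult_left[OF this, of "y ^ N / gs (- int N)"]
      have "((\<lambda>n. gs (n - int N) * y powi (n - int N) * (y ^ N / gs (- int N))) has_sum \<Phi>s) UNIV"
        by (simp add: \<Phi>s_def mult.commute)
      moreover have "gs (n - int N) * y powi (n - int N) * (y ^ N / gs (- int N)) = \<Phi> n" for n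
      proof -
        have "gs (n - int N) = gs n * gs (- int N) * q powi (n * int N)" using gs_add[of n "- int N"] by simp
        moreover have "y powi (n - int N) * y ^ N = y powi n" using y by (simp add: power_int_diff)
        moreover have "vn n * cmod t powi n = gs n * y powi n"
          using am by (simp add: vn_def y_def power_int_divide_distrib power_int_minus field_simps)
        ultimately show ?thesis using gs_pos[of "- int N"] unfolding \<Phi>_def
          by (simp add: field_simps)
      qed
      ultimately show ?thesis by simp
    qed
    define rr where "rr n = w n z - (\<Sum>l<N. X l z * th \<mu> (n - int l))" for n
    \<comment> \<open>The contribution of the geometric growth of \<open>w n\<close>; it is zero up
      to \<open>n1\<close>, where the tail estimate suffices.\<close>
    define Sw where "Sw n = (if n \<le> n1 then 0 else C * T ^ nat (n - n1) * cmod t powi n)" for n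
    have rb: "cmod (rr n * t powi n) \<le> 2 * A0 * H3 ^ N * \<Phi> n + Sw n" for n
    proof (cases "n \<le> n1")
      case True
      have bn: "H1 * q powi n \<le> 1 / 2" "H1 * q powi n \<ge> 0"
      proof -
        have "H1 * q powi n \<le> H1 * q powi n1" using True H1 q1 by (intro mult_left_mono power_int_increasing) auto
        also have "\<dots> = B * cmod \<mu> * q powi (n1 - 1)" by (simp add: H1_def power_int_diff)
        finally show "H1 * q powi n \<le> 1 / 2" using n1 by linarith
      qed (use H1 q0 in auto)
      have hs: "((\<lambda>l. X l z * th \<mu> (n - int l)) has_sum w n z) UNIV"
        unfolding w_base[OF True] base_def by (intro has_sum_infsum norm_infsum_half(2)[OF base_term[OF True z1]])
      have "((\<lambda>l. X l z * th \<mu> (n - int l)) has_sum (w n z - (\<Sum>l<N. X l z * th \<mu> (n - int l)))) (UNIV - {..<N})"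
        by (rule has_sum_Diff[OF hs has_sum_finite]) auto
      also have "UNIV - {..<N} = {N..}" by auto
      also have "((\<lambda>l. X l z * th \<mu> (n - int l)) has_sum (w n z - (\<Sum>l<N. X l z * th \<mu> (n - int l)))) {N..} \<longleftrightarrow>
          ((\<lambda>j. X (N + j) z * th \<mu> (n - int (N + j))) has_sum rr n) UNIV"
        unfolding rr_def by (rule has_sum_reindex_bij_witness[of _ "\<lambda>j. N + j" "\<lambda>l. l - N"]) auto
      finally have hr: "((\<lambda>j. X (N + j) z * th \<mu> (n - int (N + j))) has_sum rr n) UNIV" .
      have "cmod (X (N + j) z * th \<mu> (n - int (N + j))) \<le> A0 * vn n * (H1 * q powi n) ^ N * (1/2) ^ j" for j
      proof -
        have "cmod (X (N + j) z * th \<mu> (n - int (N + j))) \<le> A0 * vn n * (H1 * q powi n) ^ (N + j)" by (rule Xth[OF z1])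
        also have "\<dots> = A0 * vn n * (H1 * q powi n) ^ N * (H1 * q powi n) ^ j" by (simp add: power_add)
        also have "\<dots> \<le> A0 * vn n * (H1 * q powi n) ^ N * (1/2) ^ j"
          using bn A0 vn_pos[of n] by (intro mult_left_mono power_mono) auto
        finally show ?thesis .
      qed
      from norm_infsum_half(1)[OF this] have "cmod (rr n) \<le> 2 * (A0 * vn n * (H1 * q powi n) ^ N)"
        using infsumI[OF hr] by simp
      also have "\<dots> \<le> 2 * (A0 * vn n * (H3 ^ N * q powi (n * int N)))"
      proof -
        have "H1 \<le> H3" using H2 unfolding H3_def by linarith
        then have "H1 ^ N \<le> H3 ^ N" using H1 by (intro power_mono) auto
        then have "H1 ^ N * q powi (n * int N) \<le> H3 ^ N * q powi (n * int N)" using q0 by (intro mult_right_mono) auto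
        then show ?thesis using A0 vn_pos[of n] by (simp add: power_mult_distrib power_int_mult)
      qed
      finally have "cmod (rr n) * cmod t powi n \<le> 2 * (A0 * vn n * (H3 ^ N * q powi (n * int N))) * cmod t powi n"
        using t by (intro mult_right_mono) auto
      then show ?thesis using True by (simp add: norm_mult norm_power_int \<Phi>_def Sw_def mult_ac)
    next
      case False
      have Xb: "cmod (X l z * th \<mu> (n - int l)) \<le> A0 * vn n * (H2 ^ N * q powi (n * int N))" if "l < N" for l
      proof -
        have "q powi (n * int l) \<le> q powi (n * int N + (- n1) * int N)"
        proof (rule power_int_increasing)
          show "n * int l \<le> n * int N + - n1 * int N"
          proof -
            have "n * int l - n1 * int l \<le> n * int N - n1 * int N"
              using False that mult_left_mono[of "int l" "int N" "n - n1"] by (simp add: algebra_simps)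
            moreover have "n1 * int l \<le> 0" using n1 by (simp add: mult_nonpos_nonneg)
            ultimately show ?thesis by (simp add: algebra_simps)
          qed
        qed (use q1 in auto)
        also have "\<dots> = q powi (n * int N) * (q powi (- n1)) ^ N"
        proof -
          have "q powi (- n1 * int N) = (q powi (- n1)) ^ N" by (simp only: power_int_mult power_int_of_nat)
          moreover have "q powi (n * int N + - n1 * int N) = q powi (n * int N) * q powi (- n1 * int N)"
            by (rule power_int_add) simp
          ultimately show ?thesis by (simp only:)
        qed
        finally have 1: "q powi (n * int l) \<le> q powi (n * int N) * (q powi (- n1)) ^ N" .
        have "H1 ^ l \<le> max 1 H1 ^ l" using H1 by (intro power_mono) auto
        also have "\<dots> \<le> max 1 H1 ^ N" using that by (intro power_increasing) auto
        finally have 2: "H1 ^ l \<le> max 1 H1 ^ N" .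
        have "(H1 * q powi n) ^ l = H1 ^ l * q powi (n * int l)" by (simp add: power_mult_distrib power_int_mult)
        also have "\<dots> \<le> max 1 H1 ^ N * (q powi (n * int N) * (q powi (- n1)) ^ N)"
          using 1 2 H1 q0 by (intro mult_mono) auto
        also have "\<dots> = H2 ^ N * q powi (n * int N)" unfolding H2_def by (simp only: power_mult_distrib mult_ac)
        finally have "A0 * vn n * (H1 * q powi n) ^ l \<le> A0 * vn n * (H2 ^ N * q powi (n * int N))"
          using A0 vn_pos[of n] by (intro mult_left_mono) auto
        then show ?thesis using Xth[OF z1, of l n] by linarith
      qed
      have "cmod (\<Sum>l<N. X l z * th \<mu> (n - int l)) \<le> (\<Sum>l<N. A0 * vn n * (H2 ^ N * q powi (n * int N)))"
        by (rule sum_norm_le) (use Xb in auto)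
      also have "\<dots> = real N * (A0 * vn n * (H2 ^ N * q powi (n * int N)))" by simp
      also have "\<dots> \<le> 2 ^ N * (A0 * vn n * (H2 ^ N * q powi (n * int N)))"
      proof (intro mult_right_mono)
        show "real N \<le> 2 ^ N" using less_exp[of N] by (metis less_imp_le of_nat_le_iff of_nat_numeral of_nat_power)
      qed (use A0 vn_pos[of n] H2 q0 in auto)
      finally have s: "cmod (\<Sum>l<N. X l z * th \<mu> (n - int l)) \<le> A0 * H3 ^ N * (vn n * q powi (n * int N))"
        by (simp add: H3_def power_mult_distrib mult_ac)
      have wb: "cmod (w n z) \<le> C * T ^ nat (n - n1)" using CT(3)[OF z, of "nat (n - n1)"] False by simp
      have "cmod (rr n) \<le> C * T ^ nat (n - n1) + A0 * H3 ^ N * (vn n * q powi (n * int N))"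
        unfolding rr_def using norm_triangle_ineq4[of "w n z" "\<Sum>l<N. X l z * th \<mu> (n - int l)"] s wb by linarith
      then have "cmod (rr n) * cmod t powi n \<le> (C * T ^ nat (n - n1) + A0 * H3 ^ N * (vn n * q powi (n * int N))) * cmod t powi n"
        using t by (intro mult_right_mono) auto
      also have "\<dots> = A0 * H3 ^ N * \<Phi> n + Sw n" using False by (simp add: \<Phi>_def Sw_def algebra_simps)
      also have "\<dots> \<le> 2 * A0 * H3 ^ N * \<Phi> n + Sw n"
        using A0 H2 \<Phi>0[of n] by (simp add: H3_def)
      finally show ?thesis by (simp add: norm_mult norm_power_int)
    qed
    have Sw_sum: "(Sw has_sum (C * cmod t powi n1 * (T * cmod t / (1 - T * cmod t)))) UNIV"
    proof -
      have Tt: "T * cmod t \<ge> 0" "T * cmod t < 1" using tT CT(2) by auto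
      have "((\<lambda>k. (T * cmod t) ^ k) has_sum (T * cmod t) / (1 - T * cmod t)) {1..}"
        using has_sum_geometric_from_1[of "T * cmod t"] Tt by simp
      from has_sum_cmult_right[OF this, of "C * cmod t powi n1"]
      have "((\<lambda>k. C * cmod t powi n1 * (T * cmod t) ^ k) has_sum (C * cmod t powi n1 * (T * cmod t / (1 - T * cmod t)))) {1..}" .
      also have "?this \<longleftrightarrow> (Sw has_sum (C * cmod t powi n1 * (T * cmod t / (1 - T * cmod t)))) {n1<..}"
        by (rule has_sum_reindex_bij_witness[of _ "\<lambda>n. nat (n - n1)" "\<lambda>k. n1 + int k"])
          (use t0 in \<open>auto simp: Sw_def power_int_add power_mult_distrib\<close>)
      also have "\<dots> \<longleftrightarrow> (Sw has_sum (C * cmod t powi n1 * (T * cmod t / (1 - T * cmod t)))) UNIV"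
        by (rule has_sum_cong_neutral) (auto simp: Sw_def)
      finally show ?thesis .
    qed
    \<comment> \<open>Here \<open>cmod t < 1 / (2 * T)\<close> is used, rather than only
      \<open>cmod t < 1 / T\<close>.\<close>
    have "T * cmod t / (1 - T * cmod t) \<le> 1"
    proof -
      have "1 - T * cmod t > 0" using tT by simp
      then show ?thesis using tT by (simp add: divide_le_eq)
    qed
    then have Sw_le: "C * cmod t powi n1 * (T * cmod t / (1 - T * cmod t)) \<le> C * cmod t powi n1 * 1"
      using CT(1) by (intro mult_left_mono) auto
    \<comment> \<open>\<open>\<Phi> n1\<close> is one term of a positive series, hence at most
      \<open>\<Phi>s\<close>; solving for \<open>cmod t powi n1\<close> bounds the sum of
      \<open>Sw\<close> by the same quantity.\<close>
    have tn1: "cmod t powi n1 \<le> H3 ^ N / vn n1 * \<Phi>s"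
    proof -
      have "\<Phi> n1 \<le> \<Phi>s" using finite_sum_le_has_sum[OF \<Phi>sum, of "{n1}"] \<Phi>0 less_imp_le by auto
      then have "vn n1 * q powi (n1 * int N) * cmod t powi n1 \<le> \<Phi>s" by (simp add: \<Phi>_def)
      then have "(q powi (- n1)) ^ N / vn n1 * (vn n1 * q powi (n1 * int N) * cmod t powi n1) \<le> (q powi (- n1)) ^ N / vn n1 * \<Phi>s"
        using q0 vn_pos[of n1] by (intro mult_left_mono) auto
      also have "(q powi (- n1)) ^ N / vn n1 * (vn n1 * q powi (n1 * int N) * cmod t powi n1) = cmod t powi n1"
        using vn_pos[of n1] by (simp add: power_int_mult power_int_minus field_simps)
      finally have "cmod t powi n1 \<le> (q powi (- n1)) ^ N / vn n1 * \<Phi>s" .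
      also have "\<dots> \<le> H3 ^ N / vn n1 * \<Phi>s"
      proof (intro mult_right_mono divide_right_mono power_mono)
        show "q powi - n1 \<le> H3" using H2 unfolding H3_def by linarith
        show "\<Phi>s \<ge> 0" unfolding \<Phi>s_def using y Theta_pos[OF y] gs_pos[of "- int N"] by simp
      qed (use q0 vn_pos[of n1] in auto)
      finally show ?thesis .
    qed
    have th_nz: "theta (t / \<mu>) \<noteq> 0" and th_low: "cmod (theta (t / \<mu>)) \<ge> c * \<epsilon> * Theta y"
    proof -
      have "cmod (theta (t / \<mu>)) \<ge> c * \<epsilon> * Theta (cmod (t / \<mu>))"
      proof (rule thl[OF _ e])
        show "t / \<mu> \<noteq> 0" using t0 mu by simp
        fix k :: int
        have "t / \<mu> + of_real (q powi k) = (t + \<mu> * of_real (q powi k)) / \<mu>" using mu by (simp add: field_simps)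
        then show "\<epsilon> * cmod (t / \<mu>) \<le> cmod (t / \<mu> + of_real (q powi k))"
          using far[of k] am by (simp add: norm_divide divide_right_mono)
      qed
      then show *: "cmod (theta (t / \<mu>)) \<ge> c * \<epsilon> * Theta y" unfolding tmu .
      have "c * \<epsilon> * Theta y > 0" using c e Theta_pos[OF y] by simp
      then show "theta (t / \<mu>) \<noteq> 0" using * by auto
    qed
    have hsum: "((\<lambda>n. rr n * t powi n) has_sum (theta (t / \<mu>) * (W (t, z) - (\<Sum>l<N. X l z * t ^ l)))) UNIV"
    proof -
      have Gs: "((\<lambda>n. w n z * t powi n) has_sum G t z) UNIV"
        using dw_G_has_sum[OF t(1) tT(1) z, of zidx] by (simp add: dw_def)
      have ths: "((\<lambda>n. th \<mu> (n - int l) * t powi (n - int l)) has_sum theta (t / \<mu>)) UNIV" for l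
      proof -
        have "((\<lambda>n. of_real (gs n) * (t / \<mu>) powi n) has_sum theta (t / \<mu>)) UNIV"
          using t0 mu by (intro theta_has_sum) auto
        moreover have "th \<mu> n * t powi n = of_real (gs n) * (t / \<mu>) powi n" for n
          using mu by (simp add: th_def power_int_divide_distrib power_int_minus field_simps)
        ultimately have "((\<lambda>n. th \<mu> n * t powi n) has_sum theta (t / \<mu>)) UNIV" by simp
        then show ?thesis using has_sum_int_shift[of "\<lambda>n. th \<mu> n * t powi n" "- int l"] by simp
      qed
      have "((\<lambda>n. \<Sum>l<N. X l z * t ^ l * (th \<mu> (n - int l) * t powi (n - int l))) has_sum (\<Sum>l<N. X l z * t ^ l * theta (t / \<mu>))) UNIV"
        by (intro has_sum_finite_sum has_sum_cmult_right ths)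
      from has_sum_add[OF Gs has_sum_uminusI[OF this]]
      have "((\<lambda>n. w n z * t powi n - (\<Sum>l<N. X l z * t ^ l * (th \<mu> (n - int l) * t powi (n - int l)))) has_sum
          (G t z - (\<Sum>l<N. X l z * t ^ l * theta (t / \<mu>)))) UNIV" by simp
      moreover have "w n z * t powi n - (\<Sum>l<N. X l z * t ^ l * (th \<mu> (n - int l) * t powi (n - int l))) = rr n * t powi n" for n
      proof -
        have "(\<Sum>l<N. X l z * t ^ l * (th \<mu> (n - int l) * t powi (n - int l))) = (\<Sum>l<N. X l z * th \<mu> (n - int l)) * t powi n"
          unfolding sum_distrib_right using t0 by (intro sum.cong refl) (simp add: power_int_diff)
        then show ?thesis by (simp add: rr_def left_diff_distrib)
      qed
      moreover have "G t z - (\<Sum>l<N. X l z * t ^ l * theta (t / \<mu>)) = theta (t / \<mu>) * (W (t, z) - (\<Sum>l<N. X l z * t ^ l))"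
        using th_nz by (simp add: W_def right_diff_distrib sum_distrib_left mult.commute)
      ultimately show ?thesis by simp
    qed
    have "cmod (theta (t / \<mu>) * (W (t, z) - (\<Sum>l<N. X l z * t ^ l))) \<le>
        2 * A0 * H3 ^ N * \<Phi>s + C * cmod t powi n1 * (T * cmod t / (1 - T * cmod t))"
      by (rule norm_infsum_le[OF hsum has_sum_add[OF has_sum_cmult_right[OF \<Phi>sum] Sw_sum]]) (use rb in auto)
    also have "\<dots> \<le> 2 * A0 * H3 ^ N * \<Phi>s + C * (H3 ^ N / vn n1 * \<Phi>s)"
      using Sw_le tn1 CT(1) mult_left_mono[OF tn1, of C] by simp
    also have "\<dots> = M * H3 ^ N * \<Phi>s" by (simp add: M_def algebra_simps)
    finally have fin1: "cmod (theta (t / \<mu>)) * cmod (W (t, z) - (\<Sum>l<N. X l z * t ^ l)) \<le> M * H3 ^ N * \<Phi>s"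
      by (simp add: norm_mult)
    have "(c * \<epsilon> * Theta y) * cmod (W (t, z) - (\<Sum>l<N. X l z * t ^ l)) \<le> cmod (theta (t / \<mu>)) * cmod (W (t, z) - (\<Sum>l<N. X l z * t ^ l))"
      by (intro mult_right_mono th_low) auto
    also have "\<dots> \<le> Theta y * (M * H3 ^ N * (y ^ N / gs (- int N)))" using fin1 by (simp add: \<Phi>s_def mult_ac)
    finally have "Theta y * (c * \<epsilon> * cmod (W (t, z) - (\<Sum>l<N. X l z * t ^ l))) \<le> Theta y * (M * H3 ^ N * (y ^ N / gs (- int N)))"
      by (simp add: mult_ac)
    then have "c * \<epsilon> * cmod (W (t, z) - (\<Sum>l<N. X l z * t ^ l)) \<le> M * H3 ^ N * (y ^ N / gs (- int N))"
      by (simp only: mult_le_cancel_left_pos[OF Theta_pos[OF y]])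
    also have "\<dots> \<le> M * H3 ^ N * (y ^ N * (q ^ (2 * N) * qfact q N / q ^ N))"
    proof -
      have "1 / gs (- int N) \<le> q ^ (2 * N) * qfact q N / q ^ N"
        using qfact_ge[of N] q0 by (simp add: pos_le_divide_eq)
      then have "y ^ N * (1 / gs (- int N)) \<le> y ^ N * (q ^ (2 * N) * qfact q N / q ^ N)"
        using y by (intro mult_left_mono) auto
      then show ?thesis using M H2 by (intro mult_left_mono) (auto simp: H3_def)
    qed
    also have "\<dots> = M * (H3 * q\<^sup>2 / (cmod \<mu> * q)) ^ N * qfact q N * cmod t ^ N"
      by (simp add: y_def power_mult power_divide power_mult_distrib)
    finally have "cmod (W (t, z) - (\<Sum>l<N. X l z * t ^ l)) \<le> (M * (H3 * q\<^sup>2 / (cmod \<mu> * q)) ^ N * qfact q N * cmod t ^ N) / (c * \<epsilon>)"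
      using c e by (simp add: pos_le_divide_eq mult.commute)
    then show ?thesis by (simp add: mult_ac)
  qed
  have "M / c > 0" "H3 * q\<^sup>2 / (cmod \<mu> * q) > 0" using M c H2 q0 am by (auto simp: H3_def)
  then show ?thesis using main by blast
qed

end

end

context formal_q_equation
begin

text \<open>The constants are chosen in order of dependence: the Gevrey bound gives
  \<open>B\<close>, this the threshold \<open>n1\<close>, the threshold the polydisc
  \<open>R2\<close> on which no \<open>P n\<close> is small, the recursion then \<open>C\<close> and
  \<open>T\<close>, and these the radius \<open>r\<close>.\<close>

theorem theta_quotient_solution:
  fixes \<rho>0 :: real
  assumes "\<rho>0 > 0"
  shows "\<exists>r R' W. 0 < r \<and> r \<le> \<rho>0 \<and> 0 < R' \<and> R' \<le> R \<and>
    holo_tz W ((punctured_disc r - {t. \<exists>k::int. t = - \<mu> * of_real (q powi k)}) \<times> polydisc R') \<and>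
    (\<forall>z t. z \<in> polydisc R' \<longrightarrow> (\<forall>i\<le>m. of_real (q ^ i) * t \<in> punctured_disc r - {t. \<exists>k::int. t = - \<mu> * of_real (q powi k)}) \<longrightarrow>
      (\<Sum>i\<le>m. \<Sum>\<alpha>\<in>\<A>. (\<Sum>\<^sub>\<infinity>k. A i \<alpha> k z * t ^ k) * multi_partial_z \<alpha> (\<lambda>y. W (of_real (q ^ i) * t, y)) z)
       = (\<Sum>\<^sub>\<infinity>k. F k z * t ^ k)) \<and>
    (\<exists>M>0. \<exists>H>0. \<forall>\<epsilon>>0. \<forall>N. \<forall>t z. t \<in> punctured_disc r \<longrightarrow> z \<in> polydisc R' \<longrightarrow>
     (\<forall>k::int. cmod (t + \<mu> * of_real (q powi k)) \<ge> \<epsilon> * cmod t) \<longrightarrow>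
     cmod (W (t, z) - (\<Sum>l<N. X l z * t ^ l)) \<le> M * H ^ N / \<epsilon> * qfact q N * cmod t ^ N)"
proof -
  obtain R1 A0 B where G: "0 < R1" "R1 < R" "A0 > 0" "B \<ge> 1"
    "\<And>n z. z \<in> polydisc R1 \<Longrightarrow> cmod (X n z) \<le> A0 * B ^ n / gs (int n)" using Gevrey_estimate by blast
  obtain n1 where n1: "n1 \<le> 0" "B * cmod \<mu> * q powi (n1 - 1) \<le> 1 / 2" using exists_threshold by blast
  obtain R2 d where R2: "R2 > 0" "R2 < R1" "d > 0"
    "\<And>n z. n \<ge> n1 \<Longrightarrow> z \<in> polydisc R2 \<Longrightarrow> cmod (P n z) \<ge> d * q powi (int m * n)"
    using P_lower[OF n1(1) G(1)] G(2) by force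
  interpret theta_quotient q m m0 \<mu> \<A> A F X R C0 \<kappa> R1 A0 B R2 d n1
    by unfold_locales (use G n1 R2 in auto)
  obtain C T where CT: "C > 0" "T \<ge> 1" "\<And>j z. z \<in> polydisc (R2 / 4) \<Longrightarrow> cmod (w (n1 + int j) z) \<le> C * T ^ j"
    using w_bound by blast
  \<comment> \<open>\<open>\<rho>0\<close> is the prescribed limit, \<open>1 / (2 * T)\<close> is
    required by the asymptotic bound, and \<open>1 / (2 * \<kappa>)\<close> keeps \<open>t\<close>
    inside the disc of convergence of the coefficients of the equation.\<close>
  define r where "r = min \<rho>0 (min (1 / (2 * T)) (1 / (2 * \<kappa>)))"
  have r: "0 < r" "r \<le> \<rho>0" "r \<le> 1 / (2 * T)" "r \<le> 1 / (2 * \<kappa>)" using assms CT(2) \<kappa> by (auto simp: r_def)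
  have rT: "r < 1 / T" using r(3) CT(2) by (auto intro: le_less_trans simp: field_simps)
  let ?Z = "{t. \<exists>k::int. t = - \<mu> * of_real (q powi k)}"
  have pd: "punctured_disc r \<subseteq> punctured_disc (1 / T)" using rT by (auto simp: punctured_disc_def)
  have "holo_tz W ((punctured_disc (1 / T) - ?Z) \<times> polydisc (R2 / 4))" by (rule W_holo[OF CT])
  then have 1: "holo_tz W ((punctured_disc r - ?Z) \<times> polydisc (R2 / 4))"
    unfolding holo_tz_iff_hol by (rule TZ.hol_subset) (use pd in auto)
  have 2: "(\<Sum>i\<le>m. \<Sum>\<alpha>\<in>\<A>. (\<Sum>\<^sub>\<infinity>k. A i \<alpha> k z * t ^ k) * multi_partial_z \<alpha> (\<lambda>y. W (of_real (q ^ i) * t, y)) z)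
       = (\<Sum>\<^sub>\<infinity>k. F k z * t ^ k)"
    if z: "z \<in> polydisc (R2 / 4)" and t: "\<forall>i\<le>m. of_real (q ^ i) * t \<in> punctured_disc r - ?Z" for z t
  proof (rule W_solves[OF CT z])
    have t1: "t \<in> punctured_disc r - ?Z" using t[rule_format, of 0] by simp
    then have t0: "t \<noteq> 0" "cmod t < r" by (auto simp: punctured_disc_def)
    show "t \<noteq> 0" by (rule t0)
    show "cmod (of_real (q ^ i) * t) < 1 / T" if "i \<le> m" for i
      using t[rule_format, OF that] rT by (auto simp: punctured_disc_def)
    have "cmod t * \<kappa> < 1 / (2 * \<kappa>) * \<kappa>" using t0 r(4) \<kappa> by (intro mult_strict_right_mono) auto
    then show "cmod t * \<kappa> < 1" using \<kappa> by simp
    show "theta (t / \<mu>) \<noteq> 0"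
    proof (rule theta_nonzero)
      show "t / \<mu> \<noteq> 0" using t0 mu by simp
      show "t / \<mu> \<noteq> - of_real (q powi k)" for k using t1 mu by (auto simp: field_simps)
    qed
  qed
  have "\<exists>M>0. \<exists>H>0. \<forall>\<epsilon>>0. \<forall>N. \<forall>t z. 0 < cmod t \<longrightarrow> cmod t < 1 / (2 * T) \<longrightarrow> z \<in> polydisc (R2 / 4) \<longrightarrow>
     (\<forall>k::int. cmod (t + \<mu> * of_real (q powi k)) \<ge> \<epsilon> * cmod t) \<longrightarrow>
     cmod (W (t, z) - (\<Sum>l<N. X l z * t ^ l)) \<le> M * H ^ N / \<epsilon> * qfact q N * cmod t ^ N"
    by (rule W_asymptotic[OF CT])
  then obtain M H where MH: "M > 0" "H > 0" "\<forall>\<epsilon>>0. \<forall>N. \<forall>t z. 0 < cmod t \<longrightarrow> cmod t < 1 / (2 * T) \<longrightarrow> z \<in> polydisc (R2 / 4) \<longrightarrow>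
     (\<forall>k::int. cmod (t + \<mu> * of_real (q powi k)) \<ge> \<epsilon> * cmod t) \<longrightarrow>
     cmod (W (t, z) - (\<Sum>l<N. X l z * t ^ l)) \<le> M * H ^ N / \<epsilon> * qfact q N * cmod t ^ N"
    by blast
  have 3: "\<forall>\<epsilon>>0. \<forall>N. \<forall>t z. t \<in> punctured_disc r \<longrightarrow> z \<in> polydisc (R2 / 4) \<longrightarrow>
     (\<forall>k::int. cmod (t + \<mu> * of_real (q powi k)) \<ge> \<epsilon> * cmod t) \<longrightarrow>
     cmod (W (t, z) - (\<Sum>l<N. X l z * t ^ l)) \<le> M * H ^ N / \<epsilon> * qfact q N * cmod t ^ N"
  proof (intro allI impI)
    fix \<epsilon> :: real and N :: nat and t :: complex and z :: "(complex,'d) vec"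
    assume *: "\<epsilon> > 0" "t \<in> punctured_disc r" "z \<in> polydisc (R2 / 4)"
      "\<forall>k::int. cmod (t + \<mu> * of_real (q powi k)) \<ge> \<epsilon> * cmod t"
    have "0 < cmod t" "cmod t < 1 / (2 * T)" using *(2) r(3) by (auto simp: punctured_disc_def)
    then show "cmod (W (t, z) - (\<Sum>l<N. X l z * t ^ l)) \<le> M * H ^ N / \<epsilon> * qfact q N * cmod t ^ N"
      using MH(3) * by blast
  qed
  have sol: "\<forall>z t. z \<in> polydisc (R2 / 4) \<longrightarrow> (\<forall>i\<le>m. of_real (q ^ i) * t \<in> punctured_disc r - ?Z) \<longrightarrow>
      (\<Sum>i\<le>m. \<Sum>\<alpha>\<in>\<A>. (\<Sum>\<^sub>\<infinity>k. A i \<alpha> k z * t ^ k) * multi_partial_z \<alpha> (\<lambda>y. W (of_real (q ^ i) * t, y)) z)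
       = (\<Sum>\<^sub>\<infinity>k. F k z * t ^ k)"
    using 2 by (intro allI impI)
  have "0 < R2 / 4" "R2 / 4 \<le> R" using R2 G(2) by auto
  then show ?thesis
    by (intro exI[of _ r] exI[of _ "R2 / 4"] exI[of _ W] conjI r(1,2) 1 sol exI[of _ M] exI[of _ H] MH(1,2) 3)
qed

end

subsection \<open>Translation of the equation\<close>

text \<open>
  The coefficients of \<open>((\<sigma> - 1) / (q - 1)) ^ j\<close> in powers of \<open>\<sigma>\<close>.
\<close>

primrec qeuler_coef :: "real \<Rightarrow> nat \<Rightarrow> nat \<Rightarrow> complex" where
  "qeuler_coef q 0 i = (if i = 0 then 1 else 0)"
| "qeuler_coef q (Suc j) i = ((if i = 0 then 0 else qeuler_coef q j (i - 1)) - qeuler_coef q j i) / of_real (q - 1)"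

lemma qeuler_coef_above: "i > j \<Longrightarrow> qeuler_coef q j i = 0"
  by (induction j arbitrary: i) auto

lemma qeuler_coef_diag: "qeuler_coef q j j = 1 / of_real (q - 1) ^ j"
  by (induction j) (auto simp: qeuler_coef_above)

text \<open>\<open>qeuler q\<close> is dilation minus identity, divided by \<open>q - 1\<close>, the
  factor \<open>t\<close> cancelling. The sum runs to a fixed \<open>m\<close>, with zero
  coefficients beyond \<open>j\<close>, so that all \<open>j\<close> share one index range.\<close>

lemma qeuler_iter:
  assumes q: "q > 1" and t: "t \<noteq> 0" and jm: "j \<le> m"
  shows "(qeuler q ^^ j) g t = (\<Sum>i\<le>m. qeuler_coef q j i * g (of_real (q ^ i) * t))"
  using t jm
proof (induction j arbitrary: t)
  case 0
  have "(\<Sum>i\<le>m. qeuler_coef q 0 i * g (of_real (q ^ i) * t)) = (\<Sum>i\<in>{0}. qeuler_coef q 0 i * g (of_real (q ^ i) * t))"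
    by (rule sum.mono_neutral_right) auto
  then show ?case by simp
next
  case (Suc j)
  let ?h = "(qeuler q ^^ j) g"
  have q1: "complex_of_real (q - 1) \<noteq> 0" "of_real q * t \<noteq> 0" using q Suc.prems by auto
  have "(qeuler q ^^ Suc j) g t = t * ((?h (of_real q * t) - ?h t) / (of_real q * t - t))"
    by (simp add: qeuler_def qderiv_def)
  also have "of_real q * t - t = of_real (q - 1) * t" by (simp add: algebra_simps)
  also have "t * ((?h (of_real q * t) - ?h t) / (of_real (q - 1) * t)) = (?h (of_real q * t) - ?h t) / of_real (q - 1)"
    using Suc.prems(1) by simp
  also have "?h t = (\<Sum>i\<le>m. qeuler_coef q j i * g (of_real (q ^ i) * t))" using Suc by simp
  also have "?h (of_real q * t) = (\<Sum>i\<le>m. qeuler_coef q j i * g (of_real (q ^ i) * (of_real q * t)))"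
    using Suc.IH[OF q1(2)] Suc.prems by simp
  \<comment> \<open>One more dilation shifts the index by one; the summand lost at the upper end has
    coefficient 0 because \<open>j < m\<close>.\<close>
  also have "\<dots> = (\<Sum>i\<le>m. (if i = 0 then 0 else qeuler_coef q j (i - 1)) * g (of_real (q ^ i) * t))"
  proof -
    have sh: "(\<Sum>i\<le>m. u (Suc i)) = (\<Sum>i\<le>m. u i)" if "u 0 = 0" "u (Suc m) = 0" for u :: "nat \<Rightarrow> complex"
    proof -
      have "(\<Sum>i\<le>Suc m. u i) = u 0 + (\<Sum>i\<le>m. u (Suc i))" by (rule sum.atMost_Suc_shift)
      then show ?thesis using that by simp
    qed
    have "(\<Sum>i\<le>m. (if Suc i = 0 then 0 else qeuler_coef q j (Suc i - 1)) * g (of_real (q ^ Suc i) * t))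
        = (\<Sum>i\<le>m. (if i = 0 then 0 else qeuler_coef q j (i - 1)) * g (of_real (q ^ i) * t))"
      by (rule sh) (use Suc.prems qeuler_coef_above[of j m q] in auto)
    then show ?thesis by (simp add: mult_ac)
  qed
  also have "((\<Sum>i\<le>m. (if i = 0 then 0 else qeuler_coef q j (i - 1)) * g (of_real (q ^ i) * t)) - (\<Sum>i\<le>m. qeuler_coef q j i * g (of_real (q ^ i) * t))) / of_real (q - 1)
     = (\<Sum>i\<le>m. qeuler_coef q (Suc j) i * g (of_real (q ^ i) * t))"
    by (simp add: sum_subtractf[symmetric] sum_divide_distrib left_diff_distrib[symmetric])
  finally show ?case .
qed

lemma qeuler_power:
  assumes "q > 1" shows "(qeuler q ^^ j) (\<lambda>t. t ^ n) = (\<lambda>t. of_real (qnum q n) ^ j * t ^ n)"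
proof (induction j)
  case (Suc j)
  have "qeuler q (\<lambda>t. c * t ^ n) t = of_real (qnum q n) * c * t ^ n" for c t :: complex
  proof (cases "t = 0")
    case True
    then show ?thesis by (cases n) (auto simp: qeuler_def qnum_def)
  next
    case False
    have "qeuler q (\<lambda>t. c * t ^ n) t = t * ((c * (of_real q * t) ^ n - c * t ^ n) / (of_real (q - 1) * t))"
      by (simp add: qeuler_def qderiv_def algebra_simps)
    also have "\<dots> = (c * (of_real q * t) ^ n - c * t ^ n) / of_real (q - 1)" using False by simp
    also have "c * (of_real q * t) ^ n - c * t ^ n = of_real (q ^ n - 1) * (c * t ^ n)"
      by (simp add: power_mult_distrib algebra_simps)
    finally show ?thesis by (simp add: qnum_def)
  qed
  then show ?case unfolding funpow.simps o_apply Suc.IH by (simp add: fun_eq_iff mult.assoc)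
qed simp

text \<open>Both sides are \<open>qeuler q ^^ j\<close> applied to \<open>t ^ n\<close> and taken at
  \<open>t = 1\<close>: once by the diagonal action on monomials, once by the expansion in
  dilations.\<close>

lemma qnum_power:
  assumes "q > 1" "j \<le> m"
  shows "complex_of_real (qnum q n) ^ j = (\<Sum>i\<le>m. qeuler_coef q j i * of_real (q ^ (i * n)))"
  using qeuler_iter[OF assms(1) _ assms(2), of 1 "\<lambda>t. t ^ n"] qeuler_power[OF assms(1), of j n]
  by (simp add: power_mult)

lemma fps_qeuler_nth: "fps_nth ((fps_qeuler q ^^ j) f) n = of_real (qnum q n) ^ j * fps_nth f n"
proof (induction j)
  case (Suc j)
  have "fps_nth (fps_qeuler q g) n = of_real (qnum q n) * fps_nth g n" for g
    by (cases n) (auto simp: fps_qeuler_def fps_qderiv_def qnum_def fps_X_mult_nth)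
  then show ?case using Suc by simp
qed simp

section \<open>Index set, Newton polygon and Taylor coefficients\<close>

lemma mlen_zero_iff: "mlen \<alpha> = 0 \<longleftrightarrow> \<alpha> = zidx"
  by (auto simp: mlen_def fun_eq_iff)

lemma finite_index_set:
  assumes "\<sigma> > 0" shows "finite (index_set m \<sigma> :: (nat \<times> ('d :: finite \<Rightarrow> nat)) set)"
proof -
  define N where "N = nat \<lceil>real m / \<sigma>\<rceil>"
  have "index_set m \<sigma> \<subseteq> {..m} \<times> {\<alpha>. \<forall>i::'d. \<alpha> i \<in> {..N}}"
  proof (clarsimp simp: index_set_def)
    fix j and \<alpha> :: "'d \<Rightarrow> nat" assume le: "real j + \<sigma> * real (mlen \<alpha>) \<le> real m"
    have nn: "\<sigma> * real (mlen \<alpha>) \<ge> 0" using assms by simp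
    have "\<alpha> i \<le> N" for i
    proof -
      have "\<alpha> i \<le> mlen \<alpha>" unfolding mlen_def by (rule member_le_sum) auto
      moreover have "real (mlen \<alpha>) \<le> real m / \<sigma>" using le assms by (simp add: pos_le_divide_eq mult.commute)
      moreover have "real m / \<sigma> \<le> real N" unfolding N_def by linarith
      ultimately show ?thesis by linarith
    qed
    moreover have "j \<le> m" using le nn by linarith
    ultimately show "j \<le> m \<and> (\<forall>i. \<alpha> i \<le> N)" by blast
  qed
  moreover have "finite {\<alpha>. \<forall>i::'d. \<alpha> i \<in> {..N}}"
    using finite_set_of_finite_funs[of "UNIV :: 'd set" "{..N}" undefined] by simp
  ultimately show ?thesis by (meson finite_SigmaI finite_atMost finite_subset)
qed

text \<open>Minimality of the order, or vanishing of \<open>b\<close> near the origin if the order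
  is infinite. The neighbourhood of \<open>z = 0\<close> depends on \<open>k\<close>, so one
  polydisc is available for finitely many \<open>k\<close> only.\<close>

lemma tcoef_eventually_zero:
  assumes "enat k < ord_t b"
  shows "\<forall>\<^sub>F z in nhds 0. tcoef b k z = 0"
proof (cases "\<forall>\<^sub>F p in nhds (0, 0). b p = 0")
  case True
  from eventually_nhds_tz_box[OF this] obtain \<rho> R where box: "\<rho> > 0" "R > 0" "\<And>t z. t \<in> ball 0 \<rho> \<Longrightarrow> z \<in> polydisc R \<Longrightarrow> b (t, z) = 0"
    by blast
  have "tcoef b k z = 0" if "z \<in> polydisc R" for z
  proof -
    have "(deriv ^^ k) (\<lambda>s. b (s, z)) 0 = (deriv ^^ k) (\<lambda>s. 0) 0"
    proof (rule higher_deriv_cong_ev)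
      show "\<forall>\<^sub>F s in nhds 0. b (s, z) = 0"
        using eventually_nhds_in_open[of "ball 0 \<rho>" 0] box(1) by (auto elim!: eventually_mono simp: box(3)[OF _ that])
    qed simp
    then show ?thesis by (simp add: tcoef_def)
  qed
  moreover have "\<forall>\<^sub>F z in nhds 0. z \<in> polydisc R" using open_polydisc zero_in_polydisc[OF box(2)] by (rule eventually_nhds_in_open)
  ultimately show ?thesis by (auto elim: eventually_mono)
next
  case False
  then have "k < (LEAST p. \<not> (\<forall>\<^sub>F z in nhds 0. (deriv ^^ p) (\<lambda>t. b (t, z)) 0 = 0))"
    using assms by (simp add: ord_t_def)
  then have "\<forall>\<^sub>F z in nhds 0. (deriv ^^ k) (\<lambda>t. b (t, z)) 0 = 0" using not_less_Least by blast
  then show ?thesis by eventually_elim (simp add: tcoef_def)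
qed

text \<open>Once the coefficients below \<open>k\<close> vanish, the quotient by
  \<open>s ^ k\<close> agrees off 0 with the power series \<open>g\<close>, whose value at 0 is the
  coefficient of index \<open>k\<close>. In this way the removable values in
  \<open>char_poly0\<close> become Taylor coefficients.\<close>

lemma remove_sings_tcoef:
  fixes b :: "complex \<times> (complex^'d) \<Rightarrow> complex"
  assumes b: "holo_tz b (ball 0 \<rho> \<times> polydisc R)" and \<rho>: "\<rho> > 0"
    and M: "\<And>t z. t \<in> ball 0 \<rho> \<Longrightarrow> z \<in> polydisc R \<Longrightarrow> cmod (b (t, z)) \<le> M"
    and z: "z \<in> polydisc R" and low: "\<And>j. j < k \<Longrightarrow> tcoef b j z = 0"
  shows "div_t_power k b (0, z) = tcoef b k z"
proof -
  define g where "g s = (\<Sum>n. tcoef b (n + k) z * s ^ n)" for s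
  have summ: "summable (\<lambda>n. tcoef b n z * s ^ n)" if "cmod s < \<rho>" for s
    using tcoef_has_sum[OF b \<rho> M z that] has_sum_imp_sums sums_summable by blast
  have summg: "summable (\<lambda>n. tcoef b (n + k) z * s ^ n)" if "cmod s < \<rho>" "s \<noteq> 0" for s
  proof -
    have "summable (\<lambda>n. tcoef b (n + k) z * s ^ (n + k))" using summ[OF that(1)] by (subst summable_iff_shift)
    then have "summable (\<lambda>n. (tcoef b (n + k) z * s ^ (n + k)) * (1 / s ^ k))" by (rule summable_mult2)
    then show ?thesis using that(2) by (simp add: power_add)
  qed
  have eq: "b (s, z) / s ^ k = g s" if s: "cmod s < \<rho>" "s \<noteq> 0" for s
  proof -
    have "(\<lambda>n. tcoef b n z * s ^ n) sums b (s, z)"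
      using tcoef_has_sum[OF b \<rho> M z s(1)] by (rule has_sum_imp_sums)
    then have "b (s, z) = (\<Sum>n. tcoef b n z * s ^ n)" by (rule sums_unique)
    also have "\<dots> = (\<Sum>n. tcoef b (n + k) z * s ^ (n + k)) + (\<Sum>n<k. tcoef b n z * s ^ n)"
      by (rule suminf_split_initial_segment[OF summ[OF s(1)]])
    also have "(\<Sum>n<k. tcoef b n z * s ^ n) = 0" using low by simp
    also have "(\<Sum>n. tcoef b (n + k) z * s ^ (n + k)) = g s * s ^ k"
      unfolding g_def using suminf_mult2[OF summg[OF s], of "s ^ k"] by (simp add: power_add mult.assoc)
    finally show ?thesis using s(2) by simp
  qed
  have half: "cmod (of_real (\<rho> / 2)) < \<rho>" "(of_real (\<rho> / 2) :: complex) \<noteq> 0" using \<rho> by auto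
  have "isCont g 0"
    unfolding g_def[abs_def] by (rule isCont_powser[OF summg[OF half]]) (use \<rho> in auto)
  then have "(g \<longlongrightarrow> g 0) (at 0)" by (simp add: isCont_def)
  moreover have "g 0 = tcoef b k z" unfolding g_def by (simp add: powser_zero)
  moreover have "\<forall>\<^sub>F s in at 0. g s = b (s, z) / s ^ k"
    unfolding eventually_at using \<rho> eq by (intro exI[of _ \<rho>]) auto
  ultimately have "((\<lambda>s. b (s, z) / s ^ k) \<longlongrightarrow> tcoef b k z) (at 0)"
    using Lim_transform_eventually[of g "tcoef b k z" "at 0" "\<lambda>s. b (s, z) / s ^ k"] by simp
  then show ?thesis unfolding div_t_power_def prod.case by (rule remove_sings_eqI)
qed

lemma newton_polygon_ord:
  assumes "newton_polygon m \<sigma> a = {(x, y). x \<le> real m \<and> y \<ge> max 0 (x - real m0)}"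
    and "(j, \<alpha>) \<in> index_set m \<sigma>" and "ord_t (a j \<alpha>) = enat p"
  shows "real p \<ge> real j - real m0"
proof -
  have "(real j, real p) \<in> quadrant (real j) (ord_t (a j \<alpha>))" using assms(3) by (simp add: quadrant_def)
  then have "(real j, real p) \<in> newton_polygon m \<sigma> a"
    unfolding newton_polygon_def using assms(2) by (intro hull_inc) blast
  then show ?thesis unfolding assms(1) by simp
qed

text \<open>An interior point may be moved straight down by some \<open>e > 0\<close> without
  leaving the polygon, which makes both bounds strict.\<close>

lemma newton_polygon_interior:
  assumes "newton_polygon m \<sigma> a = {(x, y). x \<le> real m \<and> y \<ge> max 0 (x - real m0)}"
    and "(u, v) \<in> interior (newton_polygon m \<sigma> a)"
  shows "v > 0" "v > u - real m0"
proof -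
  obtain e where e: "e > 0" "cball (u, v) e \<subseteq> newton_polygon m \<sigma> a"
    using assms(2) by (meson mem_interior_cball)
  have "(u, v - e) \<in> cball (u, v) e" using e(1) by (simp add: dist_Pair_Pair dist_norm)
  then have "(u, v - e) \<in> newton_polygon m \<sigma> a" using e(2) by blast
  then show "v > 0" "v > u - real m0" unfolding assms(1) using e(1) by auto
qed

lemma (in q_greater_one) gs_pos_nat: "1 / gs (int i) = q ^ (i * (i - 1) div 2)"
proof -
  have "even (i * (i - 1))" by (cases i) auto
  then have "real (i * (i - 1) div 2) = real (i * (i - 1)) / 2" by (simp add: real_of_nat_div)
  also have "real (i * (i - 1)) = real i * (real i - 1)" by (cases i) (auto simp: algebra_simps)
  finally have e: "real (i * (i - 1) div 2) = real i * (real i - 1) / 2" .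
  have "q ^ (i * (i - 1) div 2) = q powr real (i * (i - 1) div 2)" using q0 by (simp only: powr_realpow)
  also have "\<dots> = q powr (- (- (real i * (real i - 1)) / 2))" unfolding e by simp
  also have "\<dots> = 1 / gs (int i)" unfolding gs_def powr_minus_divide by simp
  finally show ?thesis by simp
qed


theorem theorem2p3:
  fixes q \<sigma> R :: real and m m0 :: nat
    and a :: "nat \<Rightarrow> ('d :: {finite, linorder} \<Rightarrow> nat) \<Rightarrow> complex \<times> (complex, 'd) vec \<Rightarrow> complex"
    and F :: "complex \<times> (complex, 'd) vec \<Rightarrow> complex"
    and U :: "(complex \<times> (complex, 'd) vec) set"
    and X :: "nat \<Rightarrow> (complex, 'd) vec \<Rightarrow> complex"
    and l :: complex
  assumes "q > 1" and "m \<ge> 1" and "\<sigma> > 0"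
    and "open U" and "(0, 0) \<in> U"
    and "\<And>j \<alpha>. (j, \<alpha>) \<in> index_set m \<sigma> \<Longrightarrow> holo_tz (a j \<alpha>) U"
    and "holo_tz F U"
    and A1: "m0 < m"
      "newton_polygon m \<sigma> a = {(x, y). x \<le> real m \<and> y \<ge> max 0 (x - real m0)}"
    and A2: "\<And>j \<alpha> p. (j, \<alpha>) \<in> index_set m \<sigma> \<Longrightarrow> mlen \<alpha> > 0 \<Longrightarrow> ord_t (a j \<alpha>) = enat p \<Longrightarrow>
      (real j, real p) \<in> interior (newton_polygon m \<sigma> a)"
    and A3: "a m0 (\<lambda>_. 0) (0, 0) \<noteq> 0"
      "div_t_power (m - m0) (a m (\<lambda>_. 0)) (0, 0) \<noteq> 0"
    and "\<And>j \<alpha>. (j, \<alpha>) \<in> index_set m \<sigma> \<Longrightarrow> m0 \<le> j \<Longrightarrow> j < m \<Longrightarrow> mlen \<alpha> > 0 \<Longrightarrow>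
      ord_t (a j \<alpha>) \<ge> enat (j - m0 + 2)"
    and "R > 0" and "\<And>n. holo_z (X n) (polydisc R)"
    and "formal_solution q m \<sigma> a F X"
    and "l \<noteq> 0" and "l \<notin> sing_dirs q m m0 a"
  shows "\<exists>r R1 W. r > 0 \<and> 0 < R1 \<and> R1 \<le> R \<and>
    holo_tz W ((punctured_disc r - qspiral q l) \<times> polydisc R1) \<and>
    function_solution_on q m \<sigma> a F U W (punctured_disc r - qspiral q l) (polydisc R1) \<and>
    qGevrey_expansion q l r R1 W X"
proof -
  note q = \<open>q > 1\<close> and \<sigma> = \<open>\<sigma> > 0\<close>
  interpret q_greater_one q by unfold_locales (rule q)
  define J where "J = (index_set m \<sigma> :: (nat \<times> ('d \<Rightarrow> nat)) set)"
  have finJ: "finite J" unfolding J_def by (rule finite_index_set[OF \<sigma>])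
  have Jm: "j \<le> m" if "(j, \<alpha>) \<in> J" for j \<alpha>
  proof -
    have "real j + \<sigma> * real (mlen \<alpha>) \<le> real m" using that by (simp add: J_def index_set_def)
    moreover have "\<sigma> * real (mlen \<alpha>) \<ge> 0" using \<sigma> by simp
    ultimately show ?thesis by linarith
  qed
  have Jmm: "\<alpha> = zidx" if "(m, \<alpha>) \<in> J" for \<alpha>
  proof -
    have "real m + \<sigma> * real (mlen \<alpha>) \<le> real m" using that by (simp add: J_def index_set_def)
    then have "mlen \<alpha> = 0" using \<sigma> by (simp add: mult_le_0_iff)
    then show ?thesis by (simp add: mlen_zero_iff)
  qed
  have J0: "(j, zidx) \<in> J" if "j \<le> m" for j using that by (simp add: J_def index_set_def mlen_def)
  define \<A> where "\<A> = insert zidx (snd ` J)"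
  have fin\<A>: "finite \<A>" using finJ by (simp add: \<A>_def)
  have J\<A>: "\<alpha> \<in> \<A>" if "(j, \<alpha>) \<in> J" for j \<alpha> using that by (force simp: \<A>_def)
  have contF: "isCont F (0, 0)" and conta: "(j, \<alpha>) \<in> J \<Longrightarrow> isCont (a j \<alpha>) (0, 0)" for j \<alpha>
    using assms(4-7) TZ.hol_imp_continuous_on continuous_on_eq_continuous_at
    unfolding holo_tz_iff_hol J_def by blast+
  have bdd: "\<forall>\<^sub>F p in nhds (0, 0). cmod (g p) < cmod (g (0, 0)) + 1"
    if "isCont g (0, 0)" for g :: "complex \<times> (complex, 'd) vec \<Rightarrow> complex"
  proof (rule order_tendstoD(2))
    show "((\<lambda>p. cmod (g p)) \<longlongrightarrow> cmod (g (0, 0))) (nhds (0, 0))"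
      using that by (intro tendsto_norm) (simp add: isCont_def tendsto_at_iff_tendsto_nhds)
  qed simp
  \<comment> \<open>A common bound near the origin: by continuity each function stays below its
    modulus at the origin plus 1, and the sum dominates every summand.\<close>
  define M where "M = cmod (F (0, 0)) + 1 + (\<Sum>(j, \<alpha>)\<in>J. cmod (a j \<alpha> (0, 0)) + 1)"
  have M1: "cmod (F (0, 0)) + 1 \<le> M" "M > 0"
  proof -
    have "(\<Sum>(j, \<alpha>)\<in>J. cmod (a j \<alpha> (0, 0)) + 1) \<ge> 0" by (intro sum_nonneg) (auto intro: add_nonneg_nonneg)
    then show "cmod (F (0, 0)) + 1 \<le> M" "M > 0" using norm_ge_zero[of "F (0, 0)"] unfolding M_def by linarith+
  qed
  have M2: "cmod (a j \<alpha> (0, 0)) + 1 \<le> M" if "(j, \<alpha>) \<in> J" for j \<alpha>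
  proof -
    have "(case (j, \<alpha>) of (j, \<alpha>) \<Rightarrow> cmod (a j \<alpha> (0, 0)) + 1) \<le> (\<Sum>(j, \<alpha>)\<in>J. cmod (a j \<alpha> (0, 0)) + 1)"
      by (rule member_le_sum[OF that _ finJ]) (auto intro: add_nonneg_nonneg)
    then show ?thesis using norm_ge_zero[of "F (0, 0)"] unfolding M_def prod.case by linarith
  qed
  have "\<forall>\<^sub>F p in nhds (0, 0). p \<in> U \<and> cmod (F p) \<le> M \<and> (\<forall>(j, \<alpha>)\<in>J. cmod (a j \<alpha> p) \<le> M)"
  proof (intro eventually_conj)
    show "\<forall>\<^sub>F p in nhds (0, 0). p \<in> U" by (rule eventually_nhds_in_open[OF assms(4,5)])
    show "\<forall>\<^sub>F p in nhds (0, 0). cmod (F p) \<le> M" using bdd[OF contF] M1 by (auto elim!: eventually_mono)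
    show "\<forall>\<^sub>F p in nhds (0, 0). \<forall>(j, \<alpha>)\<in>J. cmod (a j \<alpha> p) \<le> M"
    proof (rule eventually_ball_finite[OF finJ], clarify)
      fix j \<alpha> assume ja: "(j, \<alpha>) \<in> J"
      show "\<forall>\<^sub>F p in nhds (0, 0). cmod (a j \<alpha> p) \<le> M" using bdd[OF conta[OF ja]] M2[OF ja] by (auto elim!: eventually_mono)
    qed
  qed
  from eventually_nhds_tz_box[OF this] obtain \<rho> Ra where \<rho>: "\<rho> > 0" and Ra: "Ra > 0"
    and box: "\<And>t z. t \<in> ball 0 \<rho> \<Longrightarrow> z \<in> polydisc Ra \<Longrightarrow> (t, z) \<in> U \<and> cmod (F (t, z)) \<le> M \<and> (\<forall>(j, \<alpha>)\<in>J. cmod (a j \<alpha> (t, z)) \<le> M)"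
    by blast
  have ord: "enat (j - m0) \<le> ord_t (a j \<alpha>)" if "(j, \<alpha>) \<in> J" for j \<alpha>
  proof (cases "ord_t (a j \<alpha>)")
    case (enat p)
    have "real p \<ge> real j - real m0" by (rule newton_polygon_ord[OF A1(2) _ enat]) (use that in \<open>simp add: J_def\<close>)
    then show ?thesis using enat by simp
  qed simp
  have ord': "enat (j - m0) < ord_t (a j \<alpha>)" "enat 0 < ord_t (a j \<alpha>)" if ja: "(j, \<alpha>) \<in> J" and nz: "\<alpha> \<noteq> zidx" for j \<alpha>
  proof -
    have "enat (j - m0) < ord_t (a j \<alpha>) \<and> enat 0 < ord_t (a j \<alpha>)"
    proof (cases "ord_t (a j \<alpha>)")
      case (enat p)
      have "mlen \<alpha> > 0" using nz mlen_zero_iff by auto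
      then have "(real j, real p) \<in> interior (newton_polygon m \<sigma> a)" using A2 ja enat unfolding J_def by blast
      from newton_polygon_interior[OF A1(2) this] have "real p > 0" "real p > real j - real m0" .
      then have "j - m0 < p" "0 < p" by linarith+
      then show ?thesis using enat by simp
    qed auto
    then show "enat (j - m0) < ord_t (a j \<alpha>)" "enat 0 < ord_t (a j \<alpha>)" by auto
  qed
  \<comment> \<open>The pairs at which the position of the Newton polygon forces the coefficient of
    \<open>t ^ k\<close> to vanish. For \<open>j \<le> m\<close> they all have
    \<open>k \<le> m\<close>, so one polydisc serves all of them.\<close>
  define van where "van = (\<lambda>j (\<alpha> :: 'd \<Rightarrow> nat) k. k + m0 < j \<or> (\<alpha> \<noteq> zidx \<and> (k = 0 \<or> k + m0 \<le> j)))"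
  have "\<forall>\<^sub>F z in nhds 0. \<forall>(j, \<alpha>)\<in>J. \<forall>k\<in>{..m}. van j \<alpha> k \<longrightarrow> tcoef (a j \<alpha>) k z = 0"
  proof (rule eventually_ball_finite[OF finJ], clarify)
    fix j \<alpha> assume ja: "(j, \<alpha>) \<in> J"
    show "\<forall>\<^sub>F z in nhds 0. \<forall>k\<in>{..m}. van j \<alpha> k \<longrightarrow> tcoef (a j \<alpha>) k z = 0"
    proof (rule eventually_ball_finite, simp, rule ballI)
      fix k assume "k \<in> {..m}"
      show "\<forall>\<^sub>F z in nhds 0. van j \<alpha> k \<longrightarrow> tcoef (a j \<alpha>) k z = 0"
      proof (cases "van j \<alpha> k")
        case True
        have "enat k < ord_t (a j \<alpha>)"
        proof (cases "k + m0 < j")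
          case True
          then have "enat k < enat (j - m0)" by simp
          then show ?thesis using ord[OF ja] by (rule less_le_trans)
        next
          case False
          then have nz: "\<alpha> \<noteq> zidx" "k = 0 \<or> k + m0 \<le> j" using True by (auto simp: van_def)
          then have "enat k \<le> enat (j - m0) \<or> enat k = enat 0" by auto
          then show ?thesis using ord'[OF ja nz(1)] le_less_trans by metis
        qed
        then show ?thesis using tcoef_eventually_zero[of k "a j \<alpha>"] by simp
      qed simp
    qed
  qed
  moreover have "\<forall>\<^sub>F z in nhds 0.
        (\<Sum>(j, \<alpha>)\<in>J. fps_expansion (\<lambda>t. a j \<alpha> (t, z)) 0 * (fps_qeuler q ^^ j) (Abs_fps (\<lambda>n. multi_partial_z \<alpha> (X n) z)))
        = fps_expansion (\<lambda>t. F (t, z)) 0"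
    using \<open>formal_solution q m \<sigma> a F X\<close> unfolding formal_solution_def J_def .
  ultimately have "\<forall>\<^sub>F z in nhds 0. (\<forall>(j, \<alpha>)\<in>J. \<forall>k\<in>{..m}. van j \<alpha> k \<longrightarrow> tcoef (a j \<alpha>) k z = 0) \<and>
      (\<Sum>(j, \<alpha>)\<in>J. fps_expansion (\<lambda>t. a j \<alpha> (t, z)) 0 * (fps_qeuler q ^^ j) (Abs_fps (\<lambda>n. multi_partial_z \<alpha> (X n) z)))
        = fps_expansion (\<lambda>t. F (t, z)) 0" by (rule eventually_conj)
  from eventually_nhds_z_polydisc[OF this] obtain Rb where Rb: "Rb > 0"
    and van0: "\<And>z j \<alpha> k. z \<in> polydisc Rb \<Longrightarrow> (j, \<alpha>) \<in> J \<Longrightarrow> k \<le> m \<Longrightarrow> van j \<alpha> k \<Longrightarrow> tcoef (a j \<alpha>) k z = 0"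
    and formal: "\<And>z. z \<in> polydisc Rb \<Longrightarrow>
      (\<Sum>(j, \<alpha>)\<in>J. fps_expansion (\<lambda>t. a j \<alpha> (t, z)) 0 * (fps_qeuler q ^^ j) (Abs_fps (\<lambda>n. multi_partial_z \<alpha> (X n) z)))
        = fps_expansion (\<lambda>t. F (t, z)) 0" by blast
  define R' where "R' = min R (min Ra Rb)"
  have R': "R' > 0" "R' \<le> R" "R' \<le> Ra" "R' \<le> Rb" using Ra Rb \<open>R > 0\<close> by (auto simp: R'_def)
  have sub: "z \<in> polydisc R" "z \<in> polydisc Ra" "z \<in> polydisc Rb" if "z \<in> polydisc R'" for z :: "(complex,'d) vec"
    using that R' polydisc_mono by blast+
  have subU: "ball 0 \<rho> \<times> polydisc R' \<subseteq> U" using box sub by auto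
  have Fh: "holo_tz F (ball 0 \<rho> \<times> polydisc R')"
    using assms(7) subU unfolding holo_tz_iff_hol by (rule TZ.hol_subset)
  have ah: "holo_tz (a j \<alpha>) (ball 0 \<rho> \<times> polydisc R')" if "(j, \<alpha>) \<in> J" for j \<alpha>
    using assms(6)[of j \<alpha>] that subU unfolding holo_tz_iff_hol J_def by (blast intro: TZ.hol_subset)
  have Fb: "cmod (F (t, z)) \<le> M" if "t \<in> ball 0 \<rho>" "z \<in> polydisc R'" for t z using box sub that by blast
  have ab: "cmod (a j \<alpha> (t, z)) \<le> M" if "(j, \<alpha>) \<in> J" "t \<in> ball 0 \<rho>" "z \<in> polydisc R'" for j \<alpha> t z
    using box[of t z] sub that by blast
  have van1: "tcoef (a j \<alpha>) k z = 0" if "z \<in> polydisc R'" "(j, \<alpha>) \<in> J" "van j \<alpha> k" for z j \<alpha> k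
  proof -
    have "k \<le> m" using that(3) Jm[OF that(2)] by (auto simp: van_def)
    then show ?thesis using van0 sub that by blast
  qed
  define c where "c = qeuler_coef q"
  define aT where "aT j \<alpha> k z = (if (j, \<alpha>) \<in> J then tcoef (a j \<alpha>) k z else 0)" for j \<alpha> k z
  \<comment> \<open>The coefficient of the dilation of order \<open>i\<close>, collected from all
    powers of \<open>qeuler q\<close>.\<close>
  define A where "A i \<alpha> k z = (\<Sum>j\<le>m. c j i * aT j \<alpha> k z)" for i \<alpha> k z
  define \<mu> where "\<mu> = l * of_real (q - 1)"
  \<comment> \<open>The ratio for Cauchy's estimate on the disc of radius \<open>\<rho> / 2\<close>,
    made at least 1.\<close>
  define \<kappa> where "\<kappa> = max 1 (2 / \<rho>)"
  define Cs where "Cs = (\<Sum>j\<le>m. \<Sum>i\<le>m. cmod (c j i))"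
  define C0 where "C0 = M * (1 + Cs)"
  have Cs: "Cs \<ge> 0" unfolding Cs_def by (intro sum_nonneg) auto
  have C0: "C0 > 0" "M \<le> C0" using M1 Cs by (auto simp: C0_def)
  have \<kappa>: "\<kappa> \<ge> 1" by (simp add: \<kappa>_def)
  have pw: "M / (\<rho> / 2) ^ k \<le> M * \<kappa> ^ k" for k
  proof -
    have "M / (\<rho> / 2) ^ k = M * (2 / \<rho>) ^ k" by (simp add: power_divide)
    also have "\<dots> \<le> M * \<kappa> ^ k" using M1 \<rho> unfolding \<kappa>_def by (intro mult_left_mono power_mono) auto
    finally show ?thesis .
  qed
  have aT_bound: "cmod (aT j \<alpha> k z) \<le> M * \<kappa> ^ k" if "z \<in> polydisc R'" for j \<alpha> k z
  proof (cases "(j, \<alpha>) \<in> J")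
    case True
    have "cmod (tcoef (a j \<alpha>) k z) \<le> M / (\<rho> / 2) ^ k"
      by (rule tcoef_bound[OF ah[OF True] \<rho> ab[OF True] that]) (use \<rho> in auto)
    then show ?thesis using True pw[of k] by (simp add: aT_def)
  next
    case False
    then show ?thesis using M1 \<kappa> by (simp add: aT_def)
  qed
  \<comment> \<open>The power \<open>j\<close> of \<open>qeuler q\<close> contains only dilations of
    order at most \<open>j\<close>, so \<open>A i\<close> collects the indices
    \<open>j \<ge> i\<close>; a vanishing condition of the Newton polygon at \<open>i\<close> holds
    for these a fortiori.\<close>
  have cA: "A i \<alpha> k z = 0" if "\<And>j. j \<le> m \<Longrightarrow> i \<le> j \<Longrightarrow> aT j \<alpha> k z = 0" for i \<alpha> k z
    unfolding A_def c_def using that qeuler_coef_above[of _ i q] by (intro sum.neutral) (metis atMost_iff mult_eq_0_iff not_less)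
  have cA1: "A i \<alpha> k z = c i i * aT i \<alpha> k z" if "i \<le> m" "\<And>j. j \<le> m \<Longrightarrow> i < j \<Longrightarrow> aT j \<alpha> k z = 0" for i \<alpha> k z
  proof -
    have "A i \<alpha> k z = (\<Sum>j\<in>{i}. c j i * aT j \<alpha> k z)"
      unfolding A_def
    proof (rule sum.mono_neutral_right)
      show "\<forall>j\<in>{..m} - {i}. c j i * aT j \<alpha> k z = 0"
      proof
        fix j assume j: "j \<in> {..m} - {i}"
        show "c j i * aT j \<alpha> k z = 0"
        proof (cases "j < i")
          case True then show ?thesis by (simp add: c_def qeuler_coef_above)
        next
          case False then show ?thesis using that(2)[of j] j by simp
        qed
      qed
    qed (use that in auto)
    then show ?thesis by simp
  qed
  have aT_van: "aT j \<alpha> k z = 0" if "z \<in> polydisc R'" "van j \<alpha> k" for j \<alpha> k z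
    using van1[OF that(1) _ that(2)] by (simp add: aT_def)
  have z0: "0 \<in> polydisc R'" by (rule zero_in_polydisc[OF R'(1)])
  have cii: "c i i = 1 / of_real (q - 1) ^ i" for i by (simp add: c_def qeuler_coef_diag)
  have q1: "complex_of_real (q - 1) \<noteq> 0" using q by auto
  \<comment> \<open>On the edge of slope one the terms with \<open>j > i\<close> vanish, so only the
    diagonal coefficient \<open>1 / (q - 1) ^ i\<close> is left; this links \<open>A\<close> to
    \<open>char_poly0\<close>.\<close>
  have diag: "A i zidx (i - m0) 0 = div_t_power (i - m0) (a i zidx) (0, 0) / of_real (q - 1) ^ i"
    if "m0 \<le> i" "i \<le> m" for i
  proof -
    have "A i zidx (i - m0) 0 = c i i * aT i zidx (i - m0) 0"
      by (rule cA1[OF that(2)]) (use aT_van[OF z0] that in \<open>auto simp: van_def\<close>)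
    also have "aT i zidx (i - m0) 0 = tcoef (a i zidx) (i - m0) 0" using J0[OF that(2)] by (simp add: aT_def)
    also have "\<dots> = div_t_power (i - m0) (a i zidx) (0, 0)"
      by (rule remove_sings_tcoef[OF ah[OF J0[OF that(2)]] \<rho> ab[OF J0[OF that(2)]] z0, symmetric])
        (use van1[OF z0 J0[OF that(2)]] that in \<open>auto simp: van_def\<close>)
    finally show ?thesis by (simp add: cii)
  qed
  interpret formal_q_equation q m m0 \<mu> \<A> A "tcoef F" X R' C0 \<kappa>
  proof unfold_locales
    show "m0 < m" by (rule A1(1))
    show "finite \<A>" by (rule fin\<A>)
    show "zidx \<in> \<A>" by (simp add: \<A>_def)
    show "\<mu> \<noteq> 0" using \<open>l \<noteq> 0\<close> q1 by (simp add: \<mu>_def)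
    show "R' > 0" "C0 > 0" "\<kappa> \<ge> 1" using R' C0 \<kappa> by auto
    show "holo_z (A i \<alpha> k) (polydisc R')" for i \<alpha> k
    proof -
      have "holo_z (aT j \<alpha> k) (polydisc R')" for j
        unfolding aT_def[abs_def] using holo_z_tcoef[OF ah \<rho> ab] holo_z_const by (cases "(j, \<alpha>) \<in> J") auto
      then show ?thesis unfolding A_def[abs_def] by (intro holo_z_sum holo_z_mult holo_z_const)
    qed
    show "cmod (A i \<alpha> k z) \<le> C0 * \<kappa> ^ k" if "i \<le> m" "z \<in> polydisc R'" for i \<alpha> k z
    proof -
      have "cmod (A i \<alpha> k z) \<le> (\<Sum>j\<le>m. cmod (c j i) * (M * \<kappa> ^ k))"
        unfolding A_def by (rule sum_norm_le) (auto simp: norm_mult intro!: mult_left_mono aT_bound that)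
      also have "\<dots> = (\<Sum>j\<le>m. cmod (c j i)) * (M * \<kappa> ^ k)" by (simp add: sum_distrib_right)
      also have "\<dots> \<le> Cs * (M * \<kappa> ^ k)"
      proof (rule mult_right_mono)
        show "(\<Sum>j\<le>m. cmod (c j i)) \<le> Cs" unfolding Cs_def
          by (intro sum_mono member_le_sum[of i "{..m}"]) (use that in auto)
      qed (use M1 \<kappa> in auto)
      also have "\<dots> \<le> (1 + Cs) * (M * \<kappa> ^ k)" using M1 \<kappa> by (intro mult_right_mono) auto
      finally show ?thesis by (simp add: C0_def mult_ac)
    qed
    show "holo_z (tcoef F k) (polydisc R')" for k by (rule holo_z_tcoef[OF Fh \<rho> Fb])
    show "cmod (tcoef F k z) \<le> C0 * \<kappa> ^ k" if "z \<in> polydisc R'" for k z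
    proof -
      have "cmod (tcoef F k z) \<le> M / (\<rho> / 2) ^ k" by (rule tcoef_bound[OF Fh \<rho> Fb that]) (use \<rho> in auto)
      also have "\<dots> \<le> M * \<kappa> ^ k" by (rule pw)
      also have "\<dots> \<le> C0 * \<kappa> ^ k" using C0 \<kappa> by (intro mult_right_mono) auto
      finally show ?thesis .
    qed
    show "holo_z (X k) (polydisc R')" for k
      using assms(15)[of k] polydisc_mono[OF R'(2)] by (rule holo_z_subset)
    show "A i \<alpha> k z = 0" if "z \<in> polydisc R'" "k + m0 < i" for i \<alpha> k z
      by (rule cA) (use aT_van[OF that(1)] that in \<open>auto simp: van_def\<close>)
    show "A i \<alpha> k z = 0" if "\<alpha> \<noteq> zidx" "z \<in> polydisc R'" "k = 0 \<or> k + m0 \<le> i" for i \<alpha> k z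
      by (rule cA) (use aT_van[OF that(2)] that in \<open>auto simp: van_def\<close>)
    show "A m \<alpha> k z = 0" if "\<alpha> \<noteq> zidx" for \<alpha> k z
      by (rule cA) (use Jmm that in \<open>auto simp: aT_def\<close>)
    show "(\<Sum>k\<le>N. \<Sum>i\<le>m. \<Sum>\<alpha>\<in>\<A>. A i \<alpha> k z * of_real (q ^ (i * (N - k))) * multi_partial_z \<alpha> (X (N - k)) z) = tcoef F N z"
      if z: "z \<in> polydisc R'" for z N
    proof -
      have "tcoef F N z = fps_nth (\<Sum>(j, \<alpha>)\<in>J. fps_expansion (\<lambda>t. a j \<alpha> (t, z)) 0 * (fps_qeuler q ^^ j) (Abs_fps (\<lambda>n. multi_partial_z \<alpha> (X n) z))) N"
        unfolding formal[OF sub(3)[OF z]] by (simp add: fps_expansion_def tcoef_def)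
      also have "\<dots> = (\<Sum>(j, \<alpha>)\<in>J. \<Sum>k\<le>N. aT j \<alpha> k z * (of_real (qnum q (N - k)) ^ j * multi_partial_z \<alpha> (X (N - k)) z))"
        unfolding fps_sum_nth
      proof (rule sum.cong[OF refl], clarify)
        fix j \<alpha> assume "(j, \<alpha>) \<in> J"
        then show "fps_nth (fps_expansion (\<lambda>t. a j \<alpha> (t, z)) 0 * (fps_qeuler q ^^ j) (Abs_fps (\<lambda>n. multi_partial_z \<alpha> (X n) z))) N
          = (\<Sum>k\<le>N. aT j \<alpha> k z * (of_real (qnum q (N - k)) ^ j * multi_partial_z \<alpha> (X (N - k)) z))"
          by (simp add: fps_mult_nth fps_qeuler_nth fps_expansion_def tcoef_def aT_def atMost_atLeast0)
      qed
      also have "\<dots> = (\<Sum>(j, \<alpha>)\<in>{..m} \<times> \<A>. \<Sum>k\<le>N. aT j \<alpha> k z * (of_real (qnum q (N - k)) ^ j * multi_partial_z \<alpha> (X (N - k)) z))"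
        by (rule sum.mono_neutral_left) (use fin\<A> Jm J\<A> in \<open>auto simp: aT_def\<close>)
      also have "\<dots> = (\<Sum>j\<le>m. \<Sum>\<alpha>\<in>\<A>. \<Sum>k\<le>N. \<Sum>i\<le>m. c j i * aT j \<alpha> k z * of_real (q ^ (i * (N - k))) * multi_partial_z \<alpha> (X (N - k)) z)"
        unfolding sum.cartesian_product[symmetric]
        by (intro sum.cong refl) (simp add: qnum_power[OF q] c_def sum_distrib_left sum_distrib_right mult_ac)
      also have "\<dots> = (\<Sum>k\<le>N. \<Sum>i\<le>m. \<Sum>\<alpha>\<in>\<A>. \<Sum>j\<le>m. c j i * aT j \<alpha> k z * of_real (q ^ (i * (N - k))) * multi_partial_z \<alpha> (X (N - k)) z)"
      proof -
        have "(\<Sum>j\<le>m. \<Sum>\<alpha>\<in>\<A>. \<Sum>k\<le>N. \<Sum>i\<le>m. f j \<alpha> k i) = (\<Sum>k\<le>N. \<Sum>i\<le>m. \<Sum>\<alpha>\<in>\<A>. \<Sum>j\<le>m. f j \<alpha> k i)"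
          for f :: "nat \<Rightarrow> ('d \<Rightarrow> nat) \<Rightarrow> nat \<Rightarrow> nat \<Rightarrow> complex"
        proof -
          have "(\<Sum>j\<le>m. \<Sum>\<alpha>\<in>\<A>. \<Sum>k\<le>N. \<Sum>i\<le>m. f j \<alpha> k i) = (\<Sum>j\<le>m. \<Sum>k\<le>N. \<Sum>\<alpha>\<in>\<A>. \<Sum>i\<le>m. f j \<alpha> k i)"
            by (intro sum.cong refl sum.swap)
          also have "\<dots> = (\<Sum>k\<le>N. \<Sum>j\<le>m. \<Sum>\<alpha>\<in>\<A>. \<Sum>i\<le>m. f j \<alpha> k i)" by (rule sum.swap)
          also have "\<dots> = (\<Sum>k\<le>N. \<Sum>j\<le>m. \<Sum>i\<le>m. \<Sum>\<alpha>\<in>\<A>. f j \<alpha> k i)" by (intro sum.cong refl sum.swap)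
          also have "\<dots> = (\<Sum>k\<le>N. \<Sum>i\<le>m. \<Sum>j\<le>m. \<Sum>\<alpha>\<in>\<A>. f j \<alpha> k i)" by (intro sum.cong refl sum.swap)
          also have "\<dots> = (\<Sum>k\<le>N. \<Sum>i\<le>m. \<Sum>\<alpha>\<in>\<A>. \<Sum>j\<le>m. f j \<alpha> k i)" by (intro sum.cong refl sum.swap)
          finally show ?thesis .
        qed
        then show ?thesis .
      qed
      finally show ?thesis unfolding A_def by (simp add: sum_distrib_right)
    qed
    show "A m0 zidx 0 0 \<noteq> 0"
    proof -
      have "A m0 zidx 0 0 = c m0 m0 * aT m0 zidx 0 0"
        by (rule cA1) (use aT_van[OF z0] A1 in \<open>auto simp: van_def\<close>)
      then show ?thesis using J0[of m0] A1 A3(1) q1 by (simp add: aT_def tcoef_def cii)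
    qed
    show "A m zidx (m - m0) 0 \<noteq> 0" using diag[of m] A1(1) A3(2) q1 by simp
    show "(\<Sum>i=m0..m. A i zidx (i - m0) 0 * kp \<mu> i n) \<noteq> 0" for n
    proof
      assume 0: "(\<Sum>i=m0..m. A i zidx (i - m0) 0 * kp \<mu> i n) = 0"
      \<comment> \<open>The point at which the sum evaluates the characteristic polynomial. If it
        were a root, \<open>l = L * q powi (1 - n)\<close> would lie on the half-line through
        it.\<close>
      define L where "L = l * of_real (q powi (n - 1))"
      have L: "L \<noteq> 0" using \<open>l \<noteq> 0\<close> by (simp add: L_def)
      have "A i zidx (i - m0) 0 * kp \<mu> i n = L ^ m0 * (div_t_power (i - m0) (a i zidx) (0, 0) / of_real q ^ (i * (i - 1) div 2) * L ^ (i - m0))"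
        if i: "i \<in> {m0..m}" for i
      proof -
        have "kp \<mu> i n = of_real (q - 1) ^ i * (l ^ i * of_real (gs (int i) * (q powi (- int i) * q powi (int i * n))))"
          by (simp add: kp_def \<mu>_def power_mult_distrib gs_neg[of "int i"] mult_ac)
        also have "q powi (- int i) * q powi (int i * n) = (q powi (n - 1)) ^ i"
        proof -
          have "q powi (- int i) * q powi (int i * n) = q powi ((n - 1) * int i)"
            by (subst power_int_add[symmetric]) (auto simp: algebra_simps)
          then show ?thesis by (simp only: power_int_mult power_int_of_nat)
        qed
        also have "gs (int i) = 1 / q ^ (i * (i - 1) div 2)"
          using gs_pos_nat[of i] gs_pos[of "int i"] by (simp add: field_simps)
        finally have "kp \<mu> i n = of_real (q - 1) ^ i * (L ^ i / of_real q ^ (i * (i - 1) div 2))"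
          by (simp add: L_def power_mult_distrib)
        moreover have "L ^ i = L ^ m0 * L ^ (i - m0)" using i by (simp flip: power_add)
        ultimately show ?thesis using diag[of i] i q1 by simp
      qed
      then have "(\<Sum>i=m0..m. A i zidx (i - m0) 0 * kp \<mu> i n) = L ^ m0 * char_poly0 q m m0 a L 0"
        unfolding char_poly0_def sum_distrib_left by (intro sum.cong refl) auto
      then have "char_poly0 q m m0 a L 0 = 0" using 0 L by simp
      moreover have "l = L * of_real (q powi (1 - n))"
      proof -
        have "q powi (n - 1) * q powi (1 - n) = 1" using q by (subst power_int_add[symmetric]) auto
        then have "complex_of_real (q powi (n - 1)) * of_real (q powi (1 - n)) = 1" by (metis of_real_1 of_real_mult)
        then show ?thesis unfolding L_def by (simp only: mult.assoc mult_1_right)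
      qed
      moreover have "q powi (1 - n) > 0" using q by simp
      ultimately have "l \<in> sing_dirs q m m0 a" unfolding sing_dirs_def by blast
      then show False using \<open>l \<notin> sing_dirs q m m0 a\<close> by simp
    qed
  qed
  have qsp: "{t. \<exists>k::int. t = - \<mu> * of_real (q powi k)} = qspiral q l"
    unfolding qspiral_def \<mu>_def by (auto simp: mult.assoc)
  obtain r R1 W where r: "0 < r" "r \<le> \<rho>" and R1: "0 < R1" "R1 \<le> R'"
    and W: "holo_tz W ((punctured_disc r - qspiral q l) \<times> polydisc R1)"
    and sol: "\<forall>z t. z \<in> polydisc R1 \<longrightarrow> (\<forall>i\<le>m. of_real (q ^ i) * t \<in> punctured_disc r - qspiral q l) \<longrightarrow>
      (\<Sum>i\<le>m. \<Sum>\<alpha>\<in>\<A>. (\<Sum>\<^sub>\<infinity>k. A i \<alpha> k z * t ^ k) * multi_partial_z \<alpha> (\<lambda>y. W (of_real (q ^ i) * t, y)) z)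
       = (\<Sum>\<^sub>\<infinity>k. tcoef F k z * t ^ k)"
    and asy: "\<exists>M>0. \<exists>H>0. \<forall>\<epsilon>>0. \<forall>N. \<forall>t z. t \<in> punctured_disc r \<longrightarrow> z \<in> polydisc R1 \<longrightarrow>
     (\<forall>k::int. cmod (t + \<mu> * of_real (q powi k)) \<ge> \<epsilon> * cmod t) \<longrightarrow>
     cmod (W (t, z) - (\<Sum>l<N. X l z * t ^ l)) \<le> M * H ^ N / \<epsilon> * qfact q N * cmod t ^ N"
    using theta_quotient_solution[OF \<rho>] unfolding qsp by blast
  have "function_solution_on q m \<sigma> a F U W (punctured_disc r - qspiral q l) (polydisc R1)"
    unfolding function_solution_on_def
  proof (intro allI impI, elim conjE)
    fix t :: complex and z :: "(complex,'d) vec"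
    assume z: "z \<in> polydisc R1" and t: "\<forall>i\<le>m. of_real q ^ i * t \<in> punctured_disc r - qspiral q l"
    have z': "z \<in> polydisc R'" using z polydisc_mono[OF R1(2)] by blast
    have "t \<in> punctured_disc r" using t[rule_format, of 0] by simp
    then have t0: "t \<noteq> 0" "cmod t < \<rho>" "t \<in> ball 0 \<rho>" using r by (auto simp: punctured_disc_def)
    define V where "V i \<alpha> = multi_partial_z \<alpha> (\<lambda>y. W (of_real (q ^ i) * t, y)) z" for i \<alpha>
    \<comment> \<open>Summing the Taylor series returns the values of the coefficients at
      \<open>t\<close>; indices outside \<open>J\<close> give zero on both sides.\<close>
    have As: "(\<Sum>\<^sub>\<infinity>k. A i \<alpha> k z * t ^ k) = (\<Sum>j\<le>m. c j i * (if (j, \<alpha>) \<in> J then a j \<alpha> (t, z) else 0))" for i \<alpha>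
    proof (rule infsumI)
      have "((\<lambda>k. c j i * (aT j \<alpha> k z * t ^ k)) has_sum c j i * (if (j, \<alpha>) \<in> J then a j \<alpha> (t, z) else 0)) UNIV" for j
        using tcoef_has_sum[OF ah \<rho> ab z' t0(2), of j \<alpha>]
        by (intro has_sum_cmult_right) (auto simp: aT_def)
      then have "((\<lambda>k. \<Sum>j\<le>m. c j i * (aT j \<alpha> k z * t ^ k)) has_sum (\<Sum>j\<le>m. c j i * (if (j, \<alpha>) \<in> J then a j \<alpha> (t, z) else 0))) UNIV"
        by (rule has_sum_finite_sum)
      then show "((\<lambda>k. A i \<alpha> k z * t ^ k) has_sum (\<Sum>j\<le>m. c j i * (if (j, \<alpha>) \<in> J then a j \<alpha> (t, z) else 0))) UNIV"
        by (simp add: A_def sum_distrib_right mult.assoc)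
    qed
    have "(\<Sum>(j, \<alpha>)\<in>J. a j \<alpha> (t, z) * (qeuler q ^^ j) (\<lambda>s. multi_partial_z \<alpha> (\<lambda>y. W (s, y)) z) t)
        = (\<Sum>(j, \<alpha>)\<in>J. (if (j, \<alpha>) \<in> J then a j \<alpha> (t, z) else 0) * (\<Sum>i\<le>m. c j i * V i \<alpha>))"
      by (intro sum.cong refl) (auto simp: qeuler_iter[OF q t0(1) Jm] V_def c_def)
    also have "\<dots> = (\<Sum>(j, \<alpha>)\<in>{..m} \<times> \<A>. (if (j, \<alpha>) \<in> J then a j \<alpha> (t, z) else 0) * (\<Sum>i\<le>m. c j i * V i \<alpha>))"
      by (rule sum.mono_neutral_left) (use fin\<A> Jm J\<A> in auto)
    also have "\<dots> = (\<Sum>j\<le>m. \<Sum>\<alpha>\<in>\<A>. \<Sum>i\<le>m. c j i * (if (j, \<alpha>) \<in> J then a j \<alpha> (t, z) else 0) * V i \<alpha>)"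
      unfolding sum.cartesian_product[symmetric] by (intro sum.cong refl) (simp add: sum_distrib_left mult_ac)
    also have "\<dots> = (\<Sum>i\<le>m. \<Sum>\<alpha>\<in>\<A>. \<Sum>j\<le>m. c j i * (if (j, \<alpha>) \<in> J then a j \<alpha> (t, z) else 0) * V i \<alpha>)"
    proof -
      have "(\<Sum>j\<le>m. \<Sum>\<alpha>\<in>\<A>. \<Sum>i\<le>m. f j \<alpha> i) = (\<Sum>i\<le>m. \<Sum>\<alpha>\<in>\<A>. \<Sum>j\<le>m. f j \<alpha> i)"
        for f :: "nat \<Rightarrow> ('d \<Rightarrow> nat) \<Rightarrow> nat \<Rightarrow> complex"
      proof -
        have "(\<Sum>j\<le>m. \<Sum>\<alpha>\<in>\<A>. \<Sum>i\<le>m. f j \<alpha> i) = (\<Sum>j\<le>m. \<Sum>i\<le>m. \<Sum>\<alpha>\<in>\<A>. f j \<alpha> i)" by (intro sum.cong refl sum.swap)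
        also have "\<dots> = (\<Sum>i\<le>m. \<Sum>j\<le>m. \<Sum>\<alpha>\<in>\<A>. f j \<alpha> i)" by (rule sum.swap)
        also have "\<dots> = (\<Sum>i\<le>m. \<Sum>\<alpha>\<in>\<A>. \<Sum>j\<le>m. f j \<alpha> i)" by (intro sum.cong refl sum.swap)
        finally show ?thesis .
      qed
      then show ?thesis .
    qed
    also have "\<dots> = (\<Sum>i\<le>m. \<Sum>\<alpha>\<in>\<A>. (\<Sum>\<^sub>\<infinity>k. A i \<alpha> k z * t ^ k) * V i \<alpha>)"
      unfolding As by (simp add: sum_distrib_right)
    also have "\<dots> = (\<Sum>\<^sub>\<infinity>k. tcoef F k z * t ^ k)"
      unfolding V_def using sol z t by simp
    also have "\<dots> = F (t, z)" by (rule infsumI[OF tcoef_has_sum[OF Fh \<rho> Fb z' t0(2)]])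
    finally show "(\<Sum>(j, \<alpha>)\<in>index_set m \<sigma>. a j \<alpha> (t, z) * (qeuler q ^^ j) (\<lambda>s. multi_partial_z \<alpha> (\<lambda>y. W (s, y)) z) t) = F (t, z)"
      unfolding J_def .
  qed
  moreover have "qGevrey_expansion q l r R1 W X"
  proof -
    obtain M H where MH: "M > 0" "H > 0" and as: "\<forall>\<epsilon>>0. \<forall>N. \<forall>t z. t \<in> punctured_disc r \<longrightarrow> z \<in> polydisc R1 \<longrightarrow>
     (\<forall>k::int. cmod (t + \<mu> * of_real (q powi k)) \<ge> \<epsilon> * cmod t) \<longrightarrow>
     cmod (W (t, z) - (\<Sum>l<N. X l z * t ^ l)) \<le> M * H ^ N / \<epsilon> * qfact q N * cmod t ^ N" using asy by blast
    have "cmod (W (t, z) - (\<Sum>n<N. X n z * t ^ n)) \<le> M * H ^ N / \<epsilon> * qfact q N * cmod t ^ N"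
      if "\<epsilon> > 0" "t \<in> punctured_disc r - qspiral_nbhd q l \<epsilon>" "z \<in> polydisc R1" for \<epsilon> t z N
    proof -
      have "\<epsilon> * cmod t \<le> cmod (t + \<mu> * of_real (q powi k))" for k :: int
      proof -
        have "\<not> cmod (t + l * of_real ((q - 1) * q powi k)) < \<epsilon> * cmod t" using that(2) by (auto simp: qspiral_nbhd_def)
        then show ?thesis by (simp add: \<mu>_def mult.assoc)
      qed
      then show ?thesis using as that by blast
    qed
    \<comment> \<open>The bound holds for every \<open>\<epsilon> > 0\<close>, so the threshold 1 is
      an arbitrary choice.\<close>
    then show ?thesis unfolding qGevrey_expansion_def
      by (intro exI[of _ M] exI[of _ H] exI[of _ 1] conjI MH) auto
  qed
  moreover have "R1 \<le> R" using R1 R' by simp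
  ultimately show ?thesis using r(1) R1(1) W by blast
qed

end
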